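(* Let $p$ be a prime and $R$ a bounded $\delta$-ring over $\mathbb Z[q]_{(p,q-1)}$ with $\delta(q)=0$. Let $A$ be a bounded $\delta$-$R$-algebra with a fixed rank one element $x$ (i.e. $\delta(x)=0$), and endow $A[\xi]$ with the symmetric $\delta$-structure with respect to $x$. Then the prismatic envelope of $(A[\xi],(\xi))$ is $\widehat{A\langle\omega\rangle}_{q(-1)}$ (through the blowing up $A[\xi]\to\widehat{A\langle\omega\rangle}_{q(-1)}$, $\xi\mapsto(p)_q\omega$).
   Context: $\mathbb Z[q]_{(p,q-1)}$ is the localization of $\mathbb Z[q]$ at the prime ideal $(p,q-1)$. All $R$-algebras carry the $(p,q-1)$-adic topology; completion $\widehat{\ }$ and completeness refer to it. $(n)_q=1+q+\cdots+q^{n-1}$, and $\binom nk_q$ are $q$-binomial coefficients. $\delta$-rings are with respect to $p$. An $R$-algebra $B$ is bounded if $B$ is $(p)_q$-torsion free and $B/(p)_qB$ has bounded $p^\infty$-torsion. A $\delta$-pair over $R$ is a couple $(B,J)$ with $B$ a $\delta$-$R$-algebra and $J\subset B$ an ideal; morphisms are morphisms of $\delta$-$R$-algebras mapping the first ideal into the second. A $(p)_q$-prism over $R$ is a $\delta$-pair of the form $(B,(p)_q)$ with $B$ complete and bounded. The prismatic envelope of a $\delta$-pair $(B,J)$ over $R$ is a $(p)_q$-prism over $R$ which is universal for morphisms from $(B,J)$ to $(p)_q$-prisms over $R$ (a morphism from $(B,J)$ to it through which every morphism from $(B,J)$ to a $(p)_q$-prism over $R$ factors uniquely). The symmetric $\delta$-structure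 on $A[\xi]$ is the unique $\delta$-structure extending that of $A$ with $\delta(x+\xi)=0$; i.e. $\delta(\xi)=\sum_{i=1}^{p-1}\frac1p\binom pi x^{p-i}\xi^i$. $A\langle\omega\rangle_{q(-1)}$ is the commutative $A$-algebra which is free as an $A$-module on $\{\omega^{\{n\}_q}\}_{n\ge0}$, with unit $\omega^{\{0\}_q}$, $\omega=\omega^{\{1\}_q}$ and \[ \omega^{\{n_1\}_q}\omega^{\{n_2\}_q}=\sum_{0\le i\le\min(n_1,n_2)}q^{\frac{pi(i-1)}2}\binom{n_1+n_2-i}{n_1}_{q^p}\binom{n_1}{i}_{q^p}(q-1)^ix^i\,\omega^{\{n_1+n_2-i\}_q}. \] It carries the unique natural (functorial in $(R,q,A,x)$) $\delta$-structure for which the blowing up $A[\xi]\to A\langle\omega\rangle_{q(-1)}$, $\xi\mapsto(p)_q\omega$, is a morphism of $\delta$-rings, and its completion carries the induced $\delta$-structure. *)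

theory Defs
  imports
    "HOL-Algebra.QuotRing"
    "HOL-Algebra.UnivPoly"
    "HOL-Algebra.Ideal_Product"
    "HOL-Computational_Algebra.Primes"
    "HOL-Computational_Algebra.Polynomial"
    "HOL-Computational_Algebra.Fraction_Field"
begin

section \<open>The base ring\<close>

text \<open>\<open>\<int>[q]\<close> is \<^typ>\<open>int poly\<close>, with \<open>q = [:0, 1:]\<close> and \<open>q - 1 = [:-1, 1:]\<close>.\<close>

definition Zq :: "int poly ring" where
  "Zq = \<lparr>carrier = UNIV, monoid.mult = (*), one = 1, zero = 0, add = (+)\<rparr>"

text \<open>The localization of \<open>\<int>[q]\<close> at the prime ideal \<open>(p, q - 1)\<close>, inside its fraction field
  (\<open>\<int>[q]\<close> is a domain).\<close>

definition Zq_loc :: "nat \<Rightarrow> int poly fract ring" where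
  "Zq_loc p = \<lparr>carrier = {Fract f g | f g. g \<notin> Idl\<^bsub>Zq\<^esub> {[:int p:], [:-1, 1:]}},
     monoid.mult = (*), one = 1, zero = 0, add = (+)\<rparr>"

definition q_loc :: "int poly fract" where
  "q_loc = Fract [:0, 1:] 1"


section \<open>Delta-rings and algebras\<close>

locale delta_ring = cring B for p :: nat and B (structure) and \<delta> :: "'b \<Rightarrow> 'b" +
  assumes delta_closed: "b \<in> carrier B \<Longrightarrow> \<delta> b \<in> carrier B"
    and delta_zero: "\<delta> \<zero> = \<zero>"
    and delta_one: "\<delta> \<one> = \<zero>"
    and delta_add: "\<lbrakk>a \<in> carrier B; b \<in> carrier B\<rbrakk> \<Longrightarrow>
      \<delta> (a \<oplus> b) = (\<delta> a \<oplus> \<delta> b) \<ominus>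
        (\<Oplus>i\<in>{1..<p}. add_pow B ((p choose i) div p) (a [^] i \<otimes> b [^] (p - i)))"
    and delta_mult: "\<lbrakk>a \<in> carrier B; b \<in> carrier B\<rbrakk> \<Longrightarrow>
      \<delta> (a \<otimes> b) = (a [^] p \<otimes> \<delta> b \<oplus> b [^] p \<otimes> \<delta> a) \<oplus> add_pow B p (\<delta> a \<otimes> \<delta> b)"

definition delta_hom ::
  "('b, 'm) ring_scheme \<Rightarrow> ('b \<Rightarrow> 'b) \<Rightarrow> ('c, 'n) ring_scheme \<Rightarrow> ('c \<Rightarrow> 'c) \<Rightarrow> ('b \<Rightarrow> 'c) \<Rightarrow> bool" where
  "delta_hom B \<delta>B C \<delta>C f \<longleftrightarrow>
     f \<in> ring_hom B C \<and> (\<forall>b\<in>carrier B. f (\<delta>B b) = \<delta>C (f b))"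

text \<open>A delta-ring \<open>R\<close> over \<open>\<int>[q]\<^bsub>(p, q - 1)\<^esub>\<close> with \<open>\<delta>(q) = 0\<close>. Below, \<open>\<eta>\<close> always denotes
  the structure map of \<open>R\<close>, and \<open>\<rho>\<close> the structure map from \<open>R\<close> to an \<open>R\<close>-algebra \<open>B\<close>;
  the element \<open>q\<close> of \<open>R\<close> is \<open>\<eta> q_loc\<close> and that of \<open>B\<close> is \<open>\<rho> (\<eta> q_loc)\<close>.\<close>

definition q_delta_ring ::
  "nat \<Rightarrow> ('r, 'm) ring_scheme \<Rightarrow> ('r \<Rightarrow> 'r) \<Rightarrow> (int poly fract \<Rightarrow> 'r) \<Rightarrow> bool" where
  "q_delta_ring p R \<delta>R \<eta> \<longleftrightarrow>
     delta_ring p R \<delta>R \<and> \<eta> \<in> ring_hom (Zq_loc p) R \<and> \<delta>R (\<eta> q_loc) = \<zero>\<^bsub>R\<^esub>"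

definition delta_algebra ::
  "nat \<Rightarrow> ('r, 'm) ring_scheme \<Rightarrow> ('r \<Rightarrow> 'r) \<Rightarrow> ('b, 'n) ring_scheme \<Rightarrow> ('b \<Rightarrow> 'b) \<Rightarrow> ('r \<Rightarrow> 'b) \<Rightarrow> bool"
where
  "delta_algebra p R \<delta>R B \<delta>B \<rho> \<longleftrightarrow> delta_ring p B \<delta>B \<and> delta_hom R \<delta>R B \<delta>B \<rho>"

definition rank_one :: "('a, 'm) ring_scheme \<Rightarrow> ('a \<Rightarrow> 'a) \<Rightarrow> 'a \<Rightarrow> bool" where
  "rank_one A \<delta>A x \<longleftrightarrow> x \<in> carrier A \<and> \<delta>A x = \<zero>\<^bsub>A\<^esub>"


section \<open>q-analogues and boundedness\<close>

definition q_number :: "('b, 'm) ring_scheme \<Rightarrow> 'b \<Rightarrow> nat \<Rightarrow> 'b" where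
  "q_number B q n = (\<Oplus>\<^bsub>B\<^esub>i\<in>{..<n}. q [^]\<^bsub>B\<^esub> i)"

text \<open>The Gaussian binomial, a polynomial in \<open>q\<close> with integer coefficients, evaluated
  in \<open>B\<close> by means of the q-Pascal rule.\<close>

fun q_binomial :: "('b, 'm) ring_scheme \<Rightarrow> 'b \<Rightarrow> nat \<Rightarrow> nat \<Rightarrow> 'b" where
  "q_binomial B q n 0 = \<one>\<^bsub>B\<^esub>"
| "q_binomial B q 0 (Suc k) = \<zero>\<^bsub>B\<^esub>"
| "q_binomial B q (Suc n) (Suc k) =
     q_binomial B q n k \<oplus>\<^bsub>B\<^esub> q [^]\<^bsub>B\<^esub> Suc k \<otimes>\<^bsub>B\<^esub> q_binomial B q n (Suc k)"

definition q_ideal :: "nat \<Rightarrow> ('b, 'm) ring_scheme \<Rightarrow> 'b \<Rightarrow> 'b set" where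
  "q_ideal p B q = PIdl\<^bsub>B\<^esub> (q_number B q p)"

definition bounded_algebra :: "nat \<Rightarrow> ('b, 'm) ring_scheme \<Rightarrow> 'b \<Rightarrow> bool" where
  "bounded_algebra p B q \<longleftrightarrow>
     (\<forall>b\<in>carrier B. q_number B q p \<otimes>\<^bsub>B\<^esub> b = \<zero>\<^bsub>B\<^esub> \<longrightarrow> b = \<zero>\<^bsub>B\<^esub>) \<and>
     (let Q = B Quot (q_ideal p B q) in
      \<exists>N::nat. \<forall>y\<in>carrier Q. \<forall>m::nat.
        add_pow Q (p ^ m) y = \<zero>\<^bsub>Q\<^esub> \<longrightarrow> add_pow Q (p ^ N) y = \<zero>\<^bsub>Q\<^esub>)"


section \<open>The adic topology and completion\<close>

definition adic_ideal :: "nat \<Rightarrow> ('b, 'm) ring_scheme \<Rightarrow> 'b \<Rightarrow> 'b set" where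
  "adic_ideal p B q = Idl\<^bsub>B\<^esub> {add_pow B p \<one>\<^bsub>B\<^esub>, q \<ominus>\<^bsub>B\<^esub> \<one>\<^bsub>B\<^esub>}"

primrec ideal_power :: "('b, 'm) ring_scheme \<Rightarrow> 'b set \<Rightarrow> nat \<Rightarrow> 'b set" where
  "ideal_power B I 0 = carrier B"
| "ideal_power B I (Suc n) = ideal_prod B I (ideal_power B I n)"

text \<open>The inverse limit of the rings \<open>B / I\<^sup>n\<close>. The transition map sends the coset \<open>I\<^sup>n\<^sup>+\<^sup>1 + b\<close> to
  the unique coset of \<open>I\<^sup>n\<close> containing it, whence the inclusion in the compatibility condition.\<close>

definition completion :: "('b, 'm) ring_scheme \<Rightarrow> 'b set \<Rightarrow> (nat \<Rightarrow> 'b set) ring" where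
  "completion B I = (let Q = (\<lambda>n. B Quot (ideal_power B I n)) in
     \<lparr>carrier = {s. \<forall>n. s n \<in> carrier (Q n) \<and> s (Suc n) \<subseteq> s n},
      monoid.mult = (\<lambda>s t n. s n \<otimes>\<^bsub>Q n\<^esub> t n),
      one = (\<lambda>n. \<one>\<^bsub>Q n\<^esub>),
      zero = (\<lambda>n. \<zero>\<^bsub>Q n\<^esub>),
      add = (\<lambda>s t n. s n \<oplus>\<^bsub>Q n\<^esub> t n)\<rparr>)"

definition to_completion :: "('b, 'm) ring_scheme \<Rightarrow> 'b set \<Rightarrow> 'b \<Rightarrow> nat \<Rightarrow> 'b set" where
  "to_completion B I b = (\<lambda>n. ideal_power B I n +>\<^bsub>B\<^esub> b)"

definition adic_complete :: "('b, 'm) ring_scheme \<Rightarrow> 'b set \<Rightarrow> bool" where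
  "adic_complete B I \<longleftrightarrow> to_completion B I \<in> ring_iso B (completion B I)"

text \<open>The extension by continuity of \<open>\<delta>\<close> to the completion, for \<open>I = (p, q - 1)\<close>: as
  \<open>\<delta>(q) = 0\<close>, elements congruent modulo \<open>I\<^sup>n\<^sup>+\<^sup>1\<close> have images congruent modulo \<open>I\<^sup>n\<close>, so that the choice
  of the representative does not matter.\<close>

definition completion_delta ::
  "('b, 'm) ring_scheme \<Rightarrow> 'b set \<Rightarrow> ('b \<Rightarrow> 'b) \<Rightarrow> (nat \<Rightarrow> 'b set) \<Rightarrow> (nat \<Rightarrow> 'b set)" where
  "completion_delta B I \<delta> s = (\<lambda>n. ideal_power B I n +>\<^bsub>B\<^esub> \<delta> (SOME b. b \<in> s (Suc n)))"


section \<open>Prismatic envelopes\<close>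

definition delta_pair ::
  "nat \<Rightarrow> ('r, 'k) ring_scheme \<Rightarrow> ('r \<Rightarrow> 'r) \<Rightarrow>
   ('b, 'm) ring_scheme \<Rightarrow> ('b \<Rightarrow> 'b) \<Rightarrow> ('r \<Rightarrow> 'b) \<Rightarrow> 'b set \<Rightarrow> bool" where
  "delta_pair p R \<delta>R B \<delta>B \<rho>B J \<longleftrightarrow> delta_algebra p R \<delta>R B \<delta>B \<rho>B \<and> ideal J B"

definition delta_pair_hom ::
  "('r, 'k) ring_scheme \<Rightarrow>
   ('b, 'm) ring_scheme \<Rightarrow> ('b \<Rightarrow> 'b) \<Rightarrow> ('r \<Rightarrow> 'b) \<Rightarrow> 'b set \<Rightarrow>
   ('c, 'n) ring_scheme \<Rightarrow> ('c \<Rightarrow> 'c) \<Rightarrow> ('r \<Rightarrow> 'c) \<Rightarrow> 'c set \<Rightarrow> ('b \<Rightarrow> 'c) \<Rightarrow> bool" where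
  "delta_pair_hom R B \<delta>B \<rho>B J C \<delta>C \<rho>C K f \<longleftrightarrow>
     delta_hom B \<delta>B C \<delta>C f \<and> (\<forall>r\<in>carrier R. f (\<rho>B r) = \<rho>C r) \<and> f ` J \<subseteq> K"

text \<open>The delta-pair \<open>(B, (p)\<^sub>q)\<close> is a \<open>(p)\<^sub>q\<close>-prism over \<open>R\<close>; \<open>q\<close> is an element of \<open>R\<close>.\<close>

definition q_prism ::
  "nat \<Rightarrow> ('r, 'k) ring_scheme \<Rightarrow> ('r \<Rightarrow> 'r) \<Rightarrow> 'r \<Rightarrow>
   ('b, 'm) ring_scheme \<Rightarrow> ('b \<Rightarrow> 'b) \<Rightarrow> ('r \<Rightarrow> 'b) \<Rightarrow> bool" where
  "q_prism p R \<delta>R q B \<delta>B \<rho>B \<longleftrightarrow>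
     delta_pair p R \<delta>R B \<delta>B \<rho>B (q_ideal p B (\<rho>B q)) \<and>
     adic_complete B (adic_ideal p B (\<rho>B q)) \<and>
     bounded_algebra p B (\<rho>B q)"

text \<open>\<open>(P, (p)\<^sub>q)\<close> with \<open>u\<close> is the prismatic envelope of \<open>(B, J)\<close>. The type argument is the ambient
  type of the carriers of the test prisms \<open>C\<close>; in a theorem it is a free type variable, so that
  the test prisms are arbitrary. Maps out of \<open>P\<close> only matter on the carrier of \<open>P\<close>.\<close>

definition prismatic_envelope ::
  "'c itself \<Rightarrow> nat \<Rightarrow> ('r, 'k) ring_scheme \<Rightarrow> ('r \<Rightarrow> 'r) \<Rightarrow> 'r \<Rightarrow>
   ('b, 'm) ring_scheme \<Rightarrow> ('b \<Rightarrow> 'b) \<Rightarrow> ('r \<Rightarrow> 'b) \<Rightarrow> 'b set \<Rightarrow>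
   ('d, 'n) ring_scheme \<Rightarrow> ('d \<Rightarrow> 'd) \<Rightarrow> ('r \<Rightarrow> 'd) \<Rightarrow> ('b \<Rightarrow> 'd) \<Rightarrow> bool" where
  "prismatic_envelope (_ :: 'c itself) p R \<delta>R q B \<delta>B \<rho>B J P \<delta>P \<rho>P u \<longleftrightarrow>
     delta_pair p R \<delta>R B \<delta>B \<rho>B J \<and>
     q_prism p R \<delta>R q P \<delta>P \<rho>P \<and>
     delta_pair_hom R B \<delta>B \<rho>B J P \<delta>P \<rho>P (q_ideal p P (\<rho>P q)) u \<and>
     (\<forall>(C :: 'c ring) \<delta>C \<rho>C f.
        q_prism p R \<delta>R q C \<delta>C \<rho>C \<and>
        delta_pair_hom R B \<delta>B \<rho>B J C \<delta>C \<rho>C (q_ideal p C (\<rho>C q)) f \<longrightarrow>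
        (\<exists>!g. g \<in> extensional (carrier P) \<and>
           delta_pair_hom R P \<delta>P \<rho>P (q_ideal p P (\<rho>P q)) C \<delta>C \<rho>C (q_ideal p C (\<rho>C q)) g \<and>
           (\<forall>b\<in>carrier B. g (u b) = f b)))"


section \<open>The polynomial ring and its symmetric delta-structure\<close>

abbreviation poly_const :: "('a, 'm) ring_scheme \<Rightarrow> 'a \<Rightarrow> (nat \<Rightarrow> 'a)" where
  "poly_const A a \<equiv> up_ring.monom (UP A) a 0"

abbreviation poly_xi :: "('a, 'm) ring_scheme \<Rightarrow> (nat \<Rightarrow> 'a)" where
  "poly_xi A \<equiv> up_ring.monom (UP A) \<one>\<^bsub>A\<^esub> 1"

definition symmetric_delta ::
  "nat \<Rightarrow> ('a, 'm) ring_scheme \<Rightarrow> ('a \<Rightarrow> 'a) \<Rightarrow> 'a \<Rightarrow> ((nat \<Rightarrow> 'a) \<Rightarrow> (nat \<Rightarrow> 'a)) \<Rightarrow> bool" where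
  "symmetric_delta p A \<delta>A x \<delta> \<longleftrightarrow>
     delta_ring p (UP A) \<delta> \<and>
     (\<forall>a\<in>carrier A. \<delta> (poly_const A a) = poly_const A (\<delta>A a)) \<and>
     \<delta> (poly_const A x \<oplus>\<^bsub>UP A\<^esub> poly_xi A) = \<zero>\<^bsub>UP A\<^esub>"


section \<open>The ring of twisted divided powers of level -1\<close>

text \<open>The coefficient of \<open>\<omega>\<^bsup>{n1 + n2 - i}\<^esup>\<close> in the product of \<open>\<omega>\<^bsup>{n1}\<^esup>\<close> and \<open>\<omega>\<^bsup>{n2}\<^esup>\<close>.\<close>

definition omega_coeff ::
  "nat \<Rightarrow> ('a, 'm) ring_scheme \<Rightarrow> 'a \<Rightarrow> 'a \<Rightarrow> nat \<Rightarrow> nat \<Rightarrow> nat \<Rightarrow> 'a" where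
  "omega_coeff p A q x n1 n2 i =
     q [^]\<^bsub>A\<^esub> (p * i * (i - 1) div 2) \<otimes>\<^bsub>A\<^esub>
     q_binomial A (q [^]\<^bsub>A\<^esub> p) (n1 + n2 - i) n1 \<otimes>\<^bsub>A\<^esub>
     q_binomial A (q [^]\<^bsub>A\<^esub> p) n1 i \<otimes>\<^bsub>A\<^esub>
     (q \<ominus>\<^bsub>A\<^esub> \<one>\<^bsub>A\<^esub>) [^]\<^bsub>A\<^esub> i \<otimes>\<^bsub>A\<^esub> x [^]\<^bsub>A\<^esub> i"

text \<open>The free module on the \<open>\<omega>\<^bsup>{n}\<^esup>\<close> is realized as the set \<^term>\<open>up A\<close> of finitely supported
  sequences in \<open>A\<close>: \<open>s\<close> stands for the sum of the \<open>s n \<cdot> \<omega>\<^bsup>{n}\<^esup>\<close>. The multiplication is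
  the bilinear extension of the multiplication of the basis elements.\<close>

definition Omega :: "nat \<Rightarrow> ('a, 'm) ring_scheme \<Rightarrow> 'a \<Rightarrow> 'a \<Rightarrow> (nat \<Rightarrow> 'a) ring" where
  "Omega p A q x =
     \<lparr>carrier = up A,
      monoid.mult = (\<lambda>s t m. finsum A
        (\<lambda>(n1, n2, i). s n1 \<otimes>\<^bsub>A\<^esub> t n2 \<otimes>\<^bsub>A\<^esub> omega_coeff p A q x n1 n2 i)
        {(n1, n2, i). i \<le> min n1 n2 \<and> n1 + n2 - i = m}),
      one = (\<lambda>n. if n = 0 then \<one>\<^bsub>A\<^esub> else \<zero>\<^bsub>A\<^esub>),
      zero = (\<lambda>n. \<zero>\<^bsub>A\<^esub>),
      add = (\<lambda>s t n. s n \<oplus>\<^bsub>A\<^esub> t n)\<rparr>"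

definition omega_const :: "('a, 'm) ring_scheme \<Rightarrow> 'a \<Rightarrow> (nat \<Rightarrow> 'a)" where
  "omega_const A a = (\<lambda>n. if n = 0 then a else \<zero>\<^bsub>A\<^esub>)"

text \<open>The morphism of \<open>A\<close>-algebras \<open>\<xi> \<mapsto> (p)\<^sub>q \<omega>\<close>.\<close>

definition blowing_up ::
  "nat \<Rightarrow> ('a, 'm) ring_scheme \<Rightarrow> 'a \<Rightarrow> 'a \<Rightarrow> (nat \<Rightarrow> 'a) \<Rightarrow> (nat \<Rightarrow> 'a)" where
  "blowing_up p A q x =
     eval A (Omega p A q x) (omega_const A) (\<lambda>n. if n = 1 then q_number A q p else \<zero>\<^bsub>A\<^esub>)"


section \<open>The natural delta-structure on the twisted divided powers\<close>

definition q_datum ::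
  "nat \<Rightarrow> 'r ring \<Rightarrow> ('r \<Rightarrow> 'r) \<Rightarrow> (int poly fract \<Rightarrow> 'r) \<Rightarrow>
   'a ring \<Rightarrow> ('a \<Rightarrow> 'a) \<Rightarrow> ('r \<Rightarrow> 'a) \<Rightarrow> 'a \<Rightarrow> bool" where
  "q_datum p R \<delta>R \<eta> A \<delta>A \<rho> x \<longleftrightarrow>
     q_delta_ring p R \<delta>R \<eta> \<and> delta_algebra p R \<delta>R A \<delta>A \<rho> \<and> rank_one A \<delta>A x"

definition q_datum_hom ::
  "nat \<Rightarrow> 'r ring \<Rightarrow> ('r \<Rightarrow> 'r) \<Rightarrow> (int poly fract \<Rightarrow> 'r) \<Rightarrow>
   'a ring \<Rightarrow> ('a \<Rightarrow> 'a) \<Rightarrow> ('r \<Rightarrow> 'a) \<Rightarrow> 'a \<Rightarrow>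
   'r ring \<Rightarrow> ('r \<Rightarrow> 'r) \<Rightarrow> (int poly fract \<Rightarrow> 'r) \<Rightarrow>
   'a ring \<Rightarrow> ('a \<Rightarrow> 'a) \<Rightarrow> ('r \<Rightarrow> 'a) \<Rightarrow> 'a \<Rightarrow> ('r \<Rightarrow> 'r) \<Rightarrow> ('a \<Rightarrow> 'a) \<Rightarrow> bool" where
  "q_datum_hom p R \<delta>R \<eta> A \<delta>A \<rho> x R' \<delta>R' \<eta>' A' \<delta>A' \<rho>' x' f g \<longleftrightarrow>
     delta_hom R \<delta>R R' \<delta>R' f \<and> (\<forall>z\<in>carrier (Zq_loc p). f (\<eta> z) = \<eta>' z) \<and>
     delta_hom A \<delta>A A' \<delta>A' g \<and> (\<forall>r\<in>carrier R. g (\<rho> r) = \<rho>' (f r)) \<and> g x = x'"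

text \<open>\<open>\<Delta>\<close> assigns to every \<open>(R, q, A, x)\<close> a delta-structure on \<open>A\<langle>\<omega>\<rangle>\<close> for which the blowing up is
  a morphism of delta-rings, functorially. All \<open>R\<close> have their carrier in the type \<open>'r\<close> and all \<open>A\<close>
  in the type \<open>'a\<close>. As soon as both types are infinite they contain a copy of the initial datum
  \<open>\<int>[q]\<^bsub>(p, q - 1)\<^esub>\<close>, \<open>\<int>[q]\<^bsub>(p, q - 1)\<^esub>[x]\<close> (which is countable and over which the delta-structure is
  unique by torsion-freeness), hence \<open>\<Delta>\<close> is determined on the carriers. If one of the types
  is finite, the only bounded \<open>A\<close> is the zero ring.\<close>

definition natural_omega_delta ::
  "nat \<Rightarrow> ('r ring \<Rightarrow> ('r \<Rightarrow> 'r) \<Rightarrow> (int poly fract \<Rightarrow> 'r) \<Rightarrow>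
     'a ring \<Rightarrow> ('a \<Rightarrow> 'a) \<Rightarrow> ('r \<Rightarrow> 'a) \<Rightarrow> 'a \<Rightarrow> (nat \<Rightarrow> 'a) \<Rightarrow> (nat \<Rightarrow> 'a)) \<Rightarrow> bool" where
  "natural_omega_delta p \<Delta> \<longleftrightarrow>
     (\<forall>R \<delta>R \<eta> A \<delta>A \<rho> x. q_datum p R \<delta>R \<eta> A \<delta>A \<rho> x \<longrightarrow>
        (let q = \<rho> (\<eta> q_loc); \<delta>\<Omega> = \<Delta> R \<delta>R \<eta> A \<delta>A \<rho> x in
           delta_ring p (Omega p A q x) \<delta>\<Omega> \<and>
           (\<exists>\<delta>\<xi>. symmetric_delta p A \<delta>A x \<delta>\<xi> \<and>
              delta_hom (UP A) \<delta>\<xi> (Omega p A q x) \<delta>\<Omega> (blowing_up p A q x)))) \<and>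
     (\<forall>R \<delta>R \<eta> A \<delta>A \<rho> x R' \<delta>R' \<eta>' A' \<delta>A' \<rho>' x' f g.
        q_datum p R \<delta>R \<eta> A \<delta>A \<rho> x \<and> q_datum p R' \<delta>R' \<eta>' A' \<delta>A' \<rho>' x' \<and>
        q_datum_hom p R \<delta>R \<eta> A \<delta>A \<rho> x R' \<delta>R' \<eta>' A' \<delta>A' \<rho>' x' f g \<longrightarrow>
        delta_hom (Omega p A (\<rho> (\<eta> q_loc)) x) (\<Delta> R \<delta>R \<eta> A \<delta>A \<rho> x)
          (Omega p A' (\<rho>' (\<eta>' q_loc)) x') (\<Delta> R' \<delta>R' \<eta>' A' \<delta>A' \<rho>' x')
          (\<lambda>s n. g (s n)))"

end

(* Write f for (p)_q and Z_j for the j-fold iterate of delta on omega.  In any delta-A-algebra with an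
   element w such that delta(x + f w) = 0, the iterates z_j of w satisfy
     z_j^p = c_j z_(j+1) + (combination of digit monomials of index < p^(j+1)),
   where c_j lies in Z[q]_(p,q-1) and c_j(1) is p times a unit; the digit monomial of index
   n = sum n_j p^j is the product of the z_j^(n_j).  Hence the A-span of the digit monomials is a
   delta-subring.  In A<omega> the element Z_j has degree p^j with invertible leading coefficient:
   for the universal base Z[q]_(p,q-1)[x], which is torsion free, this follows from the relation
   above, and naturality of the delta-structure carries it to A.  So the digit monomials in the Z_j
   form an A-basis of A<omega>.  For a prism C and a morphism sending xi to f w, the span of the digit
   monomials of (omega, w) in A<omega> x C is a delta-subring and the graph of a map
   A<omega> -> C, the only possible one.  Boundedness gives that division by f is continuous for the
   (p, q-1)-adic topology, so the completion is again bounded, and delta and the map to C extend to it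
   by continuity. *)

theory Submission
  imports Defs "HOL-Algebra.Exponent" "HOL-Algebra.Chinese_Remainder" "HOL-Library.Countable_Set"
begin

text \<open>The obstacle is that delta cannot be computed directly. On \<open>Omega\<close> it is
  given only through naturality and the blowing up, with no formula for delta(omega), and test
  prisms are not assumed p-torsion free, so delta cannot be recovered there from a Frobenius lift.
  Everything is drawn from the single equation delta(x + f w) = 0. The relation for z_(j+1) comes
  from computing delta(z_j^p) twice, by the product rule and by the relation for z_j; the
  coefficient of z_(j+1)^p that remains is a unit because its value at q = 1 is prime to p. The
  leading coefficient of Z_(j+1) is found by counting powers of p at q = 1: the p-th power of Z_j
  contributes a product of q^p-binomials of valuation exactly one, as does c_j, and the quotient is
  a unit of the local ring. The product A<omega> x C is used because independence of the digit
  monomials is known in the first factor only; it forces the second component to be single valued.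
  The naturality hypothesis quantifies over two fixed types, so the universal base has to be copied
  into them, and finite types are excluded by showing that A is zero.\<close>

section \<open>Commutative rings and the correction polynomial \<open>cross\<close>\<close>

lemma (in abelian_group) add_diff_cancel:
  "u \<in> carrier G \<Longrightarrow> v \<in> carrier G \<Longrightarrow> u \<oplus> v \<ominus> u = v"
  by (simp add: minus_eq a_comm[of u v] a_assoc r_neg)

lemma (in abelian_group) diff_add_cancel:
  "u \<in> carrier G \<Longrightarrow> v \<in> carrier G \<Longrightarrow> u \<ominus> v \<oplus> v = u"
  by (simp add: minus_eq a_assoc l_neg)

lemma (in abelian_group) diff_zero_iff:
  assumes "a \<in> carrier G" "b \<in> carrier G"
  shows "a \<ominus> b = \<zero> \<longleftrightarrow> a = b"
proof
  assume "a \<ominus> b = \<zero>"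
  then show "a = b" using diff_add_cancel[OF assms] assms by simp
qed (use assms in \<open>simp add: minus_eq r_neg\<close>)

lemma (in cring) add_pow_eq_mult:
  "a \<in> carrier R \<Longrightarrow> add_pow R (n::nat) a = add_pow R n \<one> \<otimes> a"
  by (metis add_pow_ldistr l_one one_closed)

lemma (in cring) add_pow_nat_closed: "a \<in> carrier R \<Longrightarrow> add_pow R (n::nat) a \<in> carrier R"
  by simp

lemma (in cring) add_pow_Suc': "a \<in> carrier R \<Longrightarrow> add_pow R (Suc n) a = add_pow R n a \<oplus> a"
  by (simp add: add.nat_pow_Suc)

lemma (in cring) finsum_mem:
  assumes H: "additive_subgroup H R" and "\<And>i. i \<in> S \<Longrightarrow> g i \<in> H"
  shows "finsum R g S \<in> H"
proof (cases "finite S")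
  case True
  interpret additive_subgroup H R by fact
  show ?thesis using True assms(2)
  proof (induction S rule: finite_induct)
    case (insert i S)
    then have "g i \<in> carrier R" "g \<in> S \<rightarrow> carrier R" using a_Hcarr by blast+
    with insert show ?case by simp
  qed simp
next
  case False
  then show ?thesis using H by (simp add: finsum_infinite additive_subgroup.zero_closed)
qed

lemma (in cring) add_pow_mem:
  assumes H: "additive_subgroup H R" and "a \<in> H"
  shows "add_pow R (n::nat) a \<in> H"
proof -
  interpret additive_subgroup H R by fact
  show ?thesis using assms(2) by (induction n) (auto simp: add.nat_pow_Suc)
qed

lemma (in cring) binomial_cring:
  assumes a: "a \<in> carrier R" and b: "b \<in> carrier R"
  shows "(a \<oplus> b) [^] n = (\<Oplus>i\<in>{..n}. add_pow R (n choose i) (a [^] i \<otimes> b [^] (n - i)))"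
proof (induction n)
  case 0
  then show ?case by simp
next
  case (Suc n)
  let ?t = "\<lambda>n i. add_pow R (n choose i) (a [^] i \<otimes> b [^] (n - i))"
  have t: "\<And>n i. ?t n i \<in> carrier R" using a b by simp
  have A: "(\<Oplus>i\<in>{..n}. ?t n i) \<otimes> a = (\<Oplus>i\<in>{..n}. add_pow R (n choose i) (a [^] Suc i \<otimes> b [^] (n - i)))"
    (is "_ = ?A")
  proof -
    have "(\<Oplus>i\<in>{..n}. ?t n i) \<otimes> a = (\<Oplus>i\<in>{..n}. ?t n i \<otimes> a)"
      using finsum_ldistr[of "{..n}" a "?t n"] t a by auto
    also have "\<dots> = ?A"
    proof (rule finsum_cong')
      fix i
      have "?t n i \<otimes> a = add_pow R (n choose i) (a [^] i \<otimes> b [^] (n - i) \<otimes> a)"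
        using a b by (simp add: add_pow_ldistr)
      also have "a [^] i \<otimes> b [^] (n - i) \<otimes> a = a [^] Suc i \<otimes> b [^] (n - i)"
        using a b by (simp add: m_ac)
      finally show "?t n i \<otimes> a = add_pow R (n choose i) (a [^] Suc i \<otimes> b [^] (n - i))" .
    qed (use a b in auto)
    finally show ?thesis .
  qed
  have B: "(\<Oplus>i\<in>{..n}. ?t n i) \<otimes> b = (\<Oplus>i\<in>{..Suc n}. add_pow R (n choose i) (a [^] i \<otimes> b [^] (Suc n - i)))"
    (is "_ = ?B")
  proof -
    have "(\<Oplus>i\<in>{..n}. ?t n i) \<otimes> b = (\<Oplus>i\<in>{..n}. ?t n i \<otimes> b)"
      using finsum_ldistr[of "{..n}" b "?t n"] t b by auto
    also have "\<dots> = (\<Oplus>i\<in>{..n}. add_pow R (n choose i) (a [^] i \<otimes> b [^] (Suc n - i)))"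
    proof (rule finsum_cong')
      fix i assume i: "i \<in> {..n}"
      have "?t n i \<otimes> b = add_pow R (n choose i) (a [^] i \<otimes> b [^] (n - i) \<otimes> b)"
        using a b by (simp add: add_pow_ldistr)
      also have "a [^] i \<otimes> b [^] (n - i) \<otimes> b = a [^] i \<otimes> b [^] (Suc n - i)"
        using a b i by (simp add: m_assoc Suc_diff_le)
      finally show "?t n i \<otimes> b = add_pow R (n choose i) (a [^] i \<otimes> b [^] (Suc n - i))" .
    qed (use a b in auto)
    finally show ?thesis using a b by (simp add: Pi_def binomial_eq_0)
  qed
  have C: "?A = (\<Oplus>i\<in>{..Suc n}. add_pow R (if i = 0 then 0 else n choose (i - 1)) (a [^] i \<otimes> b [^] (Suc n - i)))"
    using a b by (subst finsum_Suc2) (auto simp: Pi_def)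
  have "(a \<oplus> b) [^] Suc n = ?A \<oplus> ?B"
    using a b t Suc A B by (simp add: r_distr Pi_def)
  also have "\<dots> = (\<Oplus>i\<in>{..Suc n}. add_pow R (if i = 0 then 0 else n choose (i - 1)) (a [^] i \<otimes> b [^] (Suc n - i))
       \<oplus> add_pow R (n choose i) (a [^] i \<otimes> b [^] (Suc n - i)))"
    unfolding C using a b by (subst finsum_addf) (auto simp: Pi_def)
  also have "\<dots> = (\<Oplus>i\<in>{..Suc n}. ?t (Suc n) i)"
  proof (rule finsum_cong')
    fix i
    show "add_pow R (if i = 0 then 0 else n choose (i - 1)) (a [^] i \<otimes> b [^] (Suc n - i))
       \<oplus> add_pow R (n choose i) (a [^] i \<otimes> b [^] (Suc n - i)) = ?t (Suc n) i"
      using a b by (cases i) (auto simp: add.nat_pow_mult)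
  qed (use a b in auto)
  finally show ?case .
qed

text \<open>The integral polynomial ((a + b)^p - a^p - b^p)/p, the correction term in the additivity
  of delta. Naming it allows the estimates on ideals and filtrations to be made once.\<close>

definition cross :: "nat \<Rightarrow> ('b, 'm) ring_scheme \<Rightarrow> 'b \<Rightarrow> 'b \<Rightarrow> 'b" where
  "cross p B a b =
     (\<Oplus>\<^bsub>B\<^esub>i\<in>{1..<p}. add_pow B ((p choose i) div p) (a [^]\<^bsub>B\<^esub> i \<otimes>\<^bsub>B\<^esub> b [^]\<^bsub>B\<^esub> (p - i)))"

lemma (in cring) cross_closed: "a \<in> carrier R \<Longrightarrow> b \<in> carrier R \<Longrightarrow> cross p R a b \<in> carrier R"
  unfolding cross_def by (intro finsum_closed) auto

text \<open>Only mixed monomials occur, with both exponents positive. A subgroup that contains these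
  products contains the value; it will be an ideal, or a step of a filtration.\<close>

lemma (in cring) cross_mem:
  assumes "additive_subgroup H R"
    and "\<And>i. 0 < i \<Longrightarrow> i < p \<Longrightarrow> a [^] i \<otimes> b [^] (p - i) \<in> H"
  shows "cross p R a b \<in> H"
  unfolding cross_def using assms by (intro finsum_mem add_pow_mem) auto

text \<open>The prime p divides every inner binomial coefficient. The division by p is made on the
  integer coefficients, so the identity is valid in rings with p-torsion.\<close>

lemma (in cring) power_sum_cross:
  assumes p: "prime p" and a: "a \<in> carrier R" and b: "b \<in> carrier R"
  shows "(a \<oplus> b) [^] p = a [^] p \<oplus> b [^] p \<oplus> add_pow R p (cross p R a b)"
proof -
  let ?t = "\<lambda>i. add_pow R (p choose i) (a [^] i \<otimes> b [^] (p - i))"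
  have t: "\<And>i. ?t i \<in> carrier R" using a b by simp
  have p0: "p > 0" using p prime_gt_0_nat by blast
  have "{..p} = insert 0 (insert p {1..<p})" using p0 by auto
  then have "(a \<oplus> b) [^] p = finsum R ?t (insert 0 (insert p {1..<p}))"
    using binomial_cring[OF a b, of p] by simp
  also have "\<dots> = b [^] p \<oplus> (a [^] p \<oplus> finsum R ?t {1..<p})"
    using p0 a b by (simp add: Pi_def)
  also have "finsum R ?t {1..<p} = (\<Oplus>i\<in>{1..<p}. add_pow R p \<one> \<otimes> add_pow R ((p choose i) div p) (a [^] i \<otimes> b [^] (p - i)))"
  proof (rule finsum_cong')
    fix i assume i: "i \<in> {1..<p}"
    then have "p dvd (p choose i)" using p by (intro dvd_choose_prime) auto
    then obtain k where k: "p choose i = p * k" ..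
    then have k': "(p choose i) div p = k" using p0 by simp
    show "?t i = add_pow R p \<one> \<otimes> add_pow R ((p choose i) div p) (a [^] i \<otimes> b [^] (p - i))"
      unfolding k' unfolding k using a b
      by (subst add_pow_eq_mult[of "add_pow R k _", symmetric])
         (auto simp: add.nat_pow_pow mult.commute)
  qed (use a b in auto)
  also have "\<dots> = add_pow R p \<one> \<otimes> cross p R a b"
    unfolding cross_def using a b by (intro finsum_rdistr[symmetric]) auto
  also have "\<dots> = add_pow R p (cross p R a b)"
    using a b by (metis add_pow_eq_mult cross_closed)
  finally show ?thesis using a b cross_closed[OF a b] by (simp add: a_ac)
qed

lemma (in ring_hom_cring) hom_add_pow:
  "a \<in> carrier R \<Longrightarrow> h (add_pow R (n::nat) a) = add_pow S n (h a)"
  by (induction n) (auto simp: R.add.nat_pow_Suc S.add.nat_pow_Suc)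

lemma (in ring_hom_cring) hom_cross:
  "a \<in> carrier R \<Longrightarrow> b \<in> carrier R \<Longrightarrow> h (cross p R a b) = cross p S (h a) (h b)"
  unfolding cross_def by (auto simp: hom_add_pow Pi_def intro!: S.finsum_cong')

section \<open>Delta-rings, Frobenius lifts and compatible maps\<close>

context delta_ring
begin

lemma delta_add_cross: "a \<in> carrier B \<Longrightarrow> b \<in> carrier B \<Longrightarrow> \<delta> (a \<oplus> b) = (\<delta> a \<oplus> \<delta> b) \<ominus> cross p B a b"
  unfolding cross_def by (rule delta_add)

definition frob where "frob a = a [^] p \<oplus> add_pow B p (\<delta> a)"

lemma frob_closed: "a \<in> carrier B \<Longrightarrow> frob a \<in> carrier B"
  by (simp add: frob_def delta_closed)

text \<open>Absorbing p \<delta>(a) \<delta>(b) into the first summand gives an asymmetric product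
  rule with coefficient \<open>frob a\<close> at \<delta>(b). This form serves the estimates on
  powers of an ideal and the division by an element whose \<open>frob\<close> is a unit.\<close>

lemma delta_mult_frob: "a \<in> carrier B \<Longrightarrow> b \<in> carrier B \<Longrightarrow>
   \<delta> (a \<otimes> b) = frob a \<otimes> \<delta> b \<oplus> b [^] p \<otimes> \<delta> a"
  using delta_closed[of a] delta_closed[of b]
  by (simp add: delta_mult frob_def add_pow_eq_mult[of "\<delta> a \<otimes> \<delta> b"] add_pow_eq_mult[of "\<delta> a"] l_distr m_assoc a_ac)

end

lemma delta_ringI_cross:
  assumes "cring B" "\<And>b. b \<in> carrier B \<Longrightarrow> \<delta> b \<in> carrier B" "\<delta> \<zero>\<^bsub>B\<^esub> = \<zero>\<^bsub>B\<^esub>" "\<delta> \<one>\<^bsub>B\<^esub> = \<zero>\<^bsub>B\<^esub>"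
    "\<And>a b. a \<in> carrier B \<Longrightarrow> b \<in> carrier B \<Longrightarrow>
       \<delta> (a \<oplus>\<^bsub>B\<^esub> b) = (\<delta> a \<oplus>\<^bsub>B\<^esub> \<delta> b) \<ominus>\<^bsub>B\<^esub> cross p B a b"
    "\<And>a b. a \<in> carrier B \<Longrightarrow> b \<in> carrier B \<Longrightarrow>
       \<delta> (a \<otimes>\<^bsub>B\<^esub> b) = (a [^]\<^bsub>B\<^esub> p \<otimes>\<^bsub>B\<^esub> \<delta> b \<oplus>\<^bsub>B\<^esub> b [^]\<^bsub>B\<^esub> p \<otimes>\<^bsub>B\<^esub> \<delta> a) \<oplus>\<^bsub>B\<^esub> add_pow B p (\<delta> a \<otimes>\<^bsub>B\<^esub> \<delta> b)"
  shows "delta_ring p B \<delta>"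
  using assms unfolding delta_ring_def delta_ring_axioms_def cross_def by blast

text \<open>Multiplication by p is injective, so each identity may be checked after multiplying by
  p. There it becomes additivity or multiplicativity of \<phi>, combined with the expansion of (a +
  b)^p.\<close>

lemma delta_ring_of_frobenius_lift:
  assumes "cring B" and p: "prime p"
    and tf: "\<And>b. b \<in> carrier B \<Longrightarrow> add_pow B p b = \<zero>\<^bsub>B\<^esub> \<Longrightarrow> b = \<zero>\<^bsub>B\<^esub>"
    and hom: "\<phi> \<in> ring_hom B B" and cl: "\<And>b. b \<in> carrier B \<Longrightarrow> \<delta> b \<in> carrier B"
    and lift: "\<And>b. b \<in> carrier B \<Longrightarrow> \<phi> b = b [^]\<^bsub>B\<^esub> p \<oplus>\<^bsub>B\<^esub> add_pow B p (\<delta> b)"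
  shows "delta_ring p B \<delta>"
proof -
  interpret B: cring B by fact
  interpret \<phi>: ring_hom_cring B B \<phi> by unfold_locales (rule hom)
  have p0: "p > 0" using p prime_gt_0_nat by blast
  have P: "add_pow B p a = add_pow B p \<one>\<^bsub>B\<^esub> \<otimes>\<^bsub>B\<^esub> a" if "a \<in> carrier B" for a
    using that by (rule B.add_pow_eq_mult)
  have inj: "a = b" if "a \<in> carrier B" "b \<in> carrier B" "add_pow B p a = add_pow B p b" for a b
  proof -
    have "add_pow B p (a \<ominus>\<^bsub>B\<^esub> b) = \<zero>\<^bsub>B\<^esub>"
      using that by (subst P) (simp_all add: P[of a] P[of b] B.minus_eq B.r_distr B.r_minus B.r_neg)
    with tf that show ?thesis using that B.diff_zero_iff by (meson B.minus_closed)
  qed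
  have eq: "add_pow B p (\<delta> b) = \<phi> b \<ominus>\<^bsub>B\<^esub> b [^]\<^bsub>B\<^esub> p" if "b \<in> carrier B" for b
  proof -
    show ?thesis using that cl[OF that] by (simp add: lift[OF that] B.add_diff_cancel)
  qed
  show ?thesis
  proof (rule delta_ringI_cross)
    show "\<delta> \<zero>\<^bsub>B\<^esub> = \<zero>\<^bsub>B\<^esub>"
      by (rule inj) (use cl p0 in \<open>auto simp: eq B.nat_pow_zero B.minus_eq B.r_neg\<close>)
    show "\<delta> \<one>\<^bsub>B\<^esub> = \<zero>\<^bsub>B\<^esub>"
      by (rule inj) (use cl p0 in \<open>auto simp: eq B.minus_eq B.r_neg\<close>)
  next
    fix a b assume a: "a \<in> carrier B" and b: "b \<in> carrier B"
    note c = cl[OF a] cl[OF b] a b B.cross_closed[OF a b, of p] B.nat_pow_closed[OF a, of p] B.nat_pow_closed[OF b, of p]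
      \<phi>.hom_closed[OF a] \<phi>.hom_closed[OF b]
    show "\<delta> (a \<oplus>\<^bsub>B\<^esub> b) = \<delta> a \<oplus>\<^bsub>B\<^esub> \<delta> b \<ominus>\<^bsub>B\<^esub> cross p B a b"
    proof (rule inj)
      have "add_pow B p (\<delta> a \<oplus>\<^bsub>B\<^esub> \<delta> b \<ominus>\<^bsub>B\<^esub> cross p B a b)
         = add_pow B p (\<delta> a) \<oplus>\<^bsub>B\<^esub> add_pow B p (\<delta> b) \<ominus>\<^bsub>B\<^esub> add_pow B p (cross p B a b)"
        using c by (subst P) (simp_all add: P[of "\<delta> a"] P[of "\<delta> b"] P[of "cross p B a b"]
            B.minus_eq B.r_distr B.r_minus)
      moreover have "add_pow B p (cross p B a b) \<in> carrier B" using c by simp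
      moreover have "\<And>u v s t k. \<lbrakk>u \<in> carrier B; v \<in> carrier B; s \<in> carrier B; t \<in> carrier B; k \<in> carrier B\<rbrakk> \<Longrightarrow>
         (u \<oplus>\<^bsub>B\<^esub> v) \<ominus>\<^bsub>B\<^esub> (s \<oplus>\<^bsub>B\<^esub> t \<oplus>\<^bsub>B\<^esub> k) = (u \<ominus>\<^bsub>B\<^esub> s) \<oplus>\<^bsub>B\<^esub> (v \<ominus>\<^bsub>B\<^esub> t) \<ominus>\<^bsub>B\<^esub> k" by algebra
      ultimately show "add_pow B p (\<delta> (a \<oplus>\<^bsub>B\<^esub> b)) = add_pow B p (\<delta> a \<oplus>\<^bsub>B\<^esub> \<delta> b \<ominus>\<^bsub>B\<^esub> cross p B a b)"
        using c by (simp add: eq B.power_sum_cross[OF p])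
    qed (use c cl in auto)
    show "\<delta> (a \<otimes>\<^bsub>B\<^esub> b) = a [^]\<^bsub>B\<^esub> p \<otimes>\<^bsub>B\<^esub> \<delta> b \<oplus>\<^bsub>B\<^esub> b [^]\<^bsub>B\<^esub> p \<otimes>\<^bsub>B\<^esub> \<delta> a \<oplus>\<^bsub>B\<^esub> add_pow B p (\<delta> a \<otimes>\<^bsub>B\<^esub> \<delta> b)"
    proof (rule inj)
      let ?n = "add_pow B p \<one>\<^bsub>B\<^esub>"
      have n: "?n \<in> carrier B" by simp
      have key: "\<And>u v s t. \<lbrakk>u \<in> carrier B; v \<in> carrier B; s \<in> carrier B; t \<in> carrier B\<rbrakk> \<Longrightarrow>
         (u \<oplus>\<^bsub>B\<^esub> ?n \<otimes>\<^bsub>B\<^esub> s) \<otimes>\<^bsub>B\<^esub> (v \<oplus>\<^bsub>B\<^esub> ?n \<otimes>\<^bsub>B\<^esub> t) \<ominus>\<^bsub>B\<^esub> u \<otimes>\<^bsub>B\<^esub> v =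
         ?n \<otimes>\<^bsub>B\<^esub> (u \<otimes>\<^bsub>B\<^esub> t \<oplus>\<^bsub>B\<^esub> v \<otimes>\<^bsub>B\<^esub> s \<oplus>\<^bsub>B\<^esub> ?n \<otimes>\<^bsub>B\<^esub> (s \<otimes>\<^bsub>B\<^esub> t))"
        using n by algebra
      have "add_pow B p (\<delta> (a \<otimes>\<^bsub>B\<^esub> b)) = \<phi> a \<otimes>\<^bsub>B\<^esub> \<phi> b \<ominus>\<^bsub>B\<^esub> a [^]\<^bsub>B\<^esub> p \<otimes>\<^bsub>B\<^esub> b [^]\<^bsub>B\<^esub> p"
        using c by (subst eq) (simp_all add: B.nat_pow_distrib)
      also have "\<dots> = ?n \<otimes>\<^bsub>B\<^esub> (a [^]\<^bsub>B\<^esub> p \<otimes>\<^bsub>B\<^esub> \<delta> b \<oplus>\<^bsub>B\<^esub> b [^]\<^bsub>B\<^esub> p \<otimes>\<^bsub>B\<^esub> \<delta> a \<oplus>\<^bsub>B\<^esub> ?n \<otimes>\<^bsub>B\<^esub> (\<delta> a \<otimes>\<^bsub>B\<^esub> \<delta> b))"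
        using key[OF c(6,7) c(1,2)] unfolding lift[OF a] lift[OF b] P[OF c(1)] P[OF c(2)] .
      also have "?n \<otimes>\<^bsub>B\<^esub> (\<delta> a \<otimes>\<^bsub>B\<^esub> \<delta> b) = add_pow B p (\<delta> a \<otimes>\<^bsub>B\<^esub> \<delta> b)"
        using c by (intro P[symmetric]) auto
      finally show "add_pow B p (\<delta> (a \<otimes>\<^bsub>B\<^esub> b)) =
        add_pow B p (a [^]\<^bsub>B\<^esub> p \<otimes>\<^bsub>B\<^esub> \<delta> b \<oplus>\<^bsub>B\<^esub> b [^]\<^bsub>B\<^esub> p \<otimes>\<^bsub>B\<^esub> \<delta> a \<oplus>\<^bsub>B\<^esub> add_pow B p (\<delta> a \<otimes>\<^bsub>B\<^esub> \<delta> b))"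
        using c by (subst P[of "_ \<oplus>\<^bsub>B\<^esub> _"]) auto
    qed (use c cl in auto)
  qed (use assms in auto)
qed

text \<open>The rules for delta of a sum and of a product use ring operations only, so the elements
  at which h commutes with delta are closed under both. Compatibility can then be tested on
  generators.\<close>

lemma delta_compat_add_mult:
  assumes "delta_ring p B \<delta>B" "delta_ring p C \<delta>C" "h \<in> ring_hom B C"
    and ab: "a \<in> carrier B" "b \<in> carrier B" "h (\<delta>B a) = \<delta>C (h a)" "h (\<delta>B b) = \<delta>C (h b)"
  shows "h (\<delta>B (a \<oplus>\<^bsub>B\<^esub> b)) = \<delta>C (h (a \<oplus>\<^bsub>B\<^esub> b))" "h (\<delta>B (a \<otimes>\<^bsub>B\<^esub> b)) = \<delta>C (h (a \<otimes>\<^bsub>B\<^esub> b))"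
proof -
  interpret B: delta_ring p B \<delta>B by fact
  interpret C: delta_ring p C \<delta>C by fact
  interpret ring_hom_cring B C h by unfold_locales fact
  note cl = B.delta_closed[OF ab(1)] B.delta_closed[OF ab(2)] B.cross_closed[OF ab(1,2)]
  show "h (\<delta>B (a \<oplus>\<^bsub>B\<^esub> b)) = \<delta>C (h (a \<oplus>\<^bsub>B\<^esub> b))"
    using ab cl by (simp add: B.delta_add_cross C.delta_add_cross B.minus_eq C.minus_eq hom_cross)
  show "h (\<delta>B (a \<otimes>\<^bsub>B\<^esub> b)) = \<delta>C (h (a \<otimes>\<^bsub>B\<^esub> b))"
    using ab cl by (simp add: B.delta_mult C.delta_mult hom_add_pow)
qed

lemma (in cring) genideal_pair:
  assumes u: "u \<in> carrier R" and v: "v \<in> carrier R"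
  shows "Idl {u, v} = {u \<otimes> a \<oplus> v \<otimes> b | a b. a \<in> carrier R \<and> b \<in> carrier R}" (is "_ = ?S")
proof
  have "ideal ?S R"
  proof (rule idealI)
    show "ring R" by (rule ring_axioms)
    show "subgroup ?S (add_monoid R)"
    proof (rule add.subgroupI)
      show "?S \<subseteq> carrier R" using u v by auto
      show "?S \<noteq> {}" by auto
    next
      fix s assume "s \<in> ?S"
      then obtain a b where ab: "s = u \<otimes> a \<oplus> v \<otimes> b" "a \<in> carrier R" "b \<in> carrier R" by blast
      then have "\<ominus> s = u \<otimes> (\<ominus> a) \<oplus> v \<otimes> (\<ominus> b)" using u v by (simp add: minus_add r_minus)
      with ab show "\<ominus> s \<in> ?S" by blast
    next
      fix s t assume "s \<in> ?S" "t \<in> ?S"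
      then obtain a b a' b' where ab: "s = u \<otimes> a \<oplus> v \<otimes> b" "a \<in> carrier R" "b \<in> carrier R"
        "t = u \<otimes> a' \<oplus> v \<otimes> b'" "a' \<in> carrier R" "b' \<in> carrier R" by blast
      then have "s \<oplus> t = u \<otimes> (a \<oplus> a') \<oplus> v \<otimes> (b \<oplus> b')" using u v by (simp add: r_distr a_ac)
      with ab show "s \<oplus> t \<in> ?S" by blast
    qed
  next
    fix s c assume "s \<in> ?S" and c: "c \<in> carrier R"
    then obtain a b where ab: "s = u \<otimes> a \<oplus> v \<otimes> b" "a \<in> carrier R" "b \<in> carrier R" by blast
    then have "s \<otimes> c = u \<otimes> (a \<otimes> c) \<oplus> v \<otimes> (b \<otimes> c)" using u v c by (simp add: l_distr m_assoc)
    with ab c show "s \<otimes> c \<in> ?S" by blast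
    with ab c u v show "c \<otimes> s \<in> ?S" by (simp add: m_comm)
  qed
  moreover have "u = u \<otimes> \<one> \<oplus> v \<otimes> \<zero>" "v = u \<otimes> \<zero> \<oplus> v \<otimes> \<one>" using u v by simp_all
  then have "{u, v} \<subseteq> ?S" by blast
  ultimately show "Idl {u, v} \<subseteq> ?S" by (rule genideal_minimal)
  have "ideal (Idl {u, v}) R" using u v by (intro genideal_ideal) auto
  then interpret K: ideal "Idl {u, v}" R .
  have "u \<in> Idl {u, v}" "v \<in> Idl {u, v}" using genideal_self[of "{u, v}"] u v by auto
  then show "?S \<subseteq> Idl {u, v}" using K.I_r_closed by (auto intro!: K.a_closed)
qed

section \<open>Completions\<close>

locale adic_ring = cring B for B (structure) +
  fixes I assumes I: "ideal I B"
begin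

declare ideal_power.simps [simp del]

abbreviation "ip \<equiv> ideal_power B I"
abbreviation "P \<equiv> completion B I"

lemma ip_ideal: "ideal (ip n) B"
  by (induction n) (auto simp: ideal_power.simps intro: ideal_prod_is_ideal I oneideal)

lemma ip_add_subgroup: "additive_subgroup (ip n) B"
  using ip_ideal[of n] by (rule ideal.axioms)

lemma ip_abelian_subgroup: "abelian_subgroup (ip n) B"
  using ip_ideal[of n] by (simp add: ideal.axioms(1) abelian_subgroupI3 is_abelian_group)

lemma ip_carrier: "x \<in> ip n \<Longrightarrow> x \<in> carrier B"
  using additive_subgroup.a_Hcarr[OF ip_add_subgroup] .

lemma ip_add [intro]: "x \<in> ip n \<Longrightarrow> y \<in> ip n \<Longrightarrow> x \<oplus> y \<in> ip n"
  using additive_subgroup.a_closed[OF ip_add_subgroup] .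

lemma ip_neg [intro]: "x \<in> ip n \<Longrightarrow> \<ominus> x \<in> ip n"
  using additive_subgroup.a_inv_closed[OF ip_add_subgroup] .

lemma ip_diff [intro]: "x \<in> ip n \<Longrightarrow> y \<in> ip n \<Longrightarrow> x \<ominus> y \<in> ip n"
  unfolding minus_eq by blast

lemma ip_zero [simp]: "\<zero> \<in> ip n"
  using additive_subgroup.zero_closed[OF ip_add_subgroup] .

lemma ip_mult_l [intro]: "x \<in> ip n \<Longrightarrow> y \<in> carrier B \<Longrightarrow> y \<otimes> x \<in> ip n"
  using ideal.I_l_closed[OF ip_ideal] .

lemma ip_mult_r [intro]: "x \<in> ip n \<Longrightarrow> y \<in> carrier B \<Longrightarrow> x \<otimes> y \<in> ip n"
  using ideal.I_r_closed[OF ip_ideal] .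

lemma ip_Suc_subset: "ip (Suc n) \<subseteq> ip n"
  using ideal_prod_inter[OF I ip_ideal[of n]] by (auto simp: ideal_power.simps)

lemma ip_mono: "m \<le> n \<Longrightarrow> x \<in> ip n \<Longrightarrow> x \<in> ip m"
  using lift_Suc_antimono_le[of ip, OF ip_Suc_subset] by blast

lemma ip_plus: "ip (m + n) = ideal_prod B (ip m) (ip n)"
proof (induction m)
  case 0
  then show ?case using ideal_prod_one[OF ip_ideal[of n]] ideal_prod_commute[OF ip_ideal[of n] oneideal] by (simp add: ideal_power.simps)
next
  case (Suc m)
  then show ?case using ideal_prod_assoc[OF I ip_ideal ip_ideal] by (simp add: ideal_power.simps)
qed

lemma ip_mult: "x \<in> ip m \<Longrightarrow> y \<in> ip n \<Longrightarrow> x \<otimes> y \<in> ip (m + n)"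
  unfolding ip_plus by (rule ideal_prod.prod)

lemma ip_1: "ip (Suc 0) = I"
  using ideal_prod_one[OF I] ideal_prod_commute[OF I oneideal] by (simp add: ideal_power.simps)

lemma ip_trans: "x \<ominus> y \<in> ip n \<Longrightarrow> y \<ominus> z \<in> ip n \<Longrightarrow> x \<in> carrier B \<Longrightarrow> y \<in> carrier B \<Longrightarrow> z \<in> carrier B \<Longrightarrow> x \<ominus> z \<in> ip n"
proof -
  assume *: "x \<ominus> y \<in> ip n" "y \<ominus> z \<in> ip n" and c: "x \<in> carrier B" "y \<in> carrier B" "z \<in> carrier B"
  have "x \<ominus> z = (x \<ominus> y) \<oplus> (y \<ominus> z)" using c by (simp add: minus_eq a_assoc r_neg1)
  with * show ?thesis by auto
qed

lemma ip_sym: "x \<ominus> y \<in> ip n \<Longrightarrow> x \<in> carrier B \<Longrightarrow> y \<in> carrier B \<Longrightarrow> y \<ominus> x \<in> ip n"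
proof -
  assume *: "x \<ominus> y \<in> ip n" and c: "x \<in> carrier B" "y \<in> carrier B"
  have "y \<ominus> x = \<ominus> (x \<ominus> y)" using c by (simp add: minus_eq minus_add a_comm)
  with * show ?thesis by auto
qed

text \<open>The rate is fixed: term n determines the class modulo the n-th power. Such a sequence is
  a choice of representatives of a compatible system of cosets, and the completion is computed with
  termwise.\<close>

definition Cau :: "(nat \<Rightarrow> 'a) set" where
  "Cau = {b. \<forall>n. b n \<in> carrier B \<and> b (Suc n) \<ominus> b n \<in> ip n}"

definition lim :: "(nat \<Rightarrow> 'a) \<Rightarrow> nat \<Rightarrow> 'a set" where
  "lim b = (\<lambda>n. ip n +> b n)"

lemma CauD: "b \<in> Cau \<Longrightarrow> b n \<in> carrier B" "b \<in> Cau \<Longrightarrow> b (Suc n) \<ominus> b n \<in> ip n"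
  by (auto simp: Cau_def)

lemma coset_eq_iff: "a \<in> carrier B \<Longrightarrow> b \<in> carrier B \<Longrightarrow> ip n +> a = ip n +> b \<longleftrightarrow> a \<ominus> b \<in> ip n"
  using abelian_subgroup.a_rcos_module_minus[OF ip_abelian_subgroup ring_axioms, of b a n]
    abelian_subgroup.a_rcos_self[OF ip_abelian_subgroup, of a n]
    abelian_subgroup.a_repr_independence'[OF ip_abelian_subgroup, of a n b] by blast

lemma mem_coset_iff: "a \<in> carrier B \<Longrightarrow> b \<in> carrier B \<Longrightarrow> a \<in> ip n +> b \<longleftrightarrow> a \<ominus> b \<in> ip n"
  using abelian_subgroup.a_rcos_module_minus[OF ip_abelian_subgroup ring_axioms, of b a n] by blast

lemma coset_carrier: "a \<in> ip n +> b \<Longrightarrow> b \<in> carrier B \<Longrightarrow> a \<in> carrier B"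
  using abelian_subgroup.a_elemrcos_carrier[OF ip_abelian_subgroup] by blast

lemma Cau_diff:
  assumes "b \<in> Cau" "n \<le> m" shows "b m \<ominus> b n \<in> ip n"
  using assms(2)
proof (induction m rule: dec_induct)
  case base
  then show ?case using CauD[OF assms(1)] by (simp add: minus_eq r_neg)
next
  case (step m)
  then show ?case using CauD[OF assms(1)] ip_mono[OF step(1)] by (metis ip_trans)
qed

lemma Cau_const [intro]: "b \<in> carrier B \<Longrightarrow> (\<lambda>_. b) \<in> Cau"
  by (simp add: Cau_def minus_eq r_neg)

lemma Cau_shift: "b \<in> Cau \<Longrightarrow> (\<lambda>n. b (Suc n)) \<in> Cau"
  unfolding Cau_def using ip_Suc_subset by blast

lemma lim_eq_iff:
  "(\<And>n. b n \<in> carrier B) \<Longrightarrow> (\<And>n. c n \<in> carrier B) \<Longrightarrow> lim b = lim c \<longleftrightarrow> (\<forall>n. b n \<ominus> c n \<in> ip n)"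
  by (auto simp: lim_def fun_eq_iff coset_eq_iff)

text \<open>Shifting repairs the loss of one power of the ideal that delta causes, without changing
  the element represented.\<close>

lemma lim_shift: "b \<in> Cau \<Longrightarrow> lim (\<lambda>n. b (Suc n)) = lim b"
  by (subst lim_eq_iff) (auto simp: CauD)

lemma quot_carrier: "carrier (B Quot ip n) = {ip n +> b | b. b \<in> carrier B}"
  by (auto simp: FactRing_simps)

lemma carrier_completion: "carrier P = lim ` Cau"
proof (intro equalityI subsetI)
  fix s assume s: "s \<in> carrier P"
  then have *: "\<forall>n. s n \<in> carrier (B Quot ip n) \<and> s (Suc n) \<subseteq> s n"
    unfolding completion_def Let_def by simp
  then have "\<forall>n. \<exists>b. b \<in> carrier B \<and> s n = ip n +> b" and sub: "\<And>n. s (Suc n) \<subseteq> s n"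
    unfolding quot_carrier by blast+
  then obtain b where b: "\<And>n. b n \<in> carrier B" "\<And>n. s n = ip n +> b n" by metis
  have "b (Suc n) \<ominus> b n \<in> ip n" for n
  proof -
    have "b (Suc n) \<in> s (Suc n)"
      using b abelian_subgroup.a_rcos_self[OF ip_abelian_subgroup] by simp
    then have "b (Suc n) \<in> ip n +> b n" using sub b by blast
    then show ?thesis using b mem_coset_iff by blast
  qed
  then have "b \<in> Cau" using b by (simp add: Cau_def)
  moreover have "s = lim b" using b by (simp add: lim_def fun_eq_iff)
  ultimately show "s \<in> lim ` Cau" by blast
next
  fix s assume "s \<in> lim ` Cau"
  then obtain b where b: "b \<in> Cau" "s = lim b" by blast
  have "s (Suc n) \<subseteq> s n" for n
  proof
    fix a assume "a \<in> s (Suc n)"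
    then have "a \<in> ip (Suc n) +> b (Suc n)" using b by (simp add: lim_def)
    then have a: "a \<in> carrier B" "a \<ominus> b (Suc n) \<in> ip (Suc n)"
      using coset_carrier mem_coset_iff CauD(1)[OF b(1)] by blast+
    then have "a \<ominus> b n \<in> ip n" using ip_trans ip_Suc_subset CauD[OF b(1)] by blast
    then show "a \<in> s n" using a b CauD(1) mem_coset_iff by (simp add: lim_def)
  qed
  then show "s \<in> carrier P" using b CauD(1) by (auto simp: completion_def Let_def quot_carrier lim_def)
qed

lemma completionE:
  assumes "s \<in> carrier P" obtains b where "b \<in> Cau" "s = lim b"
  using assms carrier_completion by blast

lemma lim_closed [simp]: "b \<in> Cau \<Longrightarrow> lim b \<in> carrier P"
  by (simp add: carrier_completion)

lemma Cau_add: "b \<in> Cau \<Longrightarrow> c \<in> Cau \<Longrightarrow> (\<lambda>n. b n \<oplus> c n) \<in> Cau"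
proof -
  assume bc: "b \<in> Cau" "c \<in> Cau"
  have "b (Suc n) \<oplus> c (Suc n) \<ominus> (b n \<oplus> c n) = (b (Suc n) \<ominus> b n) \<oplus> (c (Suc n) \<ominus> c n)" for n
    using CauD(1)[OF bc(1)] CauD(1)[OF bc(2)] by (simp add: minus_eq minus_add a_ac)
  with bc show ?thesis unfolding Cau_def by auto
qed

lemma ip_mult_cong:
  assumes "a \<in> carrier B" "b \<in> carrier B" "a' \<in> carrier B" "b' \<in> carrier B" "a \<ominus> a' \<in> ip n" "b \<ominus> b' \<in> ip n"
  shows "a \<otimes> b \<ominus> a' \<otimes> b' \<in> ip n"
proof -
  have "a \<otimes> b \<ominus> a' \<otimes> b = (a \<ominus> a') \<otimes> b" "a' \<otimes> b \<ominus> a' \<otimes> b' = a' \<otimes> (b \<ominus> b')"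
    using assms by (simp_all add: minus_eq l_distr r_distr l_minus r_minus)
  then have "a \<otimes> b \<ominus> a' \<otimes> b \<in> ip n" "a' \<otimes> b \<ominus> a' \<otimes> b' \<in> ip n" using assms by auto
  then show ?thesis by (rule ip_trans) (use assms in auto)
qed

lemma Cau_mult: "b \<in> Cau \<Longrightarrow> c \<in> Cau \<Longrightarrow> (\<lambda>n. b n \<otimes> c n) \<in> Cau"
  unfolding Cau_def by (auto intro: ip_mult_cong)

lemma Cau_neg: "b \<in> Cau \<Longrightarrow> (\<lambda>n. \<ominus> b n) \<in> Cau"
proof -
  assume b: "b \<in> Cau"
  have "\<ominus> b (Suc n) \<ominus> \<ominus> b n = \<ominus> (b (Suc n) \<ominus> b n)" for n
    using CauD(1)[OF b] by (simp add: minus_eq minus_add)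
  with b show ?thesis unfolding Cau_def by auto
qed

lemma lim_add: "b \<in> Cau \<Longrightarrow> c \<in> Cau \<Longrightarrow> lim b \<oplus>\<^bsub>P\<^esub> lim c = lim (\<lambda>n. b n \<oplus> c n)"
  using abelian_subgroup.a_rcos_sum[OF ip_abelian_subgroup]
  by (simp add: completion_def Let_def lim_def FactRing_def CauD(1))

lemma lim_mult: "b \<in> Cau \<Longrightarrow> c \<in> Cau \<Longrightarrow> lim b \<otimes>\<^bsub>P\<^esub> lim c = lim (\<lambda>n. b n \<otimes> c n)"
  using ideal.rcoset_mult_add[OF ip_ideal]
  by (simp add: completion_def Let_def lim_def FactRing_def CauD(1))

lemma lim_one: "\<one>\<^bsub>P\<^esub> = lim (\<lambda>_. \<one>)"
  by (simp add: completion_def Let_def lim_def FactRing_def)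

lemma lim_zero: "\<zero>\<^bsub>P\<^esub> = lim (\<lambda>_. \<zero>)"
proof -
  have "ip n +> \<zero> = ip n" for n
    using ip_abelian_subgroup ip_carrier by (intro a_coset_add_zero) blast
  then show ?thesis by (simp add: completion_def Let_def lim_def FactRing_def)
qed

lemma completion_cring: "cring P"
proof (rule cringI)
  show "abelian_group P"
  proof (rule abelian_groupI)
    fix s assume "s \<in> carrier P"
    then obtain b where b: "b \<in> Cau" "s = lim b" by (rule completionE)
    then have "lim (\<lambda>n. \<ominus> b n) \<oplus>\<^bsub>P\<^esub> s = \<zero>\<^bsub>P\<^esub>"
      by (simp add: lim_add Cau_neg lim_zero l_neg CauD)
    then show "\<exists>t\<in>carrier P. t \<oplus>\<^bsub>P\<^esub> s = \<zero>\<^bsub>P\<^esub>" using lim_closed[OF Cau_neg[OF b(1)]] by (rule bexI)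
    show "\<zero>\<^bsub>P\<^esub> \<oplus>\<^bsub>P\<^esub> s = s"
      using b by (simp add: lim_add Cau_const lim_zero CauD)
  next
    fix s t assume "s \<in> carrier P" "t \<in> carrier P"
    then obtain b c where b: "b \<in> Cau" "s = lim b" and c: "c \<in> Cau" "t = lim c" by (metis completionE)
    show "s \<oplus>\<^bsub>P\<^esub> t \<in> carrier P" using b c by (simp add: lim_add Cau_add)
    show "s \<oplus>\<^bsub>P\<^esub> t = t \<oplus>\<^bsub>P\<^esub> s" using b c by (simp add: lim_add a_comm CauD)
    fix u assume "u \<in> carrier P"
    then obtain d where d: "d \<in> Cau" "u = lim d" by (rule completionE)
    show "s \<oplus>\<^bsub>P\<^esub> t \<oplus>\<^bsub>P\<^esub> u = s \<oplus>\<^bsub>P\<^esub> (t \<oplus>\<^bsub>P\<^esub> u)" using b c d by (simp add: lim_add Cau_add a_assoc CauD)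
  qed (simp add: lim_zero Cau_const)
  show "comm_monoid P"
  proof (rule comm_monoidI)
    show "\<one>\<^bsub>P\<^esub> \<in> carrier P" by (simp add: lim_one Cau_const)
    fix s t assume "s \<in> carrier P" "t \<in> carrier P"
    then obtain b c where b: "b \<in> Cau" "s = lim b" and c: "c \<in> Cau" "t = lim c" by (metis completionE)
    show "s \<otimes>\<^bsub>P\<^esub> t \<in> carrier P" using b c by (simp add: lim_mult Cau_mult)
    show "s \<otimes>\<^bsub>P\<^esub> t = t \<otimes>\<^bsub>P\<^esub> s" using b c by (simp add: lim_mult m_comm CauD)
    show "\<one>\<^bsub>P\<^esub> \<otimes>\<^bsub>P\<^esub> s = s" using b by (simp add: lim_mult lim_one Cau_const CauD)
    fix u assume "u \<in> carrier P"
    then obtain d where d: "d \<in> Cau" "u = lim d" by (rule completionE)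
    show "s \<otimes>\<^bsub>P\<^esub> t \<otimes>\<^bsub>P\<^esub> u = s \<otimes>\<^bsub>P\<^esub> (t \<otimes>\<^bsub>P\<^esub> u)" using b c d by (simp add: lim_mult Cau_mult m_assoc CauD)
  qed
  fix s t u assume "s \<in> carrier P" "t \<in> carrier P" "u \<in> carrier P"
  then obtain b c d where b: "b \<in> Cau" "s = lim b" and c: "c \<in> Cau" "t = lim c" and d: "d \<in> Cau" "u = lim d"
    by (metis completionE)
  then show "(s \<oplus>\<^bsub>P\<^esub> t) \<otimes>\<^bsub>P\<^esub> u = s \<otimes>\<^bsub>P\<^esub> u \<oplus>\<^bsub>P\<^esub> t \<otimes>\<^bsub>P\<^esub> u"
    by (simp add: lim_mult lim_add Cau_mult Cau_add l_distr CauD)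
qed

sublocale P: cring P by (rule completion_cring)

lemma to_completion_lim: "to_completion B I b = lim (\<lambda>_. b)"
  by (simp add: to_completion_def lim_def)

lemma to_completion_hom: "to_completion B I \<in> ring_hom B P"
  by (rule ring_hom_memI) (auto simp: to_completion_lim lim_add lim_mult lim_one Cau_const)

lemma lim_neg: "b \<in> Cau \<Longrightarrow> \<ominus>\<^bsub>P\<^esub> lim b = lim (\<lambda>n. \<ominus> b n)"
  by (rule P.minus_equality) (auto simp: lim_add Cau_neg lim_zero l_neg CauD)

lemma lim_diff: "b \<in> Cau \<Longrightarrow> c \<in> Cau \<Longrightarrow> lim b \<ominus>\<^bsub>P\<^esub> lim c = lim (\<lambda>n. b n \<ominus> c n)"
  by (simp add: P.minus_eq lim_neg lim_add Cau_neg minus_eq)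

lemma Cau_diff': "b \<in> Cau \<Longrightarrow> c \<in> Cau \<Longrightarrow> (\<lambda>n. b n \<ominus> c n) \<in> Cau"
  by (simp add: minus_eq Cau_neg Cau_add)

lemma Cau_pow: "b \<in> Cau \<Longrightarrow> (\<lambda>n. b n [^] (k::nat)) \<in> Cau"
  by (induction k) (auto simp: Cau_const Cau_mult)

lemma lim_pow: "b \<in> Cau \<Longrightarrow> lim b [^]\<^bsub>P\<^esub> (k::nat) = lim (\<lambda>n. b n [^] k)"
  by (induction k) (auto simp: lim_one lim_mult Cau_pow)

lemma Cau_add_pow: "b \<in> Cau \<Longrightarrow> (\<lambda>n. add_pow B (k::nat) (b n)) \<in> Cau"
  by (induction k) (auto simp: Cau_const Cau_add add.nat_pow_Suc)

lemma lim_add_pow: "b \<in> Cau \<Longrightarrow> add_pow P (k::nat) (lim b) = lim (\<lambda>n. add_pow B k (b n))"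
  by (induction k) (auto simp: lim_zero lim_add Cau_add_pow add.nat_pow_Suc P.add.nat_pow_Suc)

lemma Cau_finsum:
  assumes "finite S" "\<And>i. i \<in> S \<Longrightarrow> (\<lambda>n. b n i) \<in> Cau"
  shows "(\<lambda>n. \<Oplus>i\<in>S. b n i) \<in> Cau \<and> (\<Oplus>\<^bsub>P\<^esub>i\<in>S. lim (\<lambda>n. b n i)) = lim (\<lambda>n. \<Oplus>i\<in>S. b n i)"
  using assms
proof (induction S rule: finite_induct)
  case empty
  then show ?case by (simp add: Cau_const lim_zero)
next
  case (insert i S)
  then have *: "\<And>n. b n \<in> S \<rightarrow> carrier B" "(\<lambda>i. lim (\<lambda>n. b n i)) \<in> S \<rightarrow> carrier P"
    "\<And>n. b n i \<in> carrier B" "lim (\<lambda>n. b n i) \<in> carrier P"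
    using CauD(1) lim_closed by fastforce+
  then have "(\<lambda>n. \<Oplus>i\<in>insert i S. b n i) = (\<lambda>n. b n i \<oplus> (\<Oplus>i\<in>S. b n i))"
    using insert by simp
  with insert * show ?case by (simp add: Cau_add lim_add)
qed

lemma cross_lim:
  assumes "b \<in> Cau" "c \<in> Cau"
  shows "(\<lambda>n. cross p B (b n) (c n)) \<in> Cau" "cross p P (lim b) (lim c) = lim (\<lambda>n. cross p B (b n) (c n))"
proof -
  have "cross p P (lim b) (lim c) =
     (\<Oplus>\<^bsub>P\<^esub>i\<in>{1..<p}. lim (\<lambda>n. add_pow B ((p choose i) div p) (b n [^] i \<otimes> c n [^] (p - i))))"
    unfolding cross_def using assms
    by (intro P.finsum_cong') (auto simp: lim_pow lim_mult Cau_pow Cau_mult Cau_add_pow lim_add_pow)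
  moreover have "(\<lambda>n. add_pow B ((p choose i) div p) (b n [^] i \<otimes> c n [^] (p - i))) \<in> Cau" for i
    using assms by (intro Cau_add_pow Cau_mult Cau_pow)
  ultimately show "(\<lambda>n. cross p B (b n) (c n)) \<in> Cau" "cross p P (lim b) (lim c) = lim (\<lambda>n. cross p B (b n) (c n))"
    using Cau_finsum[of "{1..<p}" "\<lambda>n i. add_pow B ((p choose i) div p) (b n [^] i \<otimes> c n [^] (p - i))"]
    unfolding cross_def by auto
qed

text \<open>The kernel of the canonical map is the intersection of the powers of the ideal, and
  surjectivity says that every sequence in \<open>Cau\<close> has a limit at the prescribed
  rate.\<close>

lemma adic_complete_iff:
  "adic_complete B I \<longleftrightarrow>
    (\<forall>a\<in>carrier B. (\<forall>n. a \<in> ip n) \<longrightarrow> a = \<zero>) \<and> (\<forall>b\<in>Cau. \<exists>c\<in>carrier B. \<forall>n. c \<ominus> b n \<in> ip n)"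
proof -
  let ?t = "to_completion B I"
  interpret t: ring_hom_ring B P ?t
    by (rule ring_hom_ringI2[OF ring_axioms P.ring_axioms to_completion_hom])
  have "adic_complete B I \<longleftrightarrow> inj_on ?t (carrier B) \<and> ?t ` carrier B = carrier P"
    unfolding adic_complete_def ring_iso_def bij_betw_def using to_completion_hom by blast
  also have "inj_on ?t (carrier B) \<longleftrightarrow> (\<forall>a\<in>carrier B. (\<forall>n. a \<in> ip n) \<longrightarrow> a = \<zero>)"
  proof -
    have "?t a = \<zero>\<^bsub>P\<^esub> \<longleftrightarrow> (\<forall>n. a \<in> ip n)" if "a \<in> carrier B" for a
      using that by (simp add: to_completion_lim lim_zero lim_eq_iff minus_eq)
    then have "a_kernel B P ?t = {a \<in> carrier B. \<forall>n. a \<in> ip n}"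
      unfolding a_kernel_def' by blast
    moreover have "{a \<in> carrier B. \<forall>n. a \<in> ip n} = {\<zero>} \<longleftrightarrow> (\<forall>a\<in>carrier B. (\<forall>n. a \<in> ip n) \<longrightarrow> a = \<zero>)"
      using ip_zero zero_closed by blast
    ultimately show ?thesis
      unfolding t.inj_iff_trivial_ker by (rule ssubst)
  qed
  also have "?t ` carrier B = carrier P \<longleftrightarrow> (\<forall>b\<in>Cau. \<exists>c\<in>carrier B. \<forall>n. c \<ominus> b n \<in> ip n)"
  proof -
    have "?t ` carrier B = carrier P \<longleftrightarrow> (\<forall>b\<in>Cau. \<exists>c\<in>carrier B. lim b = ?t c)"
      using t.hom_closed carrier_completion by (auto 0 3 simp: image_iff)
    also have "\<dots> \<longleftrightarrow> (\<forall>b\<in>Cau. \<exists>c\<in>carrier B. \<forall>n. c \<ominus> b n \<in> ip n)"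
      by (intro ball_cong bex_cong refl) (auto simp: to_completion_lim lim_eq_iff CauD ip_sym)
    finally show ?thesis .
  qed
  finally show ?thesis .
qed

end

section \<open>Extension of delta to the completion\<close>

locale adic_delta_ring = adic_ring B I + delta_ring p B \<delta> for p and B (structure) and I and \<delta> +
  assumes prime_p: "prime p" and p_mem: "add_pow B p \<one> \<in> I"
begin

lemma p_gt_0: "p > 0"
  using prime_p prime_gt_0_nat by blast

lemma pow_p_mem: "x \<in> ip n \<Longrightarrow> x [^] p \<in> ip n"
  using p_gt_0 ip_carrier by (cases p) auto

lemma frob_mem: "x \<in> I \<Longrightarrow> frob x \<in> I"
proof -
  assume x: "x \<in> I"
  then have xc: "x \<in> carrier B" using ip_carrier ip_1 by blast
  have "x [^] p \<in> I" using pow_p_mem[of x "Suc 0"] x ip_1 by blast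
  moreover have "add_pow B p (\<delta> x) \<in> I"
    using p_mem xc delta_closed[OF xc] ip_mult_r[of _ "Suc 0"] ip_1 add_pow_eq_mult[OF delta_closed[OF xc]] by metis
  ultimately show ?thesis unfolding frob_def using ip_add[of _ "Suc 0"] ip_1 by blast
qed

lemma cross_ip:
  assumes a: "a \<in> carrier B" and b: "b \<in> ip n"
  shows "cross p B a b \<in> ip n"
proof (rule cross_mem[OF ip_add_subgroup])
  fix i assume "0 < i" "i < p"
  then have "b [^] (p - i) = b [^] (p - i - 1) \<otimes> b"
    using nat_pow_Suc[of b "p - i - 1"] by (simp add: Suc_diff_Suc)
  then have "b [^] (p - i) \<in> ip n" using b ip_carrier by auto
  then show "a [^] i \<otimes> b [^] (p - i) \<in> ip n" using a by auto
qed

text \<open>On a product i j with i in I, the factor \<open>frob i\<close> again lies in I and makes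
  up for the power lost in \<delta>(j), while j^p \<delta>(i) stays in the power containing j. On
  sums the correction \<open>cross\<close> stays in the ideal.\<close>

lemma delta_ip: "y \<in> ip (Suc n) \<Longrightarrow> \<delta> y \<in> ip n"
proof (induction n arbitrary: y)
  case 0
  then show ?case using delta_closed[OF ip_carrier[OF 0]] by (simp add: ideal_power.simps(1))
next
  case (Suc n)
  have "y \<in> ideal_prod B I (ip (Suc n))" using Suc.prems by (simp add: ideal_power.simps)
  \<comment> \<open>Membership of y itself is carried along because the case of a sum needs it to
    bound \<open>cross\<close>.\<close>
  then have "y \<in> ip (Suc (Suc n)) \<and> \<delta> y \<in> ip (Suc n)"
  proof (induction rule: ideal_prod.induct)
    case (prod i j)
    have c: "i \<in> carrier B" "j \<in> carrier B" using prod ip_carrier ip_1 by blast+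
    have "frob i \<otimes> \<delta> j \<in> ip (Suc n)"
      using ip_mult[of "frob i" "Suc 0" "\<delta> j" n] frob_mem[OF prod(1)] Suc.IH[OF prod(2)] ip_1 by simp
    moreover have "j [^] p \<otimes> \<delta> i \<in> ip (Suc n)" using pow_p_mem[OF prod(2)] delta_closed[OF c(1)] by auto
    moreover have "i \<otimes> j \<in> ip (Suc (Suc n))" using ip_mult[of i "Suc 0" j "Suc n"] prod ip_1 by simp
    ultimately show ?case using c by (auto simp: delta_mult_frob)
  next
    case (sum a b)
    then have "a \<in> carrier B" "b \<in> ip (Suc n)"
      using ip_carrier[of a] subsetD[OF ip_Suc_subset[of "Suc n"]] by blast+
    then have "cross p B a b \<in> ip (Suc n)" by (rule cross_ip)
    then have "\<delta> a \<oplus> \<delta> b \<ominus> cross p B a b \<in> ip (Suc n)" using sum by blast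
    then show ?case using sum ip_carrier[of a "Suc (Suc n)"] ip_carrier[of b "Suc (Suc n)"] delta_add_cross[of a b]
      by (simp add: ip_add)
  qed
  then show ?case by blast
qed

text \<open>With d = a - b the sum rule gives \<delta>(a) - \<delta>(b) = \<delta>(d) -
  \<open>cross\<close>(b, d), and both terms are small because d is.\<close>

lemma delta_cong:
  assumes a: "a \<in> carrier B" and b: "b \<in> carrier B" and ab: "a \<ominus> b \<in> ip (Suc n)"
  shows "\<delta> a \<ominus> \<delta> b \<in> ip n"
proof -
  let ?d = "a \<ominus> b"
  have d: "?d \<in> carrier B" "cross p B b ?d \<in> carrier B" using a b by (auto intro: cross_closed)
  have "a = b \<oplus> ?d" using a b diff_add_cancel[OF a b] a_comm[of b ?d] by simp
  then have "\<delta> a = \<delta> b \<oplus> \<delta> ?d \<ominus> cross p B b ?d" using delta_add_cross[OF b d(1)] by simp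
  also have "\<dots> = \<delta> b \<oplus> (\<delta> ?d \<ominus> cross p B b ?d)"
    using b d delta_closed by (simp add: minus_eq a_assoc)
  finally have "\<delta> a \<ominus> \<delta> b = \<delta> ?d \<ominus> cross p B b ?d"
    using add_diff_cancel[of "\<delta> b" "\<delta> ?d \<ominus> cross p B b ?d"] b d delta_closed by simp
  moreover have "cross p B b ?d \<in> ip n" using cross_ip[OF b] ab ip_Suc_subset by blast
  ultimately show ?thesis using delta_ip[OF ab] by auto
qed

abbreviation "\<delta>P \<equiv> completion_delta B I \<delta>"

lemma Cau_delta: "b \<in> Cau \<Longrightarrow> (\<lambda>n. \<delta> (b (Suc n))) \<in> Cau"
  unfolding Cau_def using delta_closed delta_cong by blast

text \<open>By \<open>delta_cong\<close> any two representatives at level n + 1 give the same class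
  at level n, so the arbitrary choice in \<open>completion_delta\<close> may be replaced by the
  given sequence.\<close>

lemma completion_delta_lim:
  assumes "b \<in> Cau" shows "\<delta>P (lim b) = lim (\<lambda>n. \<delta> (b (Suc n)))"
proof
  fix n
  have b: "\<And>n. b n \<in> carrier B" using assms CauD by blast
  let ?c = "SOME c. c \<in> lim b (Suc n)"
  have "b (Suc n) \<in> lim b (Suc n)"
    unfolding lim_def using b by (simp add: mem_coset_iff minus_eq r_neg)
  then have "?c \<in> lim b (Suc n)" by (rule someI)
  then have c: "?c \<in> carrier B" "?c \<ominus> b (Suc n) \<in> ip (Suc n)"
    unfolding lim_def using b coset_carrier mem_coset_iff by blast+
  then have "\<delta> ?c \<ominus> \<delta> (b (Suc n)) \<in> ip n" using b delta_cong by blast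
  then show "\<delta>P (lim b) n = lim (\<lambda>n. \<delta> (b (Suc n))) n"
    using c b delta_closed by (simp add: completion_delta_def lim_def coset_eq_iff)
qed

lemma completion_delta_ring: "delta_ring p P \<delta>P"
proof (rule delta_ringI_cross)
  show "cring P" by (rule completion_cring)
  show "\<delta>P \<zero>\<^bsub>P\<^esub> = \<zero>\<^bsub>P\<^esub>"
    by (simp add: lim_zero completion_delta_lim Cau_const delta_zero)
  show "\<delta>P \<one>\<^bsub>P\<^esub> = \<zero>\<^bsub>P\<^esub>"
    by (simp add: lim_one lim_zero completion_delta_lim Cau_const delta_one)
next
  fix s assume "s \<in> carrier P"
  then show "\<delta>P s \<in> carrier P" by (metis completionE completion_delta_lim lim_closed Cau_delta)
next
  fix s t assume "s \<in> carrier P" "t \<in> carrier P"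
  then obtain b c where b: "b \<in> Cau" "s = lim b" and c: "c \<in> Cau" "t = lim c" by (metis completionE)
  \<comment> \<open>All sequences are taken at index n + 1, so that the arguments and their images
    under \<delta> carry the same index.\<close>
  let ?b = "\<lambda>n. b (Suc n)" and ?c = "\<lambda>n. c (Suc n)"
  let ?db = "\<lambda>n. \<delta> (b (Suc n))" and ?dc = "\<lambda>n. \<delta> (c (Suc n))"
  have C: "?b \<in> Cau" "?c \<in> Cau" "?db \<in> Cau" "?dc \<in> Cau" using b c Cau_shift Cau_delta by auto
  have st: "s = lim ?b" "t = lim ?c" using b c lim_shift by auto
  have d: "\<delta>P s = lim ?db" "\<delta>P t = lim ?dc" using b c completion_delta_lim by auto
  show "\<delta>P (s \<oplus>\<^bsub>P\<^esub> t) = \<delta>P s \<oplus>\<^bsub>P\<^esub> \<delta>P t \<ominus>\<^bsub>P\<^esub> cross p P s t"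
  proof -
    have "\<delta>P (s \<oplus>\<^bsub>P\<^esub> t) = lim (\<lambda>n. \<delta> (b (Suc n) \<oplus> c (Suc n)))"
      unfolding b c using b c by (simp add: lim_add completion_delta_lim Cau_add)
    also have "\<dots> = lim (\<lambda>n. ?db n \<oplus> ?dc n \<ominus> cross p B (?b n) (?c n))"
      using CauD(1)[OF b(1)] CauD(1)[OF c(1)] by (simp add: delta_add_cross)
    also have "\<dots> = lim ?db \<oplus>\<^bsub>P\<^esub> lim ?dc \<ominus>\<^bsub>P\<^esub> cross p P (lim ?b) (lim ?c)"
      using C by (simp add: cross_lim lim_add lim_diff Cau_add)
    finally show ?thesis unfolding d using st by simp
  qed
  show "\<delta>P (s \<otimes>\<^bsub>P\<^esub> t) = s [^]\<^bsub>P\<^esub> p \<otimes>\<^bsub>P\<^esub> \<delta>P t \<oplus>\<^bsub>P\<^esub> t [^]\<^bsub>P\<^esub> p \<otimes>\<^bsub>P\<^esub> \<delta>P s \<oplus>\<^bsub>P\<^esub> add_pow P p (\<delta>P s \<otimes>\<^bsub>P\<^esub> \<delta>P t)"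
  proof -
    have "\<delta>P (s \<otimes>\<^bsub>P\<^esub> t) = lim (\<lambda>n. \<delta> (b (Suc n) \<otimes> c (Suc n)))"
      unfolding b c using b c by (simp add: lim_mult completion_delta_lim Cau_mult)
    also have "\<dots> = lim (\<lambda>n. ?b n [^] p \<otimes> ?dc n \<oplus> ?c n [^] p \<otimes> ?db n \<oplus> add_pow B p (?db n \<otimes> ?dc n))"
      using CauD(1)[OF b(1)] CauD(1)[OF c(1)] by (simp add: delta_mult)
    also have "\<dots> = lim ?b [^]\<^bsub>P\<^esub> p \<otimes>\<^bsub>P\<^esub> lim ?dc \<oplus>\<^bsub>P\<^esub> lim ?c [^]\<^bsub>P\<^esub> p \<otimes>\<^bsub>P\<^esub> lim ?db \<oplus>\<^bsub>P\<^esub> add_pow P p (lim ?db \<otimes>\<^bsub>P\<^esub> lim ?dc)"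
      using C by (simp add: lim_pow lim_add lim_mult lim_add_pow Cau_add Cau_mult Cau_pow Cau_add_pow)
    finally show ?thesis unfolding d using st by simp
  qed
qed

lemma to_completion_delta_hom: "delta_hom B \<delta> P \<delta>P (to_completion B I)"
  unfolding delta_hom_def using to_completion_hom
  by (auto simp: to_completion_lim completion_delta_lim Cau_const)

end

section \<open>Completeness of the completion for an ideal with two generators\<close>

lemma (in adic_ring) ip_of_diff:
  assumes "a \<ominus> b \<in> ip n" "b \<in> ip n" "a \<in> carrier B" "b \<in> carrier B"
  shows "a \<in> ip n"
  using ip_add[OF assms(1,2)] diff_add_cancel[OF assms(3,4)] by simp

text \<open>In the application u = p and v = q - 1. Finite generation allows the powers of the ideal
  extended to the completion to be described level by level, and thereby makes the completion
  complete.\<close>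

locale adic_ring_pair = adic_ring B I for B (structure) and I +
  fixes u v
  assumes u: "u \<in> carrier B" and v: "v \<in> carrier B" and I_pair: "I = genideal B {u, v}"
begin

lemma uv_mem: "u \<in> I" "v \<in> I"
  using genideal_self[of "{u, v}"] u v I_pair by auto

lemma ip_Suc_pair: "ip (Suc n) = {u \<otimes> a \<oplus> v \<otimes> b | a b. a \<in> ip n \<and> b \<in> ip n}" (is "_ = ?S")
proof
  show "?S \<subseteq> ip (Suc n)"
  proof
    fix y assume "y \<in> ?S"
    then obtain a b where ab: "y = u \<otimes> a \<oplus> v \<otimes> b" "a \<in> ip n" "b \<in> ip n" by blast
    show "y \<in> ip (Suc n)" unfolding ab(1)
      using ip_mult[of u "Suc 0" a n] ip_mult[of v "Suc 0" b n] ab uv_mem ip_1 by (intro ip_add) simp_all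
  qed
  show "ip (Suc n) \<subseteq> ?S"
  proof
    fix y assume "y \<in> ip (Suc n)"
    then have "y \<in> ideal_prod B I (ip n)" by (simp add: ideal_power.simps)
    then show "y \<in> ?S"
    proof (induction rule: ideal_prod.induct)
      case (prod i j)
      then obtain a b where ab: "i = u \<otimes> a \<oplus> v \<otimes> b" "a \<in> carrier B" "b \<in> carrier B"
        using genideal_pair[OF u v] I_pair by auto
      then have "i \<otimes> j = u \<otimes> (a \<otimes> j) \<oplus> v \<otimes> (b \<otimes> j)"
        using u v ip_carrier[OF prod(2)] by (simp add: l_distr m_assoc)
      then show ?case using ab prod(2) by blast
    next
      case (sum s t)
      then obtain a b a' b' where ab: "s = u \<otimes> a \<oplus> v \<otimes> b" "a \<in> ip n" "b \<in> ip n"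
        "t = u \<otimes> a' \<oplus> v \<otimes> b'" "a' \<in> ip n" "b' \<in> ip n" by blast
      then have "s \<oplus> t = u \<otimes> (a \<oplus> a') \<oplus> v \<otimes> (b \<oplus> b')"
        using u v ip_carrier by (simp add: r_distr a_ac)
      then show ?case using ab by blast
    qed
  qed
qed

text \<open>A monomial of degree m + n in u and v contains u^m or v^n. The induction splits off one
  generator at a time.\<close>

lemma ip_plus_pair:
  "y \<in> ip (m + n) \<Longrightarrow> \<exists>a\<in>carrier B. \<exists>b\<in>carrier B. y = u [^] m \<otimes> a \<oplus> v [^] n \<otimes> b"
proof (induction "m + n" arbitrary: m n y)
  case 0
  then have "y = u [^] m \<otimes> y \<oplus> v [^] n \<otimes> \<zero>" "y \<in> carrier B" using ip_carrier by auto
  then show ?case by blast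
next
  case (Suc k)
  have yc: "y \<in> carrier B" using Suc ip_carrier by blast
  show ?case
  proof (cases "m = 0 \<or> n = 0")
    case True
    then have "y = u [^] m \<otimes> y \<oplus> v [^] n \<otimes> \<zero> \<or> y = u [^] m \<otimes> \<zero> \<oplus> v [^] n \<otimes> y" using yc u v by auto
    then show ?thesis using yc zero_closed by blast
  next
    case False
    then obtain m' n' where mn: "m = Suc m'" "n = Suc n'" using not0_implies_Suc by blast
    have "y \<in> ip (Suc k)" using Suc by simp
    then obtain s t where st: "y = u \<otimes> s \<oplus> v \<otimes> t" "s \<in> ip k" "t \<in> ip k" unfolding ip_Suc_pair by blast
    obtain a b where ab: "a \<in> carrier B" "b \<in> carrier B" "s = u [^] m' \<otimes> a \<oplus> v [^] n \<otimes> b"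
      using Suc(1)[of m' n s] Suc(2) mn st by auto
    obtain a' b' where ab': "a' \<in> carrier B" "b' \<in> carrier B" "t = u [^] m \<otimes> a' \<oplus> v [^] n' \<otimes> b'"
      using Suc(1)[of m n' t] Suc(2) mn st by auto
    have "y = u [^] m \<otimes> (a \<oplus> v \<otimes> a') \<oplus> v [^] n \<otimes> (u \<otimes> b \<oplus> b')"
      using ab ab' u v nat_pow_closed[OF u, of m'] nat_pow_closed[OF v, of n']
      unfolding st(1) ab(3) ab'(3) mn nat_pow_Suc by algebra
    then show ?thesis using ab ab' u v by blast
  qed
qed

abbreviation "J \<equiv> genideal P {lim (\<lambda>_. u), lim (\<lambda>_. v)}"

lemma uvP: "lim (\<lambda>_. u) \<in> carrier P" "lim (\<lambda>_. v) \<in> carrier P"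
  using u v by (simp_all add: Cau_const)

sublocale PJ: adic_ring P J
  by (intro adic_ring.intro adic_ring_axioms.intro completion_cring P.genideal_ideal) (use uvP in blast)

lemma PJ_pair: "adic_ring_pair P J (lim (\<lambda>_. u)) (lim (\<lambda>_. v))"
  using uvP by (intro adic_ring_pair.intro adic_ring_pair_axioms.intro PJ.adic_ring_axioms refl)

lemmas PJ_ip_Suc_pair = adic_ring_pair.ip_Suc_pair[OF PJ_pair]

text \<open>Telescoping: consecutive differences are written as u x_k + v y_k with x_k and y_k in
  ever higher powers. The partial sums of the x_k and of the y_k converge, and the element is u
  times the first limit plus v times the second.\<close>

lemma lim_zero_level:
  assumes b: "b \<in> Cau" and "b (Suc n) \<in> ip (Suc n)"
  shows "\<exists>x\<in>Cau. \<exists>y\<in>Cau. (\<forall>k. x k \<in> ip n) \<and> (\<forall>k. y k \<in> ip n) \<and>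
     lim b = lim (\<lambda>_. u) \<otimes>\<^bsub>P\<^esub> lim x \<oplus>\<^bsub>P\<^esub> lim (\<lambda>_. v) \<otimes>\<^bsub>P\<^esub> lim y"
proof -
  \<comment> \<open>The sequence starts at index n + 1, where it lies in the (n+1)-st power by
    assumption; the maximum keeps every later difference in that power.\<close>
  define c where "c k = b (Suc (max n k))" for k
  have bc: "\<And>n. b n \<in> carrier B" using CauD(1)[OF b] .
  have cc: "\<And>k. c k \<in> carrier B" unfolding c_def using bc .
  have "c (Suc k) \<ominus> c k \<in> ip (Suc (max n k))" for k
    unfolding c_def by (rule Cau_diff[OF b]) auto
  then have "\<forall>k. \<exists>x y. x \<in> ip (max n k) \<and> y \<in> ip (max n k) \<and> c (Suc k) \<ominus> c k = u \<otimes> x \<oplus> v \<otimes> y"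
    unfolding ip_Suc_pair by blast
  then obtain x y where xy: "\<And>k. x k \<in> ip (max n k)" "\<And>k. y k \<in> ip (max n k)"
     "\<And>k. c (Suc k) \<ominus> c k = u \<otimes> x k \<oplus> v \<otimes> y k" by metis
  have "c 0 \<in> ip (Suc n)" using assms(2) c_def by simp
  then obtain x0 y0 where xy0: "x0 \<in> ip n" "y0 \<in> ip n" "c 0 = u \<otimes> x0 \<oplus> v \<otimes> y0"
    unfolding ip_Suc_pair by blast
  define X where "X = rec_nat x0 (\<lambda>k r. r \<oplus> x k)"
  define Y where "Y = rec_nat y0 (\<lambda>k r. r \<oplus> y k)"
  have X: "X 0 = x0" "\<And>k. X (Suc k) = X k \<oplus> x k" and Y: "Y 0 = y0" "\<And>k. Y (Suc k) = Y k \<oplus> y k"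
    by (simp_all add: X_def Y_def)
  have xyn: "x k \<in> ip n" "y k \<in> ip n" "x k \<in> ip k" "y k \<in> ip k" for k
    using xy(1,2)[of k] ip_mono[of n "max n k"] ip_mono[of k "max n k"] by auto
  have Xn: "X k \<in> ip n" "Y k \<in> ip n" for k
    by (induction k) (use X Y xy0 xyn in auto)
  have Xc: "X k \<in> carrier B" "Y k \<in> carrier B" for k using Xn ip_carrier by blast+
  have xc: "x k \<in> carrier B" "y k \<in> carrier B" for k using xyn ip_carrier by blast+
  have "X (Suc k) \<ominus> X k = x k" "Y (Suc k) \<ominus> Y k = y k" for k
    using Xc xc by (simp_all add: X Y add_diff_cancel)
  then have XY: "X \<in> Cau" "Y \<in> Cau" using Xc xyn by (auto simp: Cau_def)
  have c_eq: "c k = u \<otimes> X k \<oplus> v \<otimes> Y k" for k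
  proof (induction k)
    case 0
    then show ?case using xy0 X Y by simp
  next
    case (Suc k)
    have "c (Suc k) = (c (Suc k) \<ominus> c k) \<oplus> c k" using cc by (simp add: diff_add_cancel)
    also have "\<dots> = (u \<otimes> x k \<oplus> v \<otimes> y k) \<oplus> (u \<otimes> X k \<oplus> v \<otimes> Y k)"
      by (subst xy(3), subst Suc) (rule refl)
    also have "\<dots> = u \<otimes> X (Suc k) \<oplus> v \<otimes> Y (Suc k)"
      unfolding X(2) Y(2) using Xc xc u v by algebra
    finally show ?case .
  qed
  have "lim b = lim c"
    unfolding lim_eq_iff[OF bc cc] c_def
    using bc by (auto intro!: ip_sym[OF Cau_diff[OF b]])
  also have "\<dots> = lim (\<lambda>k. u \<otimes> X k \<oplus> v \<otimes> Y k)" by (rule arg_cong[where f = lim], rule ext, rule c_eq)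
  also have "\<dots> = lim (\<lambda>_. u) \<otimes>\<^bsub>P\<^esub> lim X \<oplus>\<^bsub>P\<^esub> lim (\<lambda>_. v) \<otimes>\<^bsub>P\<^esub> lim Y"
    using XY u v by (simp add: lim_add lim_mult Cau_mult Cau_const)
  finally show ?thesis using XY Xn by blast
qed

text \<open>Applied level by level, \<open>lim_zero_level\<close> identifies the powers of the
  extended ideal with the kernels of the projections to the quotients of B.\<close>

lemma PJ_power: "ideal_power P J n = {lim b | b. b \<in> Cau \<and> b n \<in> ip n}"
proof (induction n)
  case 0
  show ?case unfolding ideal_power.simps(1) carrier_completion using CauD(1) by blast
next
  case (Suc n)
  show ?case
  proof (intro equalityI subsetI)
    fix s assume "s \<in> ideal_power P J (Suc n)"
    then obtain a b where ab: "a \<in> ideal_power P J n" "b \<in> ideal_power P J n"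
      "s = lim (\<lambda>_. u) \<otimes>\<^bsub>P\<^esub> a \<oplus>\<^bsub>P\<^esub> lim (\<lambda>_. v) \<otimes>\<^bsub>P\<^esub> b"
      unfolding PJ_ip_Suc_pair by blast
    then obtain x y where x: "x \<in> Cau" "x n \<in> ip n" "a = lim x" and y: "y \<in> Cau" "y n \<in> ip n" "b = lim y"
      unfolding Suc by blast
    have mem: "z (Suc n) \<in> ip n" if "z \<in> Cau" "z n \<in> ip n" for z
      using ip_of_diff[OF CauD(2)[OF that(1)] that(2)] CauD(1)[OF that(1)] by blast
    let ?z = "\<lambda>k. u \<otimes> x k \<oplus> v \<otimes> y k"
    have "?z \<in> Cau" "s = lim ?z"
      using ab(3) x y u v by (auto simp: lim_add lim_mult Cau_mult Cau_add Cau_const)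
    moreover have "?z (Suc n) \<in> ip (Suc n)"
      unfolding ip_Suc_pair using mem x y by blast
    ultimately show "s \<in> {lim b |b. b \<in> Cau \<and> b (Suc n) \<in> ip (Suc n)}" by blast
  next
    fix s assume "s \<in> {lim b |b. b \<in> Cau \<and> b (Suc n) \<in> ip (Suc n)}"
    then obtain b where b: "b \<in> Cau" "b (Suc n) \<in> ip (Suc n)" "s = lim b" by blast
    then obtain x y where "x \<in> Cau" "y \<in> Cau" "x n \<in> ip n" "y n \<in> ip n"
     "s = lim (\<lambda>_. u) \<otimes>\<^bsub>P\<^esub> lim x \<oplus>\<^bsub>P\<^esub> lim (\<lambda>_. v) \<otimes>\<^bsub>P\<^esub> lim y"
      using lim_zero_level by blast
    then show "s \<in> ideal_power P J (Suc n)" unfolding PJ_ip_Suc_pair Suc by blast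
  qed
qed

lemma PJ_power_iff: "b \<in> Cau \<Longrightarrow> lim b \<in> ideal_power P J n \<longleftrightarrow> b n \<in> ip n"
proof -
  assume b: "b \<in> Cau"
  have "b n \<in> ip n" if "c \<in> Cau" "c n \<in> ip n" "lim b = lim c" for c
  proof -
    have "b n \<ominus> c n \<in> ip n" using lim_eq_iff[of b c] CauD(1)[OF b] CauD(1)[OF that(1)] that(3) by simp
    then show ?thesis using ip_of_diff that(2) CauD(1)[OF b] CauD(1)[OF that(1)] by blast
  qed
  then have "lim b \<in> ideal_power P J n \<Longrightarrow> b n \<in> ip n" unfolding PJ_power by blast
  then show ?thesis unfolding PJ_power using b by blast
qed

theorem completion_complete: "adic_complete P J"
  unfolding PJ.adic_complete_iff
proof (intro conjI ballI impI)
  fix s assume sP: "s \<in> carrier P" and s: "\<forall>n. s \<in> ideal_power P J n"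
  obtain b where b: "b \<in> Cau" "s = lim b" using sP by (rule completionE)
  have "\<forall>n. b n \<in> ip n" using s PJ_power_iff[OF b(1)] b(2) by simp
  then show "s = \<zero>\<^bsub>P\<^esub>" unfolding b lim_zero using CauD(1)[OF b(1)] by (subst lim_eq_iff) (auto simp: minus_eq)
next
  fix S assume S: "S \<in> PJ.Cau"
  have "\<forall>n. \<exists>b. b \<in> Cau \<and> S n = lim b" using PJ.CauD(1)[OF S] completionE by metis
  then obtain b where b: "\<And>n. b n \<in> Cau" "\<And>n. S n = lim (b n)" by metis
  have bc: "b n m \<in> carrier B" for n m using b(1) CauD(1) by blast
  have 1: "b (Suc n) n \<ominus> b n n \<in> ip n" for n
    using PJ.CauD(2)[OF S, of n] unfolding b(2) lim_diff[OF b(1) b(1)]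
    by (subst (asm) PJ_power_iff) (auto intro: Cau_diff' b)
  \<comment> \<open>Diagonal sequence: level n of the limit is read off from the n-th
    approximation.\<close>
  define c where "c n = b n n" for n
  have "c (Suc n) \<ominus> c n \<in> ip n" for n
    unfolding c_def by (rule ip_trans[OF CauD(2)[OF b(1)] 1 bc bc bc])
  then have c: "c \<in> Cau" using bc by (simp add: Cau_def c_def)
  have "lim c \<ominus>\<^bsub>P\<^esub> S n \<in> ideal_power P J n" for n
    unfolding b(2) lim_diff[OF c b(1)] PJ_power_iff[OF Cau_diff'[OF c b(1)]]
    using bc by (simp add: c_def minus_eq r_neg)
  then have "\<forall>n. lim c \<ominus>\<^bsub>P\<^esub> S n \<in> ideal_power P J n" ..
  then show "\<exists>d\<in>carrier P. \<forall>n. d \<ominus>\<^bsub>P\<^esub> S n \<in> ideal_power P J n"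
    by (rule bexI[OF _ lim_closed[OF c]])
qed

end

section \<open>Bounded torsion and its survival under completion\<close>

lemma (in cring) add_pow_power:
  fixes p :: nat
  assumes "b \<in> carrier R"
  shows "add_pow R (p ^ m) b = add_pow R p \<one> [^] m \<otimes> b"
proof (induction m)
  case (Suc m)
  have "add_pow R (p ^ Suc m) b = add_pow R p (add_pow R (p ^ m) b)"
    using assms by (simp add: add.nat_pow_pow mult.commute)
  also have "\<dots> = add_pow R p \<one> \<otimes> (add_pow R p \<one> [^] m \<otimes> b)"
    using assms Suc by (metis add_pow_eq_mult add.nat_pow_closed)
  also have "\<dots> = add_pow R p \<one> [^] Suc m \<otimes> b"
    using assms by (simp add: m_ac)
  finally show ?case .
qed (use assms in simp)

lemma (in cring) cgenideal_eq_mult: "f \<in> carrier R \<Longrightarrow> PIdl f = {f \<otimes> c | c. c \<in> carrier R}"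
  unfolding cgenideal_def using m_comm by auto

text \<open>Torsion in the quotient by f becomes a divisibility u^m b = f c in the ring itself. Such
  equations can be compared coefficient by coefficient in \<open>Omega\<close> and approximated in a
  completion.\<close>

lemma (in cring) bounded_algebra_iff:
  fixes p :: nat
  assumes q: "q \<in> carrier R"
  defines "f \<equiv> q_number R q p" and "u \<equiv> add_pow R p \<one>"
  shows "bounded_algebra p R q \<longleftrightarrow>
    (\<forall>b\<in>carrier R. f \<otimes> b = \<zero> \<longrightarrow> b = \<zero>) \<and>
    (\<exists>N::nat. \<forall>b\<in>carrier R. \<forall>m::nat. (\<exists>c\<in>carrier R. u [^] m \<otimes> b = f \<otimes> c) \<longrightarrow> (\<exists>c\<in>carrier R. u [^] N \<otimes> b = f \<otimes> c))"
proof -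
  have f: "f \<in> carrier R" unfolding f_def q_number_def using q by (intro finsum_closed) auto
  have id: "ideal (PIdl f) R" using f by (rule cgenideal_ideal)
  have as: "abelian_subgroup (PIdl f) R"
    using id by (simp add: ideal.axioms(1) abelian_subgroupI3 is_abelian_group)
  let ?Q = "R Quot (PIdl f)"
  have h: "ring_hom_cring R ?Q ((+>) (PIdl f))" by (rule ideal.rcos_ring_hom_cring[OF id is_cring])
  have zero_iff: "PIdl f +> b = \<zero>\<^bsub>?Q\<^esub> \<longleftrightarrow> (\<exists>c\<in>carrier R. b = f \<otimes> c)" if "b \<in> carrier R" for b
  proof -
    have "PIdl f +> b = \<zero>\<^bsub>?Q\<^esub> \<longleftrightarrow> b \<in> PIdl f"
    proof -
      have "\<zero>\<^bsub>?Q\<^esub> = PIdl f" by (simp add: FactRing_def)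
      then show ?thesis
        using that abelian_subgroup.a_rcos_self[OF as, of b] abelian_subgroup.a_rcos_const[OF as, of b] by metis
    qed
    then show ?thesis unfolding cgenideal_eq_mult[OF f] by blast
  qed
  have pow: "add_pow ?Q (p ^ m) (PIdl f +> b) = PIdl f +> (u [^] m \<otimes> b)" if "b \<in> carrier R" for b m
    unfolding u_def add_pow_power[OF that, symmetric] using that by (simp add: ring_hom_cring.hom_add_pow[OF h])
  have u: "u \<in> carrier R" by (simp add: u_def)
  have car: "carrier ?Q = (\<lambda>b. PIdl f +> b) ` carrier R" by (auto simp: FactRing_simps)
  have eq: "(add_pow ?Q (p ^ m) (PIdl f +> b) = \<zero>\<^bsub>?Q\<^esub>) = (\<exists>c\<in>carrier R. u [^] m \<otimes> b = f \<otimes> c)"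
    if "b \<in> carrier R" for b m
    unfolding pow[OF that] using that u by (intro zero_iff) auto
  have "bounded_algebra p R q \<longleftrightarrow>
    (\<forall>b\<in>carrier R. f \<otimes> b = \<zero> \<longrightarrow> b = \<zero>) \<and>
    (\<exists>N::nat. \<forall>b\<in>carrier R. \<forall>m::nat. add_pow ?Q (p ^ m) (PIdl f +> b) = \<zero>\<^bsub>?Q\<^esub> \<longrightarrow> add_pow ?Q (p ^ N) (PIdl f +> b) = \<zero>\<^bsub>?Q\<^esub>)"
    unfolding bounded_algebra_def Let_def q_ideal_def f_def[symmetric] car ball_simps ..
  then show ?thesis by (simp add: eq cong: ball_cong)
qed

text \<open>In the application u = p, v = q - 1, f = (p)_q and e = p - 1, and N bounds the p-power
  torsion modulo f. The condition on v^e, together with f in I, says that (u, v) and (u, f) define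
  the same topology.\<close>

locale adic_bounded = adic_ring_pair B I u v for B (structure) and I u v +
  fixes f and e N :: nat
  assumes f: "f \<in> carrier B" "f \<in> I"
    and v_pow: "\<exists>a\<in>carrier B. \<exists>b\<in>carrier B. v [^] e = u \<otimes> a \<oplus> f \<otimes> b"
    and f_regular: "\<And>b. b \<in> carrier B \<Longrightarrow> f \<otimes> b = \<zero> \<Longrightarrow> b = \<zero>"
    and f_bounded: "\<And>b c m. b \<in> carrier B \<Longrightarrow> c \<in> carrier B \<Longrightarrow> u [^] (m::nat) \<otimes> b = f \<otimes> c \<Longrightarrow>
       \<exists>c\<in>carrier B. u [^] N \<otimes> b = f \<otimes> c"
begin

lemma pow_mem_ip: "x \<in> I \<Longrightarrow> x [^] (k::nat) \<in> ip k"
proof (induction k)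
  case 0
  then show ?case by (simp add: ideal_power.simps)
next
  case (Suc k)
  then show ?case using ip_mult[of "x [^] k" k x "Suc 0"] ip_1 by simp
qed

lemma pow_mem_ip': "x \<in> I \<Longrightarrow> k \<le> (l::nat) \<Longrightarrow> x [^] l \<in> ip k"
  using pow_mem_ip ip_mono by blast

text \<open>As v^e lies in (u, f), the power v^(2 e k) lies in the 2k-th power of (u, f), hence in
  (u^k, f^k). A sufficiently high power of I is generated by multiples of u^k and v^(2 e k).\<close>

lemma ip_factor:
  fixes k :: nat
  shows "\<exists>m. \<forall>y\<in>ip m. \<exists>a\<in>carrier B. \<exists>b\<in>carrier B. y = u [^] k \<otimes> a \<oplus> f [^] k \<otimes> b"
proof -
  let ?J = "genideal B {u, f}"
  have "ideal ?J B" using u f by (intro genideal_ideal) auto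
  then interpret J: adic_ring_pair B ?J u f by (intro adic_ring_pair.intro adic_ring.intro adic_ring_axioms.intro adic_ring_pair_axioms.intro is_cring u f(1) refl)
  have "v [^] e \<in> ideal_power B ?J (Suc 0)"
    unfolding J.ip_1 using v_pow genideal_pair[OF u f(1)] by blast
  then have ve: "v [^] e \<in> ?J" unfolding J.ip_1 .
  have "x [^] k \<in> ideal_power B ?J k" if "x \<in> ?J" for x and k :: nat
  proof (induction k)
    case 0
    then show ?case using that J.ip_carrier[of x "Suc 0"] J.ip_1 by (simp add: ideal_power.simps)
  next
    case (Suc k)
    then show ?case using J.ip_mult[of "x [^] k" k x "Suc 0"] J.ip_1 that by simp
  qed
  then have "(v [^] e) [^] (k + k) \<in> ideal_power B ?J (k + k)" using ve by blast
  then obtain a b where ab: "a \<in> carrier B" "b \<in> carrier B" "v [^] (e * (k + k)) = u [^] k \<otimes> a \<oplus> f [^] k \<otimes> b"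
    using J.ip_plus_pair v by (metis nat_pow_pow)
  show ?thesis
  proof (intro exI ballI)
    fix y assume "y \<in> ip (k + e * (k + k))"
    then obtain c d where cd: "c \<in> carrier B" "d \<in> carrier B" "y = u [^] k \<otimes> c \<oplus> v [^] (e * (k + k)) \<otimes> d"
      using ip_plus_pair by blast
    have "y = u [^] k \<otimes> (c \<oplus> a \<otimes> d) \<oplus> f [^] k \<otimes> (b \<otimes> d)"
      unfolding cd(3) ab(3) using nat_pow_closed[OF u, of k] nat_pow_closed[OF f(1), of k] ab cd by algebra
    then show "\<exists>a\<in>carrier B. \<exists>b\<in>carrier B. y = u [^] k \<otimes> a \<oplus> f [^] k \<otimes> b" using ab cd by blast
  qed
qed

text \<open>If f b = u^(K+1) a + f^(K+1) c, then f divides u^(K+1) a, so u^N a = f d by bounded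
  torsion. Cancelling f expresses b by multiples of u^(k+1) and f^K.\<close>

lemma division_continuous: "\<exists>m. \<forall>b\<in>carrier B. f \<otimes> b \<in> ip m \<longrightarrow> b \<in> ip k"
proof -
  \<comment> \<open>The torsion bound consumes N factors u, and k + 1 of them remain.\<close>
  define K where "K = k + N"
  obtain m where m: "\<And>y. y \<in> ip m \<Longrightarrow> \<exists>a\<in>carrier B. \<exists>b\<in>carrier B. y = u [^] Suc K \<otimes> a \<oplus> f [^] Suc K \<otimes> b"
    using ip_factor[of "Suc K"] by blast
  show ?thesis
  proof (intro exI ballI impI)
    fix b assume b: "b \<in> carrier B" and "f \<otimes> b \<in> ip m"
    then obtain a c where ac: "a \<in> carrier B" "c \<in> carrier B" "f \<otimes> b = u [^] Suc K \<otimes> a \<oplus> f [^] Suc K \<otimes> c"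
      using m by blast
    note cl = nat_pow_closed[OF u] nat_pow_closed[OF f(1)]
    have "u [^] Suc K \<otimes> a = f \<otimes> b \<ominus> f [^] Suc K \<otimes> c"
      using ac b u f by (simp add: a_comm add_diff_cancel del: nat_pow_Suc)
    also have "\<dots> = f \<otimes> (b \<ominus> f [^] K \<otimes> c)"
      unfolding nat_pow_Suc using ac b f(1) cl(2)[of K] by algebra
    finally obtain d where d: "d \<in> carrier B" "u [^] N \<otimes> a = f \<otimes> d"
      using f_bounded[of a "b \<ominus> f [^] K \<otimes> c" "Suc K"] ac b cl by blast
    have "u [^] Suc K = u [^] Suc k \<otimes> u [^] N"
      using nat_pow_mult[OF u, of "Suc k" N] by (simp add: K_def del: nat_pow_Suc)
    then have "u [^] Suc K \<otimes> a = u [^] Suc k \<otimes> (u [^] N \<otimes> a)"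
      using ac cl m_assoc by metis
    also have "\<dots> = f \<otimes> (u [^] Suc k \<otimes> d)"
      unfolding d(2) using d(1) f(1) cl(1)[of "Suc k"] by algebra
    finally have 1: "u [^] Suc K \<otimes> a = f \<otimes> (u [^] Suc k \<otimes> d)" .
    have "f \<otimes> (b \<ominus> (u [^] Suc k \<otimes> d \<oplus> f [^] K \<otimes> c)) = f \<otimes> b \<ominus> (f \<otimes> (u [^] Suc k \<otimes> d) \<oplus> f [^] Suc K \<otimes> c)"
      unfolding nat_pow_Suc[of f] using b d(1) ac f(1) cl(1)[of "Suc k"] cl(2)[of K] by algebra
    also have "\<dots> = \<zero>"
      unfolding ac(3) 1 using b d(1) ac f(1) cl(1)[of "Suc k"] cl(2)[of "Suc K"] by (simp add: diff_zero_iff)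
    finally have z: "f \<otimes> (b \<ominus> (u [^] Suc k \<otimes> d \<oplus> f [^] K \<otimes> c)) = \<zero>" .
    have X: "u [^] Suc k \<otimes> d \<oplus> f [^] K \<otimes> c \<in> carrier B"
      using d(1) ac(2) cl(1)[of "Suc k"] cl(2)[of K] by (intro a_closed m_closed)
    have "b = u [^] Suc k \<otimes> d \<oplus> f [^] K \<otimes> c"
      using f_regular[OF _ z] diff_zero_iff[OF b X] minus_closed[OF b X] by blast
    moreover have "u [^] Suc k \<otimes> d \<in> ip k" "f [^] K \<otimes> c \<in> ip k"
      using pow_mem_ip'[of u k "Suc k"] pow_mem_ip'[of f k K] uv_mem f d(1) ac K_def by (auto simp del: nat_pow_Suc)
    ultimately show "b \<in> ip k" by auto
  qed
qed

text \<open>If f annihilates a limit, the products f b(n) tend to zero, hence so do the b(n) by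
  continuity of the division by f.\<close>

lemma completion_regular:
  assumes s: "s \<in> carrier P" and fs: "to_completion B I f \<otimes>\<^bsub>P\<^esub> s = \<zero>\<^bsub>P\<^esub>"
  shows "s = \<zero>\<^bsub>P\<^esub>"
proof -
  obtain b where b: "b \<in> Cau" "s = lim b" using s by (rule completionE)
  have bc: "\<And>n. b n \<in> carrier B" using CauD(1)[OF b(1)] .
  have "lim (\<lambda>n. f \<otimes> b n) = lim (\<lambda>_. \<zero>)"
    using fs b f(1) by (simp add: to_completion_lim lim_mult Cau_const lim_zero)
  then have fb: "f \<otimes> b n \<in> ip n" for n
    using f(1) bc lim_eq_iff[of "\<lambda>n. f \<otimes> b n" "\<lambda>_. \<zero>"] by (auto simp: minus_eq)
  have "b k \<in> ip k" for k
  proof -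
    obtain m where m: "\<And>b. b \<in> carrier B \<Longrightarrow> f \<otimes> b \<in> ip m \<Longrightarrow> b \<in> ip k" using division_continuous by blast
    let ?n = "max m k"
    have "f \<otimes> b ?n \<in> ip m" using ip_mono[OF _ fb[of ?n], of m] by simp
    then have "b ?n \<in> ip k" using m bc by blast
    then show ?thesis using Cau_diff[OF b(1), of k ?n] ip_of_diff[OF ip_sym] bc by simp
  qed
  then show ?thesis unfolding b lim_zero using bc by (subst lim_eq_iff) (auto simp: minus_eq)
qed

text \<open>At each level k the bound N gives an approximate quotient d(k) of u^N b(k) by f. The
  products f d(k) approach one another, and continuity of the division by f turns this into
  convergence of the d(k) along a suitable reindexing.\<close>

lemma completion_bounded:
  assumes s: "s \<in> carrier P" and t: "t \<in> carrier P"
    and st: "to_completion B I u [^]\<^bsub>P\<^esub> (m::nat) \<otimes>\<^bsub>P\<^esub> s = to_completion B I f \<otimes>\<^bsub>P\<^esub> t"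
  shows "\<exists>d\<in>carrier P. to_completion B I u [^]\<^bsub>P\<^esub> N \<otimes>\<^bsub>P\<^esub> s = to_completion B I f \<otimes>\<^bsub>P\<^esub> d"
proof -
  obtain b where b: "b \<in> Cau" "s = lim b" using s by (rule completionE)
  obtain c where c: "c \<in> Cau" "t = lim c" using t by (rule completionE)
  have bc: "\<And>n. b n \<in> carrier B" and cc: "\<And>n. c n \<in> carrier B" using CauD(1)[OF b(1)] CauD(1)[OF c(1)] by auto
  note cl = nat_pow_closed[OF u] nat_pow_closed[OF f(1)]
  have "lim (\<lambda>n. u [^] m \<otimes> b n) = lim (\<lambda>n. f \<otimes> c n)"
    using st b c f(1) u by (simp add: to_completion_lim lim_mult lim_pow Cau_const)
  then have ub: "u [^] m \<otimes> b n \<ominus> f \<otimes> c n \<in> ip n" for n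
    using f(1) bc cc cl lim_eq_iff[of "\<lambda>n. u [^] m \<otimes> b n" "\<lambda>n. f \<otimes> c n"] by auto
  have approx: "\<exists>d. d \<in> carrier B \<and> u [^] N \<otimes> b k \<ominus> f \<otimes> d \<in> ip k" for k
  proof -
    \<comment> \<open>The error term must contain u^m, to be merged with u^m b(n), and still leave
      u^(k+1) behind.\<close>
    define K where "K = k + m"
    obtain M where M: "\<And>y. y \<in> ip M \<Longrightarrow> \<exists>a\<in>carrier B. \<exists>b\<in>carrier B. y = u [^] Suc K \<otimes> a \<oplus> f [^] Suc K \<otimes> b"
      using ip_factor[of "Suc K"] by blast
    let ?n = "max M k"
    have "u [^] m \<otimes> b ?n \<ominus> f \<otimes> c ?n \<in> ip M" using ip_mono[OF _ ub[of ?n], of M] by simp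
    then obtain a c' where ac: "a \<in> carrier B" "c' \<in> carrier B"
      "u [^] m \<otimes> b ?n \<ominus> f \<otimes> c ?n = u [^] Suc K \<otimes> a \<oplus> f [^] Suc K \<otimes> c'" using M by blast
    have uK: "u [^] Suc K \<otimes> a = u [^] m \<otimes> (u [^] Suc k \<otimes> a)"
      using u ac cl by (simp add: K_def m_assoc[symmetric] nat_pow_mult add.commute)
    have "u [^] m \<otimes> (b ?n \<ominus> u [^] Suc k \<otimes> a) = (u [^] m \<otimes> b ?n \<ominus> f \<otimes> c ?n) \<oplus> f \<otimes> c ?n \<ominus> u [^] m \<otimes> (u [^] Suc k \<otimes> a)"
      using bc[of ?n] cc[of ?n] f(1) cl(1)[of m] cl(1)[of "Suc k"] ac(1)
      by (simp add: diff_add_cancel) (simp add: minus_eq r_distr r_minus)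
    also have "\<dots> = f \<otimes> (c ?n \<oplus> f [^] K \<otimes> c')"
    proof -
      have "\<And>x y z. x \<in> carrier B \<Longrightarrow> y \<in> carrier B \<Longrightarrow> z \<in> carrier B \<Longrightarrow> x \<oplus> y \<oplus> z \<ominus> x = y \<oplus> z"
        using add_diff_cancel a_assoc by simp
      then show ?thesis unfolding ac(3) uK[symmetric] nat_pow_Suc[of f]
        using bc[of ?n] cc[of ?n] f(1) cl(1)[of "Suc K"] cl(2)[of K] ac by (simp add: r_distr m_ac a_comm)
    qed
    finally obtain d where d: "d \<in> carrier B" "u [^] N \<otimes> (b ?n \<ominus> u [^] Suc k \<otimes> a) = f \<otimes> d"
      using f_bounded[of "b ?n \<ominus> u [^] Suc k \<otimes> a" "c ?n \<oplus> f [^] K \<otimes> c'" m] bc cc ac f cl by blast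
    have "u [^] N \<otimes> b ?n \<ominus> f \<otimes> d = u [^] N \<otimes> (u [^] Suc k \<otimes> a)"
    proof -
      have "\<And>x y. x \<in> carrier B \<Longrightarrow> y \<in> carrier B \<Longrightarrow> x \<ominus> (x \<ominus> y) = y"
        by (simp add: minus_eq minus_add r_neg1 r_neg2)
      then show ?thesis unfolding d(2)[symmetric]
        using bc[of ?n] cl(1)[of N] cl(1)[of "Suc k"] ac by (simp add: minus_eq r_distr r_minus)
    qed
    moreover have "u [^] N \<otimes> (u [^] Suc k \<otimes> a) \<in> ip k"
      using pow_mem_ip'[of u k "Suc k"] uv_mem ac cl by (auto simp del: nat_pow_Suc)
    ultimately have 1: "u [^] N \<otimes> b ?n \<ominus> f \<otimes> d \<in> ip k" by simp
    have "b k \<ominus> b ?n \<in> ip k" using Cau_diff[OF b(1), of k ?n] ip_sym bc by simp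
    then have "u [^] N \<otimes> b k \<ominus> u [^] N \<otimes> b ?n \<in> ip k"
      using bc cl by (intro ip_mult_cong) (auto simp: minus_eq r_neg)
    then have "u [^] N \<otimes> b k \<ominus> f \<otimes> d \<in> ip k" using 1 ip_trans bc cl d f by (meson m_closed)
    with d show ?thesis by blast
  qed
  then obtain d where d: "\<And>k. d k \<in> carrier B" "\<And>k. u [^] N \<otimes> b k \<ominus> f \<otimes> d k \<in> ip k" by metis
  obtain M where M: "\<And>k b. b \<in> carrier B \<Longrightarrow> f \<otimes> b \<in> ip (M k) \<Longrightarrow> b \<in> ip k" using division_continuous by metis
  \<comment> \<open>Summing the M i makes L increasing and at least M k, so that consecutive values
    d(L k) are compared at a level where division by f lands in the k-th power.\<close>
  define L where "L k = k + (\<Sum>i\<le>k. M i)" for k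
  have L: "k \<le> L k" "M k \<le> L k" "L k \<le> L (Suc k)" for k
    using member_le_sum[of k "{..k}" M] by (auto simp: L_def)
  define g where "g k = d (L k)" for k
  have gc: "g k \<in> carrier B" for k using d by (simp add: g_def)
  have close: "u [^] N \<otimes> b l \<ominus> u [^] N \<otimes> b k \<in> ip k" if "k \<le> l" for k l
    using Cau_diff[OF b(1) that] bc cl by (intro ip_mult_cong) (auto simp: minus_eq r_neg)
  have "g (Suc k) \<ominus> g k \<in> ip k" for k
  proof (rule M)
    let ?x = "u [^] N \<otimes> b (L (Suc k))" and ?y = "u [^] N \<otimes> b (L k)"
    have c: "?x \<in> carrier B" "?y \<in> carrier B" "f \<otimes> g k \<in> carrier B" "f \<otimes> g (Suc k) \<in> carrier B"
      using bc cl gc f by auto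
    have 1: "f \<otimes> g (Suc k) \<ominus> ?x \<in> ip (L k)"
      using ip_mono[OF L(3) d(2)[of "L (Suc k)"]] ip_sym c by (simp add: g_def)
    have 2: "?x \<ominus> ?y \<in> ip (L k)" using close L by blast
    have 3: "?y \<ominus> f \<otimes> g k \<in> ip (L k)" using d(2) by (simp add: g_def)
    have "f \<otimes> g (Suc k) \<ominus> f \<otimes> g k \<in> ip (L k)"
      using ip_trans[OF ip_trans[OF 1 2] 3] c by blast
    then have "f \<otimes> (g (Suc k) \<ominus> g k) \<in> ip (L k)" using gc f by (simp add: minus_eq r_distr r_minus)
    then show "f \<otimes> (g (Suc k) \<ominus> g k) \<in> ip (M k)" using ip_mono[OF L(2)] by blast
  qed (use gc in auto)
  then have g: "g \<in> Cau" using gc by (simp add: Cau_def)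
  have "u [^] N \<otimes> b k \<ominus> f \<otimes> g k \<in> ip k" for k
  proof -
    have "u [^] N \<otimes> b k \<ominus> u [^] N \<otimes> b (L k) \<in> ip k"
      using close[OF L(1)[of k]] ip_sym bc cl by simp
    moreover have "u [^] N \<otimes> b (L k) \<ominus> f \<otimes> g k \<in> ip k"
      using ip_mono[OF L(1) d(2)] by (simp add: g_def)
    ultimately show ?thesis using bc cl gc f by (meson ip_trans m_closed)
  qed
  then have "lim (\<lambda>k. u [^] N \<otimes> b k) = lim (\<lambda>k. f \<otimes> g k)"
    using bc cl gc f by (subst lim_eq_iff) auto
  then have "to_completion B I u [^]\<^bsub>P\<^esub> N \<otimes>\<^bsub>P\<^esub> s = to_completion B I f \<otimes>\<^bsub>P\<^esub> lim g"
    using b g u f by (simp add: to_completion_lim lim_mult lim_pow Cau_const)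
  then show ?thesis using lim_closed[OF g] by blast
qed

end

section \<open>Maps from a completion to a complete ring\<close>

lemma hom_ideal_power:
  assumes "adic_ring B I" "adic_ring C K" "h \<in> ring_hom B C" "h ` I \<subseteq> K" "y \<in> ideal_power B I n"
  shows "h y \<in> ideal_power C K n"
  using assms(5)
proof (induction n arbitrary: y)
  case 0
  then show ?case using ring_hom_closed[OF assms(3)] by (simp add: ideal_power.simps(1))
next
  case (Suc n)
  interpret B: adic_ring B I by fact
  interpret C: adic_ring C K by fact
  interpret h: ring_hom_cring B C h by unfold_locales fact
  have "y \<in> ideal_prod B I (ideal_power B I n)" using Suc.prems unfolding ideal_power.simps(2) .
  then have "y \<in> carrier B \<and> h y \<in> ideal_power C K (Suc n)"
  proof (induction rule: ideal_prod.induct)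
    case (prod i j)
    then have "i \<in> carrier B" "j \<in> carrier B" using B.ip_carrier B.ip_1 by blast+
    then show ?case using C.ip_mult[of "h i" "Suc 0" "h j" n] C.ip_1 Suc.IH[OF prod(2)] prod(1) assms(4)
      by (simp add: image_subset_iff)
  next
    case (sum a b)
    then show ?case using C.ip_add[of "h a" "Suc n" "h b"] by simp
  qed
  then show ?case by blast
qed

locale complete_target = adic_ring_pair B I u v + C: adic_ring C K
  for B (structure) and I u v and C (structure) and K +
  assumes complete: "adic_complete C K"
begin

lemma separated: "a \<in> carrier C \<Longrightarrow> (\<And>n. a \<in> C.ip n) \<Longrightarrow> a = \<zero>\<^bsub>C\<^esub>"
  and converges: "b \<in> C.Cau \<Longrightarrow> \<exists>c\<in>carrier C. \<forall>n. c \<ominus>\<^bsub>C\<^esub> b n \<in> C.ip n"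
  using complete[unfolded C.adic_complete_iff] by simp_all

lemma separated_diff:
  assumes "a \<in> carrier C" "b \<in> carrier C" "\<And>n. a \<ominus>\<^bsub>C\<^esub> b \<in> C.ip n"
  shows "a = b"
  using separated[of "a \<ominus>\<^bsub>C\<^esub> b"] assms C.diff_zero_iff C.minus_closed by blast

text \<open>Modulo the n-th power of \<open>J\<close> an element of the completion comes from B,
  where the maps agree. Both carry the error into the n-th power of K, and C is separated.\<close>

lemma hom_unique:
  assumes h: "h \<in> ring_hom P C" "h ` J \<subseteq> K" and k: "k \<in> ring_hom P C" "k ` J \<subseteq> K"
    and eq: "\<And>b. b \<in> carrier B \<Longrightarrow> h (to_completion B I b) = k (to_completion B I b)" and s: "s \<in> carrier P"
  shows "h s = k s"
proof -
  interpret h: ring_hom_cring P C h by unfold_locales (rule h)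
  interpret k: ring_hom_cring P C k by unfold_locales (rule k)
  obtain b where b: "b \<in> Cau" "s = lim b" using s by (rule completionE)
  have bc: "\<And>n. b n \<in> carrier B" using CauD(1)[OF b(1)] .
  show ?thesis
  proof (rule separated_diff)
    fix n
    let ?t = "to_completion B I (b n)"
    have t: "?t = lim (\<lambda>_. b n)" "?t \<in> carrier P" using bc by (simp_all add: to_completion_lim Cau_const)
    have "(\<lambda>k. b k \<ominus> b n) \<in> Cau" using b(1) bc Cau_diff' Cau_const by blast
    moreover have "s \<ominus>\<^bsub>P\<^esub> ?t = lim (\<lambda>k. b k \<ominus> b n)" unfolding b t using b(1) bc by (simp add: lim_diff Cau_const)
    ultimately have st: "s \<ominus>\<^bsub>P\<^esub> ?t \<in> ideal_power P J n" using PJ_power_iff bc by (simp add: minus_eq r_neg)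
    have "h (s \<ominus>\<^bsub>P\<^esub> ?t) \<in> C.ip n" "k (s \<ominus>\<^bsub>P\<^esub> ?t) \<in> C.ip n"
      using hom_ideal_power[OF PJ.adic_ring_axioms C.adic_ring_axioms _ _ st] h k by blast+
    then have "h s \<ominus>\<^bsub>C\<^esub> h ?t \<in> C.ip n" "k s \<ominus>\<^bsub>C\<^esub> k ?t \<in> C.ip n"
      using s t(2) by (simp_all add: P.minus_eq C.minus_eq)
    moreover have "h ?t = k ?t" using eq bc by blast
    ultimately show "h s \<ominus>\<^bsub>C\<^esub> k s \<in> C.ip n"
      using C.ip_trans[of "h s" "h ?t" n "k s"] C.ip_sym[of "k s" "k ?t" n] s t(2) by simp
  qed (use s in auto)
qed

text \<open>Completeness of C provides the limit of the images. The conclusion retains the rate of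
  approximation along every representing sequence, because the compatibility of the extension with
  delta will be deduced from it.\<close>

lemma hom_extend:
  assumes g: "g \<in> ring_hom B C" "g ` I \<subseteq> K"
  shows "\<exists>h \<in> ring_hom P C. (\<forall>b\<in>Cau. \<forall>n. h (lim b) \<ominus>\<^bsub>C\<^esub> g (b n) \<in> C.ip n)"
proof -
  interpret g: ring_hom_cring B C g by unfold_locales (rule g)
  have gd: "g a \<ominus>\<^bsub>C\<^esub> g b \<in> C.ip n" if "a \<in> carrier B" "b \<in> carrier B" "a \<ominus> b \<in> ip n" for a b n
    using hom_ideal_power[OF adic_ring_axioms C.adic_ring_axioms g that(3)] that(1,2) by (simp add: minus_eq C.minus_eq)
  have "\<exists>c. c \<in> carrier C \<and> (\<forall>b\<in>Cau. s = lim b \<longrightarrow> (\<forall>n. c \<ominus>\<^bsub>C\<^esub> g (b n) \<in> C.ip n))" if sP: "s \<in> carrier P" for s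
  proof -
    obtain b where b: "b \<in> Cau" "s = lim b" using sP by (rule completionE)
    have bc: "\<And>n. b n \<in> carrier B" using CauD(1)[OF b(1)] .
    have gb: "(\<lambda>n. g (b n)) \<in> C.Cau" unfolding C.Cau_def using bc gd CauD(2)[OF b(1)] by auto
    obtain c where c: "c \<in> carrier C" "\<And>n. c \<ominus>\<^bsub>C\<^esub> g (b n) \<in> C.ip n"
      using converges[OF gb] by blast
    have "c \<ominus>\<^bsub>C\<^esub> g (b' n) \<in> C.ip n" if b': "b' \<in> Cau" "s = lim b'" for b' n
    proof -
      have "lim b = lim b'" using b(2) b'(2) by simp
      then have "b n \<ominus> b' n \<in> ip n" using lim_eq_iff[of b b'] bc CauD(1)[OF b'(1)] by simp
      then show ?thesis using C.ip_trans[OF c(2) gd] bc CauD(1)[OF b'(1)] c(1) by simp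
    qed
    with c(1) show ?thesis by blast
  qed
  then have "\<forall>s\<in>carrier P. \<exists>c. c \<in> carrier C \<and> (\<forall>b\<in>Cau. s = lim b \<longrightarrow> (\<forall>n. c \<ominus>\<^bsub>C\<^esub> g (b n) \<in> C.ip n))"
    by blast
  then obtain h where h': "\<forall>s\<in>carrier P. h s \<in> carrier C \<and> (\<forall>b\<in>Cau. s = lim b \<longrightarrow> (\<forall>n. h s \<ominus>\<^bsub>C\<^esub> g (b n) \<in> C.ip n))"
    by (rule bchoice[THEN exE])
  have h: "h s \<in> carrier C" if "s \<in> carrier P" for s using h' that by blast
  have h2: "h (lim b) \<ominus>\<^bsub>C\<^esub> g (b n) \<in> C.ip n" if "b \<in> Cau" for b n using h' that lim_closed[OF that] by blast
  have char: "h (lim b) = c" if b: "b \<in> Cau" "c \<in> carrier C" "\<And>n. c \<ominus>\<^bsub>C\<^esub> g (b n) \<in> C.ip n" for b c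
  proof (rule separated_diff)
    fix n
    show "h (lim b) \<ominus>\<^bsub>C\<^esub> c \<in> C.ip n"
      using C.ip_trans[OF h2[OF b(1)] C.ip_sym[OF b(3)]] b h CauD(1)[OF b(1)] by simp
  qed (use b h lim_closed in auto)
  have "h \<in> ring_hom P C"
  proof (rule ring_hom_memI)
    show "h \<one>\<^bsub>P\<^esub> = \<one>\<^bsub>C\<^esub>" unfolding lim_one by (rule char) (auto simp: Cau_const C.minus_eq C.r_neg)
  next
    fix s t assume "s \<in> carrier P" "t \<in> carrier P"
    then obtain b c where b: "b \<in> Cau" "s = lim b" and c: "c \<in> Cau" "t = lim c" by (meson completionE)
    have bc: "\<And>n. b n \<in> carrier B" "\<And>n. c n \<in> carrier B" using CauD(1)[OF b(1)] CauD(1)[OF c(1)] by auto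
    have hc: "h s \<in> carrier C" "h t \<in> carrier C" using h b c lim_closed by auto
    have H: "h s \<ominus>\<^bsub>C\<^esub> g (b n) \<in> C.ip n" "h t \<ominus>\<^bsub>C\<^esub> g (c n) \<in> C.ip n" for n
      using h2 b c by auto
    show "h (s \<otimes>\<^bsub>P\<^esub> t) = h s \<otimes>\<^bsub>C\<^esub> h t"
      unfolding b(2) c(2) lim_mult[OF b(1) c(1)]
    proof (rule char)
      show "h (lim b) \<otimes>\<^bsub>C\<^esub> h (lim c) \<ominus>\<^bsub>C\<^esub> g (b n \<otimes> c n) \<in> C.ip n" for n
        using C.ip_mult_cong[OF _ _ _ _ H(1) H(2), of n] hc bc b c by simp
    qed (use b c hc Cau_mult in auto)
    show "h (s \<oplus>\<^bsub>P\<^esub> t) = h s \<oplus>\<^bsub>C\<^esub> h t"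
      unfolding b(2) c(2) lim_add[OF b(1) c(1)]
    proof (rule char)
      fix n
      have "h s \<oplus>\<^bsub>C\<^esub> h t \<ominus>\<^bsub>C\<^esub> g (b n \<oplus> c n) = (h s \<ominus>\<^bsub>C\<^esub> g (b n)) \<oplus>\<^bsub>C\<^esub> (h t \<ominus>\<^bsub>C\<^esub> g (c n))"
        using hc bc by (simp add: C.minus_eq C.minus_add C.a_ac)
      then show "h (lim b) \<oplus>\<^bsub>C\<^esub> h (lim c) \<ominus>\<^bsub>C\<^esub> g (b n \<oplus> c n) \<in> C.ip n"
        using C.ip_add[OF H(1)[of n] H(2)[of n]] b c by simp
    qed (use b c hc Cau_add in auto)
  qed (use h in auto)
  with h2 show ?thesis by blast
qed

end

section \<open>Compatibility with delta under subtraction and division\<close>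

text \<open>The correction \<open>cross\<close> is determined by h(a) and h(b) and cancels from both
  sides. This applies where a and a + b are under control, as for b = -1 and for the variable
  \<xi>.\<close>

lemma delta_compat_cancel:
  assumes "delta_ring p B \<delta>B" "delta_ring p C \<delta>C" "h \<in> ring_hom B C"
    and ab: "a \<in> carrier B" "b \<in> carrier B" "h (\<delta>B a) = \<delta>C (h a)" "h (\<delta>B (a \<oplus>\<^bsub>B\<^esub> b)) = \<delta>C (h (a \<oplus>\<^bsub>B\<^esub> b))"
  shows "h (\<delta>B b) = \<delta>C (h b)"
proof -
  interpret B: delta_ring p B \<delta>B by fact
  interpret C: delta_ring p C \<delta>C by fact
  interpret ring_hom_cring B C h by unfold_locales fact
  note cl = B.delta_closed[OF ab(1)] B.delta_closed[OF ab(2)] B.cross_closed[OF ab(1,2), of p]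
  let ?k = "cross p C (h a) (h b)"
  have k: "?k \<in> carrier C" using ab by (intro C.cross_closed) auto
  have "\<delta>C (h a) \<oplus>\<^bsub>C\<^esub> h (\<delta>B b) \<ominus>\<^bsub>C\<^esub> ?k = \<delta>C (h a) \<oplus>\<^bsub>C\<^esub> \<delta>C (h b) \<ominus>\<^bsub>C\<^esub> ?k"
    using ab cl by (simp add: B.delta_add_cross C.delta_add_cross B.minus_eq C.minus_eq hom_cross)
  then show ?thesis using ab cl k C.delta_closed
    by (simp add: C.minus_eq)
qed

text \<open>In the product rule \<delta>(b) is multiplied by \<open>frob a\<close>, whose image in C
  is a unit and can be cancelled. This is how denominators are handled.\<close>

lemma delta_compat_divide:
  assumes "delta_ring p B \<delta>B" "delta_ring p C \<delta>C" "h \<in> ring_hom B C"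
    and ab: "a \<in> carrier B" "b \<in> carrier B" "h (\<delta>B a) = \<delta>C (h a)" "h (\<delta>B (a \<otimes>\<^bsub>B\<^esub> b)) = \<delta>C (h (a \<otimes>\<^bsub>B\<^esub> b))"
    and unit: "u \<in> carrier B" "delta_ring.frob p B \<delta>B a \<otimes>\<^bsub>B\<^esub> u = \<one>\<^bsub>B\<^esub>"
  shows "h (\<delta>B b) = \<delta>C (h b)"
proof -
  interpret B: delta_ring p B \<delta>B by fact
  interpret C: delta_ring p C \<delta>C by fact
  interpret ring_hom_cring B C h by unfold_locales fact
  note cl = B.delta_closed[OF ab(1)] B.delta_closed[OF ab(2)] B.frob_closed[OF ab(1)]
  have fr: "h (B.frob a) = C.frob (h a)"
    using ab cl by (simp add: B.frob_def C.frob_def hom_add_pow)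
  have one: "C.frob (h a) \<otimes>\<^bsub>C\<^esub> h u = \<one>\<^bsub>C\<^esub>"
    using arg_cong[OF unit(2), of h] cl unit(1) by (simp add: fr)
  have "C.frob (h a) \<otimes>\<^bsub>C\<^esub> h (\<delta>B b) = C.frob (h a) \<otimes>\<^bsub>C\<^esub> \<delta>C (h b)"
    using ab cl C.frob_closed[of "h a"] C.delta_closed
    by (simp add: B.delta_mult_frob C.delta_mult_frob fr)
  moreover have "h u \<otimes>\<^bsub>C\<^esub> (C.frob (h a) \<otimes>\<^bsub>C\<^esub> x) = x" if "x \<in> carrier C" for x
  proof -
    have "h u \<otimes>\<^bsub>C\<^esub> (C.frob (h a) \<otimes>\<^bsub>C\<^esub> x) = (C.frob (h a) \<otimes>\<^bsub>C\<^esub> h u) \<otimes>\<^bsub>C\<^esub> x"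
      using that ab unit C.frob_closed[of "h a"] by (simp add: C.m_ac)
    then show ?thesis using one that by simp
  qed
  ultimately show ?thesis using cl(2) ab(2) C.delta_closed[of "h b"] hom_closed by metis
qed

lemma (in ring_hom_cring) hom_q_number:
  "q \<in> carrier R \<Longrightarrow> h (q_number R q n) = q_number S (h q) n"
  unfolding q_number_def by (auto simp: Pi_def intro!: S.finsum_cong')

lemma (in cring) q_number_closed: "q \<in> carrier R \<Longrightarrow> q_number R q n \<in> carrier R"
  unfolding q_number_def by (intro finsum_closed) auto

lemma (in cring) q_binomial_closed: "q \<in> carrier R \<Longrightarrow> q_binomial R q n k \<in> carrier R"
proof (induction n arbitrary: k)
  case 0
  then show ?case by (cases k) auto
next
  case (Suc n)
  then show ?case by (cases k) auto
qed

lemma (in ring_hom_cring) hom_q_binomial: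
  "q \<in> carrier R \<Longrightarrow> h (q_binomial R q n k) = q_binomial S (h q) n k"
proof (induction n arbitrary: k)
  case 0
  then show ?case by (cases k) auto
next
  case (Suc n)
  then show ?case using R.q_binomial_closed by (cases k) (simp_all del: R.nat_pow_Suc S.nat_pow_Suc)
qed

section \<open>The localization\<close>

interpretation Zq: cring Zq
  by (unfold_locales)
     (auto simp: Zq_def algebra_simps Units_def intro!: exI[of _ "- _"] bexI[of _ "- _"])

lemma Zq_sel [simp]: "carrier Zq = UNIV" "\<zero>\<^bsub>Zq\<^esub> = 0" "\<one>\<^bsub>Zq\<^esub> = 1" "x \<otimes>\<^bsub>Zq\<^esub> y = x * y" "x \<oplus>\<^bsub>Zq\<^esub> y = x + y"
  by (simp_all add: Zq_def)

lemma Zq_pow: "x [^]\<^bsub>Zq\<^esub> (n::nat) = x ^ n"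
  by (induction n) (auto simp: mult.commute)

lemma Zq_add_pow: "add_pow Zq (n::nat) x = of_nat n * x"
  by (induction n) (auto simp: Zq.add.nat_pow_Suc algebra_simps)

text \<open>Division by q - 1 leaves the value at 1 as remainder, so the ideal is the kernel of
  evaluation at q = 1 modulo p.\<close>

lemma Zq_ideal_iff: "g \<in> Idl\<^bsub>Zq\<^esub> {[:int p:], [:-1, 1:]} \<longleftrightarrow> int p dvd poly g 1"
proof -
  have "Idl\<^bsub>Zq\<^esub> {[:int p:], [:-1, 1:]} = {[:int p:] * a + [:-1, 1:] * b | a b. True}"
    by (subst Zq.genideal_pair) (auto simp: Zq_def)
  moreover have "\<exists>a b. g = [:int p:] * a + [:-1, 1:] * b" if "int p dvd poly g 1"
  proof -
    from that obtain k where k: "poly g 1 = int p * k" by blast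
    have "poly (g - [:poly g 1:]) 1 = 0" by simp
    then have "[:-1, 1:] dvd g - [:poly g 1:]" unfolding poly_eq_0_iff_dvd .
    then obtain b where "g - [:poly g 1:] = [:-1, 1:] * b" by blast
    then have "g = [:int p:] * [:k:] + [:-1, 1:] * b" using k by (simp add: algebra_simps)
    then show ?thesis by blast
  qed
  moreover have "int p dvd poly ([:int p:] * a + [:-1, 1:] * b) 1" for a b by simp
  ultimately show ?thesis by auto
qed

abbreviation Loc :: "nat \<Rightarrow> int poly fract set" where "Loc p \<equiv> carrier (Zq_loc p)"

lemma Loc_def: "Loc p = {Fract f g | f g. \<not> int p dvd poly g 1}"
  by (auto simp: Zq_loc_def Zq_ideal_iff)

lemma Zq_loc_sel [simp]: "\<zero>\<^bsub>Zq_loc p\<^esub> = 0" "\<one>\<^bsub>Zq_loc p\<^esub> = 1" "x \<otimes>\<^bsub>Zq_loc p\<^esub> y = x * y" "x \<oplus>\<^bsub>Zq_loc p\<^esub> y = x + y"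
  by (simp_all add: Zq_loc_def)

lemma pcompose_one [simp]: "pcompose 1 (q :: 'a :: comm_semiring_1 poly) = 1"
  by (metis one_pCons pcompose_const)

lemma Fract_power: "Fract a b ^ n = Fract (a ^ n) (b ^ n)"
  by (induction n) (auto simp: One_fract_def)

lemma of_nat_Fract: "of_nat n = Fract (of_nat n) 1"
  by (induction n) (auto simp: Zero_fract_def One_fract_def)

locale q_loc_prime =
  fixes p :: nat assumes prime_p: "prime p"
begin

lemma p_gt_0: "p > 0" using prime_p prime_gt_0_nat by blast

lemma prime_int_p: "prime (int p)" using prime_p by simp

lemma not_dvd_mult: "\<not> int p dvd a \<Longrightarrow> \<not> int p dvd b \<Longrightarrow> \<not> int p dvd a * b"
  using prime_int_p prime_dvd_mult_iff by blast

lemma not_dvd_power: "\<not> int p dvd a \<Longrightarrow> \<not> int p dvd a ^ n"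
  using prime_int_p prime_dvd_power by blast

lemma LocE:
  assumes "z \<in> Loc p" obtains f g where "z = Fract f g" "\<not> int p dvd poly g 1" "g \<noteq> 0"
  using assms unfolding Loc_def by fastforce

lemma LocI: "\<not> int p dvd poly g 1 \<Longrightarrow> Fract f g \<in> Loc p"
  unfolding Loc_def by blast

lemma Loc_Fract1: "Fract f 1 \<in> Loc p"
  using prime_int_p by (intro LocI) (auto simp: not_prime_unit)

lemma Loc_0 [simp]: "0 \<in> Loc p" and Loc_1 [simp]: "1 \<in> Loc p"
  using Loc_Fract1 by (simp_all add: Zero_fract_def One_fract_def)

lemma Loc_add [simp]: "a \<in> Loc p \<Longrightarrow> b \<in> Loc p \<Longrightarrow> a + b \<in> Loc p"
  by (elim LocE) (auto intro!: LocI simp: prime_dvd_mult_iff[OF prime_int_p])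

lemma Loc_mult [simp]: "a \<in> Loc p \<Longrightarrow> b \<in> Loc p \<Longrightarrow> a * b \<in> Loc p"
  by (elim LocE) (auto intro!: LocI simp: prime_dvd_mult_iff[OF prime_int_p])

lemma Loc_minus [simp]: "a \<in> Loc p \<Longrightarrow> - a \<in> Loc p"
  by (elim LocE) (auto intro!: LocI)

lemma Loc_diff [simp]: "a \<in> Loc p \<Longrightarrow> b \<in> Loc p \<Longrightarrow> a - b \<in> Loc p"
  using Loc_add[of a "- b"] by simp

lemma Loc_power [simp]: "a \<in> Loc p \<Longrightarrow> a ^ n \<in> Loc p"
  by (induction n) auto

lemma Loc_of_nat [simp]: "of_nat n \<in> Loc p"
  by (induction n) auto

lemma Loc_q [simp]: "q_loc \<in> Loc p"
  by (simp add: q_loc_def Loc_Fract1)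

lemma Zq_loc_cring: "cring (Zq_loc p)"
proof (rule cringI)
  show "abelian_group (Zq_loc p)"
    by (rule abelian_groupI) (auto simp: add.assoc add.commute intro!: bexI[of _ "- _"])
  show "comm_monoid (Zq_loc p)"
    by (rule comm_monoidI) (auto simp: mult.assoc mult.commute)
qed (auto simp: algebra_simps)

sublocale L: cring "Zq_loc p" by (rule Zq_loc_cring)

lemma Zq_loc_pow [simp]: "x [^]\<^bsub>Zq_loc p\<^esub> (n::nat) = x ^ n"
  by (induction n) (auto simp: mult.commute)

lemma Zq_loc_add_pow [simp]: "add_pow (Zq_loc p) (n::nat) x = of_nat n * x"
  by (induction n) (auto simp: L.add.nat_pow_Suc algebra_simps)

lemma Zq_loc_neg [simp]: "x \<in> Loc p \<Longrightarrow> \<ominus>\<^bsub>Zq_loc p\<^esub> x = - x"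
  by (rule L.minus_equality) auto

section \<open>The value at q = 1 and p-adic valuations\<close>

text \<open>Specialization at q = 1, meaningful for fractions whose denominator does not vanish at
  1, in particular on the whole localization. Invertibility in the localization will be read off
  from the p-adic valuation of this rational number.\<close>

definition ev :: "int poly fract \<Rightarrow> rat" where
  "ev z = (THE r. \<exists>f g. z = Fract f g \<and> poly g 1 \<noteq> 0 \<and> r = of_int (poly f 1) / of_int (poly g 1))"

lemma ev_Fract:
  assumes "poly g 1 \<noteq> 0" shows "ev (Fract f g) = of_int (poly f 1) / of_int (poly g 1)"
  unfolding ev_def
proof (rule the_equality)
  fix r :: rat assume "\<exists>f' g'. Fract f g = Fract f' g' \<and> poly g' 1 \<noteq> 0 \<and> r = of_int (poly f' 1) / of_int (poly g' 1)"
  then obtain f' g' where *: "Fract f g = Fract f' g'" "poly g' 1 \<noteq> 0" "r = of_int (poly f' 1) / of_int (poly g' 1)" by blast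
  have "g \<noteq> 0" "g' \<noteq> 0" using assms * by auto
  then have "f * g' = f' * g" using * by (simp add: eq_fract)
  then have "poly f 1 * poly g' 1 = poly f' 1 * poly g 1" by (metis poly_mult)
  then have "(of_int (poly f 1) * of_int (poly g' 1) :: rat) = of_int (poly f' 1) * of_int (poly g 1)" by (metis of_int_mult)
  then show "r = of_int (poly f 1) / of_int (poly g 1)"
    unfolding *(3) using assms *(2) by (simp add: frac_eq_eq)
qed (use assms in blast)

lemma nz1: "\<not> int p dvd poly g 1 \<Longrightarrow> poly g 1 \<noteq> 0"
  by auto

lemma ev_0 [simp]: "ev 0 = 0" and ev_1 [simp]: "ev 1 = 1" and ev_q [simp]: "ev q_loc = 1"
  by (simp_all add: Zero_fract_def One_fract_def q_loc_def ev_Fract)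

lemma ev_add [simp]: "a \<in> Loc p \<Longrightarrow> b \<in> Loc p \<Longrightarrow> ev (a + b) = ev a + ev b"
  by (elim LocE) (auto simp: ev_Fract nz1 field_simps dest!: nz1)

lemma ev_mult [simp]: "a \<in> Loc p \<Longrightarrow> b \<in> Loc p \<Longrightarrow> ev (a * b) = ev a * ev b"
  by (elim LocE) (auto simp: ev_Fract nz1 field_simps dest!: nz1)

lemma ev_minus [simp]: "a \<in> Loc p \<Longrightarrow> ev (- a) = - ev a"
  by (elim LocE) (auto simp: ev_Fract nz1)

lemma ev_diff [simp]: "a \<in> Loc p \<Longrightarrow> b \<in> Loc p \<Longrightarrow> ev (a - b) = ev a - ev b"
  using ev_add[of a "- b"] by simp

lemma ev_power [simp]: "a \<in> Loc p \<Longrightarrow> ev (a ^ n) = ev a ^ n"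
  by (induction n) auto

lemma ev_of_nat [simp]: "ev (of_nat n) = of_nat n"
  by (induction n) auto

text \<open>A predicate for the exact valuation instead of a valuation function, so that zero needs
  no convention.\<close>

definition pval :: "nat \<Rightarrow> rat \<Rightarrow> bool" where
  "pval k r \<longleftrightarrow> (\<exists>a b. \<not> int p dvd a \<and> \<not> int p dvd b \<and> r = of_nat p ^ k * of_int a / of_int b)"

definition pint :: "rat \<Rightarrow> bool" where
  "pint r \<longleftrightarrow> (\<exists>a b. \<not> int p dvd b \<and> r = of_int a / of_int b)"

lemma pint_ev: "z \<in> Loc p \<Longrightarrow> pint (ev z)"
  unfolding pint_def by (elim LocE) (use ev_Fract nz1 in blast)

lemma pval_mult: "pval k r \<Longrightarrow> pval l s \<Longrightarrow> pval (k + l) (r * s)"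
proof -
  assume "pval k r" "pval l s"
  then obtain a b c d where *: "\<not> int p dvd a" "\<not> int p dvd b" "r = of_nat p ^ k * of_int a / of_int b"
   "\<not> int p dvd c" "\<not> int p dvd d" "s = of_nat p ^ l * of_int c / of_int d" unfolding pval_def by blast
  then have "r * s = of_nat p ^ (k + l) * of_int (a * c) / of_int (b * d)" by (simp add: power_add)
  with * show ?thesis unfolding pval_def using not_dvd_mult by blast
qed

lemma pval_divide: "pval (k + l) r \<Longrightarrow> pval k s \<Longrightarrow> pval l (r / s)"
proof -
  assume "pval (k + l) r" "pval k s"
  then obtain a b c d where *: "\<not> int p dvd a" "\<not> int p dvd b" "r = of_nat p ^ (k + l) * of_int a / of_int b"
   "\<not> int p dvd c" "\<not> int p dvd d" "s = of_nat p ^ k * of_int c / of_int d" unfolding pval_def by blast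
  then have nz: "b \<noteq> 0" "c \<noteq> 0" "d \<noteq> 0" by auto
  have "r / s = of_nat p ^ l * of_int (a * d) / of_int (b * c)"
    using p_gt_0 nz unfolding * by (simp add: power_add field_simps)
  with * show ?thesis unfolding pval_def using not_dvd_mult by blast
qed

lemma pval_1: "pval 0 1"
  unfolding pval_def using prime_int_p by (intro exI[of _ 1]) (auto simp: not_prime_unit)

lemma pval_p: "pval 1 (of_nat p)"
  unfolding pval_def using prime_int_p by (intro exI[of _ 1]) (auto simp: not_prime_unit)

lemma pval_power: "pval k r \<Longrightarrow> pval (n * k) (r ^ n)"
  by (induction n) (auto simp: pval_1 pval_mult)

lemma pval_uminus: "pval k r \<Longrightarrow> pval k (- r)"
  unfolding pval_def by (metis dvd_minus_iff of_int_minus minus_divide_left mult_minus_right)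

lemma pint_add: "pint a \<Longrightarrow> pint b \<Longrightarrow> pint (a + b)"
proof -
  assume "pint a" "pint b"
  then obtain r s t u where *: "\<not> int p dvd s" "a = of_int r / of_int s" "\<not> int p dvd u" "b = of_int t / of_int u"
    unfolding pint_def by blast
  then have "s \<noteq> 0" "u \<noteq> 0" by auto
  then have "a + b = of_int (r * u + t * s) / of_int (s * u)" unfolding * by (simp add: field_simps)
  with * show ?thesis unfolding pint_def using not_dvd_mult by blast
qed

lemma pval_add_p_pint: "pval 0 r \<Longrightarrow> pint s \<Longrightarrow> pval 0 (r + of_nat p * s)"
proof -
  assume "pval 0 r" "pint s"
  then obtain a b c d where *: "\<not> int p dvd a" "\<not> int p dvd b" "r = of_int a / of_int b"
    "\<not> int p dvd d" "s = of_int c / of_int d" unfolding pval_def pint_def by auto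
  then have nz: "b \<noteq> 0" "d \<noteq> 0" by auto
  have "r + of_nat p * s = of_int (a * d + int p * (c * b)) / of_int (b * d)"
    unfolding * using nz by (simp add: field_simps)
  moreover have "\<not> int p dvd a * d + int p * (c * b)"
    using * not_dvd_mult[of a d] by (simp add: dvd_add_left_iff)
  ultimately have "r + of_nat p * s = of_nat p ^ 0 * of_int (a * d + int p * (c * b)) / of_int (b * d)"
    "\<not> int p dvd a * d + int p * (c * b)" "\<not> int p dvd b * d" using * not_dvd_mult[of b d] by simp_all
  then show ?thesis unfolding pval_def by blast
qed

lemma pval_of_nat: "n > 0 \<Longrightarrow> pval (multiplicity p n) (of_nat n)"
proof -
  assume n: "n > 0"
  obtain m where m: "n = p ^ multiplicity p n * m" "\<not> p dvd m"
    using multiplicity_decompose'[of n p] n prime_p by (metis not_prime_unit not_gr_zero)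
  have "(of_nat n :: rat) = of_nat p ^ multiplicity p n * of_int (int m) / of_int 1"
    by (subst m(1)) simp
  moreover have "\<not> int p dvd int m" using m(2) by simp
  moreover have "\<not> int p dvd 1" using prime_int_p not_prime_unit by blast
  ultimately show ?thesis unfolding pval_def by blast
qed

text \<open>Valuation zero forces the numerator at q = 1 to be prime to p, so the inverted fraction
  again has an admissible denominator.\<close>

lemma Loc_unit:
  assumes z: "z \<in> Loc p" and u: "pval 0 (ev z)"
  shows "inverse z \<in> Loc p" "z * inverse z = 1"
proof -
  obtain f g where fg: "z = Fract f g" "\<not> int p dvd poly g 1" "g \<noteq> 0" using z by (rule LocE)
  obtain a b where ab: "\<not> int p dvd a" "\<not> int p dvd b" "ev z = of_int a / of_int b" using u unfolding pval_def by auto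
  have nz: "b \<noteq> 0" "poly g 1 \<noteq> 0" using ab fg by auto
  have "(of_int (poly f 1) * of_int b :: rat) = of_int a * of_int (poly g 1)"
    using ab(3) nz unfolding fg(1) by (simp add: ev_Fract field_simps)
  then have "poly f 1 * b = a * poly g 1" by (metis of_int_mult of_int_eq_iff)
  then have "\<not> int p dvd poly f 1" using ab fg not_dvd_mult by (metis dvd_mult2)
  then have f: "\<not> int p dvd poly f 1" "f \<noteq> 0" by auto
  then show "inverse z \<in> Loc p" unfolding fg(1) by (simp add: LocI)
  have "z \<noteq> 0" unfolding fg(1) using f fg by (simp add: Zero_fract_def eq_fract)
  then show "z * inverse z = 1" by simp
qed

section \<open>The Frobenius lift on the localization\<close>

text \<open>The substitution of q^p for q, which is the Frobenius lift belonging to \<delta>(q) = 0.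
  It preserves values at q = 1.\<close>

definition phi :: "int poly fract \<Rightarrow> int poly fract" where
  "phi z = (THE w. \<exists>f g. z = Fract f g \<and> g \<noteq> 0 \<and> w = Fract (pcompose f (monom 1 p)) (pcompose g (monom 1 p)))"

lemma pcompose_nz: "g \<noteq> 0 \<Longrightarrow> pcompose g (monom 1 p :: int poly) \<noteq> 0"
  using p_gt_0 pcompose_eq_0[of g "monom 1 p"] by (auto simp: degree_monom_eq)

lemma phi_Fract:
  assumes "g \<noteq> 0" shows "phi (Fract f g) = Fract (pcompose f (monom 1 p)) (pcompose g (monom 1 p))"
  unfolding phi_def
proof (rule the_equality)
  fix w assume "\<exists>f' g'. Fract f g = Fract f' g' \<and> g' \<noteq> 0 \<and> w = Fract (pcompose f' (monom 1 p)) (pcompose g' (monom 1 p))"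
  then obtain f' g' where *: "Fract f g = Fract f' g'" "g' \<noteq> 0" "w = Fract (pcompose f' (monom 1 p)) (pcompose g' (monom 1 p))" by blast
  then have "f * g' = f' * g" using assms by (simp add: eq_fract)
  then have "pcompose f (monom 1 p) * pcompose g' (monom 1 p) = pcompose f' (monom 1 p) * pcompose g (monom 1 p)"
    by (metis pcompose_mult)
  then show "w = Fract (pcompose f (monom 1 p)) (pcompose g (monom 1 p))"
    using * assms pcompose_nz by (simp add: eq_fract)
qed (use assms in blast)

lemma poly_pcompose_1: "poly (pcompose f (monom 1 p)) (1::int) = poly f 1"
  by (simp add: poly_pcompose poly_monom)

lemma phi_closed [simp]: "z \<in> Loc p \<Longrightarrow> phi z \<in> Loc p"
  by (elim LocE) (auto simp: phi_Fract poly_pcompose_1 intro: LocI)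

lemma ev_phi [simp]: "z \<in> Loc p \<Longrightarrow> ev (phi z) = ev z"
  by (elim LocE) (auto simp: phi_Fract poly_pcompose_1 ev_Fract nz1)

lemma phi_hom: "phi \<in> ring_hom (Zq_loc p) (Zq_loc p)"
proof (rule ring_hom_memI)
  fix a b assume "a \<in> Loc p" "b \<in> Loc p"
  then show "phi (a \<otimes>\<^bsub>Zq_loc p\<^esub> b) = phi a \<otimes>\<^bsub>Zq_loc p\<^esub> phi b" "phi (a \<oplus>\<^bsub>Zq_loc p\<^esub> b) = phi a \<oplus>\<^bsub>Zq_loc p\<^esub> phi b"
    by (elim LocE, simp add: phi_Fract pcompose_nz pcompose_mult pcompose_add)+
qed (auto simp: One_fract_def phi_Fract)

definition frob_ok :: "int poly \<Rightarrow> bool" where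
  "frob_ok f \<longleftrightarrow> (\<exists>c. pcompose f (monom 1 p) = f ^ p + of_nat p * c)"

lemma frob_ok_add: "frob_ok f \<Longrightarrow> frob_ok g \<Longrightarrow> frob_ok (f + g)"
proof -
  assume "frob_ok f" "frob_ok g"
  then obtain c d where cd: "pcompose f (monom 1 p) = f ^ p + of_nat p * c" "pcompose g (monom 1 p) = g ^ p + of_nat p * d"
    unfolding frob_ok_def by blast
  have "(f + g) ^ p = f ^ p + g ^ p + of_nat p * cross p Zq f g"
    using Zq.power_sum_cross[OF prime_p, of f g] unfolding Zq_pow Zq_add_pow by (simp add: Zq_def)
  then have "pcompose (f + g) (monom 1 p) = (f + g) ^ p + of_nat p * (c + d - cross p Zq f g)"
    using cd by (simp add: pcompose_add algebra_simps)
  then show ?thesis unfolding frob_ok_def by blast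
qed

lemma frob_ok_mult: "frob_ok f \<Longrightarrow> frob_ok g \<Longrightarrow> frob_ok (f * g)"
proof -
  assume "frob_ok f" "frob_ok g"
  then obtain c d where cd: "pcompose f (monom 1 p) = f ^ p + of_nat p * c" "pcompose g (monom 1 p) = g ^ p + of_nat p * d"
    unfolding frob_ok_def by blast
  then have "pcompose (f * g) (monom 1 p) = (f * g) ^ p + of_nat p * (f ^ p * d + g ^ p * c + of_nat p * c * d)"
    by (simp add: pcompose_mult power_mult_distrib algebra_simps)
  then show ?thesis unfolding frob_ok_def by blast
qed

lemma frob_ok_1: "frob_ok 1" and frob_ok_0: "frob_ok 0" and frob_ok_q: "frob_ok [:0, 1:]"
  and frob_ok_m1: "frob_ok (- 1)"
proof -
  show "frob_ok 1" "frob_ok 0" unfolding frob_ok_def using p_gt_0 by (auto intro!: exI[of _ 0] simp: power_0_left)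
  show "frob_ok [:0, 1:]" unfolding frob_ok_def by (intro exI[of _ 0]) (simp add: pcompose_pCons monom_altdef)
  \<comment> \<open>For odd p one has (-1)^p = -1; for p = 2 the congruence is witnessed by -1 = 1 +
    2 (-1).\<close>
  have "(- 1 :: int poly) = (- 1) ^ p \<or> p = 2" using prime_p prime_odd_nat[of p] prime_ge_2_nat[of p] by fastforce
  then show "frob_ok (- 1)"
  proof
    assume "(- 1 :: int poly) = (- 1) ^ p"
    then show ?thesis unfolding frob_ok_def by (intro exI[of _ 0]) (simp add: pcompose_uminus)
  next
    assume "p = 2"
    then show ?thesis unfolding frob_ok_def by (intro exI[of _ "- 1"]) (simp add: pcompose_uminus)
  qed
qed

lemma frob_ok_const: "frob_ok [:a:]"
proof (induction a rule: int_induct[of _ 0])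
  case base
  then show ?case using frob_ok_0 by simp
next
  case (step1 i)
  then show ?case using frob_ok_add[OF _ frob_ok_1] by (metis add_pCons add_0 one_pCons)
next
  case (step2 i)
  have "[:i - 1:] = [:i:] + (- 1)" by (simp add: one_pCons)
  with step2 show ?case using frob_ok_add[OF _ frob_ok_m1] by metis
qed

lemma frob_ok_all: "frob_ok f"
proof (induction f)
  case 0
  then show ?case by (rule frob_ok_0)
next
  case (pCons a f)
  have "pCons a f = [:a:] + [:0, 1:] * f" by simp
  then show ?case using frob_ok_add[OF frob_ok_const frob_ok_mult[OF frob_ok_q pCons(2)]] by metis
qed

lemma phi_lift: "z \<in> Loc p \<Longrightarrow> \<exists>d\<in>Loc p. phi z = z ^ p + of_nat p * d"
proof -
  assume "z \<in> Loc p"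
  then obtain f g where fg: "z = Fract f g" "\<not> int p dvd poly g 1" "g \<noteq> 0" by (rule LocE)
  let ?m = "monom 1 p"
  obtain a b where ab: "pcompose f ?m = f ^ p + of_nat p * a" "pcompose g ?m = g ^ p + of_nat p * b"
    using frob_ok_all unfolding frob_ok_def by blast
  have nz: "pcompose g ?m \<noteq> 0" "g ^ p \<noteq> 0" using fg pcompose_nz by auto
  \<comment> \<open>This is (f(q^p)/g(q^p) - f^p/g^p)/p after inserting f(q^p) = f^p + p a and
    g(q^p) = g^p + p b.\<close>
  let ?d = "Fract (a * g ^ p - f ^ p * b) (pcompose g ?m * g ^ p)"
  have "?d \<in> Loc p" using fg by (intro LocI) (simp add: poly_pcompose_1 not_dvd_mult not_dvd_power)
  moreover have "pcompose f ?m * (g ^ p * (pcompose g ?m * g ^ p)) = (f ^ p * (pcompose g ?m * g ^ p) + of_nat p * (a * g ^ p - f ^ p * b) * g ^ p) * pcompose g ?m"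
    unfolding ab by (simp add: algebra_simps)
  then have "phi z = z ^ p + of_nat p * ?d"
    using nz fg by (simp add: phi_Fract Fract_power of_nat_Fract[of p] eq_fract)
  ultimately show ?thesis by blast
qed

definition dl :: "int poly fract \<Rightarrow> int poly fract" where
  "dl z = (SOME d. d \<in> Loc p \<and> phi z = z ^ p + of_nat p * d)"

lemma dl: "z \<in> Loc p \<Longrightarrow> dl z \<in> Loc p" "z \<in> Loc p \<Longrightarrow> phi z = z ^ p + of_nat p * dl z"
  using someI_ex[of "\<lambda>d. d \<in> Loc p \<and> phi z = z ^ p + of_nat p * d"] phi_lift[of z] unfolding dl_def by blast+

lemma of_nat_p_nz: "(of_nat p :: int poly fract) \<noteq> 0"
  using p_gt_0 by (simp add: of_nat_Fract Zero_fract_def eq_fract)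

sublocale L: delta_ring p "Zq_loc p" dl
  rewrites "\<zero>\<^bsub>Zq_loc p\<^esub> = 0" and "\<one>\<^bsub>Zq_loc p\<^esub> = 1" and "monoid.mult (Zq_loc p) = (*)" and "add (Zq_loc p) = (+)"
proof -
  show "delta_ring p (Zq_loc p) dl"
    by (rule delta_ring_of_frobenius_lift[OF Zq_loc_cring prime_p _ phi_hom])
       (use dl of_nat_p_nz in auto)
qed (simp_all add: Zq_loc_def)

lemma frob_eq_phi: "z \<in> Loc p \<Longrightarrow> L.frob z = phi z"
  by (simp add: L.frob_def dl)

lemma dl_q: "dl q_loc = 0"
proof -
  have "phi q_loc = q_loc ^ p"
    by (simp add: q_loc_def phi_Fract Fract_power pcompose_pCons monom_altdef)
  then show ?thesis using dl(2)[OF Loc_q] of_nat_p_nz by simp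
qed

lemma ev_dl: "z \<in> Loc p \<Longrightarrow> ev (dl z) = (ev z - ev z ^ p) / of_nat p"
proof -
  assume z: "z \<in> Loc p"
  have "ev z = ev z ^ p + of_nat p * ev (dl z)"
    using arg_cong[OF dl(2)[OF z], of ev] z dl(1)[OF z] by simp
  then show ?thesis using p_gt_0 by (simp add: field_simps)
qed

text \<open>The value \<delta>(q) = 0 fixes delta on all polynomials in q. Fractions follow by
  \<open>delta_compat_divide\<close>: for a denominator g, \<open>frob\<close> gives g(q^p), which
  has the same value at 1 as g and is therefore a unit.\<close>

lemma dl_compat:
  assumes C: "delta_ring p C \<delta>" and h: "h \<in> ring_hom (Zq_loc p) C" and hq: "\<delta> (h q_loc) = \<zero>\<^bsub>C\<^esub>"
    and z: "z \<in> Loc p"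
  shows "h (dl z) = \<delta> (h z)"
proof -
  interpret C: delta_ring p C \<delta> by (rule C)
  interpret h: ring_hom_cring "Zq_loc p" C h by unfold_locales (rule h)
  define ok where "ok w \<longleftrightarrow> w \<in> Loc p \<and> h (dl w) = \<delta> (h w)" for w
  note A = delta_compat_add_mult[OF L.delta_ring_axioms C h, simplified]
  have h0: "h 0 = \<zero>\<^bsub>C\<^esub>" "h 1 = \<one>\<^bsub>C\<^esub>" using h.hom_zero h.hom_one by simp_all
  have ok_add: "ok (a + b)" if "ok a" "ok b" for a b using that A(1)[of a b] by (auto simp: ok_def)
  have ok_mult: "ok (a * b)" if "ok a" "ok b" for a b using that A(2)[of a b] by (auto simp: ok_def)
  have ok_0: "ok 0" using L.delta_zero C.delta_zero h0 by (auto simp: ok_def)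
  have ok_1: "ok 1" using L.delta_one C.delta_one h0 by (auto simp: ok_def)
  have ok_q: "ok q_loc" using dl_q hq h0 by (auto simp: ok_def)
  have ok_m1: "ok (- 1)"
    using delta_compat_cancel[OF L.delta_ring_axioms C h, of 1 "- 1"] ok_0 ok_1 by (auto simp: ok_def)
  have ok_int: "ok (Fract [:a:] 1)" for a
  proof (induction a rule: int_induct[of _ 0])
    case base
    then show ?case using ok_0 by (simp add: Zero_fract_def)
  next
    case (step1 i)
    have "Fract [:i + 1:] 1 = Fract [:i:] 1 + 1" by (simp add: One_fract_def one_pCons)
    with step1 show ?case using ok_add ok_1 by metis
  next
    case (step2 i)
    have "Fract [:i - 1:] 1 = Fract [:i:] 1 + - 1" by (simp add: One_fract_def one_pCons)
    with step2 show ?case using ok_add ok_m1 by metis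
  qed
  have ok_poly: "ok (Fract f 1)" for f
  proof (induction f)
    case 0
    then show ?case using ok_0 by (simp add: Zero_fract_def)
  next
    case (pCons a f)
    have "Fract (pCons a f) 1 = Fract [:a:] 1 + q_loc * Fract f 1" by (simp add: q_loc_def)
    then show ?case using ok_add[OF ok_int ok_mult[OF ok_q pCons(2)]] by metis
  qed
  obtain f g where fg: "z = Fract f g" "\<not> int p dvd poly g 1" "g \<noteq> 0" using z by (rule LocE)
  let ?g = "Fract g 1"
  have g: "?g \<in> Loc p" by (rule Loc_Fract1)
  have "?g * z = Fract f 1" unfolding fg(1) using fg(3) by (simp add: eq_fract)
  then have "ok (?g * z)" using ok_poly by simp
  moreover have "pval 0 (ev (phi ?g))"
    using fg(2) prime_int_p not_prime_unit unfolding ev_phi[OF g] pval_def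
    by (intro exI[of _ "poly g 1"] exI[of _ 1]) (auto simp: ev_Fract)
  then have "inverse (phi ?g) \<in> Loc p" "phi ?g * inverse (phi ?g) = 1" using Loc_unit[OF phi_closed[OF g]] by auto
  ultimately show ?thesis
    using delta_compat_divide[OF L.delta_ring_axioms C h g z] ok_poly[of g] frob_eq_phi[OF g] by (simp add: ok_def)
qed

end

section \<open>Digit monomials\<close>

text \<open>For \<open>n = \<Sum> n\<^sub>j p\<^sup>j\<close> in base \<open>p\<close>, this is the product of the powers of \<open>z\<^sub>j\<close> with exponents \<open>n\<^sub>j\<close>.\<close>

function dmon :: "nat \<Rightarrow> ('d, 'm) ring_scheme \<Rightarrow> (nat \<Rightarrow> 'd) \<Rightarrow> nat \<Rightarrow> 'd" where
  "dmon p D z n = (if n = 0 \<or> p = 0 then \<one>\<^bsub>D\<^esub>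
     else z (multiplicity p n) \<otimes>\<^bsub>D\<^esub> dmon p D z (n - p ^ multiplicity p n))"
  by auto
termination by (relation "measure (\<lambda>(p, D, z, n). n)") auto

declare dmon.simps [simp del]

text \<open>The recursion exposes the term of highest index, on which the triangularity arguments
  proceed.\<close>

primrec dcomb :: "('d, 'm) ring_scheme \<Rightarrow> ('a \<Rightarrow> 'd) \<Rightarrow> (nat \<Rightarrow> 'd) \<Rightarrow> (nat \<Rightarrow> 'a) \<Rightarrow> nat \<Rightarrow> 'd" where
  "dcomb D \<kappa> M a 0 = \<zero>\<^bsub>D\<^esub>"
| "dcomb D \<kappa> M a (Suc N) = dcomb D \<kappa> M a N \<oplus>\<^bsub>D\<^esub> \<kappa> (a N) \<otimes>\<^bsub>D\<^esub> M N"

context q_loc_prime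
begin

abbreviation "vp \<equiv> multiplicity p"

definition fq :: "int poly fract" where "fq = q_number (Zq_loc p) q_loc p"

lemma fq_closed [simp]: "fq \<in> Loc p"
  unfolding fq_def by (rule L.q_number_closed) simp

lemma ev_fq: "ev fq = of_nat p"
proof -
  have "q_number (Zq_loc p) q_loc n \<in> Loc p \<and> ev (q_number (Zq_loc p) q_loc n) = of_nat n" for n
    unfolding q_number_def
  proof (induction n)
    case (Suc n)
    have "(\<Oplus>\<^bsub>Zq_loc p\<^esub>i\<in>{..<Suc n}. q_loc [^]\<^bsub>Zq_loc p\<^esub> i) = q_loc ^ n + (\<Oplus>\<^bsub>Zq_loc p\<^esub>i\<in>{..<n}. q_loc [^]\<^bsub>Zq_loc p\<^esub> i)"
      by (simp add: lessThan_Suc)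
    then show ?case using Suc by simp
  qed simp
  then show ?thesis unfolding fq_def by blast
qed

lemma pint_mult: "pint a \<Longrightarrow> pint b \<Longrightarrow> pint (a * b)"
proof -
  assume "pint a" "pint b"
  then obtain r s t u where *: "\<not> int p dvd s" "a = of_int r / of_int s" "\<not> int p dvd u" "b = of_int t / of_int u"
    unfolding pint_def by blast
  then have "a * b = of_int (r * t) / of_int (s * u)" by simp
  with * show ?thesis unfolding pint_def using not_dvd_mult by blast
qed

lemma pint_of_int: "pint (of_int a)"
  unfolding pint_def using prime_int_p not_prime_unit by (intro exI[of _ a] exI[of _ 1]) auto

lemma pint_1: "pint 1"
  using pint_of_int[of 1] by simp

lemma pint_uminus: "pint a \<Longrightarrow> pint (- a)"
  using pint_mult[OF pint_of_int[of "-1"]] by simp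

lemma pint_power: "pint a \<Longrightarrow> pint (a ^ n)"
  by (induction n) (auto simp: pint_1 pint_mult)

lemma pval_pint: "pval 0 a \<Longrightarrow> pint a"
  unfolding pval_def pint_def by auto

lemma pval_SucE: "pval 1 r \<Longrightarrow> \<exists>s. pval 0 s \<and> r = of_nat p * s"
  unfolding pval_def by force

lemma vp_power_dvd: "p ^ vp n dvd n" by (rule multiplicity_dvd)

lemma not_unit_p: "\<not> is_unit p" using prime_p not_prime_unit by blast

lemma vp_eqI: "p ^ j dvd n \<Longrightarrow> \<not> p ^ Suc j dvd n \<Longrightarrow> vp n = j"
  by (rule multiplicity_eqI)

lemma vp_dvd_iff: "n > 0 \<Longrightarrow> p ^ j dvd n \<longleftrightarrow> j \<le> vp n"
  using power_dvd_iff_le_multiplicity[of n p j] not_unit_p by auto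

lemma vp_le: "n > 0 \<Longrightarrow> p ^ vp n \<le> n"
  using vp_power_dvd dvd_imp_le by blast

lemma vp_pow: "vp (p ^ j) = j"
  using prime_p by (simp add: multiplicity_same_power not_unit_p)

lemma vp_add: "vp m < k \<Longrightarrow> m > 0 \<Longrightarrow> p ^ k dvd n \<Longrightarrow> vp (m + n) = vp m"
proof -
  assume m: "vp m < k" "m > 0" "p ^ k dvd n"
  have d: "p ^ Suc (vp m) dvd n" using m dvd_trans[OF le_imp_power_dvd[of "Suc (vp m)" k p]] by simp
  show ?thesis
  proof (rule vp_eqI)
    show "p ^ vp m dvd m + n" using d vp_power_dvd power_le_dvd[OF d, of "vp m"] by simp
    show "\<not> p ^ Suc (vp m) dvd m + n"
    proof
      assume "p ^ Suc (vp m) dvd m + n"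
      then have "p ^ Suc (vp m) dvd m" using d by (simp add: dvd_add_left_iff)
      then show False using vp_dvd_iff[OF m(2)] by (simp del: power_Suc)
    qed
  qed
qed

end

section \<open>The filtration by digit monomials\<close>

text \<open>A common setting for two rings: D = A<omega> with Z = \<omega>, and the product of
  A<omega> with a test ring, with Z = (\<omega>, w). What is known about Z is that x + (p)_q Z has
  rank one.\<close>

locale rank_one_lift = q_loc_prime p + delta_ring p D \<delta>
  for p and D (structure) and \<delta> +
  fixes A and \<delta>A and \<theta> and \<kappa> and x and Z
  assumes A_delta_ring: "delta_ring p A \<delta>A"
    and \<theta>: "delta_hom (Zq_loc p) dl A \<delta>A \<theta>"
    and \<kappa>: "delta_hom A \<delta>A D \<delta> \<kappa>"
    and x: "x \<in> carrier A" "\<delta>A x = \<zero>\<^bsub>A\<^esub>"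
    and Z: "Z \<in> carrier D" "\<delta> (\<kappa> x \<oplus> \<kappa> (\<theta> fq) \<otimes> Z) = \<zero>"
begin

sublocale A: delta_ring p A \<delta>A by (rule A_delta_ring)
sublocale \<kappa>: ring_hom_cring A D \<kappa>
  using \<kappa> unfolding delta_hom_def by unfold_locales blast
sublocale \<theta>: ring_hom_cring "Zq_loc p" A \<theta>
  using \<theta> unfolding delta_hom_def by unfold_locales blast

definition "\<iota> c = \<kappa> (\<theta> c)"

lemma \<iota>_closed [simp]: "c \<in> Loc p \<Longrightarrow> \<iota> c \<in> carrier D"
  and \<iota>_add: "c \<in> Loc p \<Longrightarrow> d \<in> Loc p \<Longrightarrow> \<iota> (c + d) = \<iota> c \<oplus> \<iota> d"
  and \<iota>_mult: "c \<in> Loc p \<Longrightarrow> d \<in> Loc p \<Longrightarrow> \<iota> (c * d) = \<iota> c \<otimes> \<iota> d"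
  and \<iota>_1: "\<iota> 1 = \<one>"
  using \<theta>.hom_closed \<theta>.hom_add[of c d] \<theta>.hom_mult[of c d] \<theta>.hom_one by (simp_all add: \<iota>_def)

lemma \<iota>_neg: "c \<in> Loc p \<Longrightarrow> \<iota> (- c) = \<ominus> \<iota> c"
  using \<theta>.hom_a_inv[of c] by (simp add: \<iota>_def)

lemma \<iota>_pow: "c \<in> Loc p \<Longrightarrow> \<iota> (c ^ n) = \<iota> c [^] n"
  using \<theta>.hom_pow[of c n] by (simp add: \<iota>_def)

lemma \<iota>_of_nat: "\<iota> (of_nat n) = add_pow D n \<one>"
  using \<theta>.hom_add_pow[of 1 n] \<theta>.hom_one by (simp add: \<iota>_def \<kappa>.hom_add_pow)

lemma \<iota>_delta: "c \<in> Loc p \<Longrightarrow> \<delta> (\<iota> c) = \<iota> (dl c)"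
  using \<theta> \<kappa> by (simp add: \<iota>_def delta_hom_def)

lemma \<iota>_frob: "c \<in> Loc p \<Longrightarrow> frob (\<iota> c) = \<iota> (phi c)"
  using dl[of c]
  by (simp add: frob_def \<iota>_delta \<iota>_add \<iota>_mult \<iota>_pow \<iota>_of_nat add_pow_eq_mult[of "\<iota> (dl c)"])

definition "Zs j = (\<delta> ^^ j) Z"

lemma Zs_closed [simp]: "Zs j \<in> carrier D"
  by (induction j) (auto simp: Zs_def Z delta_closed)

lemma delta_Zs [simp]: "\<delta> (Zs j) = Zs (Suc j)"
  by (simp add: Zs_def)

definition "M n = dmon p D Zs n"

lemma M_0 [simp]: "M 0 = \<one>"
  by (simp add: M_def dmon.simps)

lemma M_rec: "n > 0 \<Longrightarrow> M n = Zs (vp n) \<otimes> M (n - p ^ vp n)"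
  unfolding M_def using p_gt_0 by (subst dmon.simps) simp

lemma M_closed [simp]: "M n \<in> carrier D"
proof (induction n rule: less_induct)
  case (less n)
  show ?case
  proof (cases "n = 0")
    case False
    then show ?thesis using less[of "n - p ^ vp n"] p_gt_0 by (simp add: M_rec)
  qed simp
qed

lemma M_add: "vp (n + p ^ j) = j \<Longrightarrow> M (n + p ^ j) = Zs j \<otimes> M n"
  using M_rec[of "n + p ^ j"] p_gt_0 by simp

lemma M_pow: "M (p ^ j) = Zs j"
  using M_add[of 0 j] by (simp add: vp_pow)

text \<open>The digits of m lie below position k and those of n at or above it, so nothing is
  carried. The induction removes the lowest digit of m, whose position is also the valuation of m +
  n.\<close>

lemma M_low: "p ^ k dvd n \<Longrightarrow> m < p ^ k \<Longrightarrow> M m \<otimes> M n = M (m + n)"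
proof (induction m rule: less_induct)
  case (less m)
  show ?case
  proof (cases "m = 0")
    case False
    then have m: "m > 0" by simp
    have "p ^ vp m < p ^ k" using vp_le[OF m] less.prems by simp
    then have v: "vp m < k" by (metis not_less p_gt_0 power_increasing Suc_leI One_nat_def)
    have le: "p ^ vp m \<le> m" using vp_le[OF m] .
    have "M m \<otimes> M n = Zs (vp m) \<otimes> (M (m - p ^ vp m) \<otimes> M n)" by (simp add: M_rec[OF m] m_assoc)
    also have "\<dots> = Zs (vp m) \<otimes> M (m - p ^ vp m + n)"
      using less m p_gt_0 by simp
    also have "m - p ^ vp m + n = (m + n) - p ^ vp m" using le by simp
    also have "Zs (vp m) \<otimes> M ((m + n) - p ^ vp m) = M (m + n)"
      using M_rec[of "m + n"] m vp_add[OF v m less.prems(1)] by simp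
    finally show ?thesis .
  qed simp
qed

text \<open>The digit of n at position j is zero, so up to p - 1 factors Z_j can be inserted without
  a carry.\<close>

lemma M_digit: "p ^ Suc j dvd n \<Longrightarrow> i < p \<Longrightarrow> M (i * p ^ j + n) = Zs j [^] i \<otimes> M n"
proof (induction i)
  case (Suc i)
  have "vp (Suc i * p ^ j + n) = j"
  proof (rule vp_eqI)
    show "p ^ j dvd Suc i * p ^ j + n" using power_le_dvd[OF Suc(2), of j] by (simp add: dvd_add)
    show "\<not> p ^ Suc j dvd Suc i * p ^ j + n"
    proof
      assume "p ^ Suc j dvd Suc i * p ^ j + n"
      then have "p ^ Suc j dvd Suc i * p ^ j" using Suc(2) by (simp add: dvd_add_left_iff)
      then have "p dvd Suc i" using p_gt_0 dvd_times_right_cancel_iff[of "p ^ j" p "Suc i"] by (simp del: mult_Suc)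
      then show False using Suc.prems(2) by (meson dvd_imp_le not_less zero_less_Suc)
    qed
  qed
  then have "M (i * p ^ j + n + p ^ j) = Zs j \<otimes> M (i * p ^ j + n)"
    by (intro M_add) (simp add: algebra_simps)
  then show ?case using Suc by (simp add: algebra_simps m_ac)
qed simp

text \<open>A filtration and not a grading, since the digit monomials may be dependent in D. Index
  at most n is \<open>F (Suc n)\<close>, so a congruence modulo terms below index n is one modulo
  \<open>F n\<close>.\<close>

definition F :: "nat \<Rightarrow> 'a set" where
  "F N = {dcomb D \<kappa> M a N | a. \<forall>n. a n \<in> carrier A}"

lemma dcomb_closed [simp]: "(\<And>n. a n \<in> carrier A) \<Longrightarrow> dcomb D \<kappa> M a N \<in> carrier D"
  by (induction N) auto

lemma F_carrier: "y \<in> F N \<Longrightarrow> y \<in> carrier D"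
  unfolding F_def using dcomb_closed by blast

lemma dcomb_add:
  "(\<And>n. a n \<in> carrier A) \<Longrightarrow> (\<And>n. b n \<in> carrier A) \<Longrightarrow>
    dcomb D \<kappa> M (\<lambda>n. a n \<oplus>\<^bsub>A\<^esub> b n) N = dcomb D \<kappa> M a N \<oplus> dcomb D \<kappa> M b N"
  by (induction N) (auto simp: l_distr a_ac)

lemma dcomb_scal:
  "(\<And>n. a n \<in> carrier A) \<Longrightarrow> c \<in> carrier A \<Longrightarrow>
    dcomb D \<kappa> M (\<lambda>n. c \<otimes>\<^bsub>A\<^esub> a n) N = \<kappa> c \<otimes> dcomb D \<kappa> M a N"
  by (induction N) (auto simp: r_distr m_assoc)

lemma dcomb_zero: "(\<And>n. n < N \<Longrightarrow> a n = \<zero>\<^bsub>A\<^esub>) \<Longrightarrow> dcomb D \<kappa> M a N = \<zero>"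
  by (induction N) auto

lemma dcomb_extend:
  "(\<And>n. a n \<in> carrier A) \<Longrightarrow> m \<le> N \<Longrightarrow> dcomb D \<kappa> M (\<lambda>n. if n < m then a n else \<zero>\<^bsub>A\<^esub>) N = dcomb D \<kappa> M a m"
proof (induction N arbitrary: m)
  case (Suc N)
  show ?case
  proof (cases "m = Suc N")
    case True
    have "dcomb D \<kappa> M (\<lambda>n. if n < Suc N then a n else \<zero>\<^bsub>A\<^esub>) k = dcomb D \<kappa> M a k" if "k \<le> Suc N" for k
      using that by (induction k) auto
    with True show ?thesis by blast
  next
    case False
    then show ?thesis using Suc by simp
  qed
qed simp

lemma F_zero [simp]: "\<zero> \<in> F N"
  unfolding F_def using dcomb_zero[of N "\<lambda>_. \<zero>\<^bsub>A\<^esub>"] by (force intro: sym)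

lemma F_add: "y \<in> F N \<Longrightarrow> z \<in> F N \<Longrightarrow> y \<oplus> z \<in> F N"
  unfolding F_def using dcomb_add[symmetric] by fastforce

lemma F_scal: "y \<in> F N \<Longrightarrow> c \<in> carrier A \<Longrightarrow> \<kappa> c \<otimes> y \<in> F N"
  unfolding F_def using dcomb_scal[symmetric] by fastforce

lemma F_neg: "y \<in> F N \<Longrightarrow> \<ominus> y \<in> F N"
  using F_scal[of y N "\<ominus>\<^bsub>A\<^esub> \<one>\<^bsub>A\<^esub>"] F_carrier[of y N] by (simp add: l_minus)

lemma F_diff: "y \<in> F N \<Longrightarrow> z \<in> F N \<Longrightarrow> y \<ominus> z \<in> F N"
  unfolding minus_eq by (intro F_add F_neg)

lemma F_mono: "y \<in> F m \<Longrightarrow> m \<le> N \<Longrightarrow> y \<in> F N"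
proof -
  assume "y \<in> F m" "m \<le> N"
  then obtain a where a: "y = dcomb D \<kappa> M a m" "\<forall>n. a n \<in> carrier A" unfolding F_def by blast
  then have "y = dcomb D \<kappa> M (\<lambda>n. if n < m then a n else \<zero>\<^bsub>A\<^esub>) N"
    using dcomb_extend[of a m N] \<open>m \<le> N\<close> by simp
  moreover have "\<forall>n. (if n < m then a n else \<zero>\<^bsub>A\<^esub>) \<in> carrier A" using a by simp
  ultimately show ?thesis unfolding F_def by blast
qed

lemma F_0: "y \<in> F 0 \<Longrightarrow> y = \<zero>"
  unfolding F_def by auto

lemma F_M: "m < N \<Longrightarrow> M m \<in> F N"
proof -
  assume "m < N"
  let ?a = "\<lambda>n. if n = m then \<one>\<^bsub>A\<^esub> else \<zero>\<^bsub>A\<^esub>"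
  have "M m = dcomb D \<kappa> M ?a (Suc m)" using dcomb_zero[of m ?a] by simp
  moreover have "\<forall>n. ?a n \<in> carrier A" by simp
  ultimately have "M m \<in> F (Suc m)" unfolding F_def by blast
  then show ?thesis using F_mono \<open>m < N\<close> by simp
qed

lemma F_subgroup: "additive_subgroup (F N) D"
proof (rule additive_subgroup.intro, rule add.subgroupI)
  show "F N \<subseteq> carrier D" using F_carrier by blast
  show "F N \<noteq> {}" using F_zero by blast
qed (use F_add F_neg in auto)

lemma F_induct [consumes 1, case_names zero add gen]:
  assumes "y \<in> F N" and "Q \<zero>"
    and "\<And>y z. y \<in> F N \<Longrightarrow> z \<in> F N \<Longrightarrow> Q y \<Longrightarrow> Q z \<Longrightarrow> Q (y \<oplus> z)"
    and "\<And>c m. c \<in> carrier A \<Longrightarrow> m < N \<Longrightarrow> Q (\<kappa> c \<otimes> M m)"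
  shows "Q y"
proof -
  obtain a where a: "y = dcomb D \<kappa> M a N" "\<And>n. a n \<in> carrier A" using assms(1) unfolding F_def by blast
  have "dcomb D \<kappa> M a k \<in> F N \<and> Q (dcomb D \<kappa> M a k)" if "k \<le> N" for k
    using that
  proof (induction k)
    case (Suc k)
    then show ?case using assms(3)[of "dcomb D \<kappa> M a k" "\<kappa> (a k) \<otimes> M k"] assms(4)[of "a k" k] a F_add F_scal F_M by simp
  qed (use assms in simp)
  with a show ?thesis by simp
qed

lemma F_\<iota>: "y \<in> F N \<Longrightarrow> c \<in> Loc p \<Longrightarrow> \<iota> c \<otimes> y \<in> F N"
  unfolding \<iota>_def by (intro F_scal \<theta>.hom_closed)

lemma F_add_pow: "y \<in> F N \<Longrightarrow> add_pow D (n::nat) y \<in> F N"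
  using add_pow_mem[OF F_subgroup] .

text \<open>The relation, modulo lower terms, that expresses \<open>Z\<^sub>j\<^sup>p\<close> by \<open>Z\<^sub>j\<^sub>+\<^sub>1\<close>.\<close>

definition Rel :: "nat \<Rightarrow> bool" where
  "Rel j \<longleftrightarrow> (\<exists>c\<in>Loc p. pval 1 (ev c) \<and> Zs j [^] p \<ominus> \<iota> c \<otimes> Zs (Suc j) \<in> F (p ^ Suc j))"

lemma of_cong:
  assumes "a \<ominus> a' \<in> F s" "a' \<in> F (Suc s)" "a \<in> carrier D"
  shows "a \<in> F (Suc s)"
proof -
  have "a = (a \<ominus> a') \<oplus> a'" using assms F_carrier by (simp add: diff_add_cancel)
  then show ?thesis using assms F_mono[of _ s "Suc s"] F_add by (metis le_SucI order_refl)
qed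

lemma Rel_imp: "Rel j \<Longrightarrow> Zs j [^] p \<in> F (Suc (p ^ Suc j))"
proof -
  assume "Rel j"
  then obtain c where c: "c \<in> Loc p" "Zs j [^] p \<ominus> \<iota> c \<otimes> Zs (Suc j) \<in> F (p ^ Suc j)" unfolding Rel_def by blast
  have "\<iota> c \<otimes> Zs (Suc j) \<in> F (Suc (p ^ Suc j))" using F_\<iota>[OF F_M[of "p ^ Suc j"] c(1)] M_pow[of "Suc j"] by simp
  with c(2) show ?thesis by (rule of_cong) simp
qed

section \<open>Products and delta in the filtration, up to a bounded index\<close>

context
  fixes Nmax :: nat
  assumes rel: "\<And>i. p ^ Suc i \<le> Nmax \<Longrightarrow> Rel i"
begin

text \<open>The bound \<open>Nmax\<close> is there because the relations are themselves proved by
  induction, and an estimate may use only those already known. The argument is addition with carry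
  in base p: the factor Z_i fits into the expansion of the total index, or a lower digit is set
  aside, or p equal factors are completed and the relation replaces them by Z_(i+1) and lower
  terms.\<close>

lemma Zs_M_mem: "n + p ^ j \<le> Nmax \<Longrightarrow> Zs j \<otimes> M n \<in> F (Suc (n + p ^ j))"
proof (induction "n + p ^ j" arbitrary: n j rule: less_induct)
  case less
  define N where "N = n + p ^ j"
  have IH1: "Zs i \<otimes> M m \<in> F (Suc N)" if "m + p ^ i < N" for m i
    using less(1)[of m i] that less.prems F_mono unfolding N_def by simp
  have "Zs i \<otimes> M m \<in> F (Suc N)" if "m + p ^ i = N" for m i
    using that
  \<comment> \<open>Inner induction at a fixed total index N: a carry keeps N and raises i, and i <
    N makes this terminate.\<close>
  proof (induction "N - i" arbitrary: i m rule: less_induct)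
    case inner: less
    have iN: "i < N" using inner(2) less_exp[of i] p_gt_0 power_gt_expt[of p i] prime_ge_2_nat[OF prime_p] by linarith
    have N0: "N > 0" using iN by simp
    consider "vp N = i" | "vp N < i" | "vp N > i" by linarith
    then show ?case
    proof cases
      case 1
      then have "Zs i \<otimes> M m = M N" using M_add[of m i] inner(2) by simp
      then show ?thesis using F_M by simp
    next
      \<comment> \<open>The lowest digit of m sits at a position v below i. Without it the total
        index drops and the outer induction applies; putting Z_v back gives index at most N, and in
        the case of equality exactly the digit monomial of N.\<close>
      case 2
      define v where "v = vp N"
      have m0: "m > 0" using 2 inner(2) vp_pow[of i] by (metis add_0 less_irrefl gr0I)
      have vm: "vp m = v"
      proof -
        have "p ^ Suc v dvd p ^ i" using 2 by (intro le_imp_power_dvd) (simp add: v_def)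
        moreover have "p ^ v dvd N" "\<not> p ^ Suc v dvd N" using vp_dvd_iff[OF N0] by (simp_all add: v_def del: power_Suc)
        ultimately have "p ^ v dvd m" "\<not> p ^ Suc v dvd m"
          unfolding inner(2)[symmetric] using power_le_dvd[of p "Suc v" "p ^ i" v]
          by (auto simp: dvd_add_left_iff dvd_add_right_iff simp del: power_Suc)
        then show ?thesis by (rule vp_eqI)
      qed
      have le: "p ^ v \<le> m" using vp_le[OF m0] vm by simp
      have pv: "p ^ v > 0" using p_gt_0 by simp
      have "Zs i \<otimes> M (m - p ^ v) \<in> F (Suc (m - p ^ v + p ^ i))"
      proof (rule less(1))
        show "m - p ^ v + p ^ i < n + p ^ j" "m - p ^ v + p ^ i \<le> Nmax"
          using less.prems inner(2) le pv unfolding N_def by linarith+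
      qed
      then have "Zs v \<otimes> (Zs i \<otimes> M (m - p ^ v)) \<in> F (Suc N)"
      proof (induction rule: F_induct)
        case (add y z)
        then show ?case using F_add F_carrier by (simp add: r_distr)
      next
        case (gen c k)
        have eq: "Zs v \<otimes> (\<kappa> c \<otimes> M k) = \<kappa> c \<otimes> (Zs v \<otimes> M k)" using gen by (simp add: m_lcomm)
        have "k + p ^ v \<le> N" using gen(2) inner(2) le by simp
        then have "Zs v \<otimes> M k \<in> F (Suc N)"
        proof (cases "k + p ^ v = N")
          case True
          then have "Zs v \<otimes> M k = M N" using M_add[of k v] v_def by simp
          then show ?thesis using F_M by simp
        qed (use IH1 in simp)
        then show ?case unfolding eq using gen F_scal by blast
      qed simp
      moreover have "Zs i \<otimes> M m = Zs v \<otimes> (Zs i \<otimes> M (m - p ^ v))"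
        using M_rec[OF m0] vm by (simp add: m_lcomm)
      ultimately show ?thesis by simp
    next
      \<comment> \<open>Since p^(i+1) divides m + p^i, the number m has digit p - 1 at position i
        and zeros below. The factor Z_i completes the power Z_i^p.\<close>
      case 3
      define n' where "n' = N - p ^ Suc i"
      have dvd: "p ^ Suc i dvd N" using 3 vp_dvd_iff[OF N0, of "Suc i"] by (simp del: power_Suc)
      then have le: "p ^ Suc i \<le> N" using N0 dvd_imp_le by blast
      have n': "p ^ Suc i dvd n'" "n' + p ^ Suc i = N" using dvd le by (auto simp: n'_def)
      have m: "m = (p - 1) * p ^ i + n'" using n'(2) inner(2) p_gt_0 by (cases p) auto
      have "M m = Zs i [^] (p - 1) \<otimes> M n'" unfolding m using n'(1) p_gt_0 by (intro M_digit) auto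
      moreover have "Zs i [^] p = Zs i [^] (p - 1) \<otimes> Zs i" using nat_pow_Suc[of "Zs i" "p - 1"] p_gt_0 by simp
      ultimately have eq: "Zs i \<otimes> M m = Zs i [^] p \<otimes> M n'" by (simp add: m_ac)
      have "Zs i [^] p \<in> F (Suc (p ^ Suc i))" using rel le less.prems N_def Rel_imp by simp
      then have "Zs i [^] p \<otimes> M n' \<in> F (Suc N)"
      proof (induction rule: F_induct)
        case (add y z)
        then show ?case using F_add F_carrier by (simp add: l_distr)
      next
        case (gen c k)
        have "M k \<otimes> M n' \<in> F (Suc N)"
        proof (cases "k = p ^ Suc i")
          case True
          then have "M k \<otimes> M n' = Zs (Suc i) \<otimes> M n'" using M_pow[of "Suc i"] by simp
          then show ?thesis using inner(1)[of "Suc i" n'] iN n'(2) by simp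
        next
          case False
          then have "k < p ^ Suc i" using gen by simp
          then show ?thesis using M_low[OF n'(1), of k] F_M n'(2) by simp
        qed
        then show ?case using gen F_scal by (simp add: m_assoc)
      qed simp
      then show ?thesis using eq by simp
    qed
  qed
  then show ?case unfolding N_def by blast
qed

lemma M_M_mem: "m + n \<le> Nmax \<Longrightarrow> M m \<otimes> M n \<in> F (Suc (m + n))"
proof (induction m rule: less_induct)
  case (less m)
  show ?case
  proof (cases "m = 0")
    case True
    then show ?thesis using F_M by simp
  next
    case False
    then have m: "m > 0" by simp
    define v where "v = vp m"
    have le: "p ^ v \<le> m" "p ^ v > 0" using vp_le[OF m] p_gt_0 v_def by auto
    have "M (m - p ^ v) \<otimes> M n \<in> F (Suc (m - p ^ v + n))" using less(1)[of "m - p ^ v"] less.prems le m by simp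
    then have "Zs v \<otimes> (M (m - p ^ v) \<otimes> M n) \<in> F (Suc (m + n))"
    proof (induction rule: F_induct)
      case (add y z)
      then show ?case using F_add F_carrier by (simp add: r_distr)
    next
      case (gen c k)
      have eq: "Zs v \<otimes> (\<kappa> c \<otimes> M k) = \<kappa> c \<otimes> (Zs v \<otimes> M k)" using gen by (simp add: m_lcomm)
      have "Zs v \<otimes> M k \<in> F (Suc (k + p ^ v))" using gen less.prems le by (intro Zs_M_mem) simp
      then have "Zs v \<otimes> M k \<in> F (Suc (m + n))" by (rule F_mono) (use gen le in simp)
      then show ?case unfolding eq using gen F_scal by blast
    qed simp
    then show ?thesis using M_rec[OF m] by (simp add: m_assoc v_def)
  qed
qed

lemma F_mult: "y \<in> F (Suc m) \<Longrightarrow> z \<in> F (Suc n) \<Longrightarrow> m + n \<le> Nmax \<Longrightarrow> y \<otimes> z \<in> F (Suc (m + n))"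
proof (induction rule: F_induct)
  case zero
  then show ?case using F_carrier by simp
next
  case (add y y')
  then show ?case using F_add F_carrier[of z] F_carrier by (simp add: l_distr)
next
  case (gen c k)
  from gen(3,4,1,2) have "M k \<otimes> z \<in> F (Suc (m + n))"
  proof (induction rule: F_induct)
    case (add y y')
    then show ?case using F_add F_carrier by (simp add: r_distr)
  next
    case gen2: (gen d l)
    have "M k \<otimes> M l \<in> F (Suc (k + l))" using gen2 by (intro M_M_mem) simp
    then have "M k \<otimes> M l \<in> F (Suc (m + n))" by (rule F_mono) (use gen2 in simp)
    then show ?case using gen2 F_scal by (simp add: m_lcomm)
  qed simp
  then show ?case using gen F_scal F_carrier[of z] by (simp add: m_assoc)
qed

text \<open>One factor has index strictly below m, so the total index is at most m + n - 1 and the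
  bound may exceed \<open>Nmax\<close> by one.\<close>

lemma F_mult_strict: "y \<in> F m \<Longrightarrow> z \<in> F (Suc n) \<Longrightarrow> m + n \<le> Suc Nmax \<Longrightarrow> y \<otimes> z \<in> F (m + n)"
proof (cases m)
  case 0
  assume "y \<in> F m" "z \<in> F (Suc n)"
  then have "y = \<zero>" "z \<in> carrier D" using 0 F_0 F_carrier by auto
  then show ?thesis by simp
qed (use F_mult in simp)

lemma F_pow: "y \<in> F (Suc m) \<Longrightarrow> k * m \<le> Nmax \<Longrightarrow> y [^] k \<in> F (Suc (k * m))"
proof (induction k)
  case 0
  then show ?case using F_M[of 0 1] by simp
next
  case (Suc k)
  then have "y [^] k \<otimes> y \<in> F (Suc (k * m + m))" by (intro F_mult) auto
  then show ?case by (simp add: add.commute)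
qed

text \<open>After the lowest digit is removed, each term of the product rule pairs Z_v^p or Z_(v+1),
  of index at most p^(v+1), with a p-th power or a delta of the remaining monomial, of index at most
  p m.\<close>

lemma delta_M: "p * n \<le> Nmax \<Longrightarrow> \<delta> (M n) \<in> F (Suc (p * n))"
proof (induction n rule: less_induct)
  case (less n)
  show ?case
  proof (cases "n = 0")
    case True
    then show ?thesis by (simp add: delta_one)
  next
    case False
    then have n: "n > 0" by simp
    define v where "v = vp n"
    define m where "m = n - p ^ v"
    have le: "p ^ v \<le> n" "p ^ v > 0" "n = m + p ^ v" using vp_le[OF n] p_gt_0 v_def m_def by auto
    have pn: "p * n = p * m + p ^ Suc v" using le(3) by (simp add: algebra_simps)
    have d: "\<delta> (M m) \<in> F (Suc (p * m))" proof (rule less(1))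
      show "m < n" "p * m \<le> Nmax" using le(2,3) pn less.prems by linarith+
    qed
    have Zp: "Zs v [^] p \<in> F (Suc (p ^ Suc v))" using rel less.prems pn by (intro Rel_imp) simp
    have Z1: "Zs (Suc v) \<in> F (Suc (p ^ Suc v))" using F_M[of "p ^ Suc v"] M_pow[of "Suc v"] by simp
    have Mp: "M m [^] p \<in> F (Suc (p * m))" using pn less.prems by (intro F_pow F_M) auto
    have 1: "Zs v [^] p \<otimes> \<delta> (M m) \<in> F (Suc (p * n))"
      using F_mult[OF d Zp] pn less.prems d F_carrier by (simp add: m_comm)
    have 2: "M m [^] p \<otimes> Zs (Suc v) \<in> F (Suc (p * n))"
      using F_mult[OF Mp Z1] pn less.prems by simp
    have 3: "add_pow D p (Zs (Suc v) \<otimes> \<delta> (M m)) \<in> F (Suc (p * n))"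
      using F_mult[OF d Z1] pn less.prems d F_carrier by (intro F_add_pow) (simp add: m_comm)
    have "\<delta> (M n) = Zs v [^] p \<otimes> \<delta> (M m) \<oplus> M m [^] p \<otimes> Zs (Suc v) \<oplus> add_pow D p (Zs (Suc v) \<otimes> \<delta> (M m))"
      using M_rec[OF n] delta_mult[of "Zs v" "M m"] by (simp add: v_def m_def)
    then show ?thesis using 1 2 3 F_add by simp
  qed
qed

lemma delta_F: "y \<in> F (Suc n) \<Longrightarrow> p * n \<le> Nmax \<Longrightarrow> \<delta> y \<in> F (Suc (p * n))"
proof (induction rule: F_induct)
  case zero
  then show ?case by (simp add: delta_zero)
next
  case (add y z)
  have "cross p D y z \<in> F (Suc (p * n))"
  proof (rule cross_mem[OF F_subgroup])
    fix i assume i: "0 < i" "i < p"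
    then have s: "i * n + (p - i) * n = p * n" by (simp add: add_mult_distrib[symmetric])
    then show "y [^] i \<otimes> z [^] (p - i) \<in> F (Suc (p * n))"
      using F_mult[OF F_pow[OF add(1), of i] F_pow[OF add(2), of "p - i"]] add(5) by simp
  qed
  then show ?case using add F_add F_diff F_carrier by (simp add: delta_add_cross)
next
  case (gen c k)
  have pk: "p * k \<le> p * n" using gen(2) by simp
  have d: "\<delta> (M k) \<in> F (Suc (p * n))" using F_mono[OF delta_M[of k]] pk gen by simp
  have Mp: "M k [^] p \<in> F (Suc (p * n))" using F_mono[OF F_pow[OF F_M[of k "Suc k"], of p]] pk gen by simp
  have dc: "\<delta> (\<kappa> c) = \<kappa> (\<delta>A c)" using \<kappa> gen by (simp add: delta_hom_def)
  have eq: "\<delta> (\<kappa> c \<otimes> M k) = \<kappa> (c [^]\<^bsub>A\<^esub> p) \<otimes> \<delta> (M k) \<oplus> \<kappa> (\<delta>A c) \<otimes> M k [^] p \<oplus> add_pow D p (\<kappa> (\<delta>A c) \<otimes> \<delta> (M k))"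
    using gen A.delta_closed[of c] by (simp add: delta_mult dc m_comm[of _ "\<kappa> (\<delta>A c)"])
  show ?case unfolding eq
    by (intro F_add F_scal F_add_pow d Mp A.nat_pow_closed A.delta_closed gen)
qed

text \<open>As in an associated graded ring: a b - a' b' = (a - a') b + (b - b') a', and each
  summand has one strictly lower factor.\<close>

lemma cong_mult:
  assumes a: "a \<ominus> a' \<in> F s" "a' \<in> F (Suc s)" "a \<in> carrier D"
    and b: "b \<ominus> b' \<in> F t" "b' \<in> F (Suc t)" "b \<in> carrier D" and st: "s + t \<le> Suc Nmax"
  shows "a \<otimes> b \<ominus> a' \<otimes> b' \<in> F (s + t)"
proof -
  have b1: "b \<in> F (Suc t)" using b by (rule of_cong)
  have c: "a' \<in> carrier D" "b' \<in> carrier D" using a b F_carrier by auto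
  have "a \<otimes> b \<ominus> a' \<otimes> b' = (a \<ominus> a') \<otimes> b \<oplus> (b \<ominus> b') \<otimes> a'"
  proof -
    have "(a \<ominus> a') \<otimes> b \<oplus> (b \<ominus> b') \<otimes> a' = (a \<otimes> b \<ominus> a' \<otimes> b) \<oplus> (a' \<otimes> b \<ominus> a' \<otimes> b')"
      using a(3) b(3) c by (simp add: minus_eq l_distr r_distr l_minus r_minus m_comm)
    also have "\<dots> = a \<otimes> b \<ominus> a' \<otimes> b'"
      using a(3) b(3) c by (simp add: minus_eq a_assoc r_neg1)
    finally show ?thesis by simp
  qed
  moreover have "(a \<ominus> a') \<otimes> b \<in> F (s + t)" using a(1) b1 st by (rule F_mult_strict)
  moreover have "(b \<ominus> b') \<otimes> a' \<in> F (s + t)" using F_mult_strict[OF b(1) a(2)] st by (simp add: add.commute)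
  ultimately show ?thesis using F_add by simp
qed

end

lemma cong_add:
  assumes "a \<ominus> a' \<in> F s" "b \<ominus> b' \<in> F s" "a \<in> carrier D" "a' \<in> carrier D" "b \<in> carrier D" "b' \<in> carrier D"
  shows "(a \<oplus> b) \<ominus> (a' \<oplus> b') \<in> F s"
proof -
  have "(a \<oplus> b) \<ominus> (a' \<oplus> b') = (a \<ominus> a') \<oplus> (b \<ominus> b')"
    using assms by (simp add: minus_eq minus_add a_ac)
  then show ?thesis using F_add assms by simp
qed

section \<open>The relations between consecutive iterates\<close>

text \<open>Expanding \<delta>(x + f Z) = 0 shows that \<phi>(f) \<delta>(Z) + \<delta>(f) Z^p is a
  polynomial in Z of degree below p. At q = 1 the value of \<delta>(f) is 1 - p^(p-1), so
  \<delta>(f) is a unit and the equation can be solved for Z^p; the value p of \<phi>(f) gives the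
  valuation one.\<close>

lemma Rel_0: "Rel 0"
proof -
  let ?k = "cross p D (\<kappa> x) (\<iota> fq \<otimes> Z)"
  have Z0: "Zs 0 = Z" by (simp add: Zs_def)
  have kF: "?k \<in> F p"
  proof (rule cross_mem[OF F_subgroup])
    fix i assume i: "0 < i" "i < p"
    have "Zs 0 [^] (p - i) = M ((p - i) * p ^ 0 + 0)" using M_digit[of 0 0 "p - i"] i by simp
    then have "Zs 0 [^] (p - i) \<in> F p" using F_M[of "p - i" p] i by simp
    then have "\<kappa> (x [^]\<^bsub>A\<^esub> i) \<otimes> (\<iota> (fq ^ (p - i)) \<otimes> Z [^] (p - i)) \<in> F p"
      using Z0 x by (intro F_scal F_\<iota>) auto
    then show "\<kappa> x [^] i \<otimes> (\<iota> fq \<otimes> Z) [^] (p - i) \<in> F p"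
      using x Z by (simp add: nat_pow_distrib \<iota>_pow)
  qed
  have kc: "?k \<in> carrier D" using kF F_carrier by blast
  have "\<kappa> (\<delta>A x) = \<delta> (\<kappa> x)" using \<kappa> x(1) unfolding delta_hom_def by blast
  then have "\<delta> (\<kappa> x) = \<zero>" using x(2) by simp
  then have "\<zero> = \<delta> (\<iota> fq \<otimes> Z) \<ominus> ?k"
    using Z x delta_add_cross[of "\<kappa> x" "\<iota> fq \<otimes> Z"] delta_closed[of "\<iota> fq \<otimes> Z"] by (simp add: \<iota>_def[symmetric])
  then have "\<delta> (\<iota> fq \<otimes> Z) = ?k" using diff_zero_iff[of "\<delta> (\<iota> fq \<otimes> Z)" ?k] delta_closed[of "\<iota> fq \<otimes> Z"] Z kc by simp
  then have eq: "\<iota> (phi fq) \<otimes> Zs 1 \<oplus> Z [^] p \<otimes> \<iota> (dl fq) = ?k"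
    using delta_mult_frob[of "\<iota> fq" Z] Z delta_Zs[of 0] Z0 by (simp add: \<iota>_frob \<iota>_delta)
  \<comment> \<open>This is (p - p^p)/p, written as 1 plus a multiple of p.\<close>
  have e1: "ev (dl fq) = 1 + of_nat p * (- (of_nat p ^ (p - 2)))"
  proof -
    have "p = Suc (Suc (p - 2))" using prime_ge_2_nat[OF prime_p] by simp
    then have "(of_nat p :: rat) ^ p = of_nat p * (of_nat p * of_nat p ^ (p - 2))" by (metis power_Suc)
    then show ?thesis using p_gt_0 by (simp add: ev_dl ev_fq field_simps)
  qed
  have e2: "pint (- (of_nat p ^ (p - 2)))" using pint_uminus[OF pint_of_int[of "int p ^ (p - 2)"]] by simp
  have u: "pval 0 (ev (dl fq))" unfolding e1 by (rule pval_add_p_pint[OF pval_1 e2])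
  let ?w = "inverse (dl fq)"
  have dc: "dl fq \<in> Loc p" using dl by simp
  note w = Loc_unit[OF dc u]
  have "ev ?w * ev (dl fq) = 1" using w dc ev_mult[of "dl fq" ?w] by (simp add: mult.commute)
  then have "ev ?w = 1 / ev (dl fq)" by (metis mult_zero_right nonzero_eq_divide_eq zero_neq_one)
  then have "pval 0 (ev ?w)" using pval_divide[of 0 0 1] pval_1 u by simp
  then have "pval 1 (ev (- (?w * phi fq)))"
    using pval_uminus[OF pval_mult[OF _ pval_p, of 0 "ev ?w"]] w by (simp add: ev_fq)
  moreover have "Zs 0 [^] p \<ominus> \<iota> (- (?w * phi fq)) \<otimes> Zs (Suc 0) \<in> F (p ^ Suc 0)"
  proof -
    have "\<iota> ?w \<otimes> ?k = \<iota> ?w \<otimes> (\<iota> (phi fq) \<otimes> Zs 1) \<oplus> (\<iota> (dl fq) \<otimes> \<iota> ?w) \<otimes> Z [^] p"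
      unfolding eq[symmetric] using w dc Z by (simp add: r_distr m_ac)
    also have "\<iota> (dl fq) \<otimes> \<iota> ?w = \<one>" using w dc \<iota>_mult[of "dl fq" ?w] \<iota>_1 by simp
    finally have "\<iota> ?w \<otimes> ?k = Z [^] p \<ominus> \<iota> (- (?w * phi fq)) \<otimes> Zs 1"
      using w Z by (simp add: \<iota>_neg \<iota>_mult minus_eq l_minus m_assoc a_comm)
    then show ?thesis using F_\<iota>[OF kF w(1)] Z0 by simp
  qed
  moreover have "- (?w * phi fq) \<in> Loc p" using w by simp
  ultimately show ?thesis unfolding Rel_def by blast
qed

text \<open>With y = Z_j and u = Z_(j+1), \<delta>(y^p) is computed twice modulo terms below index
  p^(j+2). The product rule gives E(p-1) u^p; the relation y^p = c u + S gives \<phi>(c) Z_(j+2) +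
  \<delta>(c) u^p. Comparison yields u^p once b = E(p-1) - \<delta>(c) is known to be a
  unit.\<close>

lemma Rel_Suc:
  assumes R: "\<And>i. i \<le> j \<Longrightarrow> Rel i"
  shows "Rel (Suc j)"
proof -
  obtain c where c: "c \<in> Loc p" "pval 1 (ev c)" and S0: "Zs j [^] p \<ominus> \<iota> c \<otimes> Zs (Suc j) \<in> F (p ^ Suc j)"
    using R[of j] unfolding Rel_def by blast
  define P where "P = p ^ Suc j"
  \<comment> \<open>One below p^(j+2): within this bound only relations with i \<le> j are called
    upon.\<close>
  define Nm where "Nm = p * P - 1"
  have P0: "P > 0" "p * P > 0" using p_gt_0 by (auto simp: P_def)
  have Nm: "Suc Nm = p * P" using P0 by (simp add: Nm_def)
  have rel: "Rel i" if "p ^ Suc i \<le> Nm" for i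
  proof -
    have "p * P = p ^ Suc (Suc j)" by (simp add: P_def)
    then have "p ^ Suc i < p ^ Suc (Suc j)" using that Nm by linarith
    then have "i \<le> j" using prime_ge_2_nat[OF prime_p] by (simp add: power_strict_increasing_iff del: power_Suc)
    then show ?thesis by (rule R)
  qed
  have kP: "k * P \<le> Nm" if "k < p" for k
    using mult_strict_right_mono[OF that P0(1)] Nm by linarith
  define y where "y = Zs j"
  define u where "u = Zs (Suc j)"
  define S where "S = y [^] p \<ominus> \<iota> c \<otimes> u"
  have yc: "y \<in> carrier D" "u \<in> carrier D" "S \<in> carrier D" using c by (auto simp: y_def u_def S_def)
  have SF: "S \<in> F P" using S0 by (simp add: S_def y_def u_def P_def)
  have uF: "u \<in> F (Suc P)" unfolding u_def P_def using F_M[of "p ^ Suc j"] M_pow[of "Suc j"] by simp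
  have uk: "u [^] k \<in> F (Suc (k * P))" if "k < p" for k
    using F_pow[OF rel uF kP[OF that]] by simp
  have y_p: "y [^] p \<ominus> \<iota> c \<otimes> u \<in> F P" using SF S_def by simp
  have cuF: "\<iota> d \<otimes> u \<in> F (Suc P)" if "d \<in> Loc p" for d using uF that F_\<iota> by blast
  have ykp: "(y [^] p) [^] k \<ominus> \<iota> (c ^ k) \<otimes> u [^] k \<in> F (k * P)" if "k < p" for k
    using that
  proof (induction k)
    case 0
    then show ?case by (simp add: \<iota>_1 minus_eq r_neg)
  next
    case (Suc k)
    have "(y [^] p) [^] k \<otimes> y [^] p \<ominus> (\<iota> (c ^ k) \<otimes> u [^] k) \<otimes> (\<iota> c \<otimes> u) \<in> F (k * P + P)"
      using Suc yc c kP[of "Suc k"] by (intro cong_mult[OF rel] y_p cuF F_\<iota> uk) auto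
    moreover have "(\<iota> (c ^ k) \<otimes> u [^] k) \<otimes> (\<iota> c \<otimes> u) = \<iota> (c ^ Suc k) \<otimes> u [^] Suc k"
      using c yc by (simp add: \<iota>_mult m_ac)
    ultimately show ?case by (simp add: add.commute)
  qed
  \<comment> \<open>In closed form E k is ((c + p)^(k+1) - c^(k+1))/p. The recursion is the product
    rule for y times y^(k+1) and involves no division.\<close>
  define E where "E = rec_nat 1 (\<lambda>k d. (c + of_nat p) * d + c ^ Suc k)"
  have E: "E 0 = 1" "\<And>k. E (Suc k) = (c + of_nat p) * E k + c ^ Suc k" by (simp_all add: E_def)
  have Ec: "E k \<in> Loc p" for k by (induction k) (use c E in auto)
  have dy: "\<delta> (y [^] Suc k) \<ominus> \<iota> (E k) \<otimes> u [^] Suc k \<in> F (Suc k * P)" if "Suc k \<le> p" for k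
    using that
  proof (induction k)
    case 0
    then show ?case using yc by (simp add: y_def u_def E \<iota>_1 minus_eq r_neg)
  next
    case (Suc k)
    let ?d = "\<delta> (y [^] Suc k)" and ?d' = "\<iota> (E k) \<otimes> u [^] Suc k"
    have dc: "?d \<in> carrier D" "?d' \<in> carrier D" using yc delta_closed Ec by auto
    have kp: "Suc k < p" using Suc by simp
    have d'F: "?d' \<in> F (Suc (Suc k * P))" using uk[OF kp] Ec F_\<iota> by blast
    have IH: "?d \<ominus> ?d' \<in> F (Suc k * P)" using Suc by simp
    have kP': "P + Suc k * P \<le> Suc Nm"
    proof -
      have "P + Suc k * P = Suc (Suc k) * P" by simp
      also have "\<dots> \<le> p * P" using Suc.prems by (intro mult_le_mono1)
      finally show ?thesis using Nm by simp
    qed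
    have 1: "y [^] p \<otimes> ?d \<ominus> (\<iota> c \<otimes> u) \<otimes> ?d' \<in> F (P + Suc k * P)"
      using yc dc c d'F kP' by (intro cong_mult[OF rel] y_p IH cuF) auto
    have 2: "(y [^] p) [^] Suc k \<otimes> u \<ominus> (\<iota> (c ^ Suc k) \<otimes> u [^] Suc k) \<otimes> u \<in> F (Suc k * P + P)"
      using yc c kP' uk[OF kp] by (intro cong_mult[OF rel] ykp kp F_\<iota> uF) (auto simp: minus_eq r_neg add.commute)
    have 3: "(\<iota> (of_nat p) \<otimes> u) \<otimes> ?d \<ominus> (\<iota> (of_nat p) \<otimes> u) \<otimes> ?d' \<in> F (P + Suc k * P)"
      using yc dc d'F kP' by (intro cong_mult[OF rel] IH cuF) (auto simp: minus_eq r_neg)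
    have "\<delta> (y [^] Suc (Suc k)) = \<delta> (y \<otimes> y [^] Suc k)" using yc by (simp add: m_comm)
    also have "\<dots> = y [^] p \<otimes> ?d \<oplus> (y [^] p) [^] Suc k \<otimes> u \<oplus> add_pow D p (u \<otimes> ?d)"
    proof -
      have "(y [^] p) [^] Suc k = (y [^] Suc k) [^] p" using yc by (simp only: nat_pow_pow mult.commute)
      moreover have "\<delta> y = u" by (simp add: y_def u_def)
      ultimately show ?thesis using delta_mult[of y "y [^] Suc k"] yc by (simp del: nat_pow_Suc)
    qed
    also have "add_pow D p (u \<otimes> ?d) = (\<iota> (of_nat p) \<otimes> u) \<otimes> ?d"
      using yc dc by (subst add_pow_eq_mult) (auto simp: \<iota>_of_nat m_assoc)
    finally have L: "\<delta> (y [^] Suc (Suc k)) = y [^] p \<otimes> ?d \<oplus> (y [^] p) [^] Suc k \<otimes> u \<oplus> (\<iota> (of_nat p) \<otimes> u) \<otimes> ?d" .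
    have Rr: "\<iota> (E (Suc k)) \<otimes> u [^] Suc (Suc k) = (\<iota> c \<otimes> u) \<otimes> ?d' \<oplus> (\<iota> (c ^ Suc k) \<otimes> u [^] Suc k) \<otimes> u \<oplus> (\<iota> (of_nat p) \<otimes> u) \<otimes> ?d'"
    proof -
      have uu: "u [^] Suc (Suc k) = u \<otimes> u [^] Suc k" using yc by (simp add: m_comm)
      have "\<iota> (E (Suc k)) = (\<iota> c \<oplus> \<iota> (of_nat p)) \<otimes> \<iota> (E k) \<oplus> \<iota> (c ^ Suc k)"
        unfolding E(2) using c Ec[of k] by (simp add: \<iota>_add \<iota>_mult del: power_Suc)
      then show ?thesis unfolding uu
        using c Ec[of k] yc nat_pow_closed[OF yc(2), of "Suc k"] \<iota>_closed[OF Loc_power[OF c(1), of "Suc k"]] \<iota>_closed[OF Loc_of_nat[of p]]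
        by (simp add: l_distr r_distr m_ac a_ac del: nat_pow_Suc power_Suc)
    qed
    have s: "Suc k * P + P = P + Suc k * P" "Suc (Suc k) * P = P + Suc k * P" by simp_all
    show ?case unfolding L Rr s(2)
      using 1 2 3 c yc dc Ec delta_closed unfolding s(1)
      by (intro cong_add) (auto intro!: m_closed a_closed simp del: nat_pow_Suc power_Suc)
  qed
  define d where "d = E (p - 1)"
  have dLoc: "d \<in> Loc p" using Ec d_def by simp
  have up: "u [^] p \<in> carrier D" using yc by simp
  have L: "\<delta> (y [^] p) \<ominus> \<iota> d \<otimes> u [^] p \<in> F (p * P)"
    using dy[of "p - 1"] p_gt_0 by (simp add: d_def del: nat_pow_Suc)
  have Rr: "\<delta> (y [^] p) \<ominus> (\<iota> (phi c) \<otimes> Zs (Suc (Suc j)) \<oplus> \<iota> (dl c) \<otimes> u [^] p) \<in> F (p * P)"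
  proof -
    have yp: "y [^] p = \<iota> c \<otimes> u \<oplus> S"
      using yc c unfolding S_def by (simp add: a_comm[of "\<iota> c \<otimes> u"] diff_add_cancel)
    have cu: "\<iota> c \<otimes> u \<in> carrier D" using c yc by simp
    \<comment> \<open>S has index at most P - 1, so its delta has index at most p (P - 1), below p
      P.\<close>
    have "\<delta> S \<in> F (Suc (p * (P - 1)))"
    proof (rule delta_F[where Nmax = Nm])
      show "S \<in> F (Suc (P - 1))" using SF P0 by simp
      show "p * (P - 1) \<le> Nm" using p_gt_0 by (simp add: Nm_def diff_mult_distrib2)
    qed (rule rel)
    then have dS: "\<delta> S \<in> F (p * P)"
      by (rule F_mono) (use P0 p_gt_0 in \<open>cases P; simp\<close>)
    \<comment> \<open>Each mixed monomial contains at least one factor S, and this one strict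
      inequality pushes its index below p P.\<close>
    have cr: "cross p D (\<iota> c \<otimes> u) S \<in> F (p * P)"
    proof (rule cross_mem[OF F_subgroup])
      fix i assume i: "0 < i" "i < p"
      obtain l where l: "p - i = Suc l" "l < p" using i by (metis Suc_diff_Suc diff_less diff_Suc_less less_trans_Suc Suc_lessD)
      have s: "P + l * P + i * P = p * P"
      proof -
        have "P + l * P + i * P = (Suc l + i) * P" by (simp add: algebra_simps)
        also have "Suc l + i = p" using l i by simp
        finally show ?thesis .
      qed
      have "S [^] l \<in> F (Suc (l * P))"
        using F_pow[OF rel F_mono[OF SF] kP[OF l(2)]] by simp
      then have "S \<otimes> S [^] l \<in> F (P + l * P)" using s Nm by (intro F_mult_strict[OF rel] SF) auto
      moreover have "(\<iota> c \<otimes> u) [^] i \<in> F (Suc (i * P))"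
        using F_pow[OF rel cuF[OF c(1)] kP[OF i(2)]] by simp
      ultimately have "(S \<otimes> S [^] l) \<otimes> (\<iota> c \<otimes> u) [^] i \<in> F (P + l * P + i * P)"
        using s Nm by (intro F_mult_strict[OF rel, where y = "S \<otimes> S [^] l"]) auto
      then show "(\<iota> c \<otimes> u) [^] i \<otimes> S [^] (p - i) \<in> F (p * P)"
        unfolding l(1) s using yc cu by (simp add: m_ac)
    qed
    have "\<delta> (\<iota> c \<otimes> u) = \<iota> (phi c) \<otimes> Zs (Suc (Suc j)) \<oplus> \<iota> (dl c) \<otimes> u [^] p"
      using c yc dl(1)[OF c(1)] by (simp add: delta_mult_frob \<iota>_frob \<iota>_delta m_comm u_def)
    then have "\<delta> (y [^] p) = (\<iota> (phi c) \<otimes> Zs (Suc (Suc j)) \<oplus> \<iota> (dl c) \<otimes> u [^] p) \<oplus> \<delta> S \<ominus> cross p D (\<iota> c \<otimes> u) S"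
      unfolding yp using cu yc by (simp add: delta_add_cross)
    moreover have "\<And>a b k. a \<in> carrier D \<Longrightarrow> b \<in> carrier D \<Longrightarrow> k \<in> carrier D \<Longrightarrow> a \<oplus> b \<ominus> k \<ominus> a = b \<ominus> k"
    proof -
      fix a b k assume *: "a \<in> carrier D" "b \<in> carrier D" "k \<in> carrier D"
      have "a \<oplus> b \<ominus> k = a \<oplus> (b \<ominus> k)" using * by (simp add: minus_eq a_assoc)
      then show "a \<oplus> b \<ominus> k \<ominus> a = b \<ominus> k" using * by (simp add: add_diff_cancel)
    qed
    moreover have "\<iota> (phi c) \<otimes> Zs (Suc (Suc j)) \<oplus> \<iota> (dl c) \<otimes> u [^] p \<in> carrier D"
      using c yc dl(1)[OF c(1)] by simp
    ultimately have "\<delta> (y [^] p) \<ominus> (\<iota> (phi c) \<otimes> Zs (Suc (Suc j)) \<oplus> \<iota> (dl c) \<otimes> u [^] p) = \<delta> S \<ominus> cross p D (\<iota> c \<otimes> u) S"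
      using dS cr F_carrier by simp
    then show ?thesis using F_diff[OF dS cr] by simp
  qed
  have dcL: "dl c \<in> Loc p" using dl c by blast
  define b where "b = d - dl c"
  have bL: "b \<in> Loc p" using dLoc dcL b_def by simp
  \<comment> \<open>Let the value of c at q = 1 be p s0. The value of E(p-1) is then divisible by p,
    while that of \<delta>(c), which is (p s0 - (p s0)^p)/p, is congruent to s0. Hence b has value
    -s0 modulo p, which is prime to p.\<close>
  obtain s0 where s0: "pval 0 s0" "ev c = of_nat p * s0" using pval_SucE[OF c(2)] by blast
  have s0i: "pint s0" using s0 pval_pint by blast
  have pc: "pint (ev c)" using pint_ev c by blast
  have p2: "p - 1 = Suc (p - 2)" "p = Suc (Suc (p - 2))" using prime_ge_2_nat[OF prime_p] by auto
  have evb: "ev b = - s0 + of_nat p * ((s0 + 1) * ev (E (p - 2)) + s0 * ev c ^ (p - 2) + s0 * s0 * ev c ^ (p - 2))"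
  proof -
    have "ev d = (ev c + of_nat p) * ev (E (p - 2)) + ev c * ev c ^ (p - 2)"
      unfolding d_def p2(1) E(2) using c Ec[of "p - 2"] by simp
    moreover have "ev (dl c) = s0 - s0 * (of_nat p * s0) * ev c ^ (p - 2)"
    proof -
      have "ev c ^ p = ev c * (ev c * ev c ^ (p - 2))" using p2(2) by (metis power_Suc)
      also have "\<dots> = of_nat p * (s0 * (of_nat p * s0) * ev c ^ (p - 2))" by (subst (1 2) s0(2)) simp
      finally show ?thesis using p_gt_0 c s0(2) by (simp add: ev_dl field_simps)
    qed
    ultimately show ?thesis unfolding b_def using dLoc dcL s0(2) by (simp add: algebra_simps)
  qed
  have "pval 0 (ev b)" unfolding evb
    by (intro pval_add_p_pint pval_uminus s0 pint_add pint_mult pint_power s0i pc pint_1 pint_ev Ec)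
  note w = Loc_unit[OF bL this]
  let ?w = "inverse b"
  have "ev b * ev ?w = 1" using w bL ev_mult[of b ?w] by simp
  then have "ev ?w = 1 / ev b" by (metis mult.commute mult_zero_right nonzero_eq_divide_eq zero_neq_one)
  then have "pval 0 (ev ?w)" using pval_divide[of 0 0 1] pval_1 \<open>pval 0 (ev b)\<close> by simp
  then have "pval 1 (ev (?w * phi c))" using pval_mult[of 0 "ev ?w" 1 "ev c"] c w by simp
  moreover have "Zs (Suc j) [^] p \<ominus> \<iota> (?w * phi c) \<otimes> Zs (Suc (Suc j)) \<in> F (p ^ Suc (Suc j))"
  proof -
    let ?t = "\<iota> (phi c) \<otimes> Zs (Suc (Suc j))"
    have cl: "\<iota> d \<in> carrier D" "\<iota> (dl c) \<in> carrier D" "?t \<in> carrier D" "\<iota> ?w \<in> carrier D" "\<delta> (y [^] p) \<in> carrier D"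
      using dLoc dcL c w yc delta_closed by auto
    have "(\<delta> (y [^] p) \<ominus> (?t \<oplus> \<iota> (dl c) \<otimes> u [^] p)) \<ominus> (\<delta> (y [^] p) \<ominus> \<iota> d \<otimes> u [^] p) \<in> F (p * P)"
      using F_diff[OF Rr L] .
    also have "(\<delta> (y [^] p) \<ominus> (?t \<oplus> \<iota> (dl c) \<otimes> u [^] p)) \<ominus> (\<delta> (y [^] p) \<ominus> \<iota> d \<otimes> u [^] p)
       = (\<iota> d \<ominus> \<iota> (dl c)) \<otimes> u [^] p \<ominus> ?t"
    proof -
      have "\<And>g t e h. g \<in> carrier D \<Longrightarrow> t \<in> carrier D \<Longrightarrow> e \<in> carrier D \<Longrightarrow> h \<in> carrier D \<Longrightarrow>
        (g \<ominus> (t \<oplus> e)) \<ominus> (g \<ominus> h) = h \<ominus> e \<ominus> t"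
      proof -
        fix g t e h assume *: "g \<in> carrier D" "t \<in> carrier D" "e \<in> carrier D" "h \<in> carrier D"
        have "(g \<ominus> (t \<oplus> e)) \<ominus> (g \<ominus> h) = g \<oplus> (\<ominus> g \<oplus> (h \<ominus> e \<ominus> t))"
          using * by (simp add: minus_eq minus_add a_ac)
        then show "(g \<ominus> (t \<oplus> e)) \<ominus> (g \<ominus> h) = h \<ominus> e \<ominus> t" using * by (simp add: r_neg2)
      qed
      from this[of "\<delta> (y [^] p)" ?t "\<iota> (dl c) \<otimes> u [^] p" "\<iota> d \<otimes> u [^] p"]
      show ?thesis using cl up by (simp add: minus_eq l_distr l_minus)
    qed
    also have "\<iota> d \<ominus> \<iota> (dl c) = \<iota> b"
      unfolding b_def using dLoc dcL \<iota>_add[of d "- dl c"] by (simp add: \<iota>_neg minus_eq)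
    finally have "\<iota> ?w \<otimes> (\<iota> b \<otimes> u [^] p \<ominus> ?t) \<in> F (p * P)" using F_\<iota> w by blast
    also have "\<iota> ?w \<otimes> (\<iota> b \<otimes> u [^] p \<ominus> ?t) = (\<iota> b \<otimes> \<iota> ?w) \<otimes> u [^] p \<ominus> \<iota> (?w * phi c) \<otimes> Zs (Suc (Suc j))"
      using cl up bL w c by (simp add: minus_eq r_distr r_minus m_ac \<iota>_mult)
    also have "\<iota> b \<otimes> \<iota> ?w = \<one>" using w bL \<iota>_mult[of b ?w] \<iota>_1 by simp
    finally show ?thesis using up by (simp add: u_def P_def)
  qed
  moreover have "?w * phi c \<in> Loc p" using w c by simp
  ultimately show ?thesis unfolding Rel_def by blast
qed

lemma Rel_all: "Rel j"
proof (induction j rule: less_induct)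
  case (less j)
  then show ?case using Rel_0 Rel_Suc by (cases j) auto
qed

text \<open>With every relation available, \<open>Nmax\<close> may be taken as large as the product
  requires.\<close>

theorem span_mult: "y \<in> F m \<Longrightarrow> z \<in> F n \<Longrightarrow> y \<otimes> z \<in> F (Suc (m + n))"
  using F_mult[OF Rel_all, of y m z n "m + n"] F_mono[of y m "Suc m"] F_mono[of z n "Suc n"] by simp

theorem span_delta: "y \<in> F n \<Longrightarrow> \<delta> y \<in> F (Suc (p * n))"
  using delta_F[OF Rel_all, of y n "p * n"] F_mono[of y n "Suc n"] by simp

end

lemma (in cring) finsum_single:
  assumes "finite S" "a \<in> S" "g \<in> S \<rightarrow> carrier R" "\<And>b. b \<in> S \<Longrightarrow> b \<noteq> a \<Longrightarrow> g b = \<zero>"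
  shows "finsum R g S = g a"
proof -
  have "finsum R g S = finsum R g (insert a (S - {a}))" using assms(2) by (simp add: insert_absorb)
  also have "\<dots> = g a \<oplus> finsum R g (S - {a})"
    using assms by (intro finsum_insert) auto
  also have "finsum R g (S - {a}) = (\<Oplus>b\<in>S - {a}. \<zero>)"
    using assms by (intro finsum_cong') auto
  finally show ?thesis using assms by (simp add: Pi_iff)
qed

lemma triples_finite: "finite {(n1, n2, i). i \<le> min n1 n2 \<and> n1 + n2 - i = (m::nat)}"
  by (rule finite_subset[of _ "{..m} \<times> {..m} \<times> {..m}"]) auto

section \<open>The twisted divided power algebra\<close>

text \<open>The ring axioms for \<open>Omega\<close> are assumed here and will come from the
  naturality hypothesis, which puts a delta-ring structure on it; associativity is not verified from
  the explicit coefficients.\<close>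

locale omega = q_loc_prime p + A: cring A
  for p and A (structure) +
  fixes \<theta> x
  assumes \<theta>: "\<theta> \<in> ring_hom (Zq_loc p) A" and x: "x \<in> carrier A"
    and W_cring: "cring (Omega p A (\<theta> q_loc) x)"
begin

abbreviation "q \<equiv> \<theta> q_loc"
abbreviation "W \<equiv> Omega p A q x"

sublocale W: cring W by (rule W_cring)
sublocale \<theta>: ring_hom_cring "Zq_loc p" A \<theta> by unfold_locales (rule \<theta>)

lemma q_closed [simp]: "q \<in> carrier A" by simp

lemma carrier_W: "carrier W = up A"
  and zero_W: "\<zero>\<^bsub>W\<^esub> = (\<lambda>n. \<zero>)"
  and one_W: "\<one>\<^bsub>W\<^esub> = (\<lambda>n. if n = 0 then \<one> else \<zero>)"
  and add_W: "s \<oplus>\<^bsub>W\<^esub> t = (\<lambda>n. s n \<oplus> t n)"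
  by (simp_all add: Omega_def)

lemma W_coeff [simp]: "s \<in> carrier W \<Longrightarrow> s n \<in> carrier A"
  by (auto simp: carrier_W)

lemma neg_W: "s \<in> carrier W \<Longrightarrow> \<ominus>\<^bsub>W\<^esub> s = (\<lambda>n. \<ominus> s n)"
proof -
  assume s: "s \<in> carrier W"
  then have "(\<lambda>n. \<ominus> s n) \<in> carrier W" using A.up_a_inv_closed by (simp add: carrier_W)
  then show ?thesis using s by (intro W.minus_equality) (auto simp: add_W zero_W A.l_neg)
qed

lemma diff_W: "s \<in> carrier W \<Longrightarrow> t \<in> carrier W \<Longrightarrow> s \<ominus>\<^bsub>W\<^esub> t = (\<lambda>n. s n \<ominus> t n)"
  by (simp add: W.minus_eq neg_W add_W A.minus_eq)

definition "term s t = (\<lambda>(n1, n2, i). s n1 \<otimes> t n2 \<otimes> omega_coeff p A q x n1 n2 i)"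

lemma mult_W: "(s \<otimes>\<^bsub>W\<^esub> t) m = finsum A (term s t) {(n1, n2, i). i \<le> min n1 n2 \<and> n1 + n2 - i = m}"
  by (simp add: Omega_def term_def)

lemma omega_coeff_closed [simp]: "omega_coeff p A q x n1 n2 i \<in> carrier A"
  unfolding omega_coeff_def using x A.q_binomial_closed by simp

lemma term_closed: "s \<in> carrier W \<Longrightarrow> t \<in> carrier W \<Longrightarrow> term s t \<in> S \<rightarrow> carrier A"
  unfolding term_def by auto

lemma omega_coeff_0: "omega_coeff p A q x n1 n2 0 = q_binomial A (q [^] p) (n1 + n2) n1"
  unfolding omega_coeff_def using A.q_binomial_closed[of "q [^] p"] by simp

text \<open>The filtration by degree in \<omega>, indexed like \<open>F\<close>: degree at most n is
  \<open>G (Suc n)\<close>.\<close>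

definition G :: "nat \<Rightarrow> (nat \<Rightarrow> 'a) set" where
  "G N = {s \<in> carrier W. \<forall>n\<ge>N. s n = \<zero>}"

lemma G_D: "s \<in> G N \<Longrightarrow> s \<in> carrier W" "s \<in> G N \<Longrightarrow> N \<le> n \<Longrightarrow> s n = \<zero>"
  by (auto simp: G_def)

lemma G_ex: "s \<in> carrier W \<Longrightarrow> \<exists>N. s \<in> G N"
proof -
  assume s: "s \<in> carrier W"
  then obtain n where "bound \<zero> n s" unfolding carrier_W by blast
  then have "s \<in> G (Suc n)" using s by (auto simp: G_def bound_def)
  then show ?thesis by blast
qed

text \<open>Only the summand i = 0 reaches the top degree k + l, and its coefficient is a single
  q^p-binomial.\<close>

lemma G_mult:
  assumes s: "s \<in> G (Suc k)" and t: "t \<in> G (Suc l)"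
  shows "s \<otimes>\<^bsub>W\<^esub> t \<in> G (Suc (k + l))"
    and "(s \<otimes>\<^bsub>W\<^esub> t) (k + l) = s k \<otimes> t l \<otimes> q_binomial A (q [^] p) (k + l) k"
proof -
  have c: "s \<in> carrier W" "t \<in> carrier W" using G_D s t by blast+
  have z: "term s t (n1, n2, i) = \<zero>" if "n1 > k \<or> n2 > l" for n1 n2 i
    using that G_D(2)[OF s, of n1] G_D(2)[OF t, of n2] c unfolding term_def by auto
  have "(s \<otimes>\<^bsub>W\<^esub> t) m = \<zero>" if "m > k + l" for m
  proof -
    have "term s t y = \<zero>" if "y \<in> {(n1, n2, i). i \<le> min n1 n2 \<and> n1 + n2 - i = m}" for y
      using that \<open>m > k + l\<close> by (cases y) (auto intro!: z)
    then have "finsum A (term s t) {(n1, n2, i). i \<le> min n1 n2 \<and> n1 + n2 - i = m}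
        = (\<Oplus>y\<in>{(n1, n2, i). i \<le> min n1 n2 \<and> n1 + n2 - i = m}. \<zero>)"
      by (intro A.finsum_cong') auto
    then show ?thesis unfolding mult_W by simp
  qed
  then show "s \<otimes>\<^bsub>W\<^esub> t \<in> G (Suc (k + l))" using W.m_closed[OF c] by (simp add: G_def)
  have "(s \<otimes>\<^bsub>W\<^esub> t) (k + l) = term s t (k, l, 0)"
    unfolding mult_W
  proof (rule A.finsum_single[OF triples_finite])
    fix y :: "nat \<times> nat \<times> nat" assume y: "y \<in> {(n1, n2, i). i \<le> min n1 n2 \<and> n1 + n2 - i = k + l}" "y \<noteq> (k, l, 0)"
    obtain n1 n2 i where yy: "y = (n1, n2, i)" by (metis surj_pair)
    have "n1 > k \<or> n2 > l" using y unfolding yy by auto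
    then show "term s t y = \<zero>" unfolding yy by (rule z)
  qed (use term_closed[OF c] in auto)
  then show "(s \<otimes>\<^bsub>W\<^esub> t) (k + l) = s k \<otimes> t l \<otimes> q_binomial A (q [^] p) (k + l) k"
    by (simp add: term_def omega_coeff_0)
qed

lemma const_closed [simp]: "a \<in> carrier A \<Longrightarrow> omega_const A a \<in> carrier W"
  unfolding omega_const_def carrier_W by (auto simp: up_def bound_def intro!: exI[of _ 0])

lemma const_mult:
  assumes a: "a \<in> carrier A" and s: "s \<in> carrier W"
  shows "omega_const A a \<otimes>\<^bsub>W\<^esub> s = (\<lambda>n. a \<otimes> s n)"
proof
  fix m
  have "(omega_const A a \<otimes>\<^bsub>W\<^esub> s) m = term (omega_const A a) s (0, m, 0)"
    unfolding mult_W
  proof (rule A.finsum_single[OF triples_finite])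
    fix y :: "nat \<times> nat \<times> nat" assume y: "y \<in> {(n1, n2, i). i \<le> min n1 n2 \<and> n1 + n2 - i = m}" "y \<noteq> (0, m, 0)"
    obtain n1 n2 i where yy: "y = (n1, n2, i)" by (metis surj_pair)
    have "n1 > 0" using y unfolding yy by auto
    then show "term (omega_const A a) s y = \<zero>" unfolding yy term_def omega_const_def using s by simp
  qed (use term_closed a s in auto)
  then show "(omega_const A a \<otimes>\<^bsub>W\<^esub> s) m = a \<otimes> s m"
    using a s by (simp add: term_def omega_coeff_0 omega_const_def)
qed

lemma const_hom: "omega_const A \<in> ring_hom A W"
proof (rule ring_hom_memI)
  fix a b assume ab: "a \<in> carrier A" "b \<in> carrier A"
  show "omega_const A (a \<otimes> b) = omega_const A a \<otimes>\<^bsub>W\<^esub> omega_const A b"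
    using ab by (simp add: const_mult) (simp add: omega_const_def fun_eq_iff)
  show "omega_const A (a \<oplus> b) = omega_const A a \<oplus>\<^bsub>W\<^esub> omega_const A b"
    by (simp add: omega_const_def add_W fun_eq_iff)
next
  show "omega_const A \<one> = \<one>\<^bsub>W\<^esub>" by (simp add: one_W omega_const_def)
qed (rule const_closed)

sublocale c: ring_hom_cring A W "omega_const A" by unfold_locales (rule const_hom)

definition basis :: "nat \<Rightarrow> nat \<Rightarrow> 'a" where
  "basis n = (\<lambda>m. if m = n then \<one> else \<zero>)"

lemma basis_closed [simp]: "basis n \<in> carrier W"
  unfolding basis_def carrier_W by (auto simp: up_def bound_def intro!: exI[of _ n])

lemma \<theta>_unit: "z \<in> Loc p \<Longrightarrow> pval 0 (ev z) \<Longrightarrow> \<theta> z \<in> Units A"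
proof -
  assume z: "z \<in> Loc p" "pval 0 (ev z)"
  note w = Loc_unit[OF z]
  have "\<theta> z \<otimes> \<theta> (inverse z) = \<one>" using \<theta>.hom_mult[of z "inverse z"] w z \<theta>.hom_one by simp
  moreover from this have "\<theta> (inverse z) \<otimes> \<theta> z = \<one>" using z w A.m_comm[of "\<theta> z" "\<theta> (inverse z)"] by simp
  ultimately show ?thesis unfolding Units_def using z w \<theta>.hom_closed by blast
qed

section \<open>Leading coefficients of digit monomials and of the iterates\<close>

text \<open>The binomials appearing in \<open>G_mult\<close>, taken in the localization. There they
  can be specialized at q = 1 to ordinary binomials, which decides whether they are units.\<close>

definition qb :: "nat \<Rightarrow> nat \<Rightarrow> int poly fract" where
  "qb n k = q_binomial (Zq_loc p) (q_loc ^ p) n k"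

lemma qb_closed [simp]: "qb n k \<in> Loc p"
  unfolding qb_def by (rule L.q_binomial_closed) simp

lemma ev_qb: "ev (qb n k) = of_nat (n choose k)"
proof (induction n arbitrary: k)
  case 0
  then show ?case by (cases k) (simp_all add: qb_def)
next
  case (Suc n)
  show ?case
  proof (cases k)
    case (Suc k')
    have "qb (Suc n) (Suc k') = qb n k' + (q_loc ^ p) ^ Suc k' * qb n (Suc k')" by (simp add: qb_def)
    then show ?thesis using Suc Suc.IH by simp
  qed (simp add: qb_def)
qed

lemma \<theta>_qb: "q_binomial A (q [^] p) n k = \<theta> (qb n k)"
  using \<theta>.hom_q_binomial[of "q_loc ^ p" n k] \<theta>.hom_pow[of q_loc p] by (simp add: qb_def)

text \<open>At q = 1 the claim is that p^j m over p^j contains the same power of p as m;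
  \<open>const_p_fac\<close> is this count, familiar from Sylow's theorem.\<close>

lemma pval_qb: "m > 0 \<Longrightarrow> pval (vp m) (ev (qb (p ^ j * m) (p ^ j)))"
proof -
  assume m: "m > 0"
  have "p ^ j \<le> p ^ j * m" using m by simp
  then have "p ^ j * m choose p ^ j > 0" by (rule zero_less_binomial)
  then show ?thesis unfolding ev_qb using pval_of_nat[of "p ^ j * m choose p ^ j"] const_p_fac[OF m prime_p] by simp
qed

lemma pval_qb_vp: "n > 0 \<Longrightarrow> pval 0 (ev (qb n (p ^ vp n)))"
proof -
  assume n: "n > 0"
  obtain m where m: "n = p ^ vp n * m" "\<not> p dvd m"
    using multiplicity_decompose'[of n p] n not_unit_p by (metis not_gr_zero)
  have "m > 0" using m n by (metis gr0I mult_0_right)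
  moreover have "vp m = 0" using m(2) by (rule not_dvd_imp_multiplicity_0)
  ultimately show ?thesis using pval_qb[of m "vp n"] m(1) by simp
qed

text \<open>Removing the lowest digit costs the q^p-binomial of n over p^v, where v is the valuation
  of n. Its value at q = 1 is prime to p.\<close>

lemma dmon_lead:
  assumes z: "\<And>j. p ^ j < N \<Longrightarrow> z j \<in> G (Suc (p ^ j)) \<and> z j (p ^ j) \<in> Units A"
  shows "n < N \<Longrightarrow> dmon p W z n \<in> G (Suc n) \<and> dmon p W z n n \<in> Units A"
proof (induction n rule: less_induct)
  case (less n)
  show ?case
  proof (cases "n = 0")
    case True
    then have "dmon p W z n = \<one>\<^bsub>W\<^esub>" by (simp add: dmon.simps)
    then show ?thesis using True by (auto simp: G_def one_W W.one_closed[unfolded one_W])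
  next
    case False
    then have n: "n > 0" by simp
    define v where "v = vp n"
    have le: "p ^ v \<le> n" "p ^ v > 0" using vp_le[OF n] p_gt_0 v_def by auto
    have eq: "dmon p W z n = z v \<otimes>\<^bsub>W\<^esub> dmon p W z (n - p ^ v)" using n p_gt_0 by (subst dmon.simps) (simp add: v_def)
    have z: "z v \<in> G (Suc (p ^ v))" "z v (p ^ v) \<in> Units A" using z[of v] le less.prems by auto
    have d: "dmon p W z (n - p ^ v) \<in> G (Suc (n - p ^ v))" "dmon p W z (n - p ^ v) (n - p ^ v) \<in> Units A"
      using less(1)[of "n - p ^ v"] less.prems le n by auto
    have "q_binomial A (q [^] p) n (p ^ v) \<in> Units A" unfolding \<theta>_qb v_def using pval_qb_vp[OF n] by (intro \<theta>_unit) auto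
    then show ?thesis using G_mult[OF z(1) d(1)] le z(2) d(2) unfolding eq by simp
  qed
qed

lemma dcomb_G:
  assumes M: "\<And>n. n < N \<Longrightarrow> M n \<in> G (Suc n)" and a: "\<And>n. a n \<in> carrier A"
  shows "dcomb W (omega_const A) M a N \<in> G N"
  using M
proof (induction N)
  case 0
  then show ?case using W.zero_closed by (simp add: G_def zero_W)
next
  case (Suc N)
  then have "dcomb W (omega_const A) M a N \<in> G N" "M N \<in> G (Suc N)" by auto
  moreover from this have c: "dcomb W (omega_const A) M a N \<in> carrier W" "M N \<in> carrier W" using G_D by blast+
  moreover have "dcomb W (omega_const A) M a N \<oplus>\<^bsub>W\<^esub> omega_const A (a N) \<otimes>\<^bsub>W\<^esub> M N \<in> carrier W"
    using c a[of N] by (intro W.a_closed W.m_closed const_closed)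
  moreover have "(dcomb W (omega_const A) M a N \<oplus>\<^bsub>W\<^esub> omega_const A (a N) \<otimes>\<^bsub>W\<^esub> M N) n = \<zero>" if "Suc N \<le> n" for n
  proof -
    have "dcomb W (omega_const A) M a N n = \<zero>" "M N n = \<zero>"
      using G_D(2)[OF calculation(1), of n] G_D(2)[OF calculation(2), of n] that by simp_all
    then show ?thesis using a[of N] c by (simp add: const_mult add_W)
  qed
  ultimately show ?case by (simp add: G_def)
qed

text \<open>Triangularity with invertible diagonal: a multiple of \<open>M N\<close> cancels the
  coefficient in degree N, and what remains has lower degree.\<close>

lemma dcomb_surj:
  assumes M: "\<And>n. M n \<in> G (Suc n) \<and> M n n \<in> Units A"
  shows "s \<in> G N \<Longrightarrow> \<exists>a. (\<forall>n. a n \<in> carrier A) \<and> s = dcomb W (omega_const A) M a N"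
proof (induction N arbitrary: s)
  case 0
  then have "s = \<zero>\<^bsub>W\<^esub>" by (auto simp: G_def zero_W)
  then show ?case by (intro exI[of _ "\<lambda>_. \<zero>"]) simp
next
  case (Suc N)
  let ?u = "inv (M N N)"
  define b where "b = s N \<otimes> ?u"
  have s: "s \<in> carrier W" and Mc: "M N \<in> carrier W" using Suc.prems M[of N] G_D by blast+
  have u: "?u \<in> carrier A" "?u \<otimes> M N N = \<one>" using M[of N] by auto
  have b: "b \<in> carrier A" "b \<otimes> M N N = s N" unfolding b_def using u s Mc by (auto simp: A.m_assoc)
  let ?t = "omega_const A b \<otimes>\<^bsub>W\<^esub> M N"
  have t: "?t \<in> carrier W" using b Mc by (intro W.m_closed const_closed)
  have t': "?t = (\<lambda>n. b \<otimes> M N n)" using b Mc by (simp add: const_mult)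
  have dt: "(s \<ominus>\<^bsub>W\<^esub> ?t) n = s n \<ominus> b \<otimes> M N n" for n
    unfolding diff_W[OF s t] by (subst t') (rule refl)
  have "s \<ominus>\<^bsub>W\<^esub> ?t \<in> G N"
  proof -
    have "(s \<ominus>\<^bsub>W\<^esub> ?t) n = \<zero>" if "N \<le> n" for n
    proof (cases "n = N")
      case True
      then show ?thesis unfolding dt using s b by (simp add: A.minus_eq A.r_neg)
    next
      case False
      then have "s n = \<zero>" "M N n = \<zero>" using that G_D(2)[OF Suc.prems, of n] G_D(2)[of "M N" "Suc N" n] M[of N] by auto
      then show ?thesis unfolding dt using s b by (simp add: A.minus_eq)
    qed
    then show ?thesis using s t by (simp add: G_def)
  qed
  then obtain a where a: "\<And>n. a n \<in> carrier A" "s \<ominus>\<^bsub>W\<^esub> ?t = dcomb W (omega_const A) M a N" using Suc.IH by blast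
  let ?a = "\<lambda>n. if n = N then b else a n"
  have "dcomb W (omega_const A) M ?a k = dcomb W (omega_const A) M a k" if "k \<le> N" for k
    using that by (induction k) auto
  then have "dcomb W (omega_const A) M ?a (Suc N) = (s \<ominus>\<^bsub>W\<^esub> ?t) \<oplus>\<^bsub>W\<^esub> ?t" using a by simp
  also have "\<dots> = s" using s t by (simp add: W.diff_add_cancel)
  finally show ?case using a b by (intro exI[of _ ?a]) auto
qed

text \<open>The coefficient in the top degree is a(N) times a unit, so a(N) vanishes and the
  argument descends.\<close>

lemma dcomb_inj:
  assumes M: "\<And>n. M n \<in> G (Suc n) \<and> M n n \<in> Units A" and a: "\<And>n. a n \<in> carrier A"
  shows "dcomb W (omega_const A) M a N = \<zero>\<^bsub>W\<^esub> \<Longrightarrow> n < N \<Longrightarrow> a n = \<zero>"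
proof (induction N)
  case (Suc N)
  let ?d = "dcomb W (omega_const A) M a N"
  have d: "?d \<in> G N" using M a by (intro dcomb_G) auto
  have Mc: "M N \<in> carrier W" using M[of N] G_D by blast
  have "(?d \<oplus>\<^bsub>W\<^esub> omega_const A (a N) \<otimes>\<^bsub>W\<^esub> M N) N = \<zero>" using Suc.prems(1) by (simp add: zero_W)
  then have "a N \<otimes> M N N = \<zero>" using G_D(2)[OF d, of N] a Mc by (simp add: add_W const_mult)
  then have "(a N \<otimes> M N N) \<otimes> inv (M N N) = \<zero>" using M[of N] by simp
  then have aN: "a N = \<zero>" using M[of N] a Mc by (simp add: A.m_assoc)
  have "?d = \<zero>\<^bsub>W\<^esub>" using Suc.prems(1) aN Mc G_D(1)[OF d] by simp
  then show ?case using Suc aN by (cases "n = N") auto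
qed simp

text \<open>The step from k to k + 1 multiplies the leading coefficient by the q^p-binomial of (k+1)
  p^j over p^j, whose valuation at q = 1 is that of k + 1. Up to exponent p only the last step
  contributes, and it contributes exactly one.\<close>

lemma pow_lead:
  assumes y: "y \<in> G (Suc (p ^ j))" and k: "k \<le> p"
  shows "y [^]\<^bsub>W\<^esub> k \<in> G (Suc (k * p ^ j)) \<and>
    (\<exists>\<mu>\<in>Loc p. pval (if k = p then 1 else 0) (ev \<mu>) \<and> (y [^]\<^bsub>W\<^esub> k) (k * p ^ j) = y (p ^ j) [^] k \<otimes> \<theta> \<mu>)"
  using k
proof (induction k)
  case 0
  have "\<one>\<^bsub>W\<^esub> \<in> carrier W" by simp
  then show ?case using p_gt_0 pval_1 \<theta>.hom_one by (auto simp: G_def one_W intro!: bexI[of _ 1])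
next
  case (Suc k)
  have yc: "y \<in> carrier W" using y G_D by blast
  obtain \<mu> where \<mu>: "\<mu> \<in> Loc p" "pval 0 (ev \<mu>)" "(y [^]\<^bsub>W\<^esub> k) (k * p ^ j) = y (p ^ j) [^] k \<otimes> \<theta> \<mu>"
    and yk: "y [^]\<^bsub>W\<^esub> k \<in> G (Suc (k * p ^ j))" using Suc by auto
  have eq: "y [^]\<^bsub>W\<^esub> Suc k = y \<otimes>\<^bsub>W\<^esub> y [^]\<^bsub>W\<^esub> k" using yc by (simp add: W.m_comm)
  have s: "p ^ j + k * p ^ j = Suc k * p ^ j" "p ^ j * Suc k = Suc k * p ^ j" by simp_all
  let ?\<mu> = "\<mu> * qb (Suc k * p ^ j) (p ^ j)"
  have "vp (Suc k) = (if Suc k = p then 1 else 0)"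
  proof (cases "Suc k = p")
    case True
    then show ?thesis using vp_pow[of 1] by simp
  next
    case False
    then have "\<not> p dvd Suc k" using Suc.prems dvd_imp_le[of p "Suc k"] by auto
    then show ?thesis using False not_dvd_imp_multiplicity_0 by simp
  qed
  then have "pval (if Suc k = p then 1 else 0) (ev ?\<mu>)"
    using pval_mult[OF \<mu>(2) pval_qb[of "Suc k" j]] \<mu>(1) s(2) by (simp del: mult_Suc mult_Suc_right)
  moreover have "(y [^]\<^bsub>W\<^esub> Suc k) (Suc k * p ^ j) = y (p ^ j) [^] Suc k \<otimes> \<theta> ?\<mu>"
    using G_mult(2)[OF y yk] yc \<mu>(1) \<theta>.hom_mult[of \<mu> "qb (Suc k * p ^ j) (p ^ j)"]
    unfolding eq s(1) \<mu>(3) \<theta>_qb by (simp add: A.m_ac del: mult_Suc)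
  moreover have "?\<mu> \<in> Loc p" using \<mu>(1) by simp
  moreover have "y [^]\<^bsub>W\<^esub> Suc k \<in> G (Suc (Suc k * p ^ j))" using G_mult(1)[OF y yk] unfolding eq s(1) .
  ultimately show ?case by blast
qed

text \<open>In Z_k^p = c Z_(k+1) + lower terms, the left side has degree at most p^(k+1), and
  cancelling c by \<open>reg\<close> bounds the degree of Z_(k+1). In that degree c times the
  leading coefficient equals e^p \<mu>; \<open>div\<close> places the quotient in the localization,
  and it is a unit there since c and \<mu> both have valuation one at q = 1.\<close>

theorem iterated_delta_lead:
  assumes lift: "rank_one_lift p W \<delta>W A \<delta>A \<theta> (omega_const A) x (basis (Suc 0))"
    and reg: "\<And>c a. c \<in> Loc p \<Longrightarrow> c \<noteq> 0 \<Longrightarrow> a \<in> carrier A \<Longrightarrow> \<theta> c \<otimes> a = \<zero> \<Longrightarrow> a = \<zero>"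
    and div: "\<And>c a b. c \<in> Loc p \<Longrightarrow> c \<noteq> 0 \<Longrightarrow> a \<in> carrier A \<Longrightarrow> b \<in> Loc p \<Longrightarrow> \<theta> c \<otimes> a = \<theta> b \<Longrightarrow>
       \<exists>b'\<in>Loc p. a = \<theta> b' \<and> c * b' = b"
  shows "(\<delta>W ^^ j) (basis (Suc 0)) \<in> G (Suc (p ^ j)) \<and>
    (\<exists>e\<in>Loc p. pval 0 (ev e) \<and> (\<delta>W ^^ j) (basis (Suc 0)) (p ^ j) = \<theta> e)"
proof -
  interpret r: rank_one_lift p W \<delta>W A \<delta>A \<theta> "omega_const A" x "basis (Suc 0)" by (rule lift)
  have "r.Zs j \<in> G (Suc (p ^ j)) \<and> (\<exists>e\<in>Loc p. pval 0 (ev e) \<and> r.Zs j (p ^ j) = \<theta> e)"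
  proof (induction j rule: less_induct)
    case (less j)
    show ?case
    proof (cases j)
      case 0
      have "r.Zs 0 = basis (Suc 0)" unfolding r.Zs_def by simp
      moreover have "basis (Suc 0) \<in> G (Suc 1)" using basis_closed[of 1] by (auto simp: G_def basis_def)
      moreover have "basis (Suc 0) 1 = \<theta> 1" using \<theta>.hom_one by (simp add: basis_def)
      ultimately show ?thesis using 0 pval_1 by (auto intro!: bexI[of _ 1])
    next
      case (Suc k)
      define P where "P = p ^ Suc k"
      obtain c where c: "c \<in> Loc p" "pval 1 (ev c)" and rel: "r.Zs k [^]\<^bsub>W\<^esub> p \<ominus>\<^bsub>W\<^esub> r.\<iota> c \<otimes>\<^bsub>W\<^esub> r.Zs (Suc k) \<in> r.F P"
        using r.Rel_all[of k] unfolding r.Rel_def P_def by blast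
      have c0: "c \<noteq> 0" using c(2) p_gt_0 unfolding pval_def by auto
      have IH: "r.Zs i \<in> G (Suc (p ^ i)) \<and> (\<exists>e\<in>Loc p. pval 0 (ev e) \<and> r.Zs i (p ^ i) = \<theta> e)" if "i \<le> k" for i
        using less that Suc by simp
      \<comment> \<open>Digit monomials of index below P involve only Z_0, ..., Z_k, whose leading
        terms are known by induction, so here the filtration by index is contained in the filtration
        by degree.\<close>
      have Mlead: "r.M n \<in> G (Suc n)" if "n < P" for n
      proof -
        have "r.Zs i \<in> G (Suc (p ^ i)) \<and> r.Zs i (p ^ i) \<in> Units A" if "p ^ i < P" for i
        proof -
          have "i \<le> k" using that prime_ge_2_nat[OF prime_p] unfolding P_def
            by (simp add: power_strict_increasing_iff del: power_Suc)
          then show ?thesis using IH[of i] \<theta>_unit by auto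
        qed
        then show ?thesis using dmon_lead[of P r.Zs n] that unfolding r.M_def by blast
      qed
      have FG: "r.F P \<subseteq> G P"
        unfolding r.F_def using dcomb_G[of P r.M] Mlead by auto
      obtain e where e: "e \<in> Loc p" "pval 0 (ev e)" "r.Zs k (p ^ k) = \<theta> e" and Zk: "r.Zs k \<in> G (Suc (p ^ k))" using IH[of k] by blast
      obtain \<mu> where \<mu>: "\<mu> \<in> Loc p" "pval 1 (ev \<mu>)" "(r.Zs k [^]\<^bsub>W\<^esub> p) P = \<theta> e [^] p \<otimes> \<theta> \<mu>"
        and Zp: "r.Zs k [^]\<^bsub>W\<^esub> p \<in> G (Suc P)"
        using pow_lead[OF Zk order_refl] e(3) unfolding P_def by auto
      have zc: "r.Zs (Suc k) \<in> carrier W" "r.Zs k [^]\<^bsub>W\<^esub> p \<in> carrier W" by auto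
      let ?b = "r.\<iota> c \<otimes>\<^bsub>W\<^esub> r.Zs (Suc k)"
      have b: "?b \<in> carrier W" unfolding r.\<iota>_def using zc c(1) by (intro W.m_closed const_closed) auto
      have bn: "?b n = \<theta> c \<otimes> r.Zs (Suc k) n" for n
        using zc c(1) const_mult[of "\<theta> c" "r.Zs (Suc k)"] by (simp add: r.\<iota>_def)
      have relG: "r.Zs k [^]\<^bsub>W\<^esub> p \<ominus>\<^bsub>W\<^esub> ?b \<in> G P" using rel FG by blast
      have eq: "(r.Zs k [^]\<^bsub>W\<^esub> p) n \<ominus> \<theta> c \<otimes> r.Zs (Suc k) n = \<zero>" if "P \<le> n" for n
        using G_D(2)[OF relG that] unfolding diff_W[OF zc(2) b] bn .
      then have eq: "\<theta> c \<otimes> r.Zs (Suc k) n = (r.Zs k [^]\<^bsub>W\<^esub> p) n" if "P \<le> n" for n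
        using that zc c(1) A.diff_zero_iff[of "(r.Zs k [^]\<^bsub>W\<^esub> p) n" "\<theta> c \<otimes> r.Zs (Suc k) n"] by auto
      have "r.Zs (Suc k) n = \<zero>" if "n > P" for n
        using eq[of n] G_D(2)[OF Zp, of n] that reg[OF c(1) c0] zc by simp
      then have ZG: "r.Zs (Suc k) \<in> G (Suc P)" using zc by (auto simp: G_def)
      have "\<theta> c \<otimes> r.Zs (Suc k) P = \<theta> (e ^ p * \<mu>)"
        unfolding eq[OF order_refl] \<mu>(3) using e(1) \<mu>(1) \<theta>.hom_mult[of "e ^ p" \<mu>] \<theta>.hom_pow[of e p] by simp
      then obtain b where b: "b \<in> Loc p" "r.Zs (Suc k) P = \<theta> b" "c * b = e ^ p * \<mu>"
        using div[OF c(1) c0, of "r.Zs (Suc k) P" "e ^ p * \<mu>"] zc e \<mu> by auto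
      have "ev c * ev b = ev e ^ p * ev \<mu>"
        unfolding ev_mult[OF c(1) b(1), symmetric] b(3) using e(1) \<mu>(1) by simp
      moreover have "ev c \<noteq> 0" using c(2) p_gt_0 unfolding pval_def by auto
      ultimately have evb: "ev b = (ev e ^ p * ev \<mu>) / ev c" by (simp add: field_simps)
      have "pval (1 + 0) (ev e ^ p * ev \<mu>)" using pval_mult[OF pval_power[OF e(2), of p] \<mu>(2)] by simp
      then have "pval 0 (ev b)" unfolding evb by (rule pval_divide[OF _ c(2)])
      then show ?thesis using b ZG unfolding Suc P_def by blast
    qed
  qed
  then show ?thesis unfolding r.Zs_def .
qed

end

section \<open>Transport of structure\<close>

text \<open>Conjugation by a bijection onto the image. It moves a delta-ring into the type over
  which the naturality hypothesis quantifies.\<close>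

lemma image_ring_delta:
  assumes S: "delta_ring p S \<delta>S" and inj: "inj_on \<iota> (carrier S)"
  defines "T \<equiv> image_ring \<iota> S" and "\<kappa> \<equiv> inv_into (carrier S) \<iota>"
  shows "delta_ring p T (\<lambda>t. \<iota> (\<delta>S (\<kappa> t)))"
    and "delta_hom S \<delta>S T (\<lambda>t. \<iota> (\<delta>S (\<kappa> t))) \<iota>" and "delta_hom T (\<lambda>t. \<iota> (\<delta>S (\<kappa> t))) S \<delta>S \<kappa>"
    and "carrier T = \<iota> ` carrier S"
proof -
  interpret S: delta_ring p S \<delta>S by (rule S)
  have iso: "\<iota> \<in> ring_iso S T" unfolding T_def by (rule inj_imp_image_ring_iso[OF inj])
  then have iso': "\<kappa> \<in> ring_iso T S" unfolding \<kappa>_def by (rule ring_iso_set_sym[OF S.ring_axioms])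
  show car: "carrier T = \<iota> ` carrier S" unfolding T_def by (rule image_ring_carrier)
  have "cring (T \<lparr> zero := \<iota> \<zero>\<^bsub>S\<^esub> \<rparr>)" by (rule S.ring_iso_imp_img_cring[OF iso])
  then have T: "cring T" unfolding T_def by (simp add: image_ring_def image_group_def monoid.defs)
  interpret T: cring T by (rule T)
  have hom: "\<iota> \<in> ring_hom S T" and hom': "\<kappa> \<in> ring_hom T S" using iso iso' unfolding ring_iso_def by auto
  interpret h: ring_hom_cring S T \<iota> by unfold_locales (rule hom)
  interpret k: ring_hom_cring T S \<kappa> by unfold_locales (rule hom')
  have k\<iota>: "\<kappa> (\<iota> s) = s" if "s \<in> carrier S" for s unfolding \<kappa>_def using inj that by simp
  have \<iota>k: "\<iota> (\<kappa> t) = t" if "t \<in> carrier T" for t unfolding \<kappa>_def using that car by (simp add: f_inv_into_f)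
  show "delta_ring p T (\<lambda>t. \<iota> (\<delta>S (\<kappa> t)))"
  proof (rule delta_ringI_cross[OF T])
    fix a b assume ab: "a \<in> carrier T" "b \<in> carrier T"
    note cl = k.hom_closed[OF ab(1)] k.hom_closed[OF ab(2)] S.delta_closed[OF k.hom_closed[OF ab(1)]] S.delta_closed[OF k.hom_closed[OF ab(2)]]
      S.cross_closed[OF k.hom_closed[OF ab(1)] k.hom_closed[OF ab(2)]]
    have "cross p T a b = \<iota> (cross p S (\<kappa> a) (\<kappa> b))" using cl ab by (simp add: h.hom_cross \<iota>k)
    then show "\<iota> (\<delta>S (\<kappa> (a \<oplus>\<^bsub>T\<^esub> b))) = \<iota> (\<delta>S (\<kappa> a)) \<oplus>\<^bsub>T\<^esub> \<iota> (\<delta>S (\<kappa> b)) \<ominus>\<^bsub>T\<^esub> cross p T a b"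
      using cl ab by (simp add: S.delta_add_cross S.minus_eq T.minus_eq)
    show "\<iota> (\<delta>S (\<kappa> (a \<otimes>\<^bsub>T\<^esub> b))) = a [^]\<^bsub>T\<^esub> p \<otimes>\<^bsub>T\<^esub> \<iota> (\<delta>S (\<kappa> b)) \<oplus>\<^bsub>T\<^esub> b [^]\<^bsub>T\<^esub> p \<otimes>\<^bsub>T\<^esub> \<iota> (\<delta>S (\<kappa> a)) \<oplus>\<^bsub>T\<^esub>
       add_pow T p (\<iota> (\<delta>S (\<kappa> a)) \<otimes>\<^bsub>T\<^esub> \<iota> (\<delta>S (\<kappa> b)))"
      using cl ab by (simp add: S.delta_mult h.hom_add_pow \<iota>k)
  qed (use S.delta_closed S.delta_zero S.delta_one in simp_all)
  show "delta_hom S \<delta>S T (\<lambda>t. \<iota> (\<delta>S (\<kappa> t))) \<iota>" unfolding delta_hom_def using hom k\<iota> by simp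
  show "delta_hom T (\<lambda>t. \<iota> (\<delta>S (\<kappa> t))) S \<delta>S \<kappa>" unfolding delta_hom_def using hom' k\<iota> S.delta_closed by simp
qed

lemma delta_hom_trans:
  "delta_hom A \<delta>A B \<delta>B f \<Longrightarrow> delta_hom B \<delta>B C \<delta>C g \<Longrightarrow> delta_hom A \<delta>A C \<delta>C (\<lambda>a. g (f a))"
  unfolding delta_hom_def using ring_hom_trans[of f A B g C] ring_hom_closed[of f A B] by (simp add: comp_def)

lemma countable_inj:
  assumes "countable S" "infinite (UNIV :: 'b set)"
  shows "\<exists>\<iota> :: 's \<Rightarrow> 'b. inj_on \<iota> S"
proof -
  obtain f :: "nat \<Rightarrow> 'b" where f: "inj f" using infinite_countable_subset[OF assms(2)] by blast
  have "inj_on (f \<circ> to_nat_on S) S" using assms(1) f by (intro comp_inj_on inj_on_to_nat_on) (auto intro: inj_on_subset)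
  then show ?thesis by blast
qed

lemma countable_int_poly_fract: "countable (S :: int poly fract set)"
proof -
  have "(UNIV :: int poly set) = range Poly" by (metis Poly_coeffs surjI)
  then have P: "countable (UNIV :: int poly set)" by (metis countable_image countableI_type)
  have "(UNIV :: int poly fract set) = (\<lambda>(a, b). Fract a b) ` (UNIV \<times> UNIV)"
  proof (intro equalityI subsetI UNIV_I)
    fix z :: "int poly fract"
    obtain a b where "z = Fract a b" by (cases z rule: Fract_cases)
    then show "z \<in> (\<lambda>(a, b). Fract a b) ` (UNIV \<times> UNIV)" by force
  qed
  then have "countable (UNIV :: int poly fract set)" using P by (metis countable_image countable_SIGMA)
  then show ?thesis by (rule countable_subset[OF subset_UNIV])
qed

lemma countable_UP_Zq_loc: "countable (carrier (UP (Zq_loc p)))"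
proof -
  let ?g = "\<lambda>xs n. if n < length xs then xs ! n else (0 :: int poly fract)"
  have "carrier (UP (Zq_loc p)) \<subseteq> ?g ` lists UNIV"
  proof
    fix f assume "f \<in> carrier (UP (Zq_loc p))"
    then obtain n where "bound 0 n f" unfolding UP_def up_def by auto
    then have "f = ?g (map f [0..<Suc n])" by (auto simp: fun_eq_iff bound_def simp del: upt_Suc)
    then show "f \<in> ?g ` lists UNIV" by blast
  qed
  moreover have "countable (lists (UNIV :: int poly fract set))" using countable_int_poly_fract by (rule countable_lists)
  ultimately show ?thesis by (meson countable_image countable_subset)
qed

section \<open>Polynomials over a ring\<close>

lemma UP_induct [consumes 2, case_names const xi add mult]:
  assumes A: "cring A" and f: "f \<in> carrier (UP A)"
    and const: "\<And>a. a \<in> carrier A \<Longrightarrow> Q (poly_const A a)" and xi: "Q (poly_xi A)"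
    and add: "\<And>f g. f \<in> carrier (UP A) \<Longrightarrow> g \<in> carrier (UP A) \<Longrightarrow> Q f \<Longrightarrow> Q g \<Longrightarrow> Q (f \<oplus>\<^bsub>UP A\<^esub> g)"
    and mult: "\<And>f g. f \<in> carrier (UP A) \<Longrightarrow> g \<in> carrier (UP A) \<Longrightarrow> Q f \<Longrightarrow> Q g \<Longrightarrow> Q (f \<otimes>\<^bsub>UP A\<^esub> g)"
  shows "Q f"
proof -
  interpret U: UP_cring A "UP A" by (rule UP_cring.intro[OF A])
  have mon: "Q (up_ring.monom (UP A) a n)" if a: "a \<in> carrier A" for a n
  proof (induction n)
    case (Suc n)
    have "up_ring.monom (UP A) (a \<otimes>\<^bsub>A\<^esub> \<one>\<^bsub>A\<^esub>) (n + 1) = up_ring.monom (UP A) a n \<otimes>\<^bsub>UP A\<^esub> poly_xi A"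
      using a by (intro U.monom_mult) auto
    then show ?case using mult[OF _ _ Suc xi] a by simp
  qed (rule const[OF a])
  have "Q (\<Oplus>\<^bsub>UP A\<^esub> i \<in> S. up_ring.monom (UP A) (up_ring.coeff (UP A) f i) i)" if "finite S" for S
    using that
  proof (induction S rule: finite_induct)
    case empty
    then show ?case using const[of "\<zero>\<^bsub>A\<^esub>"] by simp
  next
    case (insert i S)
    have c: "up_ring.coeff (UP A) f i \<in> carrier A" for i using f by (rule U.coeff_closed)
    have "(\<Oplus>\<^bsub>UP A\<^esub> i \<in> insert i S. up_ring.monom (UP A) (up_ring.coeff (UP A) f i) i) =
      up_ring.monom (UP A) (up_ring.coeff (UP A) f i) i \<oplus>\<^bsub>UP A\<^esub> (\<Oplus>\<^bsub>UP A\<^esub> i \<in> S. up_ring.monom (UP A) (up_ring.coeff (UP A) f i) i)"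
      using insert c by (intro U.P.finsum_insert) auto
    then show ?case using add[OF _ _ mon[OF c] insert(3)] c by (auto simp: Pi_def)
  qed
  from this[of "{..deg A f}"] show ?thesis using U.up_repr[OF f] by simp
qed

lemma UP_xi_closed: "cring A \<Longrightarrow> poly_xi A \<in> carrier (UP A)"
  and UP_const_closed: "cring A \<Longrightarrow> a \<in> carrier A \<Longrightarrow> poly_const A a \<in> carrier (UP A)"
proof -
  assume A: "cring A"
  interpret U: UP_cring A "UP A" by (rule UP_cring.intro[OF A])
  show "poly_xi A \<in> carrier (UP A)" by simp
  show "a \<in> carrier A \<Longrightarrow> poly_const A a \<in> carrier (UP A)" by simp
qed

lemma UP_const_hom: "cring A \<Longrightarrow> poly_const A \<in> ring_hom A (UP A)"
proof -
  assume A: "cring A"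
  interpret U: UP_cring A "UP A" by (rule UP_cring.intro[OF A])
  show ?thesis by (rule U.const_ring_hom)
qed

lemma UP_is_cring: "cring A \<Longrightarrow> cring (UP A)"
proof -
  assume A: "cring A"
  interpret U: UP_cring A "UP A" by (rule UP_cring.intro[OF A])
  show ?thesis by (rule U.P.is_cring)
qed

lemma UP_eval:
  assumes "cring A" "cring S" "h \<in> ring_hom A S" "s \<in> carrier S"
  shows "eval A S h s \<in> ring_hom (UP A) S"
    and "\<And>a. a \<in> carrier A \<Longrightarrow> eval A S h s (poly_const A a) = h a"
    and "eval A S h s (poly_xi A) = s"
proof -
  interpret U: UP_pre_univ_prop A S h "UP A" by (rule UP_pre_univ_propI[OF assms(1-3)])
  show "eval A S h s \<in> ring_hom (UP A) S" using assms(4) by (rule U.eval_ring_hom)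
  show "\<And>a. a \<in> carrier A \<Longrightarrow> eval A S h s (poly_const A a) = h a" using assms(4) by (rule U.eval_const)
  show "eval A S h s (poly_xi A) = s" using assms(4) by (rule U.eval_monom1)
qed

lemma UP_hom_eq:
  assumes A: "cring A" and S: "cring S" and h: "h \<in> ring_hom (UP A) S" and k: "k \<in> ring_hom (UP A) S"
    and c: "\<And>a. a \<in> carrier A \<Longrightarrow> h (poly_const A a) = k (poly_const A a)" and xi: "h (poly_xi A) = k (poly_xi A)"
    and f: "f \<in> carrier (UP A)"
  shows "h f = k f"
  using A f
proof (induction rule: UP_induct)
  case (add f g)
  then show ?case using ring_hom_add[OF h] ring_hom_add[OF k] by simp
next
  case (mult f g)
  then show ?case using ring_hom_mult[OF h] ring_hom_mult[OF k] by simp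
qed (use c xi in auto)

lemma UP_delta_compat:
  assumes A: "cring A" and U: "delta_ring p (UP A) \<delta>" and S: "delta_ring p S \<delta>S" and h: "h \<in> ring_hom (UP A) S"
    and c: "\<And>a. a \<in> carrier A \<Longrightarrow> h (\<delta> (poly_const A a)) = \<delta>S (h (poly_const A a))"
    and xi: "h (\<delta> (poly_xi A)) = \<delta>S (h (poly_xi A))"
    and f: "f \<in> carrier (UP A)"
  shows "h (\<delta> f) = \<delta>S (h f)"
  using A f
proof (induction rule: UP_induct)
  case (add f g)
  then show ?case using delta_compat_add_mult(1)[OF U S h] by blast
next
  case (mult f g)
  then show ?case using delta_compat_add_mult(2)[OF U S h] by blast
qed (use c xi in auto)

section \<open>The delta-structure on polynomials over the localization\<close>

context q_loc_prime
begin

abbreviation "LX \<equiv> UP (Zq_loc p)"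

interpretation LX: UP_cring "Zq_loc p" LX by (rule UP_cring.intro[OF Zq_loc_cring])

text \<open>The Frobenius lift that makes the variable a rank one element; here
  \<open>poly_xi\<close> plays the part of the universal x.\<close>

definition phiX :: "(nat \<Rightarrow> int poly fract) \<Rightarrow> nat \<Rightarrow> int poly fract" where
  "phiX = eval (Zq_loc p) LX (\<lambda>a. poly_const (Zq_loc p) (phi a)) (poly_xi (Zq_loc p) [^]\<^bsub>LX\<^esub> p)"

lemma phiX: "phiX \<in> ring_hom LX LX"
  "a \<in> Loc p \<Longrightarrow> phiX (poly_const (Zq_loc p) a) = poly_const (Zq_loc p) (phi a)"
  "phiX (poly_xi (Zq_loc p)) = poly_xi (Zq_loc p) [^]\<^bsub>LX\<^esub> p"
proof -
  have h: "(\<lambda>a. poly_const (Zq_loc p) (phi a)) \<in> ring_hom (Zq_loc p) LX"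
    using ring_hom_trans[OF phi_hom UP_const_hom[OF Zq_loc_cring]] by (simp add: comp_def)
  have x: "poly_xi (Zq_loc p) [^]\<^bsub>LX\<^esub> p \<in> carrier LX" by (rule LX.P.nat_pow_closed[OF UP_xi_closed[OF Zq_loc_cring]])
  note e = UP_eval[OF Zq_loc_cring LX.P.is_cring h x]
  show "phiX \<in> ring_hom LX LX"
    "a \<in> Loc p \<Longrightarrow> phiX (poly_const (Zq_loc p) a) = poly_const (Zq_loc p) (phi a)"
    "phiX (poly_xi (Zq_loc p)) = poly_xi (Zq_loc p) [^]\<^bsub>LX\<^esub> p"
    unfolding phiX_def using e by auto
qed

lemma LX_const_lift: "a \<in> Loc p \<Longrightarrow>
   phiX (poly_const (Zq_loc p) a) = poly_const (Zq_loc p) a [^]\<^bsub>LX\<^esub> p \<oplus>\<^bsub>LX\<^esub> add_pow LX p (poly_const (Zq_loc p) (dl a))"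
proof -
  assume a: "a \<in> Loc p"
  interpret c: ring_hom_cring "Zq_loc p" LX "poly_const (Zq_loc p)"
    by unfold_locales (rule UP_const_hom[OF Zq_loc_cring])
  have "phi a = a [^]\<^bsub>Zq_loc p\<^esub> p \<oplus>\<^bsub>Zq_loc p\<^esub> add_pow (Zq_loc p) p (dl a)" using dl(2)[OF a] by simp
  then show ?thesis unfolding phiX(2)[OF a]
    using c.hom_add[of "a [^]\<^bsub>Zq_loc p\<^esub> p" "add_pow (Zq_loc p) p (dl a)"] c.hom_pow[OF a, of p] c.hom_add_pow[OF dl(1)[OF a], of p] a dl(1)[OF a]
    by (simp del: Zq_loc_sel Zq_loc_pow Zq_loc_add_pow)
qed

lemma phiX_lift:
  assumes "b \<in> carrier LX"
  shows "\<exists>c\<in>carrier LX. phiX b = b [^]\<^bsub>LX\<^esub> p \<oplus>\<^bsub>LX\<^esub> add_pow LX p c"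
  using Zq_loc_cring assms
proof (induction rule: UP_induct)
  case (const a)
  then show ?case using LX_const_lift dl(1) UP_const_closed[OF Zq_loc_cring] by blast
next
  case xi
  show ?case unfolding phiX(3) using UP_xi_closed[OF Zq_loc_cring] by (intro bexI[of _ "\<zero>\<^bsub>LX\<^esub>"]) auto
next
  case (add f g)
  then obtain c d where cd: "c \<in> carrier LX" "d \<in> carrier LX"
    "phiX f = f [^]\<^bsub>LX\<^esub> p \<oplus>\<^bsub>LX\<^esub> add_pow LX p c" "phiX g = g [^]\<^bsub>LX\<^esub> p \<oplus>\<^bsub>LX\<^esub> add_pow LX p d" by blast
  let ?k = "cross p LX f g"
  have k: "?k \<in> carrier LX" using add by (intro LX.P.cross_closed)
  let ?p = "add_pow LX p \<one>\<^bsub>LX\<^esub>"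
  have P: "add_pow LX p y = ?p \<otimes>\<^bsub>LX\<^esub> y" if "y \<in> carrier LX" for y using that by (rule LX.P.add_pow_eq_mult)
  have "(f \<oplus>\<^bsub>LX\<^esub> g) [^]\<^bsub>LX\<^esub> p \<oplus>\<^bsub>LX\<^esub> add_pow LX p (c \<oplus>\<^bsub>LX\<^esub> d \<ominus>\<^bsub>LX\<^esub> ?k) =
     (f [^]\<^bsub>LX\<^esub> p \<oplus>\<^bsub>LX\<^esub> g [^]\<^bsub>LX\<^esub> p \<oplus>\<^bsub>LX\<^esub> ?p \<otimes>\<^bsub>LX\<^esub> ?k) \<oplus>\<^bsub>LX\<^esub> ?p \<otimes>\<^bsub>LX\<^esub> (c \<oplus>\<^bsub>LX\<^esub> d \<ominus>\<^bsub>LX\<^esub> ?k)"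
    using add(1,2) k cd(1,2) LX.P.power_sum_cross[OF prime_p add(1,2)] P[OF k] P[of "c \<oplus>\<^bsub>LX\<^esub> d \<ominus>\<^bsub>LX\<^esub> ?k"] by simp
  also have "\<dots> = f [^]\<^bsub>LX\<^esub> p \<oplus>\<^bsub>LX\<^esub> g [^]\<^bsub>LX\<^esub> p \<oplus>\<^bsub>LX\<^esub> (?p \<otimes>\<^bsub>LX\<^esub> ?k \<oplus>\<^bsub>LX\<^esub> ?p \<otimes>\<^bsub>LX\<^esub> (c \<oplus>\<^bsub>LX\<^esub> d \<ominus>\<^bsub>LX\<^esub> ?k))"
    using add(1,2) k cd(1,2) by (simp add: LX.P.a_assoc)
  also have "?p \<otimes>\<^bsub>LX\<^esub> ?k \<oplus>\<^bsub>LX\<^esub> ?p \<otimes>\<^bsub>LX\<^esub> (c \<oplus>\<^bsub>LX\<^esub> d \<ominus>\<^bsub>LX\<^esub> ?k) = ?p \<otimes>\<^bsub>LX\<^esub> (c \<oplus>\<^bsub>LX\<^esub> d)"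
  proof -
    have "?p \<otimes>\<^bsub>LX\<^esub> ?k \<oplus>\<^bsub>LX\<^esub> ?p \<otimes>\<^bsub>LX\<^esub> (c \<oplus>\<^bsub>LX\<^esub> d \<ominus>\<^bsub>LX\<^esub> ?k) = ?p \<otimes>\<^bsub>LX\<^esub> (c \<oplus>\<^bsub>LX\<^esub> d \<ominus>\<^bsub>LX\<^esub> ?k \<oplus>\<^bsub>LX\<^esub> ?k)"
      using k cd(1,2) by (simp add: LX.P.r_distr[symmetric] LX.P.a_comm)
    then show ?thesis using k cd(1,2) by (simp add: LX.P.diff_add_cancel)
  qed
  finally have "phiX (f \<oplus>\<^bsub>LX\<^esub> g) = (f \<oplus>\<^bsub>LX\<^esub> g) [^]\<^bsub>LX\<^esub> p \<oplus>\<^bsub>LX\<^esub> add_pow LX p (c \<oplus>\<^bsub>LX\<^esub> d \<ominus>\<^bsub>LX\<^esub> ?k)"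
    using add(1,2) cd(1,2) ring_hom_add[OF phiX(1) add(1,2)]
    unfolding cd(3,4) P[OF cd(1)] P[OF cd(2)] by (simp add: LX.P.r_distr LX.P.a_ac)
  then show ?case using cd k by blast
next
  case (mult f g)
  then obtain c d where cd: "c \<in> carrier LX" "d \<in> carrier LX"
    "phiX f = f [^]\<^bsub>LX\<^esub> p \<oplus>\<^bsub>LX\<^esub> add_pow LX p c" "phiX g = g [^]\<^bsub>LX\<^esub> p \<oplus>\<^bsub>LX\<^esub> add_pow LX p d" by blast
  let ?p = "add_pow LX p \<one>\<^bsub>LX\<^esub>"
  have P: "add_pow LX p y = ?p \<otimes>\<^bsub>LX\<^esub> y" if "y \<in> carrier LX" for y using that by (rule LX.P.add_pow_eq_mult)
  let ?e = "f [^]\<^bsub>LX\<^esub> p \<otimes>\<^bsub>LX\<^esub> d \<oplus>\<^bsub>LX\<^esub> (c \<otimes>\<^bsub>LX\<^esub> g [^]\<^bsub>LX\<^esub> p \<oplus>\<^bsub>LX\<^esub> ?p \<otimes>\<^bsub>LX\<^esub> (c \<otimes>\<^bsub>LX\<^esub> d))"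
  have e: "?e \<in> carrier LX" using mult(1,2) cd(1,2) by simp
  have "phiX (f \<otimes>\<^bsub>LX\<^esub> g) = phiX f \<otimes>\<^bsub>LX\<^esub> phiX g" using ring_hom_mult[OF phiX(1) mult(1,2)] .
  also have "\<dots> = (f \<otimes>\<^bsub>LX\<^esub> g) [^]\<^bsub>LX\<^esub> p \<oplus>\<^bsub>LX\<^esub> ?p \<otimes>\<^bsub>LX\<^esub> ?e"
    unfolding cd(3,4) P[OF cd(1)] P[OF cd(2)] using mult(1,2) cd(1,2)
    by (simp add: LX.P.nat_pow_distrib LX.P.l_distr LX.P.r_distr LX.P.m_ac LX.P.a_ac)
  finally have "phiX (f \<otimes>\<^bsub>LX\<^esub> g) = (f \<otimes>\<^bsub>LX\<^esub> g) [^]\<^bsub>LX\<^esub> p \<oplus>\<^bsub>LX\<^esub> add_pow LX p ?e" using P[OF e] by simp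
  then show ?case using e by blast
qed

definition dlX :: "(nat \<Rightarrow> int poly fract) \<Rightarrow> nat \<Rightarrow> int poly fract" where
  "dlX b = (SOME c. c \<in> carrier LX \<and> phiX b = b [^]\<^bsub>LX\<^esub> p \<oplus>\<^bsub>LX\<^esub> add_pow LX p c)"

lemma dlX: "b \<in> carrier LX \<Longrightarrow> dlX b \<in> carrier LX"
  "b \<in> carrier LX \<Longrightarrow> phiX b = b [^]\<^bsub>LX\<^esub> p \<oplus>\<^bsub>LX\<^esub> add_pow LX p (dlX b)"
  using someI_ex[of "\<lambda>c. c \<in> carrier LX \<and> phiX b = b [^]\<^bsub>LX\<^esub> p \<oplus>\<^bsub>LX\<^esub> add_pow LX p c"] phiX_lift[of b]
  unfolding dlX_def by blast+

lemma LX_carrier: "carrier LX = up (Zq_loc p)" and LX_zero: "\<zero>\<^bsub>LX\<^esub> = (\<lambda>_. 0)"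
  and LX_add: "f \<in> carrier LX \<Longrightarrow> g \<in> carrier LX \<Longrightarrow> f \<oplus>\<^bsub>LX\<^esub> g = (\<lambda>n. f n + g n)"
  by (simp_all add: UP_def)

lemma LX_add_pow: "b \<in> carrier LX \<Longrightarrow> add_pow LX (k::nat) b = (\<lambda>n. of_nat k * b n)"
proof (induction k)
  case (Suc k)
  have "add_pow LX (Suc k) b = add_pow LX k b \<oplus>\<^bsub>LX\<^esub> b" using Suc.prems by (rule LX.P.add_pow_Suc')
  also have "\<dots> = (\<lambda>n. add_pow LX k b n + b n)" using Suc.prems by (intro LX_add LX.P.add_pow_nat_closed)
  finally show ?case using Suc by (simp add: algebra_simps)
qed (simp add: LX_zero)

lemma LX_torsion_free: "b \<in> carrier LX \<Longrightarrow> add_pow LX p b = \<zero>\<^bsub>LX\<^esub> \<Longrightarrow> b = \<zero>\<^bsub>LX\<^esub>"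
proof -
  assume b: "b \<in> carrier LX" "add_pow LX p b = \<zero>\<^bsub>LX\<^esub>"
  then have "\<And>n. of_nat p * b n = 0" unfolding LX_add_pow[OF b(1)] LX_zero by meson
  then show ?thesis using of_nat_p_nz unfolding LX_zero by auto
qed

lemma LX_delta_ring: "delta_ring p LX dlX"
  by (rule delta_ring_of_frobenius_lift[OF LX.P.is_cring prime_p LX_torsion_free phiX(1) dlX])

lemma dlX_unique:
  assumes "b \<in> carrier LX" "c \<in> carrier LX" "phiX b = b [^]\<^bsub>LX\<^esub> p \<oplus>\<^bsub>LX\<^esub> add_pow LX p c"
  shows "dlX b = c"
proof -
  have "b [^]\<^bsub>LX\<^esub> p \<oplus>\<^bsub>LX\<^esub> add_pow LX p (dlX b) = b [^]\<^bsub>LX\<^esub> p \<oplus>\<^bsub>LX\<^esub> add_pow LX p c"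
    using assms(3) dlX(2)[OF assms(1)] by simp
  then have "add_pow LX p (dlX b) = add_pow LX p c" using assms(1,2) dlX(1)[OF assms(1)]
    by (metis LX.P.add_diff_cancel LX.P.add_pow_nat_closed LX.P.nat_pow_closed)
  then have "\<And>n. of_nat p * dlX b n = of_nat p * c n"
    unfolding LX_add_pow[OF dlX(1)[OF assms(1)]] LX_add_pow[OF assms(2)] by meson
  then show ?thesis using of_nat_p_nz by auto
qed

lemma dlX_const: "a \<in> Loc p \<Longrightarrow> dlX (poly_const (Zq_loc p) a) = poly_const (Zq_loc p) (dl a)"
  by (rule dlX_unique[OF _ _ LX_const_lift]) (use dl UP_const_closed[OF Zq_loc_cring] in auto)

lemma dlX_xi: "dlX (poly_xi (Zq_loc p)) = \<zero>\<^bsub>LX\<^esub>"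
  by (rule dlX_unique) (use UP_xi_closed[OF Zq_loc_cring] phiX(3) in auto)

lemma LX_const_mult: "c \<in> Loc p \<Longrightarrow> a \<in> carrier LX \<Longrightarrow> poly_const (Zq_loc p) c \<otimes>\<^bsub>LX\<^esub> a = (\<lambda>n. c * a n)"
  unfolding LX.monom_mult_is_smult by (simp add: UP_def)

lemma LX_const_eq: "poly_const (Zq_loc p) c = (\<lambda>n. if n = 0 then c else 0)" if "c \<in> Loc p"
  using that by (auto simp: UP_def)

text \<open>Initiality of the localization with one rank one variable: compatibility with delta is
  tested on constants and on the variable, where it is the assumption on \<theta> and the vanishing
  of \<delta>(x).\<close>

lemma LX_eval_hom:
  assumes A: "delta_ring p A \<delta>A" and \<theta>: "delta_hom (Zq_loc p) dl A \<delta>A \<theta>" and x: "x \<in> carrier A" "\<delta>A x = \<zero>\<^bsub>A\<^esub>"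
  shows "delta_hom LX dlX A \<delta>A (eval (Zq_loc p) A \<theta> x)"
proof -
  interpret A: delta_ring p A \<delta>A by (rule A)
  have h: "\<theta> \<in> ring_hom (Zq_loc p) A" using \<theta> unfolding delta_hom_def by blast
  note e = UP_eval[OF Zq_loc_cring A.is_cring h x(1)]
  have z: "eval (Zq_loc p) A \<theta> x \<zero>\<^bsub>LX\<^esub> = \<zero>\<^bsub>A\<^esub>"
    by (rule ring_hom_zero[OF e(1) LX.P.ring_axioms A.ring_axioms])
  show ?thesis unfolding delta_hom_def
  proof (intro conjI ballI)
    fix f assume f: "f \<in> carrier LX"
    show "eval (Zq_loc p) A \<theta> x (dlX f) = \<delta>A (eval (Zq_loc p) A \<theta> x f)"
    proof (rule UP_delta_compat[OF Zq_loc_cring LX_delta_ring A e(1) _ _ f])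
      fix a assume a: "a \<in> Loc p"
      show "eval (Zq_loc p) A \<theta> x (dlX (poly_const (Zq_loc p) a)) = \<delta>A (eval (Zq_loc p) A \<theta> x (poly_const (Zq_loc p) a))"
        unfolding dlX_const[OF a] e(2)[OF a] e(2)[OF dl(1)[OF a]] using \<theta> a by (simp add: delta_hom_def)
    next
      show "eval (Zq_loc p) A \<theta> x (dlX (poly_xi (Zq_loc p))) = \<delta>A (eval (Zq_loc p) A \<theta> x (poly_xi (Zq_loc p)))"
        unfolding dlX_xi e(3) z x(2) by simp
    qed
  qed (rule e(1))
qed

end

section \<open>The blowing up and the consequences of naturality\<close>

context omega
begin

lemma q_number_eq: "q_number A q p = \<theta> fq"
  unfolding fq_def by (subst \<theta>.hom_q_number) auto

lemma fq_basis: "(\<lambda>n. if n = 1 then q_number A q p else \<zero>) = omega_const A (\<theta> fq) \<otimes>\<^bsub>W\<^esub> basis (Suc 0)"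
proof -
  have "omega_const A (\<theta> fq) \<otimes>\<^bsub>W\<^esub> basis (Suc 0) = (\<lambda>n. \<theta> fq \<otimes> basis (Suc 0) n)"
    by (rule const_mult) auto
  then show ?thesis unfolding q_number_eq by (auto simp: basis_def fun_eq_iff)
qed

lemma blowing_up_hom: "blowing_up p A q x \<in> ring_hom (UP A) W"
  and blowing_up_const: "a \<in> carrier A \<Longrightarrow> blowing_up p A q x (poly_const A a) = omega_const A a"
  and blowing_up_xi: "blowing_up p A q x (poly_xi A) = omega_const A (\<theta> fq) \<otimes>\<^bsub>W\<^esub> basis (Suc 0)"
proof -
  have c: "omega_const A (\<theta> fq) \<otimes>\<^bsub>W\<^esub> basis (Suc 0) \<in> carrier W" by (intro W.m_closed const_closed basis_closed) simp
  note e = UP_eval[OF A.is_cring W_cring const_hom c]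
  show "blowing_up p A q x \<in> ring_hom (UP A) W"
    "a \<in> carrier A \<Longrightarrow> blowing_up p A q x (poly_const A a) = omega_const A a"
    "blowing_up p A q x (poly_xi A) = omega_const A (\<theta> fq) \<otimes>\<^bsub>W\<^esub> basis (Suc 0)"
    unfolding blowing_up_def fq_basis using e by auto
qed

end

text \<open>\<delta>(\<xi>) is determined by \<delta>(x) and by the vanishing at x + \<xi>. The
  naturality hypothesis speaks of some symmetric structure, and uniqueness identifies it with the
  given one.\<close>

lemma symmetric_delta_unique:
  assumes A: "cring A" and x: "x \<in> carrier A" and s: "symmetric_delta p A \<delta>A x \<delta>" "symmetric_delta p A \<delta>A x \<delta>'"
    and f: "f \<in> carrier (UP A)"
  shows "\<delta> f = \<delta>' f"
proof -
  have d: "delta_ring p (UP A) \<delta>" "delta_ring p (UP A) \<delta>'" using s unfolding symmetric_delta_def by auto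
  have i: "(\<lambda>f. f) \<in> ring_hom (UP A) (UP A)" by (simp add: ring_hom_def)
  have c: "\<delta> (poly_const A a) = \<delta>' (poly_const A a)" if "a \<in> carrier A" for a
    using s that unfolding symmetric_delta_def by simp
  have "\<delta> (poly_xi A) = \<delta>' (poly_xi A)"
    using delta_compat_cancel[OF d i UP_const_closed[OF A x] UP_xi_closed[OF A]] c[OF x] s
    unfolding symmetric_delta_def by simp
  then show ?thesis using UP_delta_compat[OF A d i _ _ f] c by simp
qed

context q_loc_prime
begin

lemma datum_\<theta>:
  assumes "q_datum p R \<delta>R \<eta> A \<delta>A \<rho> x"
  shows "delta_hom (Zq_loc p) dl R \<delta>R \<eta>" "delta_hom (Zq_loc p) dl A \<delta>A (\<lambda>z. \<rho> (\<eta> z))"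
proof -
  have R: "delta_ring p R \<delta>R" "\<eta> \<in> ring_hom (Zq_loc p) R" "\<delta>R (\<eta> q_loc) = \<zero>\<^bsub>R\<^esub>"
    and \<rho>: "delta_hom R \<delta>R A \<delta>A \<rho>" using assms unfolding q_datum_def q_delta_ring_def delta_algebra_def by auto
  show \<eta>: "delta_hom (Zq_loc p) dl R \<delta>R \<eta>" unfolding delta_hom_def using R(2) dl_compat[OF R] by blast
  show "delta_hom (Zq_loc p) dl A \<delta>A (\<lambda>z. \<rho> (\<eta> z))" by (rule delta_hom_trans[OF \<eta> \<rho>])
qed

text \<open>The blowing up transports two facts from A[\<xi>]: constants commute with delta, and the
  rank one element x + \<xi> goes to x + (p)_q \<omega>. These are the conditions of
  \<open>rank_one_lift\<close> for \<omega>.\<close>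

theorem natural_lift:
  assumes dat: "q_datum p R \<delta>R \<eta> A \<delta>A \<rho> x" and nat: "natural_omega_delta p \<Delta>"
  defines "\<theta> \<equiv> \<lambda>z. \<rho> (\<eta> z)" and "\<delta>W \<equiv> \<Delta> R \<delta>R \<eta> A \<delta>A \<rho> x"
  shows "omega p A \<theta> x"
    and "rank_one_lift p (Omega p A (\<theta> q_loc) x) \<delta>W A \<delta>A \<theta> (omega_const A) x (omega.basis A (Suc 0))"
    and "symmetric_delta p A \<delta>A x \<delta>\<xi> \<Longrightarrow> delta_hom (UP A) \<delta>\<xi> (Omega p A (\<theta> q_loc) x) \<delta>W (blowing_up p A (\<theta> q_loc) x)"
proof -
  have A: "delta_ring p A \<delta>A" and x: "x \<in> carrier A" "\<delta>A x = \<zero>\<^bsub>A\<^esub>"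
    using dat unfolding q_datum_def delta_algebra_def rank_one_def by auto
  interpret A: delta_ring p A \<delta>A by (rule A)
  have \<theta>: "delta_hom (Zq_loc p) dl A \<delta>A \<theta>" unfolding \<theta>_def by (rule datum_\<theta>(2)[OF dat])
  let ?W = "Omega p A (\<theta> q_loc) x"
  from nat dat have nw: "delta_ring p ?W \<delta>W \<and> (\<exists>\<delta>\<xi>. symmetric_delta p A \<delta>A x \<delta>\<xi> \<and>
       delta_hom (UP A) \<delta>\<xi> ?W \<delta>W (blowing_up p A (\<theta> q_loc) x))"
    unfolding natural_omega_delta_def Let_def \<theta>_def \<delta>W_def by blast
  then obtain \<delta>0 where W: "delta_ring p ?W \<delta>W" and d0: "symmetric_delta p A \<delta>A x \<delta>0" "delta_hom (UP A) \<delta>0 ?W \<delta>W (blowing_up p A (\<theta> q_loc) x)"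
    by blast
  interpret W: delta_ring p ?W \<delta>W by (rule W)
  have "\<theta> \<in> ring_hom (Zq_loc p) A" using \<theta> unfolding delta_hom_def by blast
  then show om: "omega p A \<theta> x"
    using x(1) by (intro omega.intro omega_axioms.intro q_loc_prime_axioms A.is_cring W.is_cring)
  then interpret o: omega p A \<theta> x .
  have bu: "delta_hom (UP A) \<delta>' ?W \<delta>W (blowing_up p A (\<theta> q_loc) x)" if "symmetric_delta p A \<delta>A x \<delta>'" for \<delta>'
    using d0(2) symmetric_delta_unique[OF A.is_cring x(1) that d0(1)] unfolding delta_hom_def by simp
  show "symmetric_delta p A \<delta>A x \<delta>\<xi> \<Longrightarrow> delta_hom (UP A) \<delta>\<xi> ?W \<delta>W (blowing_up p A (\<theta> q_loc) x)" by (rule bu)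
  have "omega_const A (\<delta>A a) = \<delta>W (omega_const A a)" if a: "a \<in> carrier A" for a
  proof -
    have "blowing_up p A (\<theta> q_loc) x (\<delta>0 (poly_const A a)) = \<delta>W (blowing_up p A (\<theta> q_loc) x (poly_const A a))"
      using d0(2) UP_const_closed[OF A.is_cring a] unfolding delta_hom_def by blast
    moreover have "\<delta>0 (poly_const A a) = poly_const A (\<delta>A a)" using d0(1) a unfolding symmetric_delta_def by blast
    ultimately show ?thesis using o.blowing_up_const a A.delta_closed by simp
  qed
  then have \<kappa>: "delta_hom A \<delta>A ?W \<delta>W (omega_const A)" unfolding delta_hom_def using o.const_hom by blast
  have "\<delta>W (omega_const A x \<oplus>\<^bsub>?W\<^esub> omega_const A (\<theta> fq) \<otimes>\<^bsub>?W\<^esub> o.basis (Suc 0)) = \<zero>\<^bsub>?W\<^esub>"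
  proof -
    interpret U: cring "UP A" by (rule UP_is_cring[OF A.is_cring])
    let ?b = "blowing_up p A (\<theta> q_loc) x" and ?y = "poly_const A x \<oplus>\<^bsub>UP A\<^esub> poly_xi A"
    have c: "poly_const A x \<in> carrier (UP A)" "poly_xi A \<in> carrier (UP A)"
      using UP_const_closed[OF A.is_cring x(1)] UP_xi_closed[OF A.is_cring] by auto
    have "?b ?y = omega_const A x \<oplus>\<^bsub>?W\<^esub> omega_const A (\<theta> fq) \<otimes>\<^bsub>?W\<^esub> o.basis (Suc 0)"
      using ring_hom_add[OF o.blowing_up_hom c] o.blowing_up_const[OF x(1)] o.blowing_up_xi by simp
    moreover have "?b (\<delta>0 ?y) = \<delta>W (?b ?y)" using d0(2) U.a_closed[OF c] unfolding delta_hom_def by blast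
    moreover have "\<delta>0 ?y = \<zero>\<^bsub>UP A\<^esub>" using d0(1) unfolding symmetric_delta_def by blast
    moreover have "?b \<zero>\<^bsub>UP A\<^esub> = \<zero>\<^bsub>?W\<^esub>" by (rule ring_hom_zero[OF o.blowing_up_hom U.ring_axioms W.ring_axioms])
    ultimately show ?thesis by simp
  qed
  then show "rank_one_lift p ?W \<delta>W A \<delta>A \<theta> (omega_const A) x (o.basis (Suc 0))"
    using x A \<theta> \<kappa> o.basis_closed by (intro rank_one_lift.intro rank_one_lift_axioms.intro q_loc_prime_axioms W)
qed

text \<open>The naturality hypothesis only speaks about rings carried by the types \<open>'r\<close> and \<open>'a\<close>, so the
  localization and its polynomial ring, which are countable, are transported into these types.\<close>

lemma universal_datum:
  assumes infr: "infinite (UNIV :: 'r set)" and infa: "infinite (UNIV :: 'a set)"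
    and dat: "q_datum p (R :: 'r ring) \<delta>R \<eta> (A :: 'a ring) \<delta>A \<rho> x"
  shows "\<exists>(R0 :: 'r ring) \<delta>R0 \<eta>0 (A0 :: 'a ring) \<delta>A0 \<rho>0 x0 f g.
    q_datum p R0 \<delta>R0 \<eta>0 A0 \<delta>A0 \<rho>0 x0 \<and> q_datum_hom p R0 \<delta>R0 \<eta>0 A0 \<delta>A0 \<rho>0 x0 R \<delta>R \<eta> A \<delta>A \<rho> x f g \<and>
    (\<forall>c a. c \<in> Loc p \<longrightarrow> c \<noteq> 0 \<longrightarrow> a \<in> carrier A0 \<longrightarrow> \<rho>0 (\<eta>0 c) \<otimes>\<^bsub>A0\<^esub> a = \<zero>\<^bsub>A0\<^esub> \<longrightarrow> a = \<zero>\<^bsub>A0\<^esub>) \<and>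
    (\<forall>c a b. c \<in> Loc p \<longrightarrow> c \<noteq> 0 \<longrightarrow> a \<in> carrier A0 \<longrightarrow> b \<in> Loc p \<longrightarrow> \<rho>0 (\<eta>0 c) \<otimes>\<^bsub>A0\<^esub> a = \<rho>0 (\<eta>0 b) \<longrightarrow>
       (\<exists>b'\<in>Loc p. a = \<rho>0 (\<eta>0 b') \<and> c * b' = b))"
proof -
  have A: "delta_ring p A \<delta>A" and x: "x \<in> carrier A" "\<delta>A x = \<zero>\<^bsub>A\<^esub>"
    using dat unfolding q_datum_def delta_algebra_def rank_one_def by auto
  obtain \<iota>R :: "int poly fract \<Rightarrow> 'r" where \<iota>R: "inj_on \<iota>R (Loc p)"
    using countable_inj[OF countable_int_poly_fract infr] by blast
  obtain \<iota>A :: "(nat \<Rightarrow> int poly fract) \<Rightarrow> 'a" where \<iota>A: "inj_on \<iota>A (carrier LX)"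
    using countable_inj[OF countable_UP_Zq_loc infa] by blast
  define \<kappa>R where "\<kappa>R = inv_into (Loc p) \<iota>R"
  define \<kappa>A where "\<kappa>A = inv_into (carrier LX) \<iota>A"
  define R0 where "R0 = image_ring \<iota>R (Zq_loc p)"
  define A0 where "A0 = image_ring \<iota>A LX"
  define \<delta>R0 where "\<delta>R0 = (\<lambda>t. \<iota>R (dl (\<kappa>R t)))"
  define \<delta>A0 where "\<delta>A0 = (\<lambda>t. \<iota>A (dlX (\<kappa>A t)))"
  have Ldr: "delta_ring p (Zq_loc p) dl"
    by (rule delta_ring_of_frobenius_lift[OF Zq_loc_cring prime_p _ phi_hom]) (use dl of_nat_p_nz in auto)
  note TR = image_ring_delta[OF Ldr \<iota>R, folded \<kappa>R_def, folded R0_def \<delta>R0_def]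
  note TA = image_ring_delta[OF LX_delta_ring \<iota>A, folded \<kappa>A_def, folded A0_def \<delta>A0_def]
  interpret R0: delta_ring p R0 \<delta>R0 by (rule TR(1))
  interpret A0: delta_ring p A0 \<delta>A0 by (rule TA(1))
  interpret LXr: delta_ring p LX dlX by (rule LX_delta_ring)
  have \<iota>Rh: "\<iota>R \<in> ring_hom (Zq_loc p) R0" and \<iota>Ah: "\<iota>A \<in> ring_hom LX A0" using TR(2) TA(2) unfolding delta_hom_def by auto
  have \<kappa>\<iota>R: "\<kappa>R (\<iota>R z) = z" if "z \<in> Loc p" for z using that \<iota>R by (simp add: \<kappa>R_def)
  have \<kappa>\<iota>A: "\<kappa>A (\<iota>A z) = z" if "z \<in> carrier LX" for z using that \<iota>A by (simp add: \<kappa>A_def)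
  have xi: "poly_xi (Zq_loc p) \<in> carrier LX" by (rule UP_xi_closed[OF Zq_loc_cring])
  have const: "poly_const (Zq_loc p) z \<in> carrier LX" if "z \<in> Loc p" for z by (rule UP_const_closed[OF Zq_loc_cring that])
  have \<iota>A0: "\<iota>A \<zero>\<^bsub>LX\<^esub> = \<zero>\<^bsub>A0\<^esub>" by (rule ring_hom_zero[OF \<iota>Ah LXr.ring_axioms A0.ring_axioms])
  have \<iota>R0: "\<iota>R 0 = \<zero>\<^bsub>R0\<^esub>" using ring_hom_zero[OF \<iota>Rh L.ring_axioms R0.ring_axioms] by simp
  let ?\<rho> = "\<lambda>r. \<iota>A (poly_const (Zq_loc p) (\<kappa>R r))"
  let ?x = "\<iota>A (poly_xi (Zq_loc p))"
  let ?h = "eval (Zq_loc p) A (\<lambda>z. \<rho> (\<eta> z)) x"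
  let ?f = "\<lambda>r. \<eta> (\<kappa>R r)" and ?g = "\<lambda>a. ?h (\<kappa>A a)"
  have \<theta>0: "?\<rho> (\<iota>R z) = \<iota>A (poly_const (Zq_loc p) z)" if "z \<in> Loc p" for z using \<kappa>\<iota>R[OF that] by simp
  have ch: "delta_hom (Zq_loc p) dl LX dlX (poly_const (Zq_loc p))"
    unfolding delta_hom_def using UP_const_hom[OF Zq_loc_cring] dlX_const by simp
  have dat0: "q_datum p R0 \<delta>R0 \<iota>R A0 \<delta>A0 ?\<rho> ?x"
    unfolding q_datum_def q_delta_ring_def delta_algebra_def rank_one_def
  proof (intro conjI)
    show "\<delta>R0 (\<iota>R q_loc) = \<zero>\<^bsub>R0\<^esub>" unfolding \<delta>R0_def using \<kappa>\<iota>R[OF Loc_q] dl_q \<iota>R0 by simp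
    show "delta_hom R0 \<delta>R0 A0 \<delta>A0 ?\<rho>" by (rule delta_hom_trans[OF TR(3) delta_hom_trans[OF ch TA(2)]])
    show "?x \<in> carrier A0" using xi TA(4) by blast
    show "\<delta>A0 ?x = \<zero>\<^bsub>A0\<^esub>" unfolding \<delta>A0_def \<kappa>\<iota>A[OF xi] dlX_xi by (rule \<iota>A0)
  qed (rule TR(1) TA(1) \<iota>Rh)+
  have h: "delta_hom LX dlX A \<delta>A ?h" by (rule LX_eval_hom[OF A datum_\<theta>(2)[OF dat] x])
  have Ac: "cring A" using A by (rule delta_ring.axioms)
  have "(\<lambda>z. \<rho> (\<eta> z)) \<in> ring_hom (Zq_loc p) A" using datum_\<theta>(2)[OF dat] unfolding delta_hom_def by blast
  note e = UP_eval[OF Zq_loc_cring Ac this x(1)]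
  have hom0: "q_datum_hom p R0 \<delta>R0 \<iota>R A0 \<delta>A0 ?\<rho> ?x R \<delta>R \<eta> A \<delta>A \<rho> x ?f ?g"
    unfolding q_datum_hom_def
  proof (intro conjI ballI)
    show "delta_hom R0 \<delta>R0 R \<delta>R ?f" by (rule delta_hom_trans[OF TR(3) datum_\<theta>(1)[OF dat]])
    show "delta_hom A0 \<delta>A0 A \<delta>A ?g" by (rule delta_hom_trans[OF TA(3) h])
    show "\<eta> (\<kappa>R (\<iota>R z)) = \<eta> z" if "z \<in> Loc p" for z using \<kappa>\<iota>R[OF that] by simp
    show "?g ?x = x" unfolding \<kappa>\<iota>A[OF xi] by (rule e(3))
    fix r assume "r \<in> carrier R0"
    then have "\<kappa>R r \<in> Loc p" unfolding TR(4) using \<kappa>\<iota>R by auto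
    then show "?g (?\<rho> r) = \<rho> (?f r)" using \<kappa>\<iota>A[OF const] e(2) by simp
  qed
  have mult: "?\<rho> (\<iota>R c) \<otimes>\<^bsub>A0\<^esub> \<iota>A a = \<iota>A (\<lambda>n. c * a n)" "(\<lambda>n. c * a n) \<in> carrier LX" if "c \<in> Loc p" "a \<in> carrier LX" for c a
    using ring_hom_mult[OF \<iota>Ah const[OF that(1)] that(2)] LXr.m_closed[OF const[OF that(1)] that(2)]
    unfolding \<theta>0[OF that(1)] LX_const_mult[OF that] by simp_all
  \<comment> \<open>Scalars act on coefficients, which lie in a field: a nonzero c can be cancelled,
    and if c times a polynomial is constant then so is the polynomial.\<close>
  have reg: "a = \<zero>\<^bsub>A0\<^esub>" if H: "c \<in> Loc p" "c \<noteq> 0" "a \<in> carrier A0" "?\<rho> (\<iota>R c) \<otimes>\<^bsub>A0\<^esub> a = \<zero>\<^bsub>A0\<^esub>" for c a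
  proof -
    obtain a' where a': "a' \<in> carrier LX" "a = \<iota>A a'" using H(3) TA(4) by blast
    have "\<iota>A (\<lambda>n. c * a' n) = \<iota>A \<zero>\<^bsub>LX\<^esub>" using H(4) mult[OF H(1) a'(1)] a'(2) \<iota>A0 by simp
    then have "(\<lambda>n. c * a' n) = \<zero>\<^bsub>LX\<^esub>" using inj_onD[OF \<iota>A] mult(2)[OF H(1) a'(1)] LXr.zero_closed by blast
    then have "a' = \<zero>\<^bsub>LX\<^esub>" using H(2) unfolding LX_zero by (metis mult_eq_0_iff)
    then show ?thesis using a'(2) \<iota>A0 by simp
  qed
  have div: "\<exists>b'\<in>Loc p. a = ?\<rho> (\<iota>R b') \<and> c * b' = b"
    if H: "c \<in> Loc p" "c \<noteq> 0" "a \<in> carrier A0" "b \<in> Loc p" "?\<rho> (\<iota>R c) \<otimes>\<^bsub>A0\<^esub> a = ?\<rho> (\<iota>R b)" for c a b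
  proof -
    obtain a' where a': "a' \<in> carrier LX" "a = \<iota>A a'" using H(3) TA(4) by blast
    have "\<iota>A (\<lambda>n. c * a' n) = \<iota>A (poly_const (Zq_loc p) b)"
      using H(5) mult(1)[OF H(1) a'(1)] a'(2) \<theta>0[OF H(4)] by simp
    then have "(\<lambda>n. c * a' n) = poly_const (Zq_loc p) b"
      using inj_onD[OF \<iota>A] mult(2)[OF H(1) a'(1)] const[OF H(4)] by blast
    then have eq: "c * a' n = (if n = 0 then b else 0)" for n unfolding LX_const_eq[OF H(4)] by meson
    have a0: "a' 0 \<in> Loc p" using a'(1) unfolding LX_carrier by auto
    have "a' n = 0" if "n \<noteq> 0" for n using eq[of n] that \<open>c \<noteq> 0\<close> by simp
    then have "a' = poly_const (Zq_loc p) (a' 0)" unfolding LX_const_eq[OF a0] by auto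
    then show ?thesis using a0 a'(2) \<theta>0[OF a0] eq[of 0] by (intro bexI[of _ "a' 0"]) auto
  qed
  show ?thesis using dat0 hom0 reg div by blast
qed

text \<open>In a finite ring two powers of f = (p)_q coincide, and cancellation gives f^(d+1) = 1.
  But 1 - f^(d+1) has value 1 - p^(d+1) at q = 1 and comes from a unit of the localization, so a
  unit is zero.\<close>

lemma finite_regular_trivial:
  assumes B: "cring B" and \<theta>: "\<theta> \<in> ring_hom (Zq_loc p) B" and fin: "finite (carrier B)"
    and reg: "\<And>b. b \<in> carrier B \<Longrightarrow> \<theta> fq \<otimes>\<^bsub>B\<^esub> b = \<zero>\<^bsub>B\<^esub> \<Longrightarrow> b = \<zero>\<^bsub>B\<^esub>"
  shows "\<one>\<^bsub>B\<^esub> = \<zero>\<^bsub>B\<^esub>"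
proof -
  interpret B: cring B by (rule B)
  interpret \<theta>: ring_hom_cring "Zq_loc p" B \<theta> by unfold_locales (rule \<theta>)
  let ?f = "\<theta> fq"
  have "\<not> inj (\<lambda>n::nat. ?f [^]\<^bsub>B\<^esub> n)"
  proof
    assume "inj (\<lambda>n::nat. ?f [^]\<^bsub>B\<^esub> n)"
    moreover have "range (\<lambda>n::nat. ?f [^]\<^bsub>B\<^esub> n) \<subseteq> carrier B" by auto
    ultimately show False using fin finite_subset range_inj_infinite by blast
  qed
  then obtain i j :: nat where ij: "i < j" "?f [^]\<^bsub>B\<^esub> i = ?f [^]\<^bsub>B\<^esub> j"
    unfolding inj_def by (metis linorder_neqE_nat)
  obtain d where d: "j = i + Suc d" using ij(1) less_imp_Suc_add by auto
  have f: "?f \<in> carrier B" by simp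
  have cancel: "b = \<zero>\<^bsub>B\<^esub>" if "b \<in> carrier B" "?f [^]\<^bsub>B\<^esub> k \<otimes>\<^bsub>B\<^esub> b = \<zero>\<^bsub>B\<^esub>" for k :: nat and b
    using that
  proof (induction k arbitrary: b)
    case (Suc k)
    have "?f [^]\<^bsub>B\<^esub> k \<otimes>\<^bsub>B\<^esub> (?f \<otimes>\<^bsub>B\<^esub> b) = ?f [^]\<^bsub>B\<^esub> Suc k \<otimes>\<^bsub>B\<^esub> b"
      using Suc.prems(1) f by (simp add: B.m_assoc)
    then have "?f \<otimes>\<^bsub>B\<^esub> b = \<zero>\<^bsub>B\<^esub>"
      using Suc.IH[OF B.m_closed[OF f Suc.prems(1)]] Suc.prems(2) by argo
    then show ?case by (rule reg[OF Suc.prems(1)])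
  qed simp
  let ?b = "\<one>\<^bsub>B\<^esub> \<ominus>\<^bsub>B\<^esub> ?f [^]\<^bsub>B\<^esub> Suc d"
  have "?f [^]\<^bsub>B\<^esub> i \<otimes>\<^bsub>B\<^esub> ?b = ?f [^]\<^bsub>B\<^esub> i \<ominus>\<^bsub>B\<^esub> ?f [^]\<^bsub>B\<^esub> j"
    using f unfolding d B.nat_pow_mult[OF f, symmetric] by (simp add: B.minus_eq B.r_distr B.r_minus)
  also have "\<dots> = \<zero>\<^bsub>B\<^esub>" using ij(2) f by (simp add: B.minus_eq B.r_neg)
  finally have e: "?f [^]\<^bsub>B\<^esub> i \<otimes>\<^bsub>B\<^esub> ?b = \<zero>\<^bsub>B\<^esub>" .
  have b0: "?b = \<zero>\<^bsub>B\<^esub>" by (rule cancel[OF _ e]) (use f in simp)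
  let ?z = "1 - fq ^ Suc d"
  have z: "?z \<in> Loc p" by simp
  have "\<theta> ?z = ?b"
  proof -
    have pw: "\<theta> (fq ^ Suc d) = ?f [^]\<^bsub>B\<^esub> Suc d"
      using \<theta>.hom_pow[OF fq_closed, of "Suc d"] unfolding Zq_loc_pow .
    show ?thesis unfolding pw[symmetric]
      using \<theta>.hom_add[of 1 "- (fq ^ Suc d)"] \<theta>.hom_a_inv[of "fq ^ Suc d"] \<theta>.hom_one
      by (simp add: B.minus_eq del: power_Suc)
  qed
  then have z0: "\<theta> ?z = \<zero>\<^bsub>B\<^esub>" using b0 by simp
  have "ev ?z = 1 + of_nat p * (- (of_nat p ^ d))" by (simp add: ev_fq)
  moreover have "pint (- (of_nat p ^ d))" using pint_uminus[OF pint_of_int[of "int p ^ d"]] by simp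
  ultimately have "pval 0 (ev ?z)" using pval_add_p_pint[OF pval_1] by metis
  note w = Loc_unit[OF z this]
  have "\<one>\<^bsub>B\<^esub> = \<theta> (?z * inverse ?z)" using w(2) \<theta>.hom_one by simp
  also have "\<dots> = \<theta> ?z \<otimes>\<^bsub>B\<^esub> \<theta> (inverse ?z)" using \<theta>.hom_mult[of ?z "inverse ?z"] z w(1) by simp
  finally show ?thesis using z0 w(1) by simp
qed

text \<open>If A is zero, zero is a unit. Otherwise \<open>finite_regular_trivial\<close>, applied
  to R or to A, makes both types infinite, so the universal datum fits into them. The leading
  coefficient is computed there and carried to A by the map on coefficients.\<close>

theorem omega_delta_lead:
  assumes dat: "q_datum p (R :: 'r ring) \<delta>R \<eta> (A :: 'a ring) \<delta>A \<rho> x" and nat: "natural_omega_delta p \<Delta>"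
    and Rb: "bounded_algebra p R (\<eta> q_loc)" and Ab: "bounded_algebra p A (\<rho> (\<eta> q_loc))"
  shows "(\<Delta> R \<delta>R \<eta> A \<delta>A \<rho> x ^^ j) (omega.basis A (Suc 0)) \<in> omega.G p A (\<lambda>z. \<rho> (\<eta> z)) x (Suc (p ^ j)) \<and>
    (\<Delta> R \<delta>R \<eta> A \<delta>A \<rho> x ^^ j) (omega.basis A (Suc 0)) (p ^ j) \<in> Units A"
proof -
  define \<theta> where "\<theta> = (\<lambda>z. \<rho> (\<eta> z))"
  define \<delta>W where "\<delta>W = \<Delta> R \<delta>R \<eta> A \<delta>A \<rho> x"
  have lift: "omega p A \<theta> x" "rank_one_lift p (Omega p A (\<theta> q_loc) x) \<delta>W A \<delta>A \<theta> (omega_const A) x (omega.basis A (Suc 0))"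
    using natural_lift(1,2)[OF dat nat] unfolding \<theta>_def \<delta>W_def by auto
  interpret o: omega p A \<theta> x by (rule lift(1))
  interpret r: rank_one_lift p o.W \<delta>W A \<delta>A \<theta> "omega_const A" x "o.basis (Suc 0)" by (rule lift(2))
  have Zc: "(\<delta>W ^^ j) (o.basis (Suc 0)) \<in> carrier o.W" for j using r.Zs_closed unfolding r.Zs_def .
  have Rd: "delta_ring p R \<delta>R" and \<eta>: "\<eta> \<in> ring_hom (Zq_loc p) R" and \<rho>: "\<rho> \<in> ring_hom R A"
    using dat unfolding q_datum_def q_delta_ring_def delta_algebra_def delta_hom_def by auto
  interpret R: delta_ring p R \<delta>R by (rule Rd)
  interpret \<eta>: ring_hom_cring "Zq_loc p" R \<eta> by unfold_locales (rule \<eta>)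
  interpret \<rho>: ring_hom_cring R A \<rho> by unfold_locales (rule \<rho>)
  have \<eta>fq: "\<eta> fq = q_number R (\<eta> q_loc) p" unfolding fq_def by (rule \<eta>.hom_q_number) simp
  have triv: "\<one>\<^bsub>A\<^esub> = \<zero>\<^bsub>A\<^esub>" if "finite (UNIV :: 'r set) \<or> finite (UNIV :: 'a set)"
    using that
  proof
    assume "finite (UNIV :: 'r set)"
    then have "finite (carrier R)" using finite_subset subset_UNIV by blast
    then have "\<one>\<^bsub>R\<^esub> = \<zero>\<^bsub>R\<^esub>"
      by (rule finite_regular_trivial[OF R.is_cring \<eta>]) (use Rb \<eta>fq in \<open>simp add: bounded_algebra_def\<close>)
    then show ?thesis using \<rho>.hom_one \<rho>.hom_zero by simp
  next
    assume "finite (UNIV :: 'a set)"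
    then have "finite (carrier A)" using finite_subset subset_UNIV by blast
    then show ?thesis
      by (rule finite_regular_trivial[OF o.A.is_cring o.\<theta>]) (use Ab o.q_number_eq in \<open>simp add: bounded_algebra_def \<theta>_def\<close>)
  qed
  have "(\<delta>W ^^ j) (o.basis (Suc 0)) \<in> o.G (Suc (p ^ j)) \<and> (\<delta>W ^^ j) (o.basis (Suc 0)) (p ^ j) \<in> Units A"
  proof (cases "\<one>\<^bsub>A\<^esub> = \<zero>\<^bsub>A\<^esub>")
    case True
    then have c: "carrier A = {\<zero>\<^bsub>A\<^esub>}" by (rule o.A.one_zeroD)
    have "(\<delta>W ^^ j) (o.basis (Suc 0)) n = \<zero>\<^bsub>A\<^esub>" for n using o.W_coeff[OF Zc[of j], of n] c by simp
    moreover have "\<zero>\<^bsub>A\<^esub> \<in> Units A" using True o.A.Units_one_closed by simp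
    ultimately show ?thesis using Zc[of j] by (simp add: o.G_def)
  next
    case False
    then have inf: "infinite (UNIV :: 'r set)" "infinite (UNIV :: 'a set)" using triv by auto
    obtain R0 :: "'r ring" and \<delta>R0 \<eta>0 and A0 :: "'a ring" and \<delta>A0 \<rho>0 x0 f g where
      dat0: "q_datum p R0 \<delta>R0 \<eta>0 A0 \<delta>A0 \<rho>0 x0"
      and hom0: "q_datum_hom p R0 \<delta>R0 \<eta>0 A0 \<delta>A0 \<rho>0 x0 R \<delta>R \<eta> A \<delta>A \<rho> x f g"
      and reg: "\<forall>c a. c \<in> Loc p \<longrightarrow> c \<noteq> 0 \<longrightarrow> a \<in> carrier A0 \<longrightarrow> \<rho>0 (\<eta>0 c) \<otimes>\<^bsub>A0\<^esub> a = \<zero>\<^bsub>A0\<^esub> \<longrightarrow> a = \<zero>\<^bsub>A0\<^esub>"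
      and div: "\<forall>c a b. c \<in> Loc p \<longrightarrow> c \<noteq> 0 \<longrightarrow> a \<in> carrier A0 \<longrightarrow> b \<in> Loc p \<longrightarrow> \<rho>0 (\<eta>0 c) \<otimes>\<^bsub>A0\<^esub> a = \<rho>0 (\<eta>0 b) \<longrightarrow>
       (\<exists>b'\<in>Loc p. a = \<rho>0 (\<eta>0 b') \<and> c * b' = b)"
      using universal_datum[OF inf dat] by (elim exE conjE) (rule that)
    define \<theta>0 where "\<theta>0 = (\<lambda>z. \<rho>0 (\<eta>0 z))"
    define \<delta>W0 where "\<delta>W0 = \<Delta> R0 \<delta>R0 \<eta>0 A0 \<delta>A0 \<rho>0 x0"
    have lift0: "omega p A0 \<theta>0 x0" "rank_one_lift p (Omega p A0 (\<theta>0 q_loc) x0) \<delta>W0 A0 \<delta>A0 \<theta>0 (omega_const A0) x0 (omega.basis A0 (Suc 0))"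
      using natural_lift(1,2)[OF dat0 nat] unfolding \<theta>0_def \<delta>W0_def by auto
    interpret o0: omega p A0 \<theta>0 x0 by (rule lift0(1))
    interpret r0: rank_one_lift p o0.W \<delta>W0 A0 \<delta>A0 \<theta>0 "omega_const A0" x0 "o0.basis (Suc 0)" by (rule lift0(2))
    have g: "delta_hom A0 \<delta>A0 A \<delta>A g" and g\<rho>: "\<forall>r\<in>carrier R0. g (\<rho>0 r) = \<rho> (f r)" and f\<eta>: "\<forall>z\<in>Loc p. f (\<eta>0 z) = \<eta> z"
      using hom0 unfolding q_datum_hom_def by auto
    have gh: "g \<in> ring_hom A0 A" using g unfolding delta_hom_def by blast
    interpret g: ring_hom_cring A0 A g by unfold_locales (rule gh)
    have \<eta>0: "\<eta>0 \<in> ring_hom (Zq_loc p) R0" using dat0 unfolding q_datum_def q_delta_ring_def by blast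
    have g\<theta>: "g (\<theta>0 z) = \<theta> z" if "z \<in> Loc p" for z
      using g\<rho> f\<eta> that ring_hom_closed[OF \<eta>0] by (simp add: \<theta>0_def \<theta>_def)
    have nh: "delta_hom o0.W \<delta>W0 o.W \<delta>W (\<lambda>s n. g (s n))"
      unfolding \<theta>0_def \<theta>_def \<delta>W0_def \<delta>W_def
      by (rule conjunct2[OF nat[unfolded natural_omega_delta_def], rule_format], rule conjI, rule dat0, rule conjI, rule dat, rule hom0)
    have Z0c: "(\<delta>W0 ^^ j) (o0.basis (Suc 0)) \<in> carrier o0.W" for j using r0.Zs_closed unfolding r0.Zs_def .
    \<comment> \<open>The induced map sends \<omega> to \<omega> and commutes with delta, hence maps
      iterates to iterates.\<close>
    have Zeq: "(\<delta>W ^^ j) (o.basis (Suc 0)) = (\<lambda>n. g ((\<delta>W0 ^^ j) (o0.basis (Suc 0)) n))" for j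
    proof (induction j)
      case 0
      show ?case unfolding o.basis_def o0.basis_def by (auto simp: fun_eq_iff)
    next
      case (Suc j)
      have "(\<lambda>n. g (\<delta>W0 ((\<delta>W0 ^^ j) (o0.basis (Suc 0))) n)) = \<delta>W (\<lambda>n. g ((\<delta>W0 ^^ j) (o0.basis (Suc 0)) n))"
        using nh Z0c[of j] unfolding delta_hom_def by blast
      then show ?case using Suc by simp
    qed
    have "(\<delta>W0 ^^ j) (o0.basis (Suc 0)) \<in> o0.G (Suc (p ^ j)) \<and>
      (\<exists>e\<in>Loc p. pval 0 (ev e) \<and> (\<delta>W0 ^^ j) (o0.basis (Suc 0)) (p ^ j) = \<theta>0 e)"
      using o0.iterated_delta_lead[OF lift0(2)] reg div unfolding \<theta>0_def by blast
    then obtain e where G0: "(\<delta>W0 ^^ j) (o0.basis (Suc 0)) \<in> o0.G (Suc (p ^ j))" and e: "e \<in> Loc p" "pval 0 (ev e)"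
      "(\<delta>W0 ^^ j) (o0.basis (Suc 0)) (p ^ j) = \<theta>0 e" by blast
    have "(\<delta>W ^^ j) (o.basis (Suc 0)) (p ^ j) = \<theta> e" unfolding Zeq e(3) by (rule g\<theta>[OF e(1)])
    moreover have "(\<delta>W ^^ j) (o.basis (Suc 0)) n = \<zero>\<^bsub>A\<^esub>" if "Suc (p ^ j) \<le> n" for n
      unfolding Zeq using o0.G_D(2)[OF G0 that] by simp
    ultimately show ?thesis using Zc[of j] o.\<theta>_unit[OF e(1,2)] by (simp add: o.G_def)
  qed
  then show ?thesis unfolding \<theta>_def \<delta>W_def .
qed

end

section \<open>The universal property before completion\<close>

lemma RDirProd_sel:
  "carrier (RDirProd R S) = carrier R \<times> carrier S"
  "\<zero>\<^bsub>RDirProd R S\<^esub> = (\<zero>\<^bsub>R\<^esub>, \<zero>\<^bsub>S\<^esub>)" "\<one>\<^bsub>RDirProd R S\<^esub> = (\<one>\<^bsub>R\<^esub>, \<one>\<^bsub>S\<^esub>)"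
  "a \<otimes>\<^bsub>RDirProd R S\<^esub> b = (fst a \<otimes>\<^bsub>R\<^esub> fst b, snd a \<otimes>\<^bsub>S\<^esub> snd b)"
  "a \<oplus>\<^bsub>RDirProd R S\<^esub> b = (fst a \<oplus>\<^bsub>R\<^esub> fst b, snd a \<oplus>\<^bsub>S\<^esub> snd b)"
  by (auto simp: RDirProd_def DirProd_def monoid.defs split: prod.split)

lemma RDirProd_delta_ring:
  assumes R: "delta_ring p R \<delta>R" and S: "delta_ring p S \<delta>S"
  shows "delta_ring p (RDirProd R S) (\<lambda>(r, s). (\<delta>R r, \<delta>S s))"
    and "fst \<in> ring_hom (RDirProd R S) R" and "snd \<in> ring_hom (RDirProd R S) S"
proof -
  interpret R: delta_ring p R \<delta>R by (rule R)
  interpret S: delta_ring p S \<delta>S by (rule S)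
  let ?D = "RDirProd R S"
  have "ring ?D" by (rule RDirProd_ring[OF R.ring_axioms S.ring_axioms])
  moreover have "comm_monoid ?D"
    by (rule comm_monoidI) (auto simp: RDirProd_sel R.m_ac S.m_ac)
  ultimately have D: "cring ?D" by (rule cring.intro)
  interpret D: cring ?D by (rule D)
  show f: "fst \<in> ring_hom ?D R" and s: "snd \<in> ring_hom ?D S"
    by (auto simp: ring_hom_def RDirProd_sel)
  interpret f: ring_hom_cring ?D R fst by unfold_locales (rule f)
  interpret s: ring_hom_cring ?D S snd by unfold_locales (rule s)
  show "delta_ring p ?D (\<lambda>(r, s). (\<delta>R r, \<delta>S s))"
  proof (rule delta_ringI_cross[OF D])
    fix a b assume ab: "a \<in> carrier ?D" "b \<in> carrier ?D"
    have c: "fst a \<in> carrier R" "fst b \<in> carrier R" "snd a \<in> carrier S" "snd b \<in> carrier S"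
      using ab by (auto simp: RDirProd_sel)
    have k: "cross p ?D a b \<in> carrier ?D" using ab by (rule D.cross_closed)
    have dc: "(\<delta>R (fst a), \<delta>S (snd a)) \<in> carrier ?D" "(\<delta>R (fst b), \<delta>S (snd b)) \<in> carrier ?D"
      using c R.delta_closed S.delta_closed by (auto simp: RDirProd_sel)
    let ?x = "(\<delta>R (fst a), \<delta>S (snd a)) \<oplus>\<^bsub>?D\<^esub> (\<delta>R (fst b), \<delta>S (snd b)) \<ominus>\<^bsub>?D\<^esub> cross p ?D a b"
    have "fst ?x = \<delta>R (fst a \<oplus>\<^bsub>R\<^esub> fst b)"
      using k dc c ab by (simp add: D.minus_eq f.hom_cross R.delta_add_cross R.minus_eq)
    moreover have "snd ?x = \<delta>S (snd a \<oplus>\<^bsub>S\<^esub> snd b)"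
      using k dc c ab by (simp add: D.minus_eq s.hom_cross S.delta_add_cross S.minus_eq)
    ultimately have "?x = (\<delta>R (fst a \<oplus>\<^bsub>R\<^esub> fst b), \<delta>S (snd a \<oplus>\<^bsub>S\<^esub> snd b))" by (metis prod.collapse)
    then show "(case a \<oplus>\<^bsub>?D\<^esub> b of (r, s) \<Rightarrow> (\<delta>R r, \<delta>S s)) =
       (case a of (r, s) \<Rightarrow> (\<delta>R r, \<delta>S s)) \<oplus>\<^bsub>?D\<^esub> (case b of (r, s) \<Rightarrow> (\<delta>R r, \<delta>S s)) \<ominus>\<^bsub>?D\<^esub> cross p ?D a b"
      by (simp add: case_prod_beta RDirProd_sel(5))
    let ?y = "a [^]\<^bsub>?D\<^esub> p \<otimes>\<^bsub>?D\<^esub> (\<delta>R (fst b), \<delta>S (snd b)) \<oplus>\<^bsub>?D\<^esub> b [^]\<^bsub>?D\<^esub> p \<otimes>\<^bsub>?D\<^esub> (\<delta>R (fst a), \<delta>S (snd a)) \<oplus>\<^bsub>?D\<^esub>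
      add_pow ?D p ((\<delta>R (fst a), \<delta>S (snd a)) \<otimes>\<^bsub>?D\<^esub> (\<delta>R (fst b), \<delta>S (snd b)))"
    have "fst ?y = \<delta>R (fst a \<otimes>\<^bsub>R\<^esub> fst b)"
      using dc c ab by (simp add: R.delta_mult f.hom_add_pow)
    moreover have "snd ?y = \<delta>S (snd a \<otimes>\<^bsub>S\<^esub> snd b)"
      using dc c ab by (simp add: S.delta_mult s.hom_add_pow)
    ultimately have "?y = (\<delta>R (fst a \<otimes>\<^bsub>R\<^esub> fst b), \<delta>S (snd a \<otimes>\<^bsub>S\<^esub> snd b))" by (metis prod.collapse)
    then show "(case a \<otimes>\<^bsub>?D\<^esub> b of (r, s) \<Rightarrow> (\<delta>R r, \<delta>S s)) =
       a [^]\<^bsub>?D\<^esub> p \<otimes>\<^bsub>?D\<^esub> (case b of (r, s) \<Rightarrow> (\<delta>R r, \<delta>S s)) \<oplus>\<^bsub>?D\<^esub>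
       b [^]\<^bsub>?D\<^esub> p \<otimes>\<^bsub>?D\<^esub> (case a of (r, s) \<Rightarrow> (\<delta>R r, \<delta>S s)) \<oplus>\<^bsub>?D\<^esub>
       add_pow ?D p ((case a of (r, s) \<Rightarrow> (\<delta>R r, \<delta>S s)) \<otimes>\<^bsub>?D\<^esub> (case b of (r, s) \<Rightarrow> (\<delta>R r, \<delta>S s)))"
      by (simp add: case_prod_beta RDirProd_sel(4))
  qed (auto simp: RDirProd_sel R.delta_closed S.delta_closed R.delta_zero S.delta_zero R.delta_one S.delta_one)
qed

lemma (in ring_hom_cring) hom_dmon:
  assumes z: "\<And>j. z j \<in> carrier R"
  shows "dmon p R z n \<in> carrier R \<and> h (dmon p R z n) = dmon p S (\<lambda>j. h (z j)) n"
proof (induction n rule: less_induct)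
  case (less n)
  show ?case
  proof (cases "n = 0 \<or> p = 0")
    case True
    then show ?thesis by (auto simp: dmon.simps)
  next
    case False
    then have "n - p ^ multiplicity p n < n" by simp
    then have IH: "dmon p R z (n - p ^ multiplicity p n) \<in> carrier R"
      "h (dmon p R z (n - p ^ multiplicity p n)) = dmon p S (\<lambda>j. h (z j)) (n - p ^ multiplicity p n)"
      using less by auto
    have eq: "dmon p R z n = z (multiplicity p n) \<otimes> dmon p R z (n - p ^ multiplicity p n)"
      "dmon p S (\<lambda>j. h (z j)) n = h (z (multiplicity p n)) \<otimes>\<^bsub>S\<^esub> dmon p S (\<lambda>j. h (z j)) (n - p ^ multiplicity p n)"
      using False by (subst dmon.simps, simp)+
    show ?thesis unfolding eq using IH z by simp
  qed
qed

lemma (in ring_hom_cring) hom_dcomb: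
  assumes "\<And>n. \<kappa> (a n) \<in> carrier R" "\<And>n. M n \<in> carrier R"
  shows "dcomb R \<kappa> M a N \<in> carrier R \<and> h (dcomb R \<kappa> M a N) = dcomb S (\<lambda>c. h (\<kappa> c)) (\<lambda>n. h (M n)) a N"
  using assms by (induction N) auto

locale omega_delta = omega p A \<theta> x for p and A (structure) and \<theta> x +
  fixes \<delta>W \<delta>A
  assumes lift: "rank_one_lift p W \<delta>W A \<delta>A \<theta> (omega_const A) x (basis (Suc 0))"
    and lead: "\<And>j. (\<delta>W ^^ j) (basis (Suc 0)) \<in> G (Suc (p ^ j)) \<and> (\<delta>W ^^ j) (basis (Suc 0)) (p ^ j) \<in> Units A"
begin

sublocale r: rank_one_lift p W \<delta>W A \<delta>A \<theta> "omega_const A" x "basis (Suc 0)" by (rule lift)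

lemma M_lead: "r.M n \<in> G (Suc n) \<and> r.M n n \<in> Units A"
  unfolding r.M_def using dmon_lead[of "Suc n" r.Zs n] lead unfolding r.Zs_def by blast

lemma W_dcomb: "s \<in> carrier W \<Longrightarrow> \<exists>N a. (\<forall>n. a n \<in> carrier A) \<and> s = dcomb W (omega_const A) r.M a N"
  using G_ex[of s] dcomb_surj[OF M_lead] by blast

text \<open>The digit monomials in the iterates of \<omega> span over A, and a map of delta-rings is
  determined on them by its value at \<omega>.\<close>

theorem omega_hom_unique:
  assumes C: "delta_ring p C \<delta>C" and g: "delta_hom W \<delta>W C \<delta>C g" and k: "delta_hom W \<delta>W C \<delta>C k"
    and c: "\<And>a. a \<in> carrier A \<Longrightarrow> g (omega_const A a) = k (omega_const A a)"
    and b: "g (basis (Suc 0)) = k (basis (Suc 0))" and s: "s \<in> carrier W"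
  shows "g s = k s"
proof -
  interpret C: delta_ring p C \<delta>C by (rule C)
  interpret g: ring_hom_cring W C g using g unfolding delta_hom_def by unfold_locales blast
  interpret k: ring_hom_cring W C k using k unfolding delta_hom_def by unfold_locales blast
  have Z: "g (r.Zs j) = k (r.Zs j)" for j
  proof (induction j)
    case 0
    then show ?case using b by (simp add: r.Zs_def)
  next
    case (Suc j)
    have "g (\<delta>W (r.Zs j)) = \<delta>C (g (r.Zs j))" "k (\<delta>W (r.Zs j)) = \<delta>C (k (r.Zs j))"
      using g k r.Zs_closed[of j] unfolding delta_hom_def by blast+
    then show ?case using Suc r.delta_Zs[of j] by simp
  qed
  have M: "g (r.M n) = k (r.M n)" for n
    unfolding r.M_def using g.hom_dmon[of r.Zs p n] k.hom_dmon[of r.Zs p n] Z by simp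
  obtain N a where a: "\<And>n. a n \<in> carrier A" "s = dcomb W (omega_const A) r.M a N" using W_dcomb[OF s] by blast
  have "g (dcomb W (omega_const A) r.M a N) = k (dcomb W (omega_const A) r.M a N)" for N
    by (induction N) (use a c M in auto)
  then show ?thesis using a by simp
qed

text \<open>The element x + (p)_q (\<omega>, w) has rank one in the product, so
  \<open>rank_one_lift\<close> applies there and gives closure of the span under products and delta.
  It remains to see that the span projects bijectively onto A<omega>.\<close>

theorem omega_hom_exists:
  assumes C: "delta_ring p C \<delta>C" and \<alpha>: "delta_hom A \<delta>A C \<delta>C \<alpha>" and w: "w \<in> carrier C"
    and rel: "\<delta>C (\<alpha> x \<oplus>\<^bsub>C\<^esub> \<alpha> (\<theta> fq) \<otimes>\<^bsub>C\<^esub> w) = \<zero>\<^bsub>C\<^esub>"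
  shows "\<exists>g. delta_hom W \<delta>W C \<delta>C g \<and> (\<forall>a\<in>carrier A. g (omega_const A a) = \<alpha> a) \<and> g (basis (Suc 0)) = w"
proof -
  interpret C: delta_ring p C \<delta>C by (rule C)
  let ?D = "RDirProd W C" and ?\<delta> = "\<lambda>(s, c). (\<delta>W s, \<delta>C c)"
  note D = RDirProd_delta_ring[OF r.delta_ring_axioms C]
  interpret D: delta_ring p ?D ?\<delta> by (rule D(1))
  interpret fst: ring_hom_cring ?D W fst by unfold_locales (rule D(2))
  interpret snd: ring_hom_cring ?D C snd by unfold_locales (rule D(3))
  have \<alpha>h: "\<alpha> \<in> ring_hom A C" using \<alpha> unfolding delta_hom_def by blast
  interpret \<alpha>: ring_hom_cring A C \<alpha> by unfold_locales (rule \<alpha>h)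
  let ?\<kappa> = "\<lambda>a. (omega_const A a, \<alpha> a)" and ?Z = "(basis (Suc 0), w)"
  have \<kappa>h: "?\<kappa> \<in> ring_hom A ?D"
    by (rule ring_hom_memI) (auto simp: RDirProd_sel)
  have \<kappa>: "delta_hom A \<delta>A ?D ?\<delta> ?\<kappa>"
    using \<kappa>h r.\<kappa> \<alpha> unfolding delta_hom_def by auto
  have Z: "?Z \<in> carrier ?D" using w by (simp add: RDirProd_sel)
  have "?\<delta> (?\<kappa> x \<oplus>\<^bsub>?D\<^esub> ?\<kappa> (\<theta> fq) \<otimes>\<^bsub>?D\<^esub> ?Z) = \<zero>\<^bsub>?D\<^esub>"
    using r.Z(2) rel by (simp add: RDirProd_sel)
  then have "rank_one_lift p ?D ?\<delta> A \<delta>A \<theta> ?\<kappa> x ?Z"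
    using \<kappa> Z by (intro rank_one_lift.intro rank_one_lift_axioms.intro q_loc_prime_axioms D(1) r.A_delta_ring r.\<theta> r.x)
  then interpret d: rank_one_lift p ?D ?\<delta> A \<delta>A \<theta> ?\<kappa> x ?Z .
  have fZ: "fst (d.Zs j) = r.Zs j" for j
  proof (induction j)
    case (Suc j)
    have 1: "d.Zs (Suc j) = ?\<delta> (d.Zs j)" by (rule d.delta_Zs[symmetric])
    have 2: "fst (?\<delta> y) = \<delta>W (fst y)" for y by (cases y) simp
    show ?case unfolding 1 2 Suc by (rule r.delta_Zs)
  qed (simp add: d.Zs_def r.Zs_def)
  have fM: "fst (d.M n) = r.M n" for n
    unfolding d.M_def r.M_def using fst.hom_dmon[of d.Zs p n, OF d.Zs_closed] fZ by simp
  have fcomb: "fst (dcomb ?D ?\<kappa> d.M a N) = dcomb W (omega_const A) r.M a N" if "\<And>n. a n \<in> carrier A" for a N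
    using fst.hom_dcomb[where \<kappa> = ?\<kappa> and a = a and M = d.M and N = N] d.\<kappa>.hom_closed[OF that] d.M_closed fM by simp
  define S where "S = (\<Union>N. d.F N)"
  have SI: "y \<in> d.F N \<Longrightarrow> y \<in> S" for y N unfolding S_def by blast
  have SE: "y \<in> S \<Longrightarrow> \<exists>N. y \<in> d.F N" for y unfolding S_def by blast
  have S_carrier: "y \<in> S \<Longrightarrow> y \<in> carrier ?D" for y using SE d.F_carrier by blast
  have S_add: "y \<oplus>\<^bsub>?D\<^esub> z \<in> S" if yz: "y \<in> S" "z \<in> S" for y z
  proof -
    obtain M N where "y \<in> d.F M" "z \<in> d.F N" using SE[OF yz(1)] SE[OF yz(2)] by blast
    then have "y \<in> d.F (max M N)" "z \<in> d.F (max M N)" using d.F_mono by (meson max.cobounded1 max.cobounded2)+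
    then show ?thesis using d.F_add SI by blast
  qed
  have S_mult: "y \<otimes>\<^bsub>?D\<^esub> z \<in> S" if "y \<in> S" "z \<in> S" for y z
    using that SE d.span_mult SI by blast
  have S_neg: "\<ominus>\<^bsub>?D\<^esub> y \<in> S" if "y \<in> S" for y using that SE d.F_neg SI by blast
  have S_delta: "?\<delta> y \<in> S" if yS: "y \<in> S" for y
  proof -
    obtain N where "y \<in> d.F N" using SE[OF yS] by blast
    from SI[OF d.span_delta[OF this]] show ?thesis .
  qed
  \<comment> \<open>The first component is the same combination of the digit monomials in A<omega>,
    where they are independent. All coefficients vanish, and with them the second component.\<close>
  have zero: "snd y = \<zero>\<^bsub>C\<^esub>" if yS: "y \<in> S" and y0: "fst y = \<zero>\<^bsub>W\<^esub>" for y
  proof -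
    obtain N where "y \<in> d.F N" using SE[OF yS] by blast
    then obtain a where a: "y = dcomb ?D ?\<kappa> d.M a N" "\<And>n. a n \<in> carrier A" unfolding d.F_def by blast
    have d0: "dcomb W (omega_const A) r.M a N = \<zero>\<^bsub>W\<^esub>" using fcomb[of a N, OF a(2)] a(1) y0 by simp
    have "a n = \<zero>" if "n < N" for n by (rule dcomb_inj[of r.M a N n, OF M_lead a(2) d0 that])
    then have "y = \<zero>\<^bsub>?D\<^esub>" unfolding a(1) by (rule d.dcomb_zero)
    then show ?thesis by (simp add: RDirProd_sel)
  qed
  have ex: "\<exists>c. (s, c) \<in> S" if s: "s \<in> carrier W" for s
  proof -
    obtain N a where a: "\<And>n. a n \<in> carrier A" "s = dcomb W (omega_const A) r.M a N" using W_dcomb[OF s] by blast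
    have "dcomb ?D ?\<kappa> d.M a N \<in> S" using a(1) by (intro SI[of _ N]) (auto simp: d.F_def)
    then have "(s, snd (dcomb ?D ?\<kappa> d.M a N)) \<in> S" unfolding a(2) fcomb[of a N, OF a(1), symmetric] by simp
    then show ?thesis by blast
  qed
  have uniq: "c = c'" if "(s, c) \<in> S" "(s, c') \<in> S" for s c c'
  proof -
    have cc: "s \<in> carrier W" "c \<in> carrier C" "c' \<in> carrier C" using that S_carrier by (auto simp: RDirProd_sel)
    let ?y = "(s, c) \<oplus>\<^bsub>?D\<^esub> (\<ominus>\<^bsub>?D\<^esub> (s, c'))"
    have "?y \<in> S" using that S_add S_neg by blast
    moreover have "fst ?y = \<zero>\<^bsub>W\<^esub>" using S_carrier[OF that(1)] S_carrier[OF that(2)] cc by (simp add: W.r_neg)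
    ultimately have "snd ?y = \<zero>\<^bsub>C\<^esub>" by (rule zero)
    then have "c \<ominus>\<^bsub>C\<^esub> c' = \<zero>\<^bsub>C\<^esub>" using S_carrier[OF that(1)] S_carrier[OF that(2)] by (simp add: C.minus_eq)
    then show ?thesis using C.diff_zero_iff cc by blast
  qed
  define g where "g s = (SOME c. (s, c) \<in> S)" for s
  have gS: "(s, g s) \<in> S" if "s \<in> carrier W" for s unfolding g_def by (rule someI_ex[OF ex[OF that]])
  have g_eq: "g s = c" if "(s, c) \<in> S" for s c
    using uniq[OF gS that] S_carrier[OF that] by (simp add: RDirProd_sel)
  \<comment> \<open>The digit monomial of index 0 is 1, so constants lie in the span; the pair
    (\<omega>, w) will be the one of index 1.\<close>
  have g\<kappa>: "?\<kappa> a \<in> S" if "a \<in> carrier A" for a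
  proof -
    have "?\<kappa> a \<otimes>\<^bsub>?D\<^esub> d.M 0 \<in> d.F 1" by (intro d.F_scal d.F_M that) simp
    then have "?\<kappa> a \<in> d.F 1" unfolding d.M_0 using D.r_one[OF d.\<kappa>.hom_closed[OF that]] by simp
    then show ?thesis by (rule SI)
  qed
  have hom: "g \<in> ring_hom W C"
  proof (rule ring_hom_memI)
    show "g s \<in> carrier C" if "s \<in> carrier W" for s using S_carrier[OF gS[OF that]] by (simp add: RDirProd_sel)
    show "g \<one>\<^bsub>W\<^esub> = \<one>\<^bsub>C\<^esub>" using g_eq[OF g\<kappa>[OF A.one_closed, simplified]] by simp
    fix s t assume st: "s \<in> carrier W" "t \<in> carrier W"
    show "g (s \<otimes>\<^bsub>W\<^esub> t) = g s \<otimes>\<^bsub>C\<^esub> g t"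
      using S_mult[OF gS[OF st(1)] gS[OF st(2)]] by (intro g_eq) (simp add: RDirProd_sel)
    show "g (s \<oplus>\<^bsub>W\<^esub> t) = g s \<oplus>\<^bsub>C\<^esub> g t"
      using S_add[OF gS[OF st(1)] gS[OF st(2)]] by (intro g_eq) (simp add: RDirProd_sel)
  qed
  have "g (\<delta>W s) = \<delta>C (g s)" if "s \<in> carrier W" for s
    using S_delta[OF gS[OF that]] by (intro g_eq) simp
  then have 1: "delta_hom W \<delta>W C \<delta>C g" unfolding delta_hom_def using hom by blast
  have 2: "g (omega_const A a) = \<alpha> a" if "a \<in> carrier A" for a by (rule g_eq[OF g\<kappa>[OF that]])
  have "d.M (p ^ 0) \<in> d.F (Suc (p ^ 0))" by (rule d.F_M) simp
  then have "?Z \<in> S" unfolding d.M_pow by (intro SI) (simp add: d.Zs_def)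
  then have 3: "g (basis (Suc 0)) = w" by (rule g_eq)
  from 1 2 3 show ?thesis by blast
qed

end

section \<open>Bounded algebras over the localization\<close>

context q_loc_prime
begin

text \<open>With t = q - 1 the geometric sum gives t (p)_q = (1 + t)^p - 1 = t^p + p
  \<open>cross\<close>(t, 1), and every mixed monomial is divisible by t. Cancelling the nonzero t
  leaves the congruence of (p)_q with t^(p-1) modulo p.\<close>

lemma fq_pow: "\<exists>c\<in>Loc p. fq = (q_loc - 1) ^ (p - 1) + of_nat p * c"
proof -
  let ?t = "q_loc - 1"
  have t: "?t \<in> Loc p" by simp
  have t0: "?t \<noteq> 0" by (simp add: q_loc_def One_fract_def Zero_fract_def eq_fract one_pCons)
  have geo: "?t * q_number (Zq_loc p) q_loc n = q_loc ^ n - 1" for n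
    unfolding q_number_def by (induction n) (auto simp: lessThan_Suc algebra_simps)
  let ?k = "cross p (Zq_loc p) ?t 1"
  let ?H = "{?t * c | c. c \<in> Loc p}"
  have "additive_subgroup ?H (Zq_loc p)"
  proof (rule additive_subgroup.intro, rule L.add.subgroupI)
    show "?H \<subseteq> Loc p" using t by auto
    show "?H \<noteq> {}" using Loc_0 by blast
    fix a assume "a \<in> ?H"
    then obtain c where c: "a = ?t * c" "c \<in> Loc p" by blast
    then have "\<ominus>\<^bsub>Zq_loc p\<^esub> a = ?t * (- c)" using t by simp
    then show "\<ominus>\<^bsub>Zq_loc p\<^esub> a \<in> ?H" using c Loc_minus by blast
    fix b assume "b \<in> ?H"
    then obtain d where d: "b = ?t * d" "d \<in> Loc p" by blast
    have "a \<oplus>\<^bsub>Zq_loc p\<^esub> b = ?t * (c + d)" using c d by (simp add: algebra_simps)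
    then show "a \<oplus>\<^bsub>Zq_loc p\<^esub> b \<in> ?H" using c d Loc_add by blast
  qed
  then have "?k \<in> ?H"
  proof (rule L.cross_mem)
    fix i assume "0 < i" "i < p"
    then have "?t [^]\<^bsub>Zq_loc p\<^esub> i \<otimes>\<^bsub>Zq_loc p\<^esub> 1 [^]\<^bsub>Zq_loc p\<^esub> (p - i) = ?t * ?t ^ (i - 1)"
      by (cases i) auto
    then show "?t [^]\<^bsub>Zq_loc p\<^esub> i \<otimes>\<^bsub>Zq_loc p\<^esub> 1 [^]\<^bsub>Zq_loc p\<^esub> (p - i) \<in> ?H" using Loc_power[OF t] by blast
  qed
  then obtain c where c: "?k = ?t * c" "c \<in> Loc p" by blast
  have "q_loc ^ p = ?t ^ p + 1 + of_nat p * ?k"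
    using L.power_sum_cross[OF prime_p t Loc_1] by simp
  then have "?t * fq = ?t ^ p + of_nat p * (?t * c)" using geo[of p] c(1) by (simp add: fq_def)
  moreover have "?t ^ p = ?t * ?t ^ (p - 1)" using p_gt_0 by (cases p) auto
  ultimately have "?t * fq = ?t * (?t ^ (p - 1) + of_nat p * c)" by (simp add: algebra_simps)
  then have "fq = ?t ^ (p - 1) + of_nat p * c" using t0 by (metis mult_left_cancel)
  then show ?thesis using c(2) by blast
qed

text \<open>The congruence of (p)_q with (q - 1)^(p-1) modulo p puts (p)_q into (p, q - 1) and (q -
  1)^(p-1) into (p, (p)_q). This is the origin of the exponent p - 1.\<close>

lemma adic_bounded_of_bounded:
  assumes B: "cring B" and \<theta>: "\<theta> \<in> ring_hom (Zq_loc p) B" and bd: "bounded_algebra p B (\<theta> q_loc)"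
  shows "\<exists>N. adic_bounded B (adic_ideal p B (\<theta> q_loc)) (add_pow B p \<one>\<^bsub>B\<^esub>) (\<theta> q_loc \<ominus>\<^bsub>B\<^esub> \<one>\<^bsub>B\<^esub>) (\<theta> fq) (p - 1) N"
proof -
  interpret B: cring B by (rule B)
  interpret \<theta>: ring_hom_cring "Zq_loc p" B \<theta> by unfold_locales (rule \<theta>)
  have fq: "q_number B (\<theta> q_loc) p = \<theta> fq" unfolding fq_def by (subst \<theta>.hom_q_number) auto
  have q: "\<theta> q_loc \<in> carrier B" by simp
  let ?u = "add_pow B p \<one>\<^bsub>B\<^esub>" and ?v = "\<theta> q_loc \<ominus>\<^bsub>B\<^esub> \<one>\<^bsub>B\<^esub>"
  obtain N where reg: "\<And>b. b \<in> carrier B \<Longrightarrow> \<theta> fq \<otimes>\<^bsub>B\<^esub> b = \<zero>\<^bsub>B\<^esub> \<Longrightarrow> b = \<zero>\<^bsub>B\<^esub>"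
    and N: "\<And>b c m. b \<in> carrier B \<Longrightarrow> c \<in> carrier B \<Longrightarrow> ?u [^]\<^bsub>B\<^esub> (m::nat) \<otimes>\<^bsub>B\<^esub> b = \<theta> fq \<otimes>\<^bsub>B\<^esub> c \<Longrightarrow>
       \<exists>c\<in>carrier B. ?u [^]\<^bsub>B\<^esub> (N::nat) \<otimes>\<^bsub>B\<^esub> b = \<theta> fq \<otimes>\<^bsub>B\<^esub> c"
    using bd unfolding B.bounded_algebra_iff[OF q] fq by blast
  obtain c where c: "c \<in> Loc p" "fq = (q_loc - 1) ^ (p - 1) + of_nat p * c" using fq_pow by blast
  have \<theta>v: "\<theta> (q_loc - 1) = ?v"
    using \<theta>.hom_add[of q_loc "- 1"] \<theta>.hom_a_inv[of 1] \<theta>.hom_one by (simp add: B.minus_eq)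
  have \<theta>p: "\<theta> (of_nat p) = ?u" using \<theta>.hom_add_pow[of 1 p] \<theta>.hom_one by simp
  have "\<theta> ((q_loc - 1) ^ (p - 1)) = ?v [^]\<^bsub>B\<^esub> (p - 1)"
    using \<theta>.hom_pow[of "q_loc - 1" "p - 1"] \<theta>v by simp
  then have f_eq: "\<theta> fq = ?v [^]\<^bsub>B\<^esub> (p - 1) \<oplus>\<^bsub>B\<^esub> ?u \<otimes>\<^bsub>B\<^esub> \<theta> c"
    using \<theta>.hom_add[of "(q_loc - 1) ^ (p - 1)" "of_nat p * c"] \<theta>.hom_mult[of "of_nat p" c] c(1) \<theta>p
    by (subst c(2)) simp
  have cl: "?u \<in> carrier B" "?v \<in> carrier B" "\<theta> c \<in> carrier B" "?v [^]\<^bsub>B\<^esub> (p - 1) \<in> carrier B" "?v [^]\<^bsub>B\<^esub> (p - 2) \<in> carrier B"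
    using c(1) by simp_all
  have "?v [^]\<^bsub>B\<^esub> (p - 1) = ?v \<otimes>\<^bsub>B\<^esub> ?v [^]\<^bsub>B\<^esub> (p - 2)"
  proof -
    have "p - 1 = Suc (p - 2)" using prime_ge_2_nat[OF prime_p] by simp
    then show ?thesis using cl by (simp add: B.m_comm)
  qed
  then have "\<theta> fq = ?u \<otimes>\<^bsub>B\<^esub> \<theta> c \<oplus>\<^bsub>B\<^esub> ?v \<otimes>\<^bsub>B\<^esub> ?v [^]\<^bsub>B\<^esub> (p - 2)" unfolding f_eq using cl by (simp add: B.a_comm)
  then have f_mem: "\<theta> fq \<in> adic_ideal p B (\<theta> q_loc)"
    unfolding adic_ideal_def B.genideal_pair[OF cl(1,2)] using cl by blast
  have "?u \<otimes>\<^bsub>B\<^esub> (\<ominus>\<^bsub>B\<^esub> \<theta> c) \<oplus>\<^bsub>B\<^esub> \<theta> fq \<otimes>\<^bsub>B\<^esub> \<one>\<^bsub>B\<^esub> = ?v [^]\<^bsub>B\<^esub> (p - 1)"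
  proof -
    have "?u \<otimes>\<^bsub>B\<^esub> (\<ominus>\<^bsub>B\<^esub> \<theta> c) \<oplus>\<^bsub>B\<^esub> \<theta> fq \<otimes>\<^bsub>B\<^esub> \<one>\<^bsub>B\<^esub> = (?u \<otimes>\<^bsub>B\<^esub> \<theta> c \<oplus>\<^bsub>B\<^esub> ?v [^]\<^bsub>B\<^esub> (p - 1)) \<ominus>\<^bsub>B\<^esub> ?u \<otimes>\<^bsub>B\<^esub> \<theta> c"
      unfolding f_eq using cl by (simp add: B.r_minus B.minus_eq B.a_ac)
    also have "\<dots> = ?v [^]\<^bsub>B\<^esub> (p - 1)" using cl by (intro B.add_diff_cancel) auto
    finally show ?thesis .
  qed
  then have v_pow: "\<exists>a\<in>carrier B. \<exists>b\<in>carrier B. ?v [^]\<^bsub>B\<^esub> (p - 1) = ?u \<otimes>\<^bsub>B\<^esub> a \<oplus>\<^bsub>B\<^esub> \<theta> fq \<otimes>\<^bsub>B\<^esub> b"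
    using cl B.a_inv_closed[OF cl(3)] B.one_closed by metis
  have id: "ideal (adic_ideal p B (\<theta> q_loc)) B" unfolding adic_ideal_def using cl by (intro B.genideal_ideal) auto
  have pair: "adic_ring_pair B (adic_ideal p B (\<theta> q_loc)) ?u ?v"
    by (intro adic_ring_pair.intro adic_ring_pair_axioms.intro adic_ring.intro adic_ring_axioms.intro B id cl)
       (simp add: adic_ideal_def)
  have fc: "\<theta> fq \<in> carrier B" by simp
  have "adic_bounded B (adic_ideal p B (\<theta> q_loc)) ?u ?v (\<theta> fq) (p - 1) N"
  proof (rule adic_bounded.intro[OF pair], rule adic_bounded_axioms.intro)
    fix b c m assume "b \<in> carrier B" "c \<in> carrier B" "?u [^]\<^bsub>B\<^esub> (m::nat) \<otimes>\<^bsub>B\<^esub> b = \<theta> fq \<otimes>\<^bsub>B\<^esub> c"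
    then show "\<exists>c\<in>carrier B. ?u [^]\<^bsub>B\<^esub> N \<otimes>\<^bsub>B\<^esub> b = \<theta> fq \<otimes>\<^bsub>B\<^esub> c" by (rule N)
  next
    fix b assume "b \<in> carrier B" "\<theta> fq \<otimes>\<^bsub>B\<^esub> b = \<zero>\<^bsub>B\<^esub>"
    then show "b = \<zero>\<^bsub>B\<^esub>" by (rule reg)
  qed (rule fc f_mem v_pow)+
  then show ?thesis by blast
qed

end

text \<open>Constants act coefficient by coefficient on A<omega>, so regularity of (p)_q and the
  torsion bound are inherited, with the same N.\<close>

lemma (in omega) W_bounded:
  assumes Ab: "bounded_algebra p A q"
  shows "bounded_algebra p W (omega_const A q)"
proof -
  let ?u = "add_pow A p \<one>" and ?f = "\<theta> fq"
  obtain N where reg: "\<And>b. b \<in> carrier A \<Longrightarrow> ?f \<otimes> b = \<zero> \<Longrightarrow> b = \<zero>"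
    and N: "\<And>b m. b \<in> carrier A \<Longrightarrow> \<exists>c\<in>carrier A. ?u [^] (m::nat) \<otimes> b = ?f \<otimes> c \<Longrightarrow>
       \<exists>c\<in>carrier A. ?u [^] (N::nat) \<otimes> b = ?f \<otimes> c"
    using Ab unfolding A.bounded_algebra_iff[OF q_closed] q_number_eq by blast
  have f: "?f \<in> carrier A" by simp
  have fW: "q_number W (omega_const A q) p = omega_const A ?f"
    using c.hom_q_number[OF q_closed, of p] q_number_eq by simp
  have uW: "add_pow W p \<one>\<^bsub>W\<^esub> [^]\<^bsub>W\<^esub> (m::nat) = omega_const A (?u [^] m)" for m
    using c.hom_add_pow[of \<one> p] c.hom_pow[of ?u m] by simp
  have um: "?u [^] (m::nat) \<in> carrier A" for m by simp
  show ?thesis unfolding W.bounded_algebra_iff[OF const_closed[OF q_closed]] fW uW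
  proof (intro conjI exI ballI allI impI)
    fix s assume s: "s \<in> carrier W" "omega_const A ?f \<otimes>\<^bsub>W\<^esub> s = \<zero>\<^bsub>W\<^esub>"
    have "(\<lambda>n. ?f \<otimes> s n) = (\<lambda>n. \<zero>)" using const_mult[OF f s(1)] s(2) unfolding zero_W by (rule trans[OF sym])
    then have "?f \<otimes> s n = \<zero>" for n by (rule fun_cong)
    then have "s n = \<zero>" for n using reg s(1) by simp
    then show "s = \<zero>\<^bsub>W\<^esub>" by (auto simp: zero_W)
  next
    fix s and m :: nat assume s: "s \<in> carrier W" and "\<exists>t\<in>carrier W. omega_const A (?u [^] m) \<otimes>\<^bsub>W\<^esub> s = omega_const A ?f \<otimes>\<^bsub>W\<^esub> t"
    then obtain t where t: "t \<in> carrier W" "omega_const A (?u [^] m) \<otimes>\<^bsub>W\<^esub> s = omega_const A ?f \<otimes>\<^bsub>W\<^esub> t" by blast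
    have "?u [^] m \<otimes> s n = ?f \<otimes> t n" for n
      using fun_cong[OF t(2)[unfolded const_mult[OF um s] const_mult[OF f t(1)]], of n] .
    then have "\<exists>c\<in>carrier A. ?u [^] N \<otimes> s n = ?f \<otimes> c" for n using N[of "s n" m] s t(1) W_coeff by blast
    then obtain c where c: "\<And>n. c n \<in> carrier A" "\<And>n. ?u [^] N \<otimes> s n = ?f \<otimes> c n" by metis
    obtain K where K: "s \<in> G K" using G_ex[OF s] by blast
    \<comment> \<open>The quotients were chosen separately for each n; beyond the support of s they
      are replaced by zero to make the sequence finitely supported.\<close>
    define c' where "c' n = (if n < K then c n else \<zero>)" for n
    have c'c: "c' n \<in> carrier A" for n using c c'_def by simp
    have "bound \<zero> K c'" by (rule bound.intro) (simp add: c'_def)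
    then have c': "c' \<in> carrier W" unfolding carrier_W up_def using c'c by blast
    have "?u [^] N \<otimes> s n = ?f \<otimes> c' n" for n
      using c(2)[of n] G_D(2)[OF K, of n] um f by (auto simp: c'_def)
    then have "omega_const A (?u [^] N) \<otimes>\<^bsub>W\<^esub> s = omega_const A ?f \<otimes>\<^bsub>W\<^esub> c'"
      using const_mult[OF um s] const_mult[OF f c'] by simp
    then show "\<exists>c\<in>carrier W. omega_const A (?u [^] N) \<otimes>\<^bsub>W\<^esub> s = omega_const A ?f \<otimes>\<^bsub>W\<^esub> c" using c' by blast
  qed
qed

lemma hom_cgenideal:
  assumes "cring B" "cring C" "g \<in> ring_hom B C" "b \<in> carrier B" "c \<in> carrier C" "g b \<in> PIdl\<^bsub>C\<^esub> c"
  shows "g ` (PIdl\<^bsub>B\<^esub> b) \<subseteq> PIdl\<^bsub>C\<^esub> c"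
proof -
  interpret B: cring B by fact
  interpret C: cring C by fact
  interpret g: ring_hom_cring B C g by unfold_locales fact
  obtain d where d: "d \<in> carrier C" "g b = c \<otimes>\<^bsub>C\<^esub> d" using assms(6) unfolding C.cgenideal_eq_mult[OF assms(5)] by blast
  show ?thesis
  proof
    fix y assume "y \<in> g ` (PIdl\<^bsub>B\<^esub> b)"
    then obtain a where a: "a \<in> carrier B" "y = g (b \<otimes>\<^bsub>B\<^esub> a)" unfolding B.cgenideal_eq_mult[OF assms(4)] by blast
    then have "y = c \<otimes>\<^bsub>C\<^esub> (d \<otimes>\<^bsub>C\<^esub> g a)" using d assms(4,5) by (simp add: C.m_assoc)
    then show "y \<in> PIdl\<^bsub>C\<^esub> c" unfolding C.cgenideal_eq_mult[OF assms(5)] using a d by blast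
  qed
qed

lemma hom_genideal_pair:
  assumes "cring B" "cring C" "g \<in> ring_hom B C" "u \<in> carrier B" "v \<in> carrier B" "ideal K C" "g u \<in> K" "g v \<in> K"
  shows "g ` genideal B {u, v} \<subseteq> K"
proof -
  interpret B: cring B by fact
  interpret C: cring C by fact
  interpret g: ring_hom_cring B C g by unfold_locales fact
  interpret K: ideal K C by fact
  show ?thesis
  proof
    fix y assume "y \<in> g ` genideal B {u, v}"
    then obtain a b where ab: "a \<in> carrier B" "b \<in> carrier B" "y = g (u \<otimes>\<^bsub>B\<^esub> a \<oplus>\<^bsub>B\<^esub> v \<otimes>\<^bsub>B\<^esub> b)"
      unfolding B.genideal_pair[OF assms(4,5)] by blast
    then have "y = g u \<otimes>\<^bsub>C\<^esub> g a \<oplus>\<^bsub>C\<^esub> g v \<otimes>\<^bsub>C\<^esub> g b" using assms(4,5) by simp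
    then show "y \<in> K" using K.a_closed[OF K.I_r_closed[OF assms(7)] K.I_r_closed[OF assms(8)]] ab by simp
  qed
qed

lemma (in cring) adic_ideal_ideal: "q \<in> carrier R \<Longrightarrow> ideal (adic_ideal p R q) R"
  unfolding adic_ideal_def by (intro genideal_ideal) auto

lemma (in cring) adic_ideal_gen:
  assumes "q \<in> carrier R" shows "add_pow R p \<one> \<in> adic_ideal p R q" "q \<ominus> \<one> \<in> adic_ideal p R q"
  using genideal_self[of "{add_pow R p \<one>, q \<ominus> \<one>}"] assms unfolding adic_ideal_def by auto

text \<open>Ring maps preserve p and 1, so continuity for the (p, q - 1)-adic topologies is
  automatic once the elements q correspond.\<close>

lemma hom_adic_ideal:
  assumes "cring B" "cring C" "g \<in> ring_hom B C" "q \<in> carrier B"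
  shows "g ` adic_ideal p B q \<subseteq> adic_ideal p C (g q)"
proof -
  interpret B: cring B by fact
  interpret C: cring C by fact
  interpret g: ring_hom_cring B C g by unfold_locales fact
  have gq: "g q \<in> carrier C" using assms(4) by simp
  have "g (add_pow B p \<one>\<^bsub>B\<^esub>) = add_pow C p \<one>\<^bsub>C\<^esub>" by (simp add: g.hom_add_pow)
  moreover have "g (q \<ominus>\<^bsub>B\<^esub> \<one>\<^bsub>B\<^esub>) = g q \<ominus>\<^bsub>C\<^esub> \<one>\<^bsub>C\<^esub>" using assms(4) by (simp add: B.minus_eq C.minus_eq)
  ultimately show ?thesis unfolding adic_ideal_def[of p B]
    using assms(4) C.adic_ideal_gen[OF gq, of p]
    by (intro hom_genideal_pair[OF assms(1-3)] C.adic_ideal_ideal[OF gq]) auto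
qed

section \<open>The prismatic envelope\<close>

locale omega_prism = omega_delta p A \<theta> x \<delta>W \<delta>A for p and A (structure) and \<theta> x \<delta>W \<delta>A +
  fixes N :: nat
  assumes W_adic: "adic_bounded W (adic_ideal p W (omega_const A q)) (add_pow W p \<one>\<^bsub>W\<^esub>)
     (omega_const A q \<ominus>\<^bsub>W\<^esub> \<one>\<^bsub>W\<^esub>) (omega_const A (\<theta> fq)) (p - 1) N"
begin

abbreviation "I \<equiv> adic_ideal p W (omega_const A q)"
abbreviation "PW \<equiv> completion W I"
abbreviation "\<delta>PW \<equiv> completion_delta W I \<delta>W"
abbreviation "to \<equiv> to_completion W I"

lemma W_adic_delta: "adic_delta_ring p W I \<delta>W"
proof -
  interpret ab: adic_bounded W I "add_pow W p \<one>\<^bsub>W\<^esub>" "omega_const A q \<ominus>\<^bsub>W\<^esub> \<one>\<^bsub>W\<^esub>" "omega_const A (\<theta> fq)" "p - 1" N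
    by (rule W_adic)
  show ?thesis
    by (intro adic_delta_ring.intro adic_delta_ring_axioms.intro ab.adic_ring_axioms r.delta_ring_axioms prime_p ab.uv_mem)
qed

lemma PW_delta_ring: "delta_ring p PW \<delta>PW" and to_delta_hom: "delta_hom W \<delta>W PW \<delta>PW to"
  using adic_delta_ring.completion_delta_ring[OF W_adic_delta] adic_delta_ring.to_completion_delta_hom[OF W_adic_delta] by auto

lemma PW_cring: "cring PW" and to_hom: "to \<in> ring_hom W PW"
  using PW_delta_ring to_delta_hom by (auto simp: delta_ring_def delta_hom_def)

lemma to_u: "to (add_pow W p \<one>\<^bsub>W\<^esub>) = add_pow PW p \<one>\<^bsub>PW\<^esub>"
  and to_v: "to (omega_const A q \<ominus>\<^bsub>W\<^esub> \<one>\<^bsub>W\<^esub>) = to (omega_const A q) \<ominus>\<^bsub>PW\<^esub> \<one>\<^bsub>PW\<^esub>"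
  and to_f: "q_number PW (to (omega_const A q)) p = to (omega_const A (\<theta> fq))"
proof -
  interpret P: cring PW by (rule PW_cring)
  interpret t: ring_hom_cring W PW to by unfold_locales (rule to_hom)
  show "to (add_pow W p \<one>\<^bsub>W\<^esub>) = add_pow PW p \<one>\<^bsub>PW\<^esub>" using t.hom_add_pow[OF W.one_closed, of p] t.hom_one by simp
  show "to (omega_const A q \<ominus>\<^bsub>W\<^esub> \<one>\<^bsub>W\<^esub>) = to (omega_const A q) \<ominus>\<^bsub>PW\<^esub> \<one>\<^bsub>PW\<^esub>" by (simp add: W.minus_eq P.minus_eq)
  have "q_number W (omega_const A q) p = omega_const A (\<theta> fq)"
    using c.hom_q_number[OF q_closed, of p] q_number_eq by simp
  then show "q_number PW (to (omega_const A q)) p = to (omega_const A (\<theta> fq))"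
    using t.hom_q_number[of "omega_const A q" p] by simp
qed

lemma PW_complete: "adic_complete PW (adic_ideal p PW (to (omega_const A q)))"
proof -
  interpret ab: adic_bounded W I "add_pow W p \<one>\<^bsub>W\<^esub>" "omega_const A q \<ominus>\<^bsub>W\<^esub> \<one>\<^bsub>W\<^esub>" "omega_const A (\<theta> fq)" "p - 1" N
    by (rule W_adic)
  show ?thesis
    using ab.completion_complete unfolding adic_ideal_def[of p PW] to_u[symmetric] to_v[symmetric]
    unfolding ab.to_completion_lim .
qed

lemma PW_bounded: "bounded_algebra p PW (to (omega_const A q))"
proof -
  interpret ab: adic_bounded W I "add_pow W p \<one>\<^bsub>W\<^esub>" "omega_const A q \<ominus>\<^bsub>W\<^esub> \<one>\<^bsub>W\<^esub>" "omega_const A (\<theta> fq)" "p - 1" N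
    by (rule W_adic)
  interpret P: cring PW by (rule PW_cring)
  interpret t: ring_hom_cring W PW to by unfold_locales (rule to_hom)
  have q: "to (omega_const A q) \<in> carrier PW" by simp
  show ?thesis unfolding cring.bounded_algebra_iff[OF PW_cring q] to_f to_u[symmetric]
  proof (intro conjI exI ballI allI impI)
    fix b assume "b \<in> carrier PW" "to (omega_const A (\<theta> fq)) \<otimes>\<^bsub>PW\<^esub> b = \<zero>\<^bsub>PW\<^esub>"
    then show "b = \<zero>\<^bsub>PW\<^esub>" by (rule ab.completion_regular)
  next
    fix b and m :: nat assume b: "b \<in> carrier PW"
      and "\<exists>c\<in>carrier PW. to (add_pow W p \<one>\<^bsub>W\<^esub>) [^]\<^bsub>PW\<^esub> m \<otimes>\<^bsub>PW\<^esub> b = to (omega_const A (\<theta> fq)) \<otimes>\<^bsub>PW\<^esub> c"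
    then obtain c where "c \<in> carrier PW" "to (add_pow W p \<one>\<^bsub>W\<^esub>) [^]\<^bsub>PW\<^esub> m \<otimes>\<^bsub>PW\<^esub> b = to (omega_const A (\<theta> fq)) \<otimes>\<^bsub>PW\<^esub> c" by blast
    then show "\<exists>c\<in>carrier PW. to (add_pow W p \<one>\<^bsub>W\<^esub>) [^]\<^bsub>PW\<^esub> N \<otimes>\<^bsub>PW\<^esub> b = to (omega_const A (\<theta> fq)) \<otimes>\<^bsub>PW\<^esub> c"
      by (rule ab.completion_bounded[OF b])
  qed
qed

lemma target:
  assumes C: "delta_ring p C \<delta>C" and qC: "qC \<in> carrier C" and cc: "adic_complete C (adic_ideal p C qC)"
  shows "complete_target W I (add_pow W p \<one>\<^bsub>W\<^esub>) (omega_const A q \<ominus>\<^bsub>W\<^esub> \<one>\<^bsub>W\<^esub>) C (adic_ideal p C qC)"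
    and "adic_delta_ring p C (adic_ideal p C qC) \<delta>C"
proof -
  interpret C: delta_ring p C \<delta>C by (rule C)
  have ar: "adic_ring C (adic_ideal p C qC)"
    by (intro adic_ring.intro adic_ring_axioms.intro C.is_cring C.adic_ideal_ideal qC)
  show "complete_target W I (add_pow W p \<one>\<^bsub>W\<^esub>) (omega_const A q \<ominus>\<^bsub>W\<^esub> \<one>\<^bsub>W\<^esub>) C (adic_ideal p C qC)"
    by (intro complete_target.intro complete_target_axioms.intro ar cc adic_bounded.axioms(1)[OF W_adic])
  show "adic_delta_ring p C (adic_ideal p C qC) \<delta>C"
    by (intro adic_delta_ring.intro adic_delta_ring_axioms.intro ar C prime_p C.adic_ideal_gen qC)
qed

theorem PW_hom_exists:
  assumes C: "delta_ring p C \<delta>C" and cc: "adic_complete C (adic_ideal p C (\<alpha> q))"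
    and \<alpha>: "delta_hom A \<delta>A C \<delta>C \<alpha>" and w: "w \<in> carrier C"
    and rel: "\<delta>C (\<alpha> x \<oplus>\<^bsub>C\<^esub> \<alpha> (\<theta> fq) \<otimes>\<^bsub>C\<^esub> w) = \<zero>\<^bsub>C\<^esub>"
  shows "\<exists>g. delta_hom PW \<delta>PW C \<delta>C g \<and> (\<forall>a\<in>carrier A. g (to (omega_const A a)) = \<alpha> a) \<and> g (to (basis (Suc 0))) = w"
proof -
  interpret C: delta_ring p C \<delta>C by (rule C)
  obtain k where k: "delta_hom W \<delta>W C \<delta>C k" "\<forall>a\<in>carrier A. k (omega_const A a) = \<alpha> a" "k (basis (Suc 0)) = w"
    using omega_hom_exists[OF C \<alpha> w rel] by blast
  have kh: "k \<in> ring_hom W C" using k(1) unfolding delta_hom_def by blast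
  interpret k: ring_hom_cring W C k by unfold_locales (rule kh)
  let ?q = "\<alpha> q"
  have kq: "k (omega_const A q) = ?q" using k(2) by simp
  have qC: "?q \<in> carrier C" using k.hom_closed[OF const_closed[OF q_closed]] kq by simp
  let ?K = "adic_ideal p C ?q"
  interpret ad: adic_delta_ring p W I \<delta>W by (rule W_adic_delta)
  interpret cd: adic_delta_ring p C ?K \<delta>C by (rule target(2)[OF C qC cc])
  interpret ct: complete_target W I "add_pow W p \<one>\<^bsub>W\<^esub>" "omega_const A q \<ominus>\<^bsub>W\<^esub> \<one>\<^bsub>W\<^esub>" C ?K by (rule target(1)[OF C qC cc])
  have kI: "k ` I \<subseteq> ?K"
    using hom_adic_ideal[OF W_cring C.is_cring kh const_closed[OF q_closed]] unfolding kq .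
  obtain g where gh: "g \<in> ring_hom PW C"
    and gl: "\<And>b n. b \<in> ad.Cau \<Longrightarrow> g (ad.lim b) \<ominus>\<^bsub>C\<^esub> k (b n) \<in> ideal_power C ?K n"
    using ct.hom_extend[OF kh kI] by blast
  interpret g: ring_hom_cring PW C g by unfold_locales (rule gh)
  have gt: "g (to s) = k s" if s: "s \<in> carrier W" for s
  proof (rule ct.separated_diff)
    show "g (to s) \<ominus>\<^bsub>C\<^esub> k s \<in> ideal_power C ?K n" for n
      using gl[OF ad.Cau_const[OF s], of n] unfolding ad.to_completion_lim .
  qed (use s ring_hom_closed[OF to_hom s] in auto)
  \<comment> \<open>Level n of delta on the completion is read off at index n + 1, and delta on C
    loses one power. Approximating s at index n + 1 therefore makes both sides agree modulo the n-th
    power.\<close>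
  have "g (\<delta>PW s) = \<delta>C (g s)" if s: "s \<in> carrier PW" for s
  proof -
    obtain b where b: "b \<in> ad.Cau" "s = ad.lim b" using s by (rule ad.completionE)
    have bc: "b n \<in> carrier W" for n using ad.CauD(1)[OF b(1)] .
    have gs: "g s \<in> carrier C" using s by simp
    have dP: "\<delta>PW s = ad.lim (\<lambda>n. \<delta>W (b (Suc n)))" unfolding b(2) by (rule ad.completion_delta_lim[OF b(1)])
    have dPc: "\<delta>PW s \<in> carrier PW" by (rule delta_ring.delta_closed[OF PW_delta_ring s])
    show ?thesis
    proof (rule ct.separated_diff)
      fix n
      have kb: "k (b (Suc n)) \<in> carrier C" using bc by simp
      have 1: "g (\<delta>PW s) \<ominus>\<^bsub>C\<^esub> k (\<delta>W (b (Suc n))) \<in> ideal_power C ?K n"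
        using gl[OF ad.Cau_delta[OF b(1)], of n] unfolding dP .
      have 2: "k (\<delta>W (b (Suc n))) = \<delta>C (k (b (Suc n)))" using k(1) bc unfolding delta_hom_def by blast
      have 3: "\<delta>C (g s) \<ominus>\<^bsub>C\<^esub> \<delta>C (k (b (Suc n))) \<in> ideal_power C ?K n"
        using gl[OF b(1), of "Suc n"] unfolding b(2)[symmetric] by (rule cd.delta_cong[OF gs kb])
      have c: "g (\<delta>PW s) \<in> carrier C" "\<delta>C (k (b (Suc n))) \<in> carrier C" "\<delta>C (g s) \<in> carrier C"
        using dPc kb gs C.delta_closed by auto
      show "g (\<delta>PW s) \<ominus>\<^bsub>C\<^esub> \<delta>C (g s) \<in> ideal_power C ?K n"
        by (rule cd.ip_trans[OF 1[unfolded 2] cd.ip_sym[OF 3 c(3,2)] c])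
    qed (use dPc gs C.delta_closed in auto)
  qed
  then have "delta_hom PW \<delta>PW C \<delta>C g" unfolding delta_hom_def using gh by blast
  moreover have "\<forall>a\<in>carrier A. g (to (omega_const A a)) = \<alpha> a" using gt k(2) by simp
  moreover have "g (to (basis (Suc 0))) = w" using gt k(3) by simp
  ultimately show ?thesis by blast
qed

text \<open>Both maps are continuous by \<open>hom_adic_ideal\<close>, so it suffices to compare
  them on A<omega>, where A and \<omega> determine them.\<close>

theorem PW_hom_unique:
  assumes C: "delta_ring p C \<delta>C" and cc: "adic_complete C (adic_ideal p C qC)"
    and g: "delta_hom PW \<delta>PW C \<delta>C g" and k: "delta_hom PW \<delta>PW C \<delta>C k"
    and gq: "g (to (omega_const A q)) = qC"
    and c: "\<And>a. a \<in> carrier A \<Longrightarrow> g (to (omega_const A a)) = k (to (omega_const A a))"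
    and b: "g (to (basis (Suc 0))) = k (to (basis (Suc 0)))" and s: "s \<in> carrier PW"
  shows "g s = k s"
proof -
  interpret C: delta_ring p C \<delta>C by (rule C)
  have gh: "g \<in> ring_hom PW C" and kh: "k \<in> ring_hom PW C" using g k unfolding delta_hom_def by auto
  have tq: "to (omega_const A q) \<in> carrier PW" by (rule ring_hom_closed[OF to_hom const_closed[OF q_closed]])
  have qC: "qC \<in> carrier C" using ring_hom_closed[OF gh tq] gq by simp
  let ?K = "adic_ideal p C qC"
  interpret ct: complete_target W I "add_pow W p \<one>\<^bsub>W\<^esub>" "omega_const A q \<ominus>\<^bsub>W\<^esub> \<one>\<^bsub>W\<^esub>" C ?K by (rule target(1)[OF C qC cc])
  have kq: "k (to (omega_const A q)) = qC" using c[OF q_closed] gq by simp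
  have J: "adic_ideal p PW (to (omega_const A q)) = ct.J"
    unfolding adic_ideal_def[of p PW] to_u[symmetric] to_v[symmetric] unfolding ct.to_completion_lim ..
  have gJ: "g ` ct.J \<subseteq> ?K" using hom_adic_ideal[OF PW_cring C.is_cring gh tq, of p] unfolding gq J .
  have kJ: "k ` ct.J \<subseteq> ?K" using hom_adic_ideal[OF PW_cring C.is_cring kh tq, of p] unfolding kq J .
  show ?thesis
  proof (rule ct.hom_unique[OF gh gJ kh kJ _ s])
    fix t assume t: "t \<in> carrier W"
    show "g (to t) = k (to t)"
      by (rule omega_hom_unique[OF C delta_hom_trans[OF to_delta_hom g] delta_hom_trans[OF to_delta_hom k] c b t])
  qed
qed

end

theorem corollary5p6:
  fixes p :: nat
    and R :: "'r ring" and \<delta>R :: "'r \<Rightarrow> 'r" and \<eta> :: "int poly fract \<Rightarrow> 'r"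
    and A :: "'a ring" and \<delta>A :: "'a \<Rightarrow> 'a" and \<rho> :: "'r \<Rightarrow> 'a" and x :: 'a
    and \<delta>\<xi> :: "(nat \<Rightarrow> 'a) \<Rightarrow> (nat \<Rightarrow> 'a)"
    and \<Delta> :: "'r ring \<Rightarrow> ('r \<Rightarrow> 'r) \<Rightarrow> (int poly fract \<Rightarrow> 'r) \<Rightarrow>
      'a ring \<Rightarrow> ('a \<Rightarrow> 'a) \<Rightarrow> ('r \<Rightarrow> 'a) \<Rightarrow> 'a \<Rightarrow> (nat \<Rightarrow> 'a) \<Rightarrow> (nat \<Rightarrow> 'a)"
  assumes "prime p"
    and "q_delta_ring p R \<delta>R \<eta>" and "bounded_algebra p R (\<eta> q_loc)"
    and "delta_algebra p R \<delta>R A \<delta>A \<rho>" and "bounded_algebra p A (\<rho> (\<eta> q_loc))"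
    and "rank_one A \<delta>A x"
    and "symmetric_delta p A \<delta>A x \<delta>\<xi>"
    and "natural_omega_delta p \<Delta>"
  shows "let q = \<eta> q_loc;
      W = Omega p A (\<rho> q) x;
      I = adic_ideal p W (omega_const A (\<rho> q))
    in prismatic_envelope TYPE('c) p R \<delta>R q
        (UP A) \<delta>\<xi> (\<lambda>r. poly_const A (\<rho> r)) (PIdl\<^bsub>UP A\<^esub> (poly_xi A))
        (completion W I) (completion_delta W I (\<Delta> R \<delta>R \<eta> A \<delta>A \<rho> x))
        (\<lambda>r. to_completion W I (omega_const A (\<rho> r)))
        (\<lambda>f. to_completion W I (blowing_up p A (\<rho> q) x f))"
proof -
  interpret Q: q_loc_prime p by unfold_locales (rule assms(1))
  define \<theta> where "\<theta> = (\<lambda>z. \<rho> (\<eta> z))"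
  define \<delta>W where "\<delta>W = \<Delta> R \<delta>R \<eta> A \<delta>A \<rho> x"
  have dat: "q_datum p R \<delta>R \<eta> A \<delta>A \<rho> x" unfolding q_datum_def using assms by blast
  have om: "omega p A \<theta> x" and lift: "rank_one_lift p (Omega p A (\<theta> q_loc) x) \<delta>W A \<delta>A \<theta> (omega_const A) x (omega.basis A (Suc 0))"
    and bu: "delta_hom (UP A) \<delta>\<xi> (Omega p A (\<theta> q_loc) x) \<delta>W (blowing_up p A (\<theta> q_loc) x)"
    using Q.natural_lift[OF dat assms(8)] assms(7) unfolding \<theta>_def \<delta>W_def by auto
  have lead: "(\<delta>W ^^ j) (omega.basis A (Suc 0)) \<in> omega.G p A \<theta> x (Suc (p ^ j)) \<and>
    (\<delta>W ^^ j) (omega.basis A (Suc 0)) (p ^ j) \<in> Units A" for j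
    using Q.omega_delta_lead[OF dat assms(8,3,5)] unfolding \<theta>_def \<delta>W_def .
  interpret od: omega_delta p A \<theta> x \<delta>W \<delta>A
    by (intro omega_delta.intro omega_delta_axioms.intro om lift lead)
  have Ab: "bounded_algebra p A (\<theta> q_loc)" using assms(5) unfolding \<theta>_def .
  have \<theta>W: "(\<lambda>z. omega_const A (\<theta> z)) \<in> ring_hom (Zq_loc p) od.W"
    using ring_hom_trans[OF od.\<theta> od.const_hom] by (simp add: comp_def)
  obtain N where "adic_bounded od.W (adic_ideal p od.W (omega_const A (\<theta> q_loc))) (add_pow od.W p \<one>\<^bsub>od.W\<^esub>)
     (omega_const A (\<theta> q_loc) \<ominus>\<^bsub>od.W\<^esub> \<one>\<^bsub>od.W\<^esub>) (omega_const A (\<theta> Q.fq)) (p - 1) N"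
    using Q.adic_bounded_of_bounded[OF od.W_cring \<theta>W od.W_bounded[OF Ab]] by blast
  then interpret op: omega_prism p A \<theta> x \<delta>W \<delta>A N
    by (intro omega_prism.intro omega_prism_axioms.intro od.omega_delta_axioms)
  have R: "delta_ring p R \<delta>R" and \<eta>: "\<eta> \<in> ring_hom (Zq_loc p) R" and A: "delta_ring p A \<delta>A" and \<rho>: "delta_hom R \<delta>R A \<delta>A \<rho>"
    and x: "x \<in> carrier A" "\<delta>A x = \<zero>\<^bsub>A\<^esub>"
    using assms unfolding q_delta_ring_def delta_algebra_def rank_one_def by auto
  interpret A: delta_ring p A \<delta>A by (rule A)
  have Ac: "cring A" using A unfolding delta_ring_def by blast
  have U: "delta_ring p (UP A) \<delta>\<xi>" using assms(7) unfolding symmetric_delta_def by blast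
  interpret U: delta_ring p "UP A" \<delta>\<xi> by (rule U)
  interpret P: delta_ring p op.PW op.\<delta>PW by (rule op.PW_delta_ring)
  have \<rho>c: "\<rho> r \<in> carrier A" if "r \<in> carrier R" for r using \<rho> that ring_hom_closed unfolding delta_hom_def by fast
  have q: "\<eta> q_loc \<in> carrier R" using ring_hom_closed[OF \<eta>] by simp
  have \<theta>q: "\<rho> (\<eta> q_loc) = \<theta> q_loc" by (simp add: \<theta>_def)
  have xi: "poly_xi A \<in> carrier (UP A)" by (rule UP_xi_closed[OF Ac])
  have const\<delta>: "delta_hom A \<delta>A (UP A) \<delta>\<xi> (poly_const A)"
    using UP_const_hom[OF Ac] assms(7) unfolding delta_hom_def symmetric_delta_def by simp
  have \<kappa>P: "delta_hom A \<delta>A op.PW op.\<delta>PW (\<lambda>a. op.to (omega_const A a))"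
    by (rule delta_hom_trans[OF od.r.\<kappa> op.to_delta_hom])
  let ?bu = "blowing_up p A (\<theta> q_loc) x"
  let ?qP = "op.to (omega_const A (\<theta> q_loc))"
  have qP: "?qP \<in> carrier op.PW" by (rule ring_hom_closed[OF op.to_hom od.const_closed[OF od.q_closed]])
  have fP: "op.to (omega_const A (\<theta> Q.fq)) \<in> carrier op.PW"
    by (rule ring_hom_closed[OF op.to_hom od.const_closed]) simp
  have tb: "op.to (od.basis (Suc 0)) \<in> carrier op.PW" by (rule ring_hom_closed[OF op.to_hom od.basis_closed])
  have tbu: "delta_hom (UP A) \<delta>\<xi> op.PW op.\<delta>PW (\<lambda>f. op.to (?bu f))" by (rule delta_hom_trans[OF bu op.to_delta_hom])
  have tbu_xi: "op.to (?bu (poly_xi A)) = op.to (omega_const A (\<theta> Q.fq)) \<otimes>\<^bsub>op.PW\<^esub> op.to (od.basis (Suc 0))"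
    unfolding od.blowing_up_xi by (rule ring_hom_mult[OF op.to_hom]) (auto intro: od.const_closed)
  have pairU: "delta_pair p R \<delta>R (UP A) \<delta>\<xi> (\<lambda>r. poly_const A (\<rho> r)) (PIdl\<^bsub>UP A\<^esub> (poly_xi A))"
    unfolding delta_pair_def delta_algebra_def
    by (intro conjI U delta_hom_trans[OF \<rho> const\<delta>] U.cgenideal_ideal xi)
  have prismP: "q_prism p R \<delta>R (\<eta> q_loc) op.PW op.\<delta>PW (\<lambda>r. op.to (omega_const A (\<rho> r)))"
    unfolding q_prism_def delta_pair_def delta_algebra_def q_ideal_def \<theta>q
    by (intro conjI op.PW_delta_ring delta_hom_trans[OF \<rho> \<kappa>P] U.cgenideal_ideal P.cgenideal_ideal P.q_number_closed qP
        op.PW_complete op.PW_bounded)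
  have tbuh: "(\<lambda>f. op.to (?bu f)) \<in> ring_hom (UP A) op.PW" using tbu unfolding delta_hom_def by blast
  have homP: "delta_pair_hom R (UP A) \<delta>\<xi> (\<lambda>r. poly_const A (\<rho> r)) (PIdl\<^bsub>UP A\<^esub> (poly_xi A)) op.PW op.\<delta>PW
     (\<lambda>r. op.to (omega_const A (\<rho> r))) (q_ideal p op.PW ?qP) (\<lambda>f. op.to (?bu f))"
    unfolding delta_pair_hom_def
  proof (intro conjI ballI tbu)
    fix r assume "r \<in> carrier R"
    then show "op.to (?bu (poly_const A (\<rho> r))) = op.to (omega_const A (\<rho> r))" using od.blowing_up_const[OF \<rho>c] by simp
  next
    show "(\<lambda>f. op.to (?bu f)) ` (PIdl\<^bsub>UP A\<^esub> (poly_xi A)) \<subseteq> q_ideal p op.PW ?qP"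
      unfolding q_ideal_def op.to_f
      by (rule hom_cgenideal[OF U.is_cring P.is_cring tbuh xi fP])
         (unfold tbu_xi P.cgenideal_eq_mult[OF fP], use tb in blast)
  qed
  have univ: "\<exists>!g. g \<in> extensional (carrier op.PW) \<and>
       delta_pair_hom R op.PW op.\<delta>PW (\<lambda>r. op.to (omega_const A (\<rho> r))) (q_ideal p op.PW ?qP) C \<delta>C \<rho>C (q_ideal p C (\<rho>C (\<eta> q_loc))) g \<and>
       (\<forall>b\<in>carrier (UP A). g (op.to (?bu b)) = f b)"
    if prismC: "q_prism p R \<delta>R (\<eta> q_loc) C \<delta>C \<rho>C"
      and homC: "delta_pair_hom R (UP A) \<delta>\<xi> (\<lambda>r. poly_const A (\<rho> r)) (PIdl\<^bsub>UP A\<^esub> (poly_xi A)) C \<delta>C \<rho>C (q_ideal p C (\<rho>C (\<eta> q_loc))) f"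
    for C :: "'c ring" and \<delta>C \<rho>C f
  proof -
    have C: "delta_ring p C \<delta>C" and \<rho>C: "delta_hom R \<delta>R C \<delta>C \<rho>C" and cc: "adic_complete C (adic_ideal p C (\<rho>C (\<eta> q_loc)))"
      and bC: "bounded_algebra p C (\<rho>C (\<eta> q_loc))"
      using prismC unfolding q_prism_def delta_pair_def delta_algebra_def by auto
    interpret C: delta_ring p C \<delta>C by (rule C)
    have f\<delta>: "delta_hom (UP A) \<delta>\<xi> C \<delta>C f" and f\<rho>: "\<And>r. r \<in> carrier R \<Longrightarrow> f (poly_const A (\<rho> r)) = \<rho>C r"
      and fI: "f ` (PIdl\<^bsub>UP A\<^esub> (poly_xi A)) \<subseteq> q_ideal p C (\<rho>C (\<eta> q_loc))"
      using homC unfolding delta_pair_hom_def by auto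
    have fh: "f \<in> ring_hom (UP A) C" using f\<delta> unfolding delta_hom_def by blast
    interpret f: ring_hom_cring "UP A" C f by unfold_locales (rule fh)
    let ?\<alpha> = "\<lambda>a. f (poly_const A a)"
    have \<alpha>: "delta_hom A \<delta>A C \<delta>C ?\<alpha>" by (rule delta_hom_trans[OF const\<delta> f\<delta>])
    have \<alpha>h: "?\<alpha> \<in> ring_hom A C" using \<alpha> unfolding delta_hom_def by blast
    interpret \<alpha>: ring_hom_cring A C ?\<alpha> by unfold_locales (rule \<alpha>h)
    have \<alpha>q: "?\<alpha> (\<theta> q_loc) = \<rho>C (\<eta> q_loc)" using f\<rho>[OF q] unfolding \<theta>q .
    have qC: "\<rho>C (\<eta> q_loc) \<in> carrier C" using \<alpha>.hom_closed[OF od.q_closed] \<alpha>q by simp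
    let ?fC = "?\<alpha> (\<theta> Q.fq)"
    have fC: "q_number C (\<rho>C (\<eta> q_loc)) p = ?fC"
      using \<alpha>.hom_q_number[OF od.q_closed, of p] od.q_number_eq \<alpha>q by simp
    have fCc: "?fC \<in> carrier C" by (rule \<alpha>.hom_closed) simp
    have regC: "b = \<zero>\<^bsub>C\<^esub>" if "b \<in> carrier C" "?fC \<otimes>\<^bsub>C\<^esub> b = \<zero>\<^bsub>C\<^esub>" for b
      using bC that unfolding bounded_algebra_def fC by blast
    have idC: "q_ideal p C (\<rho>C (\<eta> q_loc)) = PIdl\<^bsub>C\<^esub> ?fC" unfolding q_ideal_def fC ..
    \<comment> \<open>The condition on ideals writes f(\<xi>) as (p)_q w. This w is the prospective
      image of \<omega>, and x + (p)_q w has rank one as the image of x + \<xi>.\<close>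
    have "f (poly_xi A) \<in> PIdl\<^bsub>C\<^esub> ?fC" using fI U.cgenideal_self[OF xi] unfolding idC by blast
    then obtain w where w: "w \<in> carrier C" "f (poly_xi A) = ?fC \<otimes>\<^bsub>C\<^esub> w" unfolding C.cgenideal_eq_mult[OF fCc] by blast
    have cx: "poly_const A x \<in> carrier (UP A)" by (rule UP_const_closed[OF Ac x(1)])
    have "\<delta>C (f (poly_const A x \<oplus>\<^bsub>UP A\<^esub> poly_xi A)) = f (\<delta>\<xi> (poly_const A x \<oplus>\<^bsub>UP A\<^esub> poly_xi A))"
      using f\<delta> U.a_closed[OF cx xi] unfolding delta_hom_def by simp
    also have "\<dots> = \<zero>\<^bsub>C\<^esub>" using assms(7) f.hom_zero unfolding symmetric_delta_def by simp
    finally have rel: "\<delta>C (?\<alpha> x \<oplus>\<^bsub>C\<^esub> ?fC \<otimes>\<^bsub>C\<^esub> w) = \<zero>\<^bsub>C\<^esub>" unfolding f.hom_add[OF cx xi] w(2) .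
    obtain g where g: "delta_hom op.PW op.\<delta>PW C \<delta>C g" "\<And>a. a \<in> carrier A \<Longrightarrow> g (op.to (omega_const A a)) = ?\<alpha> a"
      "g (op.to (od.basis (Suc 0))) = w"
      using op.PW_hom_exists[OF C cc[folded \<alpha>q] \<alpha> w(1) rel] by blast
    have gh: "g \<in> ring_hom op.PW C" using g(1) unfolding delta_hom_def by blast
    have factor: "g (op.to (?bu b)) = f b" if b: "b \<in> carrier (UP A)" for b
    proof -
      have h: "(\<lambda>b. g (op.to (?bu b))) \<in> ring_hom (UP A) C" using ring_hom_trans[OF tbuh gh] by (simp add: comp_def)
      show ?thesis
      proof (rule UP_hom_eq[OF Ac C.is_cring h fh _ _ b])
        show "g (op.to (?bu (poly_const A a))) = f (poly_const A a)" if "a \<in> carrier A" for a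
          unfolding od.blowing_up_const[OF that] by (rule g(2)[OF that])
        have "\<theta> Q.fq \<in> carrier A" by simp
        then show "g (op.to (?bu (poly_xi A))) = f (poly_xi A)"
          unfolding tbu_xi ring_hom_mult[OF gh fP tb] g(3) w(2) using g(2) by simp
      qed
    qed
    \<comment> \<open>Restriction to the carrier picks the extensional representative, which
      uniqueness as a total function requires.\<close>
    let ?g = "restrict g (carrier op.PW)"
    have g': "delta_hom op.PW op.\<delta>PW C \<delta>C ?g"
      using g(1) P.delta_closed unfolding delta_hom_def ring_hom_def by (auto simp: Pi_iff)
    have g'h: "?g \<in> ring_hom op.PW C" using g' unfolding delta_hom_def by blast
    have tc: "op.to (omega_const A a) \<in> carrier op.PW" if "a \<in> carrier A" for a
      by (rule ring_hom_closed[OF op.to_hom od.const_closed[OF that]])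
    show ?thesis
    proof (rule ex1I[of _ ?g], intro conjI ballI)
      show "?g \<in> extensional (carrier op.PW)" by simp
      show "delta_pair_hom R op.PW op.\<delta>PW (\<lambda>r. op.to (omega_const A (\<rho> r))) (q_ideal p op.PW ?qP) C \<delta>C \<rho>C (q_ideal p C (\<rho>C (\<eta> q_loc))) ?g"
        unfolding delta_pair_hom_def
      proof (intro conjI ballI g')
        fix r assume r: "r \<in> carrier R"
        show "?g (op.to (omega_const A (\<rho> r))) = \<rho>C r" using g(2)[OF \<rho>c[OF r]] tc[OF \<rho>c[OF r]] f\<rho>[OF r] by simp
      next
        have "\<theta> Q.fq \<in> carrier A" by simp
        then have "?g (op.to (omega_const A (\<theta> Q.fq))) = ?fC" using g(2) fP by simp
        moreover have "?fC \<in> PIdl\<^bsub>C\<^esub> ?fC" by (rule C.cgenideal_self[OF fCc])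
        ultimately show "?g ` q_ideal p op.PW ?qP \<subseteq> q_ideal p C (\<rho>C (\<eta> q_loc))"
          unfolding idC unfolding q_ideal_def op.to_f
          by (intro hom_cgenideal[OF P.is_cring C.is_cring g'h fP fCc]) simp
      qed
      fix b assume b: "b \<in> carrier (UP A)"
      show "?g (op.to (?bu b)) = f b" using factor[OF b] ring_hom_closed[OF tbuh b] by simp
    next
      fix k assume k: "k \<in> extensional (carrier op.PW) \<and>
       delta_pair_hom R op.PW op.\<delta>PW (\<lambda>r. op.to (omega_const A (\<rho> r))) (q_ideal p op.PW ?qP) C \<delta>C \<rho>C (q_ideal p C (\<rho>C (\<eta> q_loc))) k \<and>
       (\<forall>b\<in>carrier (UP A). k (op.to (?bu b)) = f b)"
      then have ke: "k \<in> extensional (carrier op.PW)" and k\<delta>: "delta_hom op.PW op.\<delta>PW C \<delta>C k"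
        and kf: "\<And>b. b \<in> carrier (UP A) \<Longrightarrow> k (op.to (?bu b)) = f b" unfolding delta_pair_hom_def by auto
      have kh: "k \<in> ring_hom op.PW C" using k\<delta> unfolding delta_hom_def by blast
      have kc: "k (op.to (omega_const A a)) = ?\<alpha> a" if "a \<in> carrier A" for a
        using kf[OF UP_const_closed[OF Ac that]] unfolding od.blowing_up_const[OF that] .
      have kb: "k (op.to (od.basis (Suc 0))) \<in> carrier C" by (rule ring_hom_closed[OF kh tb])
      have "\<theta> Q.fq \<in> carrier A" by simp
      \<comment> \<open>A competing k satisfies (p)_q k(\<omega>) = f(\<xi>) = (p)_q w, and (p)_q is
        regular on C.\<close>
      then have "?fC \<otimes>\<^bsub>C\<^esub> k (op.to (od.basis (Suc 0))) = ?fC \<otimes>\<^bsub>C\<^esub> w"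
        using kf[OF xi] kc unfolding tbu_xi ring_hom_mult[OF kh fP tb] w(2) by simp
      then have "?fC \<otimes>\<^bsub>C\<^esub> (k (op.to (od.basis (Suc 0))) \<ominus>\<^bsub>C\<^esub> w) = \<zero>\<^bsub>C\<^esub>"
        using kb w(1) fCc by (simp add: C.minus_eq C.r_distr C.r_minus C.r_neg)
      then have kw: "k (op.to (od.basis (Suc 0))) = w"
        using regC[OF C.minus_closed[OF kb w(1)]] C.diff_zero_iff[OF kb w(1)] by blast
      show "k = ?g"
      proof
        fix s
        show "k s = ?g s"
        proof (cases "s \<in> carrier op.PW")
          case True
          have "k s = g s"
            by (rule op.PW_hom_unique[OF C cc k\<delta> g(1) _ _ _ True])
               (use kc g(2,3) kw \<alpha>q od.q_closed in auto)
          then show ?thesis using True by simp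
        next
          case False
          then show ?thesis using ke by (simp add: extensional_def)
        qed
      qed
    qed
  qed
  show ?thesis
    unfolding Let_def prismatic_envelope_def \<theta>q \<delta>W_def[symmetric]
    using pairU prismP homP univ by blast
qed

end
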